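(* Under assumptions (A1)-(A3) and (B1)-(B3) listed in the context, for every $\delta>0$ it holds that $$\Pi\left(\exists\,\sigma\in\mathcal{S}_K\ \text{s.t.}\ \|\theta_k^*-\theta_{\sigma(k)}\|\le\frac{1}{n^{1/2-\delta}}\ \text{and}\ |w_k^*-w_{\sigma(k)}|\le\frac{1}{n^{1/2-\delta}}\ \text{for } k=1,\dots,K\ \Big|\ X_{1:n}\right)\to1$$ as $n\to\infty$ in $Q^{(\infty)}$-probability. In particular, $$\Pi\left(W_1(P^*,P)>\frac{1}{n^{1/2-\delta}}\ \Big|\ X_{1:n}\right)\to0$$ as $n\to\infty$ in $Q^{(\infty)}$-probability.
   Context: Let $D\ge 1$, let $\|\cdot\|$ be the Euclidean norm, and let $f$ be a probability density on $\mathbb{R}^D$ (w.r.t. Lebesgue measure). For a probability measure $P$ on $\mathbb{R}^D$ write $Pf(x)=\int f(x-\theta)\,P(d\theta)$. Prior: $\alpha>0$, $P_0$ is a probability measure on $\Theta\subset\mathbb{R}^D$, and $\Pi$ is the law of the Dirichlet process $P\sim \mathrm{DP}(\alpha,P_0)$ in stick-breaking form, $P=\sum_{k\ge1}w_k\delta_{\theta_k}$, $w_k=v_k\prod_{j=1}^{k-1}(1-v_j)$, $v_k$ i.i.d. $\mathrm{Beta}(1,\alpha)$, $\theta_k$ i.i.d. $P_0$, the two sequences being independent; $\Pi$ is identified with the joint law of $(w_k)_{k\ge1},(\theta_k)_{k\ge1}$. The posterior is $\Pi(B\mid X_{1:n})=\int_B\prod_{i=1}^nPf(X_i)\,\Pi(dP)\big/\int\prod_{i=1}^nPf(X_i)\,\Pi(dP)$.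 Assumptions: (A1) $X_1,X_2,\dots$ are i.i.d. from $Q(dx)=P^*f(x)\,dx$, where $P^*=\sum_{k=1}^K w_k^*\delta_{\theta_k^*}$, $K<\infty$, $(w_1^*,\dots,w_K^* )$ is a probability vector, and $P^*$ has exactly $K$ support points (the $\theta_k^*$ are distinct and $w_k^*>0$). (A2) $\Theta\subset\mathbb{R}^D$ is compact and $\theta_k^*\in\Theta$ for all $k=1,\dots,K$. (A3) $P_0$ has a continuous bounded density $p_0$ on $\Theta$ w.r.t. Lebesgue measure, with $p_0(\theta_k^* )>0$ for all $k=1,\dots,K$. (B1) $f\in C^3(\mathbb{R}^D)$ and there is a constant $F$ with $0<f(x)<F$ for all $x$. (B2) There are $R>0$, $\gamma\ge0$ with $\|\nabla\log f(x)\|\le R(1+\|x\|)^\gamma$ and $\|\nabla^2\log f(x)\|\le R(1+\|x\|)^\gamma$ for all $x$, and $\int e^{M\|x\|^\gamma}f(x)\,dx<\infty$ for every $M>0$. (B3) There are $C,r>0$ with $\|\nabla^g f(x)\|\le C(1+\|x\|)^{-(D+r)}$ for all $x$ and $g=1,2,3$. $Q^{(\infty)}$ is the law of the i.i.d. sequence $(X_i)_{i\ge1}$, and $X_{1:n}=(X_1,\dots,X_n)$. $\mathcal{S}_K$ is the set of permutations of $\{1,\dots,K\}$. For probability measures $P,P'$ on $\Theta$, $W_1(P,P')=\inf_{\gamma}\int\|\theta-\theta'\|\,\gamma(d\theta,d\theta')$, the infimum being over couplings $\gamma$ of $P$ and $P'$.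
   Formalization: Added to (A2)-(A3): at each θ_k^*, Θ fills a fixed positive fraction of every small ball. Without it the claim fails, e.g. Θ=[0,1]∪{2}, p_0=1 on Θ, K=1, θ_1^*=2; it is automatic for interior θ_k^* or p_0 continuous on R^D. *)

theory Defs
  imports "HOL-Probability.Probability" "HOL-Combinatorics.Permutations"
begin

section \<open>Higher derivatives\<close>

text \<open>
  \<open>total_deriv f x\<close> is the derivative of \<open>f\<close> at \<open>x\<close> as a bounded linear map, so that iterating
  it yields the gradient, the Hessian and the third derivative as multilinear maps, and \<open>norm\<close> is
  the operator norm. It is meaningful only where \<open>f\<close> is differentiable.
\<close>

definition total_deriv ::
    "('a::real_normed_vector \<Rightarrow> 'b::real_normed_vector) \<Rightarrow> 'a \<Rightarrow> 'a \<Rightarrow>\<^sub>L 'b" where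
  "total_deriv f x = Blinfun (frechet_derivative f (at x))"

lemma has_derivative_total_deriv:
  assumes "f differentiable (at x)"
  shows "(f has_derivative blinfun_apply (total_deriv f x)) (at x)"
proof -
  have "(f has_derivative frechet_derivative f (at x)) (at x)"
    using assms frechet_derivative_works by blast
  then show ?thesis
    unfolding total_deriv_def by (metis bounded_linear_Blinfun_apply has_derivative_bounded_linear)
qed

definition C3_function :: "('a::real_normed_vector \<Rightarrow> real) \<Rightarrow> bool" where
  "C3_function f \<longleftrightarrow>
     (\<forall>x. f differentiable (at x)) \<and>
     (\<forall>x. total_deriv f differentiable (at x)) \<and>
     (\<forall>x. total_deriv (total_deriv f) differentiable (at x)) \<and>
     continuous_on UNIV (total_deriv (total_deriv (total_deriv f)))"


section \<open>Mixtures\<close>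

text \<open>
  The measure \<open>\<Sum>k\<in>I. w k \<cdot> \<delta>(\<theta> k)\<close>, obtained by pushing the measure on the indices with
  weights \<open>w\<close> forward along \<open>\<theta>\<close>. Negative weights count as 0.
\<close>

definition discrete_measure ::
    "nat set \<Rightarrow> (nat \<Rightarrow> real) \<Rightarrow> (nat \<Rightarrow> 'a::euclidean_space) \<Rightarrow> 'a measure" where
  "discrete_measure I w \<theta> = distr (density (count_space I) (\<lambda>k. ennreal (w k))) borel \<theta>"

definition mixture :: "('a::euclidean_space \<Rightarrow> real) \<Rightarrow> 'a measure \<Rightarrow> 'a \<Rightarrow> real" where
  "mixture f P x = (\<integral>\<theta>. f (x - \<theta>) \<partial>P)"


section \<open>The Dirichlet process prior and its posterior\<close>

definition beta_density :: "real \<Rightarrow> real \<Rightarrow> real \<Rightarrow> real" where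
  "beta_density a b x =
     (if 0 < x \<and> x < 1 then x powr (a - 1) * (1 - x) powr (b - 1) / Beta a b else 0)"

definition beta_measure :: "real \<Rightarrow> real \<Rightarrow> real measure" where
  "beta_measure a b = density lborel (\<lambda>x. ennreal (beta_density a b x))"

definition stick_weights :: "(nat \<Rightarrow> real) \<Rightarrow> nat \<Rightarrow> real" where
  "stick_weights v k = v k * (\<Prod>j<k. 1 - v j)"

text \<open>
  The joint law of the stick-breaking weights and atoms, both indexed from 0.
\<close>

definition DP_prior ::
    "real \<Rightarrow> 'a::euclidean_space measure \<Rightarrow> ((nat \<Rightarrow> real) \<times> (nat \<Rightarrow> 'a)) measure" where
  "DP_prior \<alpha> P0 =
     distr ((\<Pi>\<^sub>M k\<in>UNIV. beta_measure 1 \<alpha>) \<Otimes>\<^sub>M (\<Pi>\<^sub>M k\<in>UNIV. P0))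
       ((\<Pi>\<^sub>M k\<in>UNIV. borel) \<Otimes>\<^sub>M (\<Pi>\<^sub>M k\<in>UNIV. borel))
       (\<lambda>(v, \<theta>). (stick_weights v, \<theta>))"

text \<open>The observations \<open>X\<^sub>1, \<dots>, X\<^sub>n\<close> are \<open>X 0, \<dots>, X (n - 1)\<close>.\<close>

definition likelihood ::
    "('a::euclidean_space \<Rightarrow> real) \<Rightarrow> (nat \<Rightarrow> 'a) \<Rightarrow> nat \<Rightarrow> (nat \<Rightarrow> real) \<times> (nat \<Rightarrow> 'a) \<Rightarrow> real" where
  "likelihood f X n = (\<lambda>(w, \<theta>). \<Prod>i<n. mixture f (discrete_measure UNIV w \<theta>) (X i))"

definition posterior ::
    "((nat \<Rightarrow> real) \<times> (nat \<Rightarrow> 'a)) measure \<Rightarrow> ('a::euclidean_space \<Rightarrow> real) \<Rightarrow> nat \<Rightarrow> (nat \<Rightarrow> 'a)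
       \<Rightarrow> ((nat \<Rightarrow> real) \<times> (nat \<Rightarrow> 'a)) set \<Rightarrow> real" where
  "posterior M f n X B =
     (LINT p:B|M. likelihood f X n p) / (LINT p|M. likelihood f X n p)"


section \<open>Wasserstein distance and convergence in probability\<close>

definition couplings ::
    "'a::euclidean_space measure \<Rightarrow> 'a measure \<Rightarrow> ('a \<times> 'a) measure set" where
  "couplings P P' =
     {\<gamma>. sets \<gamma> = sets (borel \<Otimes>\<^sub>M borel) \<and> distr \<gamma> borel fst = P \<and> distr \<gamma> borel snd = P'}"

definition wasserstein1 :: "'a::euclidean_space measure \<Rightarrow> 'a measure \<Rightarrow> ennreal" where
  "wasserstein1 P P' = (INF \<gamma>\<in>couplings P P'. \<integral>\<^sup>+p. ennreal (norm (fst p - snd p)) \<partial>\<gamma>)"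

definition tendsto_in_prob ::
    "'s measure \<Rightarrow> (nat \<Rightarrow> 's \<Rightarrow> real) \<Rightarrow> real \<Rightarrow> bool" where
  "tendsto_in_prob M Y c \<longleftrightarrow>
     (\<forall>n. Y n \<in> borel_measurable M) \<and>
     (\<forall>\<epsilon>>0. (\<lambda>n. measure M {x \<in> space M. \<bar>Y n x - c\<bar> > \<epsilon>}) \<longlonglongrightarrow> 0)"

end

theory Submission
 imports Defs
begin

text \<open>
  For bounded \<open>g\<close> the map \<open>\<phi>(\<theta>) = \<integral> g(x) f(x - \<theta>) dx\<close> turns \<open>\<integral> g \<cdot> Pf\<close> into the mean \<open>\<integral> \<phi> dP\<close>, so
  Hoeffding tests confine the posterior to those \<open>P\<close> whose means of finitely many such \<open>\<phi>\<close> lie within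
  \<open>\<epsilon> \<approx> n powr (-1/2)\<close> of the true ones. The characteristic function of \<open>f\<close> does not vanish near 0, so
  low-frequency trigonometric polynomials are among the \<open>\<phi>\<close>. Built from them, one \<open>\<phi>\<close> is comparable to the
  squared distance to the true atoms, and others compute, up to its multiples, mass and centre of \<open>P\<close> near each
  true atom.

  Such a \<open>P\<close> either is close to \<open>P\<^sup>*\<close> atom by atom, or leaves mass \<open>\<rho> \<gg> \<epsilon>\<close> outside any \<open>K\<close> atoms. With
  \<open>s = K - 1 + \<alpha> + K D\<close> the prior mass of \<open>n powr (-1/2)\<close>-neighbourhoods of \<open>P\<^sup>*\<close>, on which the chi-square
  divergence is \<open>O(1/n)\<close>, is at least \<open>n powr (-s/2)\<close>, and this bounds the evidence from below. In the second
  case the \<open>K\<close> heavy atoms are moved to the front of the stick-breaking sequence (a size-biased reordering, at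
  a bounded cost per atom). The remaining mass must then sit within \<open>O(\<surd>(\<epsilon>/\<rho>))\<close> of the true atoms on average,
  which costs an extra factor \<open>(\<epsilon>/\<rho>)\<close> to a positive power, so that the posterior mass vanishes.
\<close>

section \<open>Sequences of independent variables\<close>

text \<open>The obstacle is that no fixed power of \<open>n\<close> may be lost. The prior mass of
  the measures that pass the tests and the lower bound for the evidence agree up to \<open>n\<close>
  to small powers, so a bad set is negligible only if it gains a fixed power. The gain comes from
  random means: under the prior the mean of \<open>q\<close> is below \<open>x\<close> with
  probability of order \<open>x powr (\<alpha> + 1/4)\<close>, whereas a leftover mass below
  \<open>x\<close> has only the exponent \<open>\<alpha>\<close>. When the leftover mass lies in
  cell number l of width \<open>\<epsilon>\<close>, the two effects give l^(\<alpha>-1) and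
  l^(-\<alpha>-1/4); the product is summable, and beyond \<open>\<rho> / \<epsilon>\<close> it still
  yields \<open>(\<epsilon> / \<rho>) powr (1/8)\<close>. The matching at the end concerns the first
  \<open>K\<close> sticks, not any \<open>K\<close> atoms. If the heavy atoms leave little mass but
  the first \<open>K\<close> sticks do not, a light atom stands before a heavy one. Its stick is
  small and independent of everything else, so deleting it gains a factor of nearly
  \<open>n powr (-1/2)\<close>, which is more than enough.\<close>

context sequence_space
begin

lemma nn_integral_seq_step:
 assumes [measurable]: "f \<in> borel_measurable S"
 shows "(\<integral>\<^sup>+\<omega>. f \<omega> \<partial>S) = (\<integral>\<^sup>+x. \<integral>\<^sup>+\<omega>. f (case_nat x \<omega>) \<partial>S \<partial>M)"
proof -
 have "(\<integral>\<^sup>+\<omega>. f \<omega> \<partial>S) = (\<integral>\<^sup>+\<omega>. f \<omega> \<partial>distr (M \<Otimes>\<^sub>M S) S (\<lambda>(s, \<omega>). case_nat s \<omega>))"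
  by (simp add: PiM_iter)
 also have "\<dots> = (\<integral>\<^sup>+z. f (case_nat (fst z) (snd z)) \<partial>(M \<Otimes>\<^sub>M S))"
  by (subst nn_integral_distr) (auto simp: split_beta')
 also have "\<dots> = (\<integral>\<^sup>+x. \<integral>\<^sup>+\<omega>. f (case_nat x \<omega>) \<partial>S \<partial>M)"
  by (subst P.nn_integral_fst[symmetric]) auto
 finally show ?thesis .
qed

text \<open>The prefix is the inner variable and the tail the outer one, so that estimates for the
  first \<open>n\<close> coordinates can be made with the tail frozen.\<close>

lemma nn_integral_comb_seq:
 assumes [measurable]: "f \<in> borel_measurable S"
 shows "(\<integral>\<^sup>+\<omega>. f \<omega> \<partial>S) = (\<integral>\<^sup>+\<omega>'. \<integral>\<^sup>+\<omega>. f (comb_seq n \<omega> \<omega>') \<partial>S \<partial>S)"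
proof -
 have "(\<integral>\<^sup>+\<omega>. f \<omega> \<partial>S) = (\<integral>\<^sup>+\<omega>. f \<omega> \<partial>distr (S \<Otimes>\<^sub>M S) S (\<lambda>(s, \<omega>). comb_seq n s \<omega>))"
  by (simp add: PiM_comb_seq)
 also have "\<dots> = (\<integral>\<^sup>+z. f (comb_seq n (fst z) (snd z)) \<partial>(S \<Otimes>\<^sub>M S))"
  by (subst nn_integral_distr) (auto simp: split_beta')
 also have "\<dots> = (\<integral>\<^sup>+\<omega>. \<integral>\<^sup>+\<omega>'. f (comb_seq n \<omega> \<omega>') \<partial>S \<partial>S)"
  by (subst P.nn_integral_fst[symmetric]) auto
 also have "\<dots> = (\<integral>\<^sup>+\<omega>'. \<integral>\<^sup>+\<omega>. f (comb_seq n \<omega> \<omega>') \<partial>S \<partial>S)"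
  by (intro pair_sigma_finite.Fubini'[OF pair_sigma_finite.intro])
    (auto intro!: P.sigma_finite_measure_axioms)
 finally show ?thesis .
qed

lemma nn_integral_component:
 assumes [measurable]: "f \<in> borel_measurable M"
 shows "(\<integral>\<^sup>+\<omega>. f (\<omega> i) \<partial>S) = (\<integral>\<^sup>+x. f x \<partial>M)"
proof -
 have "(\<integral>\<^sup>+x. f x \<partial>M) = (\<integral>\<^sup>+x. f x \<partial>distr S M (\<lambda>\<omega>. \<omega> i))"
  by (simp add: PiM_component)
 also have "\<dots> = (\<integral>\<^sup>+\<omega>. f (\<omega> i) \<partial>S)"
  by (intro nn_integral_distr) auto
 finally show ?thesis by simp
qed

lemma nn_integral_prod_iid:
 assumes [measurable]: "f \<in> borel_measurable M"
 shows "(\<integral>\<^sup>+\<omega>. (\<Prod>i<n. f (\<omega> i)) \<partial>S) = (\<integral>\<^sup>+x. f x \<partial>M) ^ n"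
proof (induction n)
 case 0
 show ?case by (simp add: P.emeasure_space_1)
next
 case (Suc n)
 have "(\<integral>\<^sup>+\<omega>. (\<Prod>i<Suc n. f (\<omega> i)) \<partial>S) = (\<integral>\<^sup>+x. \<integral>\<^sup>+\<omega>. f x * (\<Prod>i<n. f (\<omega> i)) \<partial>S \<partial>M)"
  by (subst nn_integral_seq_step) (auto simp: prod.lessThan_Suc_shift simp del: prod.lessThan_Suc)
 also have "\<dots> = (\<integral>\<^sup>+x. f x * (\<integral>\<^sup>+\<omega>. (\<Prod>i<n. f (\<omega> i)) \<partial>S) \<partial>M)"
  by (intro nn_integral_cong nn_integral_cmult) auto
 also have "\<dots> = (\<integral>\<^sup>+x. f x \<partial>M) ^ Suc n"
  by (simp add: Suc nn_integral_multc)
 finally show ?case .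
qed

lemma measurable_reindex [measurable]: "(\<lambda>\<omega>. \<omega> \<circ> \<pi>) \<in> measurable S S"
proof -
 have "(\<lambda>\<omega>. \<lambda>i\<in>UNIV. \<omega> (\<pi> i)) \<in> measurable S S"
  by (intro measurable_restrict measurable_component_singleton) auto
 thus ?thesis by (simp add: comp_def restrict_UNIV)
qed

text \<open>Coordinates at distinct indices are again i.i.d., so an injection of indices preserves
  the law. It is applied to \<open>front i\<close>, which reorders, and to \<open>skip i\<close>,
  which drops a coordinate.\<close>

lemma nn_integral_reindex:
 assumes [measurable]: "f \<in> borel_measurable S" and "inj \<pi>"
 shows "(\<integral>\<^sup>+\<omega>. f (\<omega> \<circ> \<pi>) \<partial>S) = (\<integral>\<^sup>+\<omega>. f \<omega> \<partial>S)"
proof -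
 have "distr S S (\<lambda>\<omega>. \<lambda>n\<in>UNIV. \<omega> (\<pi> n)) = S"
  using distr_PiM_reindex[of UNIV "\<lambda>_. M" \<pi> UNIV] assms(2) M.prob_space_axioms by auto
 hence "distr S S (\<lambda>\<omega>. \<omega> \<circ> \<pi>) = S"
  by (simp add: comp_def restrict_UNIV)
 hence "(\<integral>\<^sup>+\<omega>. f \<omega> \<partial>S) = (\<integral>\<^sup>+\<omega>. f \<omega> \<partial>distr S S (\<lambda>\<omega>. \<omega> \<circ> \<pi>))" by simp
 also have "\<dots> = (\<integral>\<^sup>+\<omega>. f (\<omega> \<circ> \<pi>) \<partial>S)"
  by (intro nn_integral_distr) auto
 finally show ?thesis by simp
qed

text \<open>Successive conditioning: given the earlier coordinates, \<open>A k\<close> has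
  probability at most \<open>b k\<close>, and these bounds multiply. This form is needed because the
  admissible interval for a stick depends on the sticks before it.\<close>

lemma emeasure_seq_adapted_le:
 assumes [measurable]: "\<And>k. Measurable.pred S (A k)"
  and adapted: "\<And>k \<omega> \<omega>'. (\<And>j. j \<le> k \<Longrightarrow> \<omega> j = \<omega>' j) \<Longrightarrow> A k \<omega> = A k \<omega>'"
  and bound: "\<And>k \<omega>. k < n \<Longrightarrow> \<omega> \<in> space S \<Longrightarrow> emeasure M {x\<in>space M. A k (fun_upd \<omega> k x)} \<le> b k"
 shows "emeasure S {\<omega>\<in>space S. \<forall>k<n. A k \<omega>} \<le> (\<Prod>k<n. b k)"
 using bound
proof (induction n)
 case 0
 show ?case by (simp add: P.emeasure_space_1)
next
 case (Suc n)
 have comb: "A k (comb_seq n \<omega> \<omega>') = A k \<omega>" if "k < n" for k \<omega> \<omega>'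
  using that by (intro adapted) (auto simp: comb_seq_less)
 have comb_n: "A n (comb_seq n \<omega> \<omega>') = A n (fun_upd \<omega> n (\<omega>' 0))" for \<omega> \<omega>'
  by (intro adapted) (auto simp: comb_seq_def)
 have upd [measurable]: "(\<lambda>x. fun_upd \<omega> n x) \<in> measurable M S" if "\<omega> \<in> space S" for \<omega>
 proof (rule measurable_PiM_single')
  show "(\<lambda>x. fun_upd \<omega> n x i) \<in> measurable M M" for i
   using that by (cases "i = n") (auto simp: space_PiM PiE_iff intro!: measurable_const)
 qed (use that in \<open>auto simp: space_PiM\<close>)
 have "emeasure S {\<omega>\<in>space S. \<forall>k<Suc n. A k \<omega>} =
   (\<integral>\<^sup>+\<omega>. indicator {\<omega>\<in>space S. \<forall>k<Suc n. A k \<omega>} \<omega> \<partial>S)"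
  by (rule nn_integral_indicator[symmetric]) measurable
 also have "\<dots> = (\<integral>\<^sup>+\<omega>. indicator {\<omega>\<in>space S. \<forall>k<n. A k \<omega>} \<omega> * indicator {\<omega>\<in>space S. A n \<omega>} \<omega> \<partial>S)"
  by (intro nn_integral_cong) (auto simp: less_Suc_eq split: split_indicator)
 \<comment> \<open>Coordinates below \<open>n\<close> come from \<open>\<omega>\<close> and
   coordinate \<open>n\<close> is \<open>\<omega>' 0\<close>, so the first indicator does not depend
   on \<open>\<omega>'\<close>.\<close>
 also have "\<dots> = (\<integral>\<^sup>+\<omega>'. \<integral>\<^sup>+\<omega>. indicator {\<omega>\<in>space S. \<forall>k<n. A k \<omega>} (comb_seq n \<omega> \<omega>') *
   indicator {\<omega>\<in>space S. A n \<omega>} (comb_seq n \<omega> \<omega>') \<partial>S \<partial>S)"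
  by (rule nn_integral_comb_seq) measurable
 also have "\<dots> = (\<integral>\<^sup>+\<omega>. \<integral>\<^sup>+\<omega>'. indicator {\<omega>\<in>space S. \<forall>k<n. A k \<omega>} (comb_seq n \<omega> \<omega>') *
   indicator {\<omega>\<in>space S. A n \<omega>} (comb_seq n \<omega> \<omega>') \<partial>S \<partial>S)"
  by (intro pair_sigma_finite.Fubini'[OF pair_sigma_finite.intro])
    (auto intro!: P.sigma_finite_measure_axioms)
 also have "\<dots> = (\<integral>\<^sup>+\<omega>. indicator {\<omega>\<in>space S. \<forall>k<n. A k \<omega>} \<omega> *
   (\<integral>\<^sup>+\<omega>'. indicator {x\<in>space M. A n (fun_upd \<omega> n x)} (\<omega>' 0) \<partial>S) \<partial>S)"
 proof (intro nn_integral_cong)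
  fix \<omega> assume w: "\<omega> \<in> space S"
  note upd[OF w, measurable]
  have "(\<integral>\<^sup>+\<omega>'. indicator {\<omega>\<in>space S. \<forall>k<n. A k \<omega>} (comb_seq n \<omega> \<omega>') *
   indicator {\<omega>\<in>space S. A n \<omega>} (comb_seq n \<omega> \<omega>') \<partial>S) =
   (\<integral>\<^sup>+\<omega>'. indicator {\<omega>\<in>space S. \<forall>k<n. A k \<omega>} \<omega> * indicator {x\<in>space M. A n (fun_upd \<omega> n x)} (\<omega>' 0) \<partial>S)"
  proof (intro nn_integral_cong)
   fix \<omega>' assume w': "\<omega>' \<in> space S"
   have "comb_seq n \<omega> \<omega>' \<in> space S" using w w' by (auto simp: space_PiM comb_seq_def PiE_iff)
   thus "indicator {\<omega>\<in>space S. \<forall>k<n. A k \<omega>} (comb_seq n \<omega> \<omega>') *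
     indicator {\<omega>\<in>space S. A n \<omega>} (comb_seq n \<omega> \<omega>') =
     (indicator {\<omega>\<in>space S. \<forall>k<n. A k \<omega>} \<omega> * indicator {x\<in>space M. A n (fun_upd \<omega> n x)} (\<omega>' 0) :: ennreal)"
    using w w' comb comb_n by (auto simp: space_PiM split: split_indicator)
  qed
  also have "\<dots> = indicator {\<omega>\<in>space S. \<forall>k<n. A k \<omega>} \<omega> *
   (\<integral>\<^sup>+\<omega>'. indicator {x\<in>space M. A n (fun_upd \<omega> n x)} (\<omega>' 0) \<partial>S)"
   by (intro nn_integral_cmult) measurable
  finally show "(\<integral>\<^sup>+\<omega>'. indicator {\<omega>\<in>space S. \<forall>k<n. A k \<omega>} (comb_seq n \<omega> \<omega>') *
   indicator {\<omega>\<in>space S. A n \<omega>} (comb_seq n \<omega> \<omega>') \<partial>S) =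
   indicator {\<omega>\<in>space S. \<forall>k<n. A k \<omega>} \<omega> *
   (\<integral>\<^sup>+\<omega>'. indicator {x\<in>space M. A n (fun_upd \<omega> n x)} (\<omega>' 0) \<partial>S)" .
 qed
 also have "\<dots> \<le> (\<integral>\<^sup>+\<omega>. indicator {\<omega>\<in>space S. \<forall>k<n. A k \<omega>} \<omega> * b n \<partial>S)"
 proof (intro nn_integral_mono mult_left_mono)
  fix \<omega> assume w: "\<omega> \<in> space S"
  note upd[OF w, measurable]
  have "(\<integral>\<^sup>+\<omega>'. indicator {x\<in>space M. A n (fun_upd \<omega> n x)} (\<omega>' 0) \<partial>S) = emeasure M {x\<in>space M. A n (fun_upd \<omega> n x)}"
   by (subst nn_integral_component[where i = 0]) auto
  also have "\<dots> \<le> b n" by (rule Suc.prems[of n \<omega>]) (use w in simp_all)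
  finally show "(\<integral>\<^sup>+\<omega>'. indicator {x\<in>space M. A n (fun_upd \<omega> n x)} (\<omega>' 0) \<partial>S) \<le> b n" .
 qed auto
 also have "\<dots> = emeasure S {\<omega>\<in>space S. \<forall>k<n. A k \<omega>} * b n"
  by (simp add: nn_integral_multc)
 also have "\<dots> \<le> (\<Prod>k<n. b k) * b n"
  using Suc by (intro mult_right_mono Suc.IH) auto
 finally show ?case by simp
qed

end

section \<open>The law of the stick-breaking proportions\<close>

lemma Beta_1: "\<alpha> > 0 \<Longrightarrow> Beta 1 \<alpha> = 1 / (\<alpha>::real)"
proof -
 assume a: "\<alpha> > 0"
 have "Gamma (1 + \<alpha>) = \<alpha> * Gamma \<alpha>"
  using Gamma_plus1[of \<alpha>] a by (auto simp: add.commute nonpos_Ints_def)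
 moreover have "Gamma \<alpha> \<noteq> 0" using Gamma_real_pos[OF a] by simp
 ultimately show ?thesis using a by (simp add: Beta_def)
qed

lemma sets_beta_measure [simp, measurable_cong]: "sets (beta_measure a b) = sets borel"
 and space_beta_measure [simp]: "space (beta_measure a b) = UNIV"
 by (auto simp: beta_measure_def)

lemma measurable_beta_density [measurable]: "beta_density a b \<in> borel_measurable borel"
 unfolding beta_density_def by measurable

lemma beta_density_1: "\<alpha> > 0 \<Longrightarrow> beta_density 1 \<alpha> x = (if 0 < x \<and> x < 1 then \<alpha> * (1 - x) powr (\<alpha> - 1) else 0)"
 by (simp add: beta_density_def Beta_1)

lemma nn_integral_beta:
 assumes [measurable]: "f \<in> borel_measurable borel"
 shows "(\<integral>\<^sup>+v. f v \<partial>beta_measure a b) = (\<integral>\<^sup>+v. ennreal (beta_density a b v) * f v \<partial>lborel)"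
 unfolding beta_measure_def by (subst nn_integral_density) auto

locale stick_proportions =
 fixes \<alpha> :: real
 assumes \<alpha>_pos: "\<alpha> > 0"
begin

abbreviation "\<beta> \<equiv> beta_measure 1 \<alpha>"

lemma nn_integral_beta_reflect:
 assumes [measurable]: "f \<in> borel_measurable borel"
 shows "(\<integral>\<^sup>+v. f v \<partial>\<beta>) = (\<integral>\<^sup>+u. (if 0 < u \<and> u < 1 then ennreal (\<alpha> * u powr (\<alpha> - 1)) * f (1 - u) else 0) \<partial>lborel)"
proof -
 have "(\<integral>\<^sup>+v. f v \<partial>\<beta>) = (\<integral>\<^sup>+u. ennreal (beta_density 1 \<alpha> (1 + -1 * u)) * f (1 + -1 * u) \<partial>lborel)"
  using nn_integral_real_affine[of "\<lambda>v. ennreal (beta_density 1 \<alpha> v) * f v" "-1" 1]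
  by (simp add: nn_integral_beta)
 also have "\<dots> = (\<integral>\<^sup>+u. (if 0 < u \<and> u < 1 then ennreal (\<alpha> * u powr (\<alpha> - 1)) * f (1 - u) else 0) \<partial>lborel)"
  using \<alpha>_pos by (intro nn_integral_cong) (auto simp: beta_density_1)
 finally show ?thesis .
qed

text \<open>The last of the \<open>K\<close> heavy sticks must leave only mass of order
  \<open>\<epsilon>\<close>; this distribution function is the source of the summand
  \<open>\<alpha>\<close> in \<open>prior_exponent\<close>.\<close>

lemma emeasure_beta_upper:
 assumes u: "0 \<le> u" "u \<le> 1"
 shows "emeasure \<beta> {v. 1 - v \<le> u} = ennreal (u powr \<alpha>)"
proof -
 have "emeasure \<beta> {v. 1 - v \<le> u} = (\<integral>\<^sup>+v. indicator {v. 1 - v \<le> u} v \<partial>\<beta>)"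
  by (subst nn_integral_indicator) auto
 also have "\<dots> = (\<integral>\<^sup>+t. (if 0 < t \<and> t < 1 then ennreal (\<alpha> * t powr (\<alpha> - 1)) * indicator {v. 1 - v \<le> u} (1 - t) else 0) \<partial>lborel)"
  by (rule nn_integral_beta_reflect) auto
 also have "\<dots> = (\<integral>\<^sup>+t. ennreal (indicator {0..u} t * (\<alpha> * t powr (\<alpha> - 1))) \<partial>lborel)"
 proof (intro nn_integral_cong_AE)
  have "AE t in lborel. t \<noteq> (1::real)" by (rule AE_lborel_singleton)
  thus "AE t in lborel. (if 0 < t \<and> t < 1 then ennreal (\<alpha> * t powr (\<alpha> - 1)) * indicator {v. 1 - v \<le> u} (1 - t) else 0) =
    ennreal (indicator {0..u} t * (\<alpha> * t powr (\<alpha> - 1)))"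
   by eventually_elim (use u in \<open>auto split: split_indicator\<close>)
 qed
 also have "\<dots> = ennreal (\<alpha> * (u powr (\<alpha> - 1 + 1) / (\<alpha> - 1 + 1)))"
  using \<alpha>_pos u
  by (intro nn_integral_has_integral_lebesgue has_integral_mult_right has_integral_powr_from_0) auto
 finally show ?thesis using \<alpha>_pos by simp
qed

sublocale prob_space \<beta>
proof
 have "AE v in \<beta>. v \<in> {v. 1 - v \<le> 1}"
  unfolding beta_measure_def
  by (subst AE_density) (auto simp: beta_density_def)
 hence "emeasure \<beta> (space \<beta>) = emeasure \<beta> {v. 1 - v \<le> 1}"
  by (intro emeasure_eq_AE) auto
 also have "\<dots> = 1" using \<alpha>_pos by (subst emeasure_beta_upper) auto
 finally show "emeasure \<beta> (space \<beta>) = 1" .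
qed

lemma AE_beta: "AE v in \<beta>. 0 < v \<and> v < 1"
 unfolding beta_measure_def by (subst AE_density) (auto simp: beta_density_def)

text \<open>A difference of two values of the distribution function of \<open>1 - v\<close>. The
  cell may reach beyond 1, and truncation at 1 only shrinks the difference.\<close>

lemma emeasure_beta_cell:
 assumes "0 \<le> a" "a \<le> b"
 shows "emeasure \<beta> {v. a < 1 - v \<and> 1 - v \<le> b} \<le> ennreal (b powr \<alpha> - a powr \<alpha>)"
proof -
 have up: "emeasure \<beta> {v. 1 - v \<le> u} = ennreal ((min u 1) powr \<alpha>)" if "u \<ge> 0" for u
 proof (cases "u \<le> 1")
  case False
  have "emeasure \<beta> {v. 1 - v \<le> u} = emeasure \<beta> (space \<beta>)"
   using AE_beta by (intro emeasure_eq_AE) (use False in \<open>auto elim!: eventually_mono\<close>)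
  thus ?thesis using False emeasure_space_1 by (simp add: min_def)
 qed (use that emeasure_beta_upper in auto)
 have "emeasure \<beta> {v. a < 1 - v \<and> 1 - v \<le> b} = emeasure \<beta> ({v. 1 - v \<le> b} - {v. 1 - v \<le> a})"
  by (intro arg_cong[where f = "emeasure \<beta>"]) auto
 also have "\<dots> = emeasure \<beta> {v. 1 - v \<le> b} - emeasure \<beta> {v. 1 - v \<le> a}"
  using assms by (intro emeasure_Diff) auto
 also have "\<dots> = ennreal ((min b 1) powr \<alpha> - (min a 1) powr \<alpha>)"
  using assms by (simp add: up ennreal_minus)
 also have "\<dots> \<le> ennreal (b powr \<alpha> - a powr \<alpha>)"
 proof (rule ennreal_leI, cases "a \<ge> 1")
  case True
  thus "(min b 1) powr \<alpha> - (min a 1) powr \<alpha> \<le> b powr \<alpha> - a powr \<alpha>"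
   using assms \<alpha>_pos by (auto simp: min_def intro!: powr_mono2 ge_one_powr_ge_zero)
 next
  case False
  thus "(min b 1) powr \<alpha> - (min a 1) powr \<alpha> \<le> b powr \<alpha> - a powr \<alpha>"
   using assms \<alpha>_pos by (cases "b \<le> 1") (auto simp: min_def not_le intro!: ge_one_powr_ge_zero)
 qed
 finally show ?thesis .
qed

text \<open>For every positive \<open>\<alpha>\<close> the density is at most
  \<open>\<alpha> / (1 - v)\<close>, so keeping \<open>1 - v\<close> above \<open>c\<close> bounds
  it without a case distinction on \<open>\<alpha>\<close>.\<close>

lemma emeasure_beta_interval_le:
 assumes c: "0 < c" "c \<le> 1" and "lo \<le> hi"
 shows "emeasure \<beta> {v. lo \<le> v \<and> v \<le> hi \<and> c \<le> 1 - v} \<le> ennreal (\<alpha> / c * (hi - lo))"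
proof -
 have "emeasure \<beta> {v. lo \<le> v \<and> v \<le> hi \<and> c \<le> 1 - v} =
   (\<integral>\<^sup>+v. ennreal (beta_density 1 \<alpha> v) * indicator {v. lo \<le> v \<and> v \<le> hi \<and> c \<le> 1 - v} v \<partial>lborel)"
  unfolding beta_measure_def by (subst emeasure_density) (auto simp: beta_density_def)
 also have "\<dots> \<le> (\<integral>\<^sup>+v. ennreal (\<alpha> / c) * indicator {lo..hi} v \<partial>lborel)"
 proof (intro nn_integral_mono)
  fix v :: real
  show "ennreal (beta_density 1 \<alpha> v) * indicator {v. lo \<le> v \<and> v \<le> hi \<and> c \<le> 1 - v} v \<le>
    ennreal (\<alpha> / c) * indicator {lo..hi} v"
  proof (cases "0 < v \<and> c \<le> 1 - v \<and> v < 1")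
   case True
   have "(1 - v) powr (\<alpha> - 1) \<le> (1 - v) powr (- 1)"
    using True \<alpha>_pos by (intro powr_mono') auto
   also have "\<dots> = 1 / (1 - v)" using True by (simp add: powr_minus_divide)
   also have "\<dots> \<le> 1 / c" using True c by (intro divide_left_mono) auto
   finally have "beta_density 1 \<alpha> v \<le> \<alpha> / c"
    using \<alpha>_pos True mult_left_mono[of "(1 - v) powr (\<alpha> - 1)" "1 / c" \<alpha>]
    by (auto simp: beta_density_1)
   thus ?thesis by (auto split: split_indicator intro: ennreal_leI)
  qed (use \<alpha>_pos c in \<open>auto simp: beta_density_1 split: split_indicator\<close>)
 qed
 also have "\<dots> = ennreal (\<alpha> / c * (hi - lo))"
  using assms \<alpha>_pos
  by (subst nn_integral_cmult_indicator) (auto simp: ennreal_mult'[symmetric])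
 finally show ?thesis .
qed

text \<open>The minimum with 1 bounds \<open>(1 - v) powr (\<alpha> - 1)\<close> from below for both
  signs of \<open>\<alpha> - 1\<close>.\<close>

lemma emeasure_beta_interval_ge:
 assumes "0 < lo" "lo \<le> hi" "hi \<le> 1 - c" and c: "0 < c"
 shows "emeasure \<beta> {lo..hi} \<ge> ennreal (\<alpha> * min 1 (c powr (\<alpha> - 1)) * (hi - lo))"
proof -
 have "ennreal (\<alpha> * min 1 (c powr (\<alpha> - 1)) * (hi - lo)) =
   (\<integral>\<^sup>+v. ennreal (\<alpha> * min 1 (c powr (\<alpha> - 1))) * indicator {lo..hi} v \<partial>lborel)"
  using assms \<alpha>_pos by (subst nn_integral_cmult_indicator) (auto simp: ennreal_mult')
 also have "\<dots> \<le> (\<integral>\<^sup>+v. ennreal (beta_density 1 \<alpha> v) * indicator {lo..hi} v \<partial>lborel)"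
 proof (intro nn_integral_mono)
  fix v :: real
  show "ennreal (\<alpha> * min 1 (c powr (\<alpha> - 1))) * indicator {lo..hi} v \<le>
   ennreal (beta_density 1 \<alpha> v) * indicator {lo..hi} v"
  proof (cases "v \<in> {lo..hi}")
   case True
   have "min 1 (c powr (\<alpha> - 1)) \<le> (1 - v) powr (\<alpha> - 1)"
   proof (cases "\<alpha> \<ge> 1")
    case True
    hence "c powr (\<alpha> - 1) \<le> (1 - v) powr (\<alpha> - 1)"
     using assms \<open>v \<in> {lo..hi}\<close> by (intro powr_mono2) auto
    thus ?thesis by simp
   next
    case False
    hence "1 powr (\<alpha> - 1) \<le> (1 - v) powr (\<alpha> - 1)"
     using assms \<open>v \<in> {lo..hi}\<close> by (intro powr_mono2') auto
    thus ?thesis by simp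
   qed
   thus ?thesis
    using True assms \<alpha>_pos by (auto simp: beta_density_1 intro!: ennreal_leI)
  qed auto
 qed
 also have "\<dots> = emeasure \<beta> {lo..hi}"
  unfolding beta_measure_def by (subst emeasure_density) (auto simp: beta_density_def)
 finally show ?thesis .
qed

lemma nn_integral_one_minus_beta: "(\<integral>\<^sup>+v. ennreal (1 - v) \<partial>\<beta>) = ennreal (\<alpha> / (\<alpha> + 1))"
proof -
 have "(\<integral>\<^sup>+v. ennreal (1 - v) \<partial>\<beta>) =
   (\<integral>\<^sup>+u. (if 0 < u \<and> u < 1 then ennreal (\<alpha> * u powr (\<alpha> - 1)) * ennreal (1 - (1 - u)) else 0) \<partial>lborel)"
  by (rule nn_integral_beta_reflect) auto
 also have "\<dots> = (\<integral>\<^sup>+t. ennreal (indicator {0..1} t * (\<alpha> * t powr \<alpha>)) \<partial>lborel)"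
 proof (intro nn_integral_cong_AE)
  have "AE t in lborel. t \<noteq> (1::real)" by (rule AE_lborel_singleton)
  thus "AE u in lborel. (if 0 < u \<and> u < 1 then ennreal (\<alpha> * u powr (\<alpha> - 1)) * ennreal (1 - (1 - u)) else 0) =
    ennreal (indicator {0..1} u * (\<alpha> * u powr \<alpha>))"
   by eventually_elim (use \<alpha>_pos in \<open>auto simp: powr_diff ennreal_mult'[symmetric] split: split_indicator\<close>)
 qed
 also have "\<dots> = ennreal (\<alpha> * (1 powr (\<alpha> + 1) / (\<alpha> + 1)))"
  using \<alpha>_pos
  by (intro nn_integral_has_integral_lebesgue has_integral_mult_right has_integral_powr_from_0) auto
 finally show ?thesis by simp
qed

text \<open>The bound is \<open>\<alpha> * Beta (1/2) (\<alpha> - a)\<close>. The condition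
  \<open>a < \<alpha>\<close> is what limits the iteration of \<open>mean_cdf_step\<close>.\<close>

lemma nn_integral_beta_powr_finite:
 assumes "a < \<alpha>"
 shows "(\<integral>\<^sup>+v. ennreal (v powr (-1/2) * (1 - v) powr (- a)) \<partial>\<beta>) < \<infinity>"
proof -
 have "(\<integral>\<^sup>+v. ennreal (v powr (-1/2) * (1 - v) powr (- a)) \<partial>\<beta>) =
  (\<integral>\<^sup>+v. ennreal (beta_density 1 \<alpha> v) * ennreal (v powr (-1/2) * (1 - v) powr (- a)) \<partial>lborel)"
  by (rule nn_integral_beta) auto
 also have "\<dots> \<le> (\<integral>\<^sup>+v. ennreal (indicator {0..1} v * (\<alpha> * (v powr (1/2 - 1) * (1 - v) powr (\<alpha> - a - 1)))) \<partial>lborel)"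
 proof (intro nn_integral_mono)
  fix v :: real
  show "ennreal (beta_density 1 \<alpha> v) * ennreal (v powr (-1/2) * (1 - v) powr (- a)) \<le>
   ennreal (indicator {0..1} v * (\<alpha> * (v powr (1/2 - 1) * (1 - v) powr (\<alpha> - a - 1))))"
  proof (cases "0 < v \<and> v < 1")
   case True
   have e: "(1 - v) powr (\<alpha> - a - 1) = (1 - v) powr (\<alpha> - 1) * (1 - v) powr (- a)"
    by (simp add: powr_add[symmetric] algebra_simps)
   show ?thesis unfolding e
    using True \<alpha>_pos by (auto simp: beta_density_1 ennreal_mult'[symmetric] mult_ac)
  qed (use \<alpha>_pos in \<open>auto simp: beta_density_1\<close>)
 qed
 also have "\<dots> = ennreal (\<alpha> * Beta (1/2) (\<alpha> - a))"
  using assms \<alpha>_pos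
  by (intro nn_integral_has_integral_lebesgue has_integral_mult_right has_integral_Beta_real) auto
 finally show ?thesis by (rule order_le_less_trans) simp
qed

text \<open>In the weights \<open>(v\<^sub>0, (1 - v\<^sub>0) v\<^sub>1)\<close> the density times \<open>1 - v\<^sub>0\<close> is \<open>\<alpha>\<^sup>2 (1 - w\<^sub>0 - w\<^sub>1)\<^bsup>\<alpha> - 1\<^esup>\<close>,
 which is symmetric.\<close>

lemma beta_swap:
 fixes m :: "real \<Rightarrow> real \<Rightarrow> ennreal"
 assumes [measurable]: "(\<lambda>(x, y). m x y) \<in> borel_measurable (borel \<Otimes>\<^sub>M borel)"
 shows "(\<integral>\<^sup>+v0. \<integral>\<^sup>+v1. ennreal (1 - v0) * m v0 (v1 * (1 - v0)) \<partial>\<beta> \<partial>\<beta>) =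
     (\<integral>\<^sup>+v0. \<integral>\<^sup>+v1. ennreal (1 - v0) * m (v1 * (1 - v0)) v0 \<partial>\<beta> \<partial>\<beta>)"
proof -
 define g where "g x y = (if 0 < x \<and> 0 < y \<and> x + y < 1 then ennreal (\<alpha> * \<alpha> * (1 - x - y) powr (\<alpha> - 1)) else 0)" for x y :: real
 have [measurable]: "(\<lambda>(x, y). g x y) \<in> borel_measurable (borel \<Otimes>\<^sub>M borel)"
  unfolding g_def split_beta' by measurable
 have key: "(\<integral>\<^sup>+v0. \<integral>\<^sup>+v1. ennreal (1 - v0) * m v0 (v1 * (1 - v0)) \<partial>\<beta> \<partial>\<beta>) =
   (\<integral>\<^sup>+x. \<integral>\<^sup>+y. g x y * m x y \<partial>lborel \<partial>lborel)"
  if [measurable]: "(\<lambda>(x, y). m x y) \<in> borel_measurable (borel \<Otimes>\<^sub>M borel)" for m :: "real \<Rightarrow> real \<Rightarrow> ennreal"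
 proof -
  have "(\<integral>\<^sup>+v0. \<integral>\<^sup>+v1. ennreal (1 - v0) * m v0 (v1 * (1 - v0)) \<partial>\<beta> \<partial>\<beta>) =
    (\<integral>\<^sup>+x. ennreal (beta_density 1 \<alpha> x) * (\<integral>\<^sup>+v1. ennreal (1 - x) * m x (v1 * (1 - x)) \<partial>\<beta>) \<partial>lborel)"
   by (rule nn_integral_beta) measurable
  also have "\<dots> = (\<integral>\<^sup>+x. \<integral>\<^sup>+y. g x y * m x y \<partial>lborel \<partial>lborel)"
  proof (intro nn_integral_cong)
   fix x :: real
   show "ennreal (beta_density 1 \<alpha> x) * (\<integral>\<^sup>+v1. ennreal (1 - x) * m x (v1 * (1 - x)) \<partial>\<beta>) =
     (\<integral>\<^sup>+y. g x y * m x y \<partial>lborel)"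
   proof (cases "0 < x \<and> x < 1")
    case True
    \<comment> \<open>Substituting \<open>y = (1 - x) * v\<close> produces the Jacobian
      \<open>1 - x\<close>, which is exactly the weight in front of \<open>m\<close>.\<close>
    have "(\<integral>\<^sup>+y. g x y * m x y \<partial>lborel) =
      ennreal (1 - x) * (\<integral>\<^sup>+v. g x ((1 - x) * v) * m x ((1 - x) * v) \<partial>lborel)"
     using True nn_integral_real_affine[of "\<lambda>y. g x y * m x y" "1 - x" 0] by simp
    also have "\<dots> = (\<integral>\<^sup>+v. ennreal (1 - x) * (g x ((1 - x) * v) * m x ((1 - x) * v)) \<partial>lborel)"
     by (rule nn_integral_cmult[symmetric]) measurable
    also have "\<dots> = (\<integral>\<^sup>+v. ennreal (beta_density 1 \<alpha> x) * (ennreal (beta_density 1 \<alpha> v) * (ennreal (1 - x) * m x (v * (1 - x)))) \<partial>lborel)"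
    proof (intro nn_integral_cong)
     fix v :: real
     have iff: "x + (1 - x) * v < 1 \<longleftrightarrow> v < 1"
     proof -
      have "1 - (x + (1 - x) * v) = (1 - x) * (1 - v)" by (simp add: algebra_simps)
      thus ?thesis using True by (metis diff_gt_0_iff_gt zero_less_mult_pos mult_pos_pos)
     qed
     have "g x ((1 - x) * v) = ennreal (beta_density 1 \<alpha> x) * ennreal (beta_density 1 \<alpha> v)"
     proof (cases "0 < v \<and> v < 1")
      case v: True
      have "1 - x - (1 - x) * v = (1 - x) * (1 - v)" by (simp add: algebra_simps)
      hence "(1 - x - (1 - x) * v) powr (\<alpha> - 1) = (1 - x) powr (\<alpha> - 1) * (1 - v) powr (\<alpha> - 1)"
       using True v by (simp add: powr_mult)
      thus ?thesis using True v \<alpha>_pos iff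
       by (simp add: g_def beta_density_1 ennreal_mult'[symmetric] mult_ac)
     next
      case False
      thus ?thesis using True \<alpha>_pos iff
       by (auto simp: g_def beta_density_1 zero_less_mult_iff)
     qed
     thus "ennreal (1 - x) * (g x ((1 - x) * v) * m x ((1 - x) * v)) =
      ennreal (beta_density 1 \<alpha> x) * (ennreal (beta_density 1 \<alpha> v) * (ennreal (1 - x) * m x (v * (1 - x))))"
      by (simp add: mult_ac)
    qed
    also have "\<dots> = ennreal (beta_density 1 \<alpha> x) * (\<integral>\<^sup>+v. ennreal (beta_density 1 \<alpha> v) * (ennreal (1 - x) * m x (v * (1 - x))) \<partial>lborel)"
     by (rule nn_integral_cmult) measurable
    also have "\<dots> = ennreal (beta_density 1 \<alpha> x) * (\<integral>\<^sup>+v1. ennreal (1 - x) * m x (v1 * (1 - x)) \<partial>\<beta>)"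
     by (subst nn_integral_beta) auto
    finally show ?thesis by simp
   next
    case False
    hence "beta_density 1 \<alpha> x = 0" "g x y = 0" for y
     by (auto simp: beta_density_def g_def)
    thus ?thesis by simp
   qed
  qed
  finally show ?thesis .
 qed
 have "(\<integral>\<^sup>+x. \<integral>\<^sup>+y. g x y * m x y \<partial>lborel \<partial>lborel) = (\<integral>\<^sup>+y. \<integral>\<^sup>+x. g x y * m x y \<partial>lborel \<partial>lborel)"
  by (rule lborel_pair.Fubini'[symmetric]) (simp add: split_beta')
 also have "\<dots> = (\<integral>\<^sup>+y. \<integral>\<^sup>+x. g y x * m x y \<partial>lborel \<partial>lborel)"
  by (intro nn_integral_cong arg_cong2[where f = "(*)"] refl) (auto simp: g_def algebra_simps)
 finally have "(\<integral>\<^sup>+x. \<integral>\<^sup>+y. g x y * m x y \<partial>lborel \<partial>lborel) = (\<integral>\<^sup>+y. \<integral>\<^sup>+x. g y x * m x y \<partial>lborel \<partial>lborel)" .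
 moreover have "(\<lambda>(x, y). m y x) \<in> borel_measurable (borel \<Otimes>\<^sub>M borel)"
  unfolding split_beta' by measurable
 ultimately show ?thesis
  using key[OF assms] key[of "\<lambda>x y. m y x"] by simp
qed

end

section \<open>Stick-breaking weights\<close>

definition rem_mass :: "(nat \<Rightarrow> real) \<Rightarrow> nat \<Rightarrow> real" where
 "rem_mass v k = (\<Prod>j<k. 1 - v j)"

definition proper :: "(nat \<Rightarrow> real) \<Rightarrow> bool" where
 "proper v \<longleftrightarrow> (\<forall>k. 0 < v k \<and> v k < 1)"

text \<open>The integral of \<open>\<phi>\<close> against the random discrete measure. The argument
  is the sequence of sticks rather than of weights, because all changes of variables below act on
  sticks.\<close>

definition sp_mean :: "('a \<Rightarrow> real) \<Rightarrow> (nat \<Rightarrow> real) \<Rightarrow> (nat \<Rightarrow> 'a) \<Rightarrow> real" where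
 "sp_mean \<phi> v \<theta> = (\<Sum>j. stick_weights v j * \<phi> (\<theta> j))"

lemma rem_mass_0 [simp]: "rem_mass v 0 = 1"
 and rem_mass_Suc: "rem_mass v (Suc k) = rem_mass v k * (1 - v k)"
 by (auto simp: rem_mass_def)

lemma stick_weights_eq: "stick_weights v k = v k * rem_mass v k"
 by (simp add: stick_weights_def rem_mass_def)

lemma stick_weights_0: "stick_weights v 0 = v 0"
 by (simp add: stick_weights_def)

lemma stick_weights_diff: "stick_weights v k = rem_mass v k - rem_mass v (Suc k)"
 by (simp add: stick_weights_eq rem_mass_Suc algebra_simps)

lemma sum_stick_weights: "(\<Sum>k<n. stick_weights v k) = 1 - rem_mass v n"
 by (induction n) (auto simp: stick_weights_diff)

lemma rem_mass_case_nat [simp]: "rem_mass (case_nat a v) (Suc k) = (1 - a) * rem_mass v k"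
 by (induction k) (auto simp: rem_mass_Suc)

lemma stick_weights_case_nat [simp]:
 "stick_weights (case_nat a v) 0 = a"
 "stick_weights (case_nat a v) (Suc k) = (1 - a) * stick_weights v k"
 by (auto simp: stick_weights_eq)

lemma stick_weights_add: "stick_weights v (j + n) = rem_mass v n * stick_weights (\<lambda>i. v (i + n)) j"
proof -
 have "rem_mass v (j + n) = rem_mass v n * rem_mass (\<lambda>i. v (i + n)) j"
  by (induction j) (auto simp: rem_mass_Suc)
 thus ?thesis by (simp add: stick_weights_eq)
qed

lemma proper_case_nat [simp]: "proper (case_nat a v) \<longleftrightarrow> 0 < a \<and> a < 1 \<and> proper v"
 by (auto simp: proper_def split: nat.split)

lemma case_nat_shift: "case_nat (f 0) (f \<circ> Suc) = f"
 by (auto split: nat.split)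

lemma proper_Suc: "proper v \<Longrightarrow> proper (v \<circ> Suc)"
 and proper_comb_seq: "proper v \<Longrightarrow> proper v' \<Longrightarrow> proper (comb_seq n v v')"
 by (auto simp: proper_def comb_seq_def)

context
 fixes v assumes v: "proper v"
begin

lemma rem_mass_pos: "0 < rem_mass v k"
 using v by (auto simp: rem_mass_def proper_def intro!: prod_pos)

lemma rem_mass_le_1: "rem_mass v k \<le> 1"
 using v by (auto simp: rem_mass_def proper_def less_imp_le intro!: prod_le_1)

lemma stick_weights_pos: "0 < stick_weights v k"
 using rem_mass_pos v by (auto simp: stick_weights_eq proper_def)

lemma rem_mass_antimono: "i \<le> j \<Longrightarrow> rem_mass v j \<le> rem_mass v i"
proof (induction j rule: dec_induct)
 case (step n)
 thus ?case using stick_weights_pos[of n] by (simp add: stick_weights_diff)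
qed simp

lemma stick_weights_le_rem_mass: "j \<le> i \<Longrightarrow> stick_weights v i \<le> rem_mass v j"
 using rem_mass_antimono[of j i] rem_mass_pos[of "Suc i"] by (simp add: stick_weights_diff)

lemma stick_weights_less_1: "stick_weights v k < 1"
proof -
 have "v k * rem_mass v k \<le> v k * 1"
  using v rem_mass_le_1[of k] by (intro mult_left_mono) (auto simp: proper_def less_imp_le)
 also have "\<dots> < 1" using v by (simp add: proper_def)
 finally show ?thesis by (simp add: stick_weights_eq)
qed

lemma summable_stick_weights: "summable (stick_weights v)"
proof (rule summableI_nonneg_bounded[where x = 1])
 show "sum (stick_weights v) {..<n} \<le> 1" for n
  using rem_mass_pos[of n] by (simp add: sum_stick_weights)
qed (use stick_weights_pos in \<open>auto intro: less_imp_le\<close>)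

lemma suminf_stick_weights_le_1: "suminf (stick_weights v) \<le> 1"
 using summable_stick_weights
proof (rule suminf_le_const)
 show "sum (stick_weights v) {..<n} \<le> 1" for n
  using rem_mass_pos[of n] by (simp add: sum_stick_weights)
qed

context
 fixes \<phi> :: "'a \<Rightarrow> real" and b assumes \<phi>: "\<And>x. \<bar>\<phi> x\<bar> \<le> b"
begin

lemma summable_abs_sp_mean: "summable (\<lambda>j. \<bar>stick_weights v j * \<phi> (\<theta> j)\<bar>)"
proof (rule summable_comparison_test)
 show "summable (\<lambda>j. stick_weights v j * b)"
  using summable_stick_weights by (rule summable_mult2)
 have "\<bar>stick_weights v j * \<phi> (\<theta> j)\<bar> \<le> stick_weights v j * b" for j
  using \<phi>[of "\<theta> j"] stick_weights_pos[of j] by (auto simp: abs_mult intro!: mult_left_mono)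
 thus "\<exists>N. \<forall>n\<ge>N. norm \<bar>stick_weights v n * \<phi> (\<theta> n)\<bar> \<le> stick_weights v n * b" by auto
qed

lemma summable_sp_mean: "summable (\<lambda>j. stick_weights v j * \<phi> (\<theta> j))"
 using summable_abs_sp_mean by (rule summable_rabs_cancel)

lemma abs_sp_mean_le: "\<bar>sp_mean \<phi> v \<theta>\<bar> \<le> b"
proof -
 have b: "0 \<le> b" using \<phi>[of undefined] by simp
 have "\<bar>sp_mean \<phi> v \<theta>\<bar> \<le> (\<Sum>j. \<bar>stick_weights v j * \<phi> (\<theta> j)\<bar>)"
  unfolding sp_mean_def by (rule summable_rabs[OF summable_abs_sp_mean])
 also have "\<dots> \<le> (\<Sum>j. stick_weights v j * b)"
 proof (rule suminf_le[OF _ summable_abs_sp_mean summable_mult2[OF summable_stick_weights]])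
  show "\<bar>stick_weights v j * \<phi> (\<theta> j)\<bar> \<le> stick_weights v j * b" for j
   using \<phi>[of "\<theta> j"] stick_weights_pos[of j] by (auto simp: abs_mult intro!: mult_left_mono)
 qed
 also have "\<dots> = suminf (stick_weights v) * b"
  using summable_stick_weights by (rule suminf_mult2[symmetric])
 also have "\<dots> \<le> b" using suminf_stick_weights_le_1 b by (auto intro: mult_left_le_one_le simp: suminf_nonneg summable_stick_weights stick_weights_pos less_imp_le)
 finally show ?thesis .
qed

text \<open>Self-similarity: what follows the first \<open>n\<close> sticks is again a
  stick-breaking measure, scaled by \<open>rem_mass v n\<close>.\<close>

lemma sp_mean_split:
 "sp_mean \<phi> v \<theta> = (\<Sum>k<n. stick_weights v k * \<phi> (\<theta> k)) + rem_mass v n * sp_mean \<phi> (\<lambda>i. v (i + n)) (\<lambda>i. \<theta> (i + n))"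
proof -
 have "sp_mean \<phi> v \<theta> = (\<Sum>j. stick_weights v (j + n) * \<phi> (\<theta> (j + n))) + (\<Sum>k<n. stick_weights v k * \<phi> (\<theta> k))"
  unfolding sp_mean_def by (rule suminf_split_initial_segment[OF summable_sp_mean])
 also have "(\<lambda>j. stick_weights v (j + n) * \<phi> (\<theta> (j + n))) =
   (\<lambda>j. rem_mass v n * (stick_weights (\<lambda>i. v (i + n)) j * \<phi> (\<theta> (j + n))))"
  by (simp add: stick_weights_add mult_ac)
 also have "suminf \<dots> = rem_mass v n * sp_mean \<phi> (\<lambda>i. v (i + n)) (\<lambda>i. \<theta> (i + n))"
  unfolding sp_mean_def
 proof (rule suminf_mult)
  have "summable (\<lambda>j. stick_weights v (j + n) * \<phi> (\<theta> (j + n)))"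
   using summable_sp_mean[of \<theta>] by (subst summable_iff_shift[of "\<lambda>j. stick_weights v j * \<phi> (\<theta> j)" n])
  hence "summable (\<lambda>j. (1 / rem_mass v n) * (stick_weights v (j + n) * \<phi> (\<theta> (j + n))))"
   by (rule summable_mult)
  thus "summable (\<lambda>j. stick_weights (\<lambda>i. v (i + n)) j * \<phi> (\<theta> (j + n)))"
   using rem_mass_pos[of n] by (simp add: stick_weights_add)
 qed
 finally show ?thesis by simp
qed

end

end

lemma sp_mean_nonneg:
 assumes "proper v" "\<And>x. 0 \<le> \<phi> x" "\<And>x. \<phi> x \<le> b"
 shows "0 \<le> sp_mean \<phi> v \<theta>"
 unfolding sp_mean_def using assms
 by (intro suminf_nonneg summable_sp_mean[where b = b]) (auto simp: stick_weights_pos less_imp_le abs_le_iff intro: order_trans)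

lemma sp_mean_case_nat:
 assumes "proper v" "0 < a" "a < 1" "\<And>x. \<bar>\<phi> x\<bar> \<le> b"
 shows "sp_mean \<phi> (case_nat a v) (case_nat t \<theta>) = a * \<phi> t + (1 - a) * sp_mean \<phi> v \<theta>"
 using sp_mean_split[of "case_nat a v" \<phi> b "case_nat t \<theta>" 1] assms by simp

section \<open>Moving an atom to the front\<close>

text \<open>The sticks that exchange the first two weights: the old second weight is the new first
  stick, and the old first weight relative to what then remains is the second. Later sticks stay,
  because the mass left after both atoms does not depend on their order.\<close>

definition swap_sticks :: "(nat \<Rightarrow> real) \<Rightarrow> nat \<Rightarrow> real" where
 "swap_sticks v = case_nat (v 1 * (1 - v 0)) (case_nat (v 0 / (1 - v 1 * (1 - v 0))) (\<lambda>j. v (j + 2)))"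

text \<open>The tail is treated first, which brings the wanted atom to its head; one exchange of
  neighbours then moves it to position 0. The other atoms keep their order.\<close>

primrec stick_to_front :: "nat \<Rightarrow> (nat \<Rightarrow> real) \<Rightarrow> nat \<Rightarrow> real" where
 "stick_to_front 0 v = v"
| "stick_to_front (Suc i) v = swap_sticks (case_nat (v 0) (stick_to_front i (v \<circ> Suc)))"

text \<open>The increasing enumeration of all indices other than \<open>i\<close>.\<close>

definition skip :: "nat \<Rightarrow> nat \<Rightarrow> nat" where
 "skip i j = (if j < i then j else Suc j)"

definition front :: "nat \<Rightarrow> nat \<Rightarrow> nat" where
 "front i = case_nat i (skip i)"

lemma skip_0 [simp]: "skip 0 = Suc"
 and skip_Suc_0 [simp]: "skip (Suc i) 0 = 0"
 and skip_Suc_Suc [simp]: "skip (Suc i) (Suc j) = Suc (skip i j)"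
 and skip_neq [simp]: "skip i j \<noteq> i"
 and front_0 [simp]: "front i 0 = i"
 and front_Suc [simp]: "front i (Suc j) = skip i j"
 by (auto simp: skip_def front_def)

lemma inj_front: "inj (front i)"
 by (rule injI) (auto simp: front_def skip_def split: nat.splits if_splits)

lemma inj_skip: "inj (skip i)"
 by (rule injI) (auto simp: skip_def split: if_splits)

lemma front_zero: "front 0 = id"
 by (auto simp: front_def fun_eq_iff split: nat.split)

lemma swap_sticks_case_nat:
 "swap_sticks (case_nat a (case_nat b v)) = case_nat (b * (1 - a)) (case_nat (a / (1 - b * (1 - a))) v)"
 by (simp add: swap_sticks_def numeral_2_eq_2)

lemma swap_denom:
 fixes a b :: real
 assumes "0 < a" "a < 1" "0 < b" "b < 1"
 shows "a < 1 - b * (1 - a)" "b * (1 - a) < 1" "0 < b * (1 - a)"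
proof -
 have "b * (1 - a) < 1 * (1 - a)" using assms by (intro mult_strict_right_mono) auto
 moreover have "a < 1 - p \<and> p < 1" if "p < 1 * (1 - a)" for p using assms that by auto
 ultimately have "a < 1 - b * (1 - a) \<and> b * (1 - a) < 1" by blast
 thus "a < 1 - b * (1 - a)" "b * (1 - a) < 1" by auto
 show "0 < b * (1 - a)" using assms by auto
qed

lemma proper_swap_sticks:
 assumes "proper v" shows "proper (swap_sticks v)"
proof -
 have p: "0 < v 0" "v 0 < 1" "0 < v 1" "v 1 < 1" "proper (\<lambda>j. v (j + 2))"
  using assms by (auto simp: proper_def)
 show ?thesis
  using swap_denom[OF p(1-4)] p by (simp add: swap_sticks_def divide_less_eq)
qed

lemma proper_stick_to_front: "proper v \<Longrightarrow> proper (stick_to_front i v)"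
proof (induction i arbitrary: v)
 case (Suc i)
 thus ?case
  using Suc.IH[OF proper_Suc[OF Suc.prems]] unfolding stick_to_front.simps
  by (intro proper_swap_sticks) (simp only: proper_case_nat, simp add: proper_def[of v])
qed simp

lemma stick_weights_swap:
 assumes "0 < a" "a < 1" "0 < b" "b < 1"
 shows "stick_weights (swap_sticks (case_nat a (case_nat b v))) 0 = (1 - a) * b"
  "stick_weights (swap_sticks (case_nat a (case_nat b v))) (Suc 0) = a"
  "stick_weights (swap_sticks (case_nat a (case_nat b v))) (Suc (Suc k)) = (1 - a) * (1 - b) * stick_weights v k"
proof -
 have d: "1 - b * (1 - a) \<noteq> 0" using swap_denom[OF assms] by simp
 hence "(1 - b * (1 - a)) * (1 - a / (1 - b * (1 - a))) = (1 - a) * (1 - b)"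
  by (simp add: field_simps)
 thus "stick_weights (swap_sticks (case_nat a (case_nat b v))) (Suc (Suc k)) = (1 - a) * (1 - b) * stick_weights v k"
  by (simp add: swap_sticks_case_nat mult.assoc[symmetric])
qed (use swap_denom[OF assms] in \<open>auto simp: swap_sticks_case_nat\<close>)

lemma stick_weights_to_front:
 "proper v \<Longrightarrow> stick_weights (stick_to_front i v) j = stick_weights v (front i j)"
proof (induction i arbitrary: v j)
 case 0
 thus ?case by (simp add: front_zero)
next
 case (Suc i)
 define u where "u = stick_to_front i (v \<circ> Suc)"
 have pv: "0 < v 0" "v 0 < 1" "proper (v \<circ> Suc)" using Suc.prems by (auto simp: proper_def)
 have IH: "stick_weights u k = stick_weights (v \<circ> Suc) (front i k)" for k
  unfolding u_def by (rule Suc.IH[OF pv(3)])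
 have u: "proper u" unfolding u_def using pv by (intro proper_stick_to_front)
 hence pu: "0 < u 0" "u 0 < 1" "proper (u \<circ> Suc)" by (auto simp: proper_def)
 have uc: "u = case_nat (u 0) (u \<circ> Suc)" by (rule case_nat_shift[symmetric])
 have vc: "v = case_nat (v 0) (v \<circ> Suc)" by (rule case_nat_shift[symmetric])
 have S: "stick_weights v (Suc k) = (1 - v 0) * stick_weights (v \<circ> Suc) k" for k
  by (subst vc) simp
 note sw = stick_weights_swap[OF pv(1,2) pu(1,2), of "u \<circ> Suc", unfolded uc[symmetric]]
 have e: "stick_to_front (Suc i) v = swap_sticks (case_nat (v 0) u)" by (simp add: u_def)
 show ?case
 proof (cases j)
  case 0
  have "u 0 = stick_weights (v \<circ> Suc) i" using IH[of 0] by (simp add: stick_weights_0)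
  thus ?thesis unfolding e 0 by (simp only: sw(1) front_0 S)
 next
  case (Suc j')
  show ?thesis
  proof (cases j')
   case 0
   thus ?thesis using Suc unfolding e by (simp add: sw stick_weights_0)
  next
   case (Suc j'')
   have "stick_weights u (Suc j'') = (1 - u 0) * stick_weights (u \<circ> Suc) j''" by (subst uc) simp
   thus ?thesis using IH[of "Suc j''"] \<open>j = Suc j'\<close> Suc unfolding e by (simp add: sw S)
  qed
 qed
qed

lemma sp_mean_swap:
 assumes "proper v" "0 < a" "a < 1" "0 < b" "b < 1" "\<And>x. \<bar>\<phi> x\<bar> \<le> B"
 shows "sp_mean \<phi> (swap_sticks (case_nat a (case_nat b v))) (case_nat t (case_nat s \<theta>)) =
  sp_mean \<phi> (case_nat a (case_nat b v)) (case_nat s (case_nat t \<theta>))"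
proof -
 \<comment> \<open>The mass left by the atom that comes first after the exchange.\<close>
 define d where "d = 1 - b * (1 - a)"
 have d: "0 < d" "a < d" "d < 1" using swap_denom[OF assms(2-5)] by (auto simp: d_def)
 have e: "b * (1 - a) = 1 - d" by (simp add: d_def)
 have "sp_mean \<phi> (swap_sticks (case_nat a (case_nat b v))) (case_nat t (case_nat s \<theta>)) =
   (1 - d) * \<phi> t + d * (a / d * \<phi> s + (1 - a / d) * sp_mean \<phi> v \<theta>)"
  using assms d
  by (subst swap_sticks_case_nat, subst sp_mean_case_nat[where b = B])
    (auto simp: d_def[symmetric] sp_mean_case_nat[where b = B] divide_less_eq e)
 also have "d * (a / d * \<phi> s + (1 - a / d) * sp_mean \<phi> v \<theta>) = a * \<phi> s + (d - a) * sp_mean \<phi> v \<theta>"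
  using d by (simp add: field_simps)
 also have "(1 - d) * \<phi> t + (a * \<phi> s + (d - a) * sp_mean \<phi> v \<theta>) =
   a * \<phi> s + (1 - a) * (b * \<phi> t + (1 - b) * sp_mean \<phi> v \<theta>)"
  by (simp add: d_def algebra_simps)
 also have "\<dots> = sp_mean \<phi> (case_nat a (case_nat b v)) (case_nat s (case_nat t \<theta>))"
  using assms by (simp add: sp_mean_case_nat[where b = B])
 finally show ?thesis .
qed

lemma sp_mean_to_front:
 assumes "proper v" and \<phi>: "\<And>x. \<bar>\<phi> x\<bar> \<le> B"
 shows "sp_mean \<phi> (stick_to_front i v) (\<theta> \<circ> front i) = sp_mean \<phi> v \<theta>"
 using assms(1)
proof (induction i arbitrary: v \<theta>)
 case (Suc i)
 define u where "u = stick_to_front i (v \<circ> Suc)"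
 have pv: "0 < v 0" "v 0 < 1" "proper (v \<circ> Suc)" using Suc.prems by (auto simp: proper_def)
 have u: "proper u" unfolding u_def using pv by (intro proper_stick_to_front)
 hence pu: "0 < u 0" "u 0 < 1" "proper (u \<circ> Suc)" by (auto simp: proper_def)
 have th: "\<theta> \<circ> front (Suc i) = case_nat (\<theta> (Suc i)) (case_nat (\<theta> 0) (\<lambda>k. \<theta> (Suc (skip i k))))"
  by (auto simp: fun_eq_iff front_def split: nat.split)
 have th': "(\<theta> \<circ> Suc) \<circ> front i = case_nat (\<theta> (Suc i)) (\<lambda>k. \<theta> (Suc (skip i k)))"
  by (auto simp: fun_eq_iff front_def split: nat.split)
 have "sp_mean \<phi> (stick_to_front (Suc i) v) (\<theta> \<circ> front (Suc i)) =
   sp_mean \<phi> (swap_sticks (case_nat (v 0) (case_nat (u 0) (u \<circ> Suc)))) (\<theta> \<circ> front (Suc i))"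
  by (simp add: u_def case_nat_shift)
 also have "\<dots> = sp_mean \<phi> (case_nat (v 0) (case_nat (u 0) (u \<circ> Suc))) (case_nat (\<theta> 0) ((\<theta> \<circ> Suc) \<circ> front i))"
  unfolding th th' by (rule sp_mean_swap[OF pu(3) pv(1,2) pu(1,2) \<phi>])
 also have "\<dots> = v 0 * \<phi> (\<theta> 0) + (1 - v 0) * sp_mean \<phi> u ((\<theta> \<circ> Suc) \<circ> front i)"
  using u pv by (subst sp_mean_case_nat[where b = B]) (auto simp: case_nat_shift \<phi>)
 also have "sp_mean \<phi> u ((\<theta> \<circ> Suc) \<circ> front i) = sp_mean \<phi> (v \<circ> Suc) (\<theta> \<circ> Suc)"
  unfolding u_def by (rule Suc.IH[OF pv(3)])
 also have "v 0 * \<phi> (\<theta> 0) + (1 - v 0) * sp_mean \<phi> (v \<circ> Suc) (\<theta> \<circ> Suc) =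
   sp_mean \<phi> (case_nat (v 0) (v \<circ> Suc)) (case_nat (\<theta> 0) (\<theta> \<circ> Suc))"
  using pv by (subst sp_mean_case_nat[where b = B]) (auto simp: \<phi>)
 finally show ?case by (simp add: case_nat_shift)
qed (simp add: front_zero)

text \<open>Every index in the list refers to the sequence from which the atoms named earlier in the
  list have already been removed.\<close>

primrec sticks_to_front :: "nat list \<Rightarrow> (nat \<Rightarrow> real) \<Rightarrow> nat \<Rightarrow> real" where
 "sticks_to_front [] v = v"
| "sticks_to_front (i # is) v = case_nat (stick_to_front i v 0) (sticks_to_front is (stick_to_front i v \<circ> Suc))"

primrec atoms_to_front :: "nat list \<Rightarrow> (nat \<Rightarrow> 'a) \<Rightarrow> nat \<Rightarrow> 'a" where
 "atoms_to_front [] \<theta> = \<theta>"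
| "atoms_to_front (i # is) \<theta> = case_nat (\<theta> i) (atoms_to_front is (\<theta> \<circ> skip i))"

text \<open>The factor that has to be inserted under the integral for the reordering to be dominated
  by the prior; one remaining mass per moved atom.\<close>

primrec front_weight :: "nat list \<Rightarrow> (nat \<Rightarrow> real) \<Rightarrow> real" where
 "front_weight [] v = 1"
| "front_weight (i # is) v = rem_mass v i * front_weight is (stick_to_front i v \<circ> Suc)"

text \<open>Translates indices of the original sequence into the relative indices of
  \<open>sticks_to_front\<close>. The factor \<open>front_weight\<close> is at least
  \<open>c\<close> per atom, because the mass remaining before an atom is at least its weight, and
  removing other atoms first only enlarges its relative weight.\<close>

lemma sticks_to_front_exists:
 assumes "proper v" "distinct Is" "set Is \<subseteq> {..<n}" "0 < c" "\<And>i. i \<in> set Is \<Longrightarrow> c \<le> stick_weights v i"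
 shows "\<exists>is. length is = length Is \<and> set is \<subseteq> {..<n} \<and> c ^ length Is \<le> front_weight is v \<and>
  proper (sticks_to_front is v) \<and>
  (\<forall>k<length Is. stick_weights (sticks_to_front is v) k = stick_weights v (Is ! k)) \<and>
  (\<forall>\<theta>::nat \<Rightarrow> 'a. (\<forall>k<length Is. atoms_to_front is \<theta> k = \<theta> (Is ! k)) \<and>
   (\<forall>\<phi> B. (\<forall>x. \<bar>\<phi> x\<bar> \<le> B) \<longrightarrow> sp_mean \<phi> (sticks_to_front is v) (atoms_to_front is \<theta>) = sp_mean \<phi> v \<theta>))"
 using assms
proof (induction "length Is" arbitrary: Is v)
 case 0
 thus ?case by (intro exI[of _ "[]"]) auto
next
 case (Suc m Is0 v)
 obtain i Is where Is0: "Is0 = i # Is" using Suc.hyps(2) by (cases Is0) auto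
 have len: "m = length (map unskip Is)" for unskip :: "nat \<Rightarrow> nat" using Suc.hyps(2) Is0 by simp
 note prems = Suc.prems[unfolded Is0]
 define v' where "v' = stick_to_front i v \<circ> Suc"
 define s where "s = stick_weights v i"
 have pf: "proper (stick_to_front i v)" using prems(1) by (rule proper_stick_to_front)
 hence pv': "proper v'" unfolding v'_def by (rule proper_Suc)
 have s0: "stick_to_front i v 0 = s"
  using stick_weights_to_front[OF prems(1), of i 0] by (simp add: s_def stick_weights_0)
 have s: "0 < s" "s < 1" using stick_weights_pos[OF prems(1)] stick_weights_less_1[OF prems(1)]
  by (auto simp: s_def)
 have fc: "stick_to_front i v = case_nat s v'" unfolding v'_def using s0 by (metis case_nat_shift)
 have S': "stick_weights v (skip i j) = (1 - s) * stick_weights v' j" for j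
  using stick_weights_to_front[OF prems(1), of i "Suc j"] by (simp add: fc)
 \<comment> \<open>Inverse of \<open>skip i\<close> away from \<open>i\<close>: the position of atom
   \<open>l\<close> once atom \<open>i\<close> is gone.\<close>
 define unskip where "unskip l = (if l < i then l else l - 1)" for l
 have us: "skip i (unskip l) = l" if "l \<noteq> i" for l
  using that by (auto simp: unskip_def skip_def)
 have dist: "distinct (map unskip Is)"
  using prems(2) us by (auto simp: distinct_map intro!: inj_on_inverseI[where g = "skip i"] us)
 have sub: "set (map unskip Is) \<subseteq> {..<n}"
  using prems(3) by (auto simp: unskip_def)
 \<comment> \<open>Weights relative to the mass \<open>1 - s\<close> exceed the original ones, so
   the lower bound \<open>c\<close> survives the removal.\<close>
 have ge: "c \<le> stick_weights v' j" if j: "j \<in> set (map unskip Is)" for j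
 proof -
  obtain l where l: "l \<in> set Is" "j = unskip l" using j unfolding set_map by blast
  hence "l \<noteq> i" using prems(2) by auto
  hence "c \<le> stick_weights v (skip i j)" using l prems(5)[of l] us[of l] by simp
  also have "\<dots> = (1 - s) * stick_weights v' j" by (rule S')
  also have "\<dots> \<le> stick_weights v' j"
   using s stick_weights_pos[OF pv', of j] by (intro mult_left_le_one_le) auto
  finally show ?thesis .
 qed
 obtain "is" where IS: "length is = length (map unskip Is)" "set is \<subseteq> {..<n}" "c ^ length (map unskip Is) \<le> front_weight is v'"
  "proper (sticks_to_front is v')"
  "\<And>k. k < length (map unskip Is) \<Longrightarrow> stick_weights (sticks_to_front is v') k = stick_weights v' (map unskip Is ! k)"
  "\<And>(\<theta>::nat \<Rightarrow> 'a) k. k < length (map unskip Is) \<Longrightarrow> atoms_to_front is \<theta> k = \<theta> (map unskip Is ! k)"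
  "\<And>(\<theta>::nat \<Rightarrow> 'a) \<phi> B. (\<And>x. \<bar>\<phi> x\<bar> \<le> B) \<Longrightarrow> sp_mean \<phi> (sticks_to_front is v') (atoms_to_front is \<theta>) = sp_mean \<phi> v' \<theta>"
  using Suc.hyps(1)[OF len pv' dist sub prems(4) ge] by metis
 have ins: "Is ! k \<noteq> i" if "k < length Is" for k
  using prems(2) that by (auto simp: in_set_conv_nth)
 show ?case unfolding Is0
 proof (intro exI[of _ "i # is"] conjI allI impI)
  show "set (i # is) \<subseteq> {..<n}" using prems(3) IS(2) by auto
  have "c \<le> rem_mass v i"
   using prems(5)[of i] stick_weights_le_rem_mass[OF prems(1), of i i] by simp
  thus "c ^ length (i # Is) \<le> front_weight (i # is) v"
   using IS(3) \<open>0 < c\<close> by (auto simp: v'_def[symmetric] intro!: mult_mono)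
  show "proper (sticks_to_front (i # is) v)"
   using IS(4) s s0 by (simp add: v'_def[symmetric])
  show "stick_weights (sticks_to_front (i # is) v) k = stick_weights v ((i # Is) ! k)" if "k < length (i # Is)" for k
  proof (cases k)
   case (Suc l)
   thus ?thesis using that IS(5)[of l] S' us ins[of l] by (simp add: v'_def[symmetric] s0 flip: S')
  qed (simp add: s0 s_def)
  fix \<theta> :: "nat \<Rightarrow> 'a"
  show "atoms_to_front (i # is) \<theta> k = \<theta> ((i # Is) ! k)" if "k < length (i # Is)" for k
  proof (cases k)
   case (Suc l)
   thus ?thesis using that IS(6)[of l "\<theta> \<circ> skip i"] us ins[of l] by simp
  qed simp
  fix \<phi> :: "'a \<Rightarrow> real" and B assume "\<forall>x. \<bar>\<phi> x\<bar> \<le> B"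
  hence \<phi>: "\<And>x. \<bar>\<phi> x\<bar> \<le> B" by simp
  have th: "case_nat (\<theta> i) (\<theta> \<circ> skip i) = \<theta> \<circ> front i"
   by (auto simp: fun_eq_iff front_def split: nat.split)
  have "sp_mean \<phi> (sticks_to_front (i # is) v) (atoms_to_front (i # is) \<theta>) =
    s * \<phi> (\<theta> i) + (1 - s) * sp_mean \<phi> v' (\<theta> \<circ> skip i)"
   using IS(4) s \<phi> by (simp add: s0 v'_def[symmetric] sp_mean_case_nat[where b = B] IS(7)[where B = B])
  also have "\<dots> = sp_mean \<phi> (stick_to_front i v) (\<theta> \<circ> front i)"
   unfolding fc th[symmetric] using pv' s \<phi> by (intro sp_mean_case_nat[symmetric]) auto
  also have "\<dots> = sp_mean \<phi> v \<theta>" by (rule sp_mean_to_front[OF prems(1) \<phi>])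
  finally show "sp_mean \<phi> (sticks_to_front (i # is) v) (atoms_to_front (i # is) \<theta>) = sp_mean \<phi> v \<theta>" .
 qed (use IS(1) in auto)
qed

section \<open>The prior\<close>

type_synonym 'a sticks = "(nat \<Rightarrow> real) \<times> (nat \<Rightarrow> 'a)"

locale dirichlet_process = stick_proportions \<alpha> + base: prob_space P0
 for \<alpha> :: real and P0 :: "'a::euclidean_space measure" +
 assumes sets_P0 [measurable_cong]: "sets P0 = sets borel"
begin

sublocale B: sequence_space \<beta>
 by unfold_locales

sublocale T: sequence_space P0
 by unfold_locales

definition sticks_law :: "(nat \<Rightarrow> real) measure" where
 "sticks_law = (\<Pi>\<^sub>M i\<in>UNIV. \<beta>)"

definition atoms_law :: "(nat \<Rightarrow> 'a) measure" where
 "atoms_law = (\<Pi>\<^sub>M i\<in>UNIV. P0)"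

text \<open>Kept in terms of sticks, where the coordinates are independent; \<open>DP_prior\<close>
  is its image under \<open>stick_weights\<close>.\<close>

definition prior :: "'a sticks measure" where
 "prior = sticks_law \<Otimes>\<^sub>M atoms_law"

lemma space_P0 [simp]: "space P0 = UNIV"
 using sets_eq_imp_space_eq[OF sets_P0] by simp

lemma sets_sticks_law: "sets sticks_law = sets (\<Pi>\<^sub>M i\<in>UNIV. borel)"
 unfolding sticks_law_def by (intro sets_PiM_cong) auto

lemma sets_atoms_law: "sets atoms_law = sets (\<Pi>\<^sub>M i\<in>UNIV. borel)"
 unfolding atoms_law_def by (intro sets_PiM_cong) (auto simp: sets_P0)

lemma space_sticks_law [simp]: "space sticks_law = UNIV"
 and space_atoms_law [simp]: "space atoms_law = UNIV"
 and space_prior [simp]: "space prior = UNIV"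
 by (auto simp: sticks_law_def atoms_law_def prior_def space_PiM space_pair_measure)

sublocale SL: prob_space sticks_law
 unfolding sticks_law_def by unfold_locales

sublocale AL: prob_space atoms_law
 unfolding atoms_law_def by unfold_locales

sublocale SA: pair_prob_space sticks_law atoms_law
 by unfold_locales

sublocale PR: prob_space prior
 unfolding prior_def by unfold_locales

lemma nn_integral_prior:
 assumes [measurable]: "h \<in> borel_measurable prior"
 shows "(\<integral>\<^sup>+p. h p \<partial>prior) = (\<integral>\<^sup>+v. \<integral>\<^sup>+\<theta>. h (v, \<theta>) \<partial>atoms_law \<partial>sticks_law)"
 unfolding prior_def using assms
 by (intro AL.nn_integral_fst[symmetric]) (simp add: prior_def)

lemma measurable_sticks_component [measurable (raw)]: "(\<lambda>v. v i) \<in> borel_measurable sticks_law"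
 by (subst measurable_cong_sets[OF sets_sticks_law refl]) (rule measurable_component_singleton, simp)

lemma measurable_sticks_component' [measurable_dest]:
 assumes "f \<in> measurable N sticks_law" shows "(\<lambda>x. f x i) \<in> borel_measurable N"
 using measurable_compose[OF assms measurable_sticks_component[of i]] .

lemma measurable_atoms_component [measurable (raw)]: "(\<lambda>v. v i) \<in> borel_measurable atoms_law"
 by (subst measurable_cong_sets[OF sets_atoms_law refl]) (rule measurable_component_singleton, simp)

lemma measurable_atoms_component' [measurable_dest]:
 assumes "f \<in> measurable N atoms_law" shows "(\<lambda>x. f x i) \<in> borel_measurable N"
 using measurable_compose[OF assms measurable_atoms_component[of i]] .

lemma measurable_rem_mass [measurable]: "(\<lambda>v. rem_mass v k) \<in> borel_measurable sticks_law"
 unfolding rem_mass_def by measurable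

lemma measurable_stick_weights [measurable]: "(\<lambda>v. stick_weights v k) \<in> borel_measurable sticks_law"
 unfolding stick_weights_def by measurable

lemma measurable_shift_sticks: "(\<lambda>v i. v (\<pi> i)) \<in> measurable sticks_law sticks_law"
 using B.measurable_reindex[of \<pi>] by (simp add: sticks_law_def comp_def)

lemma measurable_shift_atoms: "(\<lambda>v i. v (\<pi> i)) \<in> measurable atoms_law atoms_law"
 using T.measurable_reindex[of \<pi>] by (simp add: atoms_law_def comp_def)

lemmas measurable_shift_sticks' [measurable] =
 measurable_shift_sticks[of Suc] measurable_shift_sticks[of "\<lambda>j. j + 2"]

lemmas measurable_shift_atoms' [measurable] =
 measurable_shift_atoms[of Suc] measurable_shift_atoms[of "skip i" for i]

lemma measurable_case_nat_sticks [measurable]: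
 assumes f: "f \<in> borel_measurable N" and g: "g \<in> measurable N sticks_law"
 shows "(\<lambda>x. case_nat (f x) (g x)) \<in> measurable N sticks_law"
proof -
 have "f \<in> measurable N \<beta>"
  using f by (subst measurable_cong_sets[OF refl sets_beta_measure])
 from measurable_case_nat'[OF this g[unfolded sticks_law_def]] show ?thesis
  unfolding sticks_law_def .
qed

lemma measurable_case_nat_atoms [measurable]:
 assumes f: "f \<in> borel_measurable N" and g: "g \<in> measurable N atoms_law"
 shows "(\<lambda>x. case_nat (f x) (g x)) \<in> measurable N atoms_law"
proof -
 have "f \<in> measurable N P0"
  using f by (subst measurable_cong_sets[OF refl sets_P0])
 from measurable_case_nat'[OF this g[unfolded atoms_law_def]] show ?thesis
  unfolding atoms_law_def .
qed

lemma measurable_swap_sticks [measurable]: "swap_sticks \<in> measurable sticks_law sticks_law"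
 unfolding swap_sticks_def[abs_def] by measurable

lemma measurable_stick_to_front [measurable]: "stick_to_front i \<in> measurable sticks_law sticks_law"
proof (induction i)
 case (Suc i)
 note Suc[measurable]
 show ?case unfolding stick_to_front.simps comp_def by measurable
qed simp

lemma measurable_sticks_to_front [measurable]: "sticks_to_front is \<in> measurable sticks_law sticks_law"
proof (induction "is")
 case (Cons i "is")
 note Cons[measurable]
 show ?case unfolding sticks_to_front.simps comp_def by measurable
qed simp

lemma measurable_atoms_to_front [measurable]: "atoms_to_front is \<in> measurable atoms_law atoms_law"
proof (induction "is")
 case (Cons i "is")
 note Cons[measurable]
 show ?case unfolding atoms_to_front.simps comp_def by measurable
qed simp

lemma measurable_front_weight [measurable]: "(\<lambda>v. front_weight is v) \<in> borel_measurable sticks_law"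
proof (induction "is")
 case (Cons i "is")
 have "(\<lambda>v. stick_to_front i v \<circ> Suc) \<in> measurable sticks_law sticks_law"
  unfolding comp_def by measurable
 from measurable_compose[OF this Cons] show ?case
  unfolding front_weight.simps by (intro borel_measurable_times measurable_rem_mass)
qed simp

lemma measurable_prior_fst [measurable]: "fst \<in> measurable prior sticks_law"
 and measurable_prior_snd [measurable]: "snd \<in> measurable prior atoms_law"
 unfolding prior_def by (rule measurable_fst measurable_snd)+

lemma measurable_prior_Pair [measurable]:
 "f \<in> measurable N sticks_law \<Longrightarrow> g \<in> measurable N atoms_law \<Longrightarrow> (\<lambda>x. (f x, g x)) \<in> measurable N prior"
 unfolding prior_def by (rule measurable_Pair)

lemma sets_prior_Collect: "Measurable.pred prior P \<Longrightarrow> {p. P p} \<in> sets prior"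
 by (simp add: pred_def)

lemma AE_prior_fst:
 assumes [measurable]: "Measurable.pred sticks_law P" and "AE v in sticks_law. P v"
 shows "AE p in prior. P (fst p)"
proof -
 have "Measurable.pred prior (\<lambda>p. P (fst p))" by measurable
 thus ?thesis
  unfolding prior_def using assms(2) by (intro SA.AE_pair_measure) (auto simp: pred_def prior_def)
qed

lemma AE_prior_snd:
 assumes [measurable]: "Measurable.pred atoms_law P" and "AE \<theta> in atoms_law. P \<theta>"
 shows "AE p in prior. P (snd p)"
proof -
 have "Measurable.pred prior (\<lambda>p. P (snd p))" by measurable
 thus ?thesis
  unfolding prior_def using assms(2) by (intro SA.AE_pair_measure) (auto simp: pred_def prior_def)
qed

lemma AE_proper: "AE p in prior. proper (fst p)"
proof -
 have "AE p in prior. 0 < fst p i \<and> fst p i < 1" for i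
 proof (rule AE_prior_fst)
  show "AE v in sticks_law. 0 < v i \<and> v i < 1"
   unfolding sticks_law_def using AE_beta by (intro B.AE_component) auto
 qed measurable
 thus ?thesis unfolding proper_def by (subst AE_all_countable) auto
qed

lemma measurable_sp_mean [measurable]:
 assumes [measurable]: "\<phi> \<in> borel_measurable borel"
 shows "(\<lambda>p. sp_mean \<phi> (fst p) (snd p)) \<in> borel_measurable prior"
 unfolding sp_mean_def by measurable

lemma nn_integral_sticks_step:
 assumes "f \<in> borel_measurable sticks_law"
 shows "(\<integral>\<^sup>+v. f v \<partial>sticks_law) = (\<integral>\<^sup>+a. \<integral>\<^sup>+v. f (case_nat a v) \<partial>sticks_law \<partial>\<beta>)"
 using assms unfolding sticks_law_def by (rule B.nn_integral_seq_step)

lemma nn_integral_atoms_step: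
 assumes "f \<in> borel_measurable atoms_law"
 shows "(\<integral>\<^sup>+v. f v \<partial>atoms_law) = (\<integral>\<^sup>+a. \<integral>\<^sup>+v. f (case_nat a v) \<partial>atoms_law \<partial>P0)"
 using assms unfolding atoms_law_def by (rule T.nn_integral_seq_step)

text \<open>The distributional fixed point of the Dirichlet process: first stick, first atom, and an
  independent copy of the whole prior.\<close>

lemma nn_integral_prior_step:
 assumes [measurable]: "h \<in> borel_measurable prior"
 shows "(\<integral>\<^sup>+p. h p \<partial>prior) =
  (\<integral>\<^sup>+a. \<integral>\<^sup>+t. \<integral>\<^sup>+p. h (case_nat a (fst p), case_nat t (snd p)) \<partial>prior \<partial>P0 \<partial>\<beta>)"
proof -
 have "(\<integral>\<^sup>+p. h p \<partial>prior) = (\<integral>\<^sup>+v. \<integral>\<^sup>+\<theta>. h (v, \<theta>) \<partial>atoms_law \<partial>sticks_law)"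
  by (rule nn_integral_prior) fact
 also have "\<dots> = (\<integral>\<^sup>+v. \<integral>\<^sup>+t. \<integral>\<^sup>+\<theta>. h (v, case_nat t \<theta>) \<partial>atoms_law \<partial>P0 \<partial>sticks_law)"
  by (intro nn_integral_cong nn_integral_atoms_step) measurable
 also have "\<dots> = (\<integral>\<^sup>+a. \<integral>\<^sup>+v. \<integral>\<^sup>+t. \<integral>\<^sup>+\<theta>. h (case_nat a v, case_nat t \<theta>) \<partial>atoms_law \<partial>P0 \<partial>sticks_law \<partial>\<beta>)"
  by (rule nn_integral_sticks_step) measurable
 also have "\<dots> = (\<integral>\<^sup>+a. \<integral>\<^sup>+t. \<integral>\<^sup>+v. \<integral>\<^sup>+\<theta>. h (case_nat a v, case_nat t \<theta>) \<partial>atoms_law \<partial>sticks_law \<partial>P0 \<partial>\<beta>)"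
 proof (intro nn_integral_cong)
  fix a
  show "(\<integral>\<^sup>+v. \<integral>\<^sup>+t. \<integral>\<^sup>+\<theta>. h (case_nat a v, case_nat t \<theta>) \<partial>atoms_law \<partial>P0 \<partial>sticks_law) =
   (\<integral>\<^sup>+t. \<integral>\<^sup>+v. \<integral>\<^sup>+\<theta>. h (case_nat a v, case_nat t \<theta>) \<partial>atoms_law \<partial>sticks_law \<partial>P0)"
  proof (rule pair_sigma_finite.Fubini'[of P0 sticks_law])
   show "pair_sigma_finite P0 sticks_law"
    by (intro pair_sigma_finite.intro base.sigma_finite_measure_axioms SL.sigma_finite_measure_axioms)
   show "(\<lambda>(t, v). \<integral>\<^sup>+\<theta>. h (case_nat a v, case_nat t \<theta>) \<partial>atoms_law) \<in> borel_measurable (P0 \<Otimes>\<^sub>M sticks_law)"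
    by measurable
  qed
 qed
 also have "\<dots> = (\<integral>\<^sup>+a. \<integral>\<^sup>+t. \<integral>\<^sup>+p. h (case_nat a (fst p), case_nat t (snd p)) \<partial>prior \<partial>P0 \<partial>\<beta>)"
  by (intro nn_integral_cong, subst nn_integral_prior) auto
 finally show ?thesis .
qed

text \<open>The law of the sticks weighted by \<open>1 - v 0\<close> is invariant under the
  exchange. This is \<open>beta_swap\<close> for the first two sticks, as the later ones are
  independent of them and unchanged.\<close>

lemma nn_integral_swap_sticks:
 assumes [measurable]: "h \<in> borel_measurable sticks_law"
 shows "(\<integral>\<^sup>+v. ennreal (1 - v 0) * h (swap_sticks v) \<partial>sticks_law) = (\<integral>\<^sup>+v. ennreal (1 - v 0) * h v \<partial>sticks_law)"
proof -
 \<comment> \<open>Integrates out the later sticks given the first two weights \<open>x\<close> and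
   \<open>y\<close>; the quotient \<open>y / (1 - x)\<close> recovers the second stick.\<close>
 define m where "m x y = (\<integral>\<^sup>+v. h (case_nat x (case_nat (y / (1 - x)) v)) \<partial>sticks_law)" for x y
 have [measurable]: "(\<lambda>(x, y). m x y) \<in> borel_measurable (borel \<Otimes>\<^sub>M borel)"
  unfolding m_def split_beta' by measurable
 have two: "(\<integral>\<^sup>+v. f v \<partial>sticks_law) = (\<integral>\<^sup>+a. \<integral>\<^sup>+b. \<integral>\<^sup>+v. f (case_nat a (case_nat b v)) \<partial>sticks_law \<partial>\<beta> \<partial>\<beta>)"
  if [measurable]: "f \<in> borel_measurable sticks_law" for f
  by (subst nn_integral_sticks_step, measurable, intro nn_integral_cong nn_integral_sticks_step, measurable)
 have "(\<integral>\<^sup>+v. ennreal (1 - v 0) * h v \<partial>sticks_law) = (\<integral>\<^sup>+a. \<integral>\<^sup>+b. ennreal (1 - a) * m a (b * (1 - a)) \<partial>\<beta> \<partial>\<beta>)"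
 proof (subst two, measurable, intro nn_integral_cong_AE)
  show "AE a in \<beta>. (\<integral>\<^sup>+b. \<integral>\<^sup>+v. ennreal (1 - case_nat a (case_nat b v) 0) * h (case_nat a (case_nat b v)) \<partial>sticks_law \<partial>\<beta>) =
    (\<integral>\<^sup>+b. ennreal (1 - a) * m a (b * (1 - a)) \<partial>\<beta>)"
   using AE_beta
  proof eventually_elim
   case (elim a)
   thus ?case by (intro nn_integral_cong) (simp add: m_def nn_integral_cmult)
  qed
 qed
 also have "\<dots> = (\<integral>\<^sup>+a. \<integral>\<^sup>+b. ennreal (1 - a) * m (b * (1 - a)) a \<partial>\<beta> \<partial>\<beta>)"
  by (rule beta_swap) measurable
 also have "\<dots> = (\<integral>\<^sup>+v. ennreal (1 - v 0) * h (swap_sticks v) \<partial>sticks_law)"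
  by (subst two, measurable, intro nn_integral_cong) (simp add: m_def nn_integral_cmult swap_sticks_case_nat)
 finally show ?thesis by simp
qed

text \<open>The factor \<open>rem_mass v (Suc i)\<close> splits into \<open>1 - v 0\<close> and the
  remaining mass of the tail. The induction hypothesis absorbs the second, the invariance under the
  exchange uses the first, which is finally bounded by 1.\<close>

lemma nn_integral_stick_to_front:
 assumes [measurable]: "h \<in> borel_measurable sticks_law"
 shows "(\<integral>\<^sup>+v. ennreal (rem_mass v i) * h (stick_to_front i v) \<partial>sticks_law) \<le> (\<integral>\<^sup>+v. h v \<partial>sticks_law)"
 using assms
proof (induction i arbitrary: h)
 case (Suc i)
 note [measurable] = Suc.prems
 have "(\<integral>\<^sup>+v. ennreal (rem_mass v (Suc i)) * h (stick_to_front (Suc i) v) \<partial>sticks_law) =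
   (\<integral>\<^sup>+a. \<integral>\<^sup>+v. ennreal (1 - a) * (ennreal (rem_mass v i) * h (swap_sticks (case_nat a (stick_to_front i v)))) \<partial>sticks_law \<partial>\<beta>)"
 proof (subst nn_integral_sticks_step, measurable, intro nn_integral_cong_AE)
  show "AE a in \<beta>. (\<integral>\<^sup>+v. ennreal (rem_mass (case_nat a v) (Suc i)) * h (stick_to_front (Suc i) (case_nat a v)) \<partial>sticks_law) =
    (\<integral>\<^sup>+v. ennreal (1 - a) * (ennreal (rem_mass v i) * h (swap_sticks (case_nat a (stick_to_front i v)))) \<partial>sticks_law)"
   using AE_beta
  proof eventually_elim
   case (elim a)
   thus ?case
    by (intro nn_integral_cong) (simp add: ennreal_mult' mult.assoc comp_def)
  qed
 qed
 also have "\<dots> = (\<integral>\<^sup>+a. ennreal (1 - a) * (\<integral>\<^sup>+v. ennreal (rem_mass v i) * h (swap_sticks (case_nat a (stick_to_front i v))) \<partial>sticks_law) \<partial>\<beta>)"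
  by (intro nn_integral_cong nn_integral_cmult) measurable
 also have "\<dots> \<le> (\<integral>\<^sup>+a. ennreal (1 - a) * (\<integral>\<^sup>+v. h (swap_sticks (case_nat a v)) \<partial>sticks_law) \<partial>\<beta>)"
  by (intro nn_integral_mono mult_left_mono Suc.IH) auto
 also have "\<dots> = (\<integral>\<^sup>+a. \<integral>\<^sup>+v. ennreal (1 - a) * h (swap_sticks (case_nat a v)) \<partial>sticks_law \<partial>\<beta>)"
  by (intro nn_integral_cong nn_integral_cmult[symmetric]) measurable
 also have "\<dots> = (\<integral>\<^sup>+v. ennreal (1 - v 0) * h (swap_sticks v) \<partial>sticks_law)"
  by (subst nn_integral_sticks_step) auto
 also have "\<dots> = (\<integral>\<^sup>+v. ennreal (1 - v 0) * h v \<partial>sticks_law)"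
  by (rule nn_integral_swap_sticks) measurable
 also have "\<dots> = (\<integral>\<^sup>+a. \<integral>\<^sup>+v. ennreal (1 - a) * h (case_nat a v) \<partial>sticks_law \<partial>\<beta>)"
  by (subst nn_integral_sticks_step) auto
 also have "\<dots> \<le> (\<integral>\<^sup>+a. \<integral>\<^sup>+v. h (case_nat a v) \<partial>sticks_law \<partial>\<beta>)"
 proof (intro nn_integral_mono_AE)
  show "AE a in \<beta>. (\<integral>\<^sup>+v. ennreal (1 - a) * h (case_nat a v) \<partial>sticks_law) \<le> (\<integral>\<^sup>+v. h (case_nat a v) \<partial>sticks_law)"
   using AE_beta
  proof eventually_elim
   case (elim a)
   hence "ennreal (1 - a) \<le> 1" by (simp add: ennreal_le_1)
   hence "ennreal (1 - a) * x \<le> x" for x using mult_right_mono[of "ennreal (1 - a)" 1 x] by simp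
   thus ?case by (intro nn_integral_mono)
  qed
 qed
 also have "\<dots> = (\<integral>\<^sup>+v. h v \<partial>sticks_law)"
  by (rule nn_integral_sticks_step[symmetric]) measurable
 finally show ?case .
qed simp

text \<open>The atoms are i.i.d. and independent of the sticks, so reordering them is free; the
  whole cost stems from the sticks.\<close>

lemma nn_integral_prior_to_front:
 assumes [measurable]: "h \<in> borel_measurable prior"
 shows "(\<integral>\<^sup>+p. ennreal (rem_mass (fst p) i) * h (stick_to_front i (fst p), snd p \<circ> front i) \<partial>prior) \<le> (\<integral>\<^sup>+p. h p \<partial>prior)"
proof -
 have [measurable]: "(\<lambda>\<theta>. \<theta> \<circ> front i) \<in> measurable atoms_law atoms_law"
  using measurable_shift_atoms[of "front i"] by (simp add: comp_def)
 have "(\<integral>\<^sup>+p. ennreal (rem_mass (fst p) i) * h (stick_to_front i (fst p), snd p \<circ> front i) \<partial>prior) =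
   (\<integral>\<^sup>+v. ennreal (rem_mass v i) * (\<integral>\<^sup>+\<theta>. h (stick_to_front i v, \<theta> \<circ> front i) \<partial>atoms_law) \<partial>sticks_law)"
  by (subst nn_integral_prior) (auto simp: nn_integral_cmult)
 also have "\<dots> = (\<integral>\<^sup>+v. ennreal (rem_mass v i) * (\<integral>\<^sup>+\<theta>. h (stick_to_front i v, \<theta>) \<partial>atoms_law) \<partial>sticks_law)"
 proof -
  have "(\<integral>\<^sup>+\<theta>. h (stick_to_front i v, \<theta> \<circ> front i) \<partial>atoms_law) = (\<integral>\<^sup>+\<theta>. h (stick_to_front i v, \<theta>) \<partial>atoms_law)" for v
   using T.nn_integral_reindex[of "\<lambda>\<theta>. h (stick_to_front i v, \<theta>)" "front i"] inj_front
   by (simp add: atoms_law_def[symmetric])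
  thus ?thesis by (simp only:)
 qed
 also have "\<dots> \<le> (\<integral>\<^sup>+v. \<integral>\<^sup>+\<theta>. h (v, \<theta>) \<partial>atoms_law \<partial>sticks_law)"
  by (rule nn_integral_stick_to_front[of "\<lambda>v. \<integral>\<^sup>+\<theta>. h (v, \<theta>) \<partial>atoms_law" i]) measurable
 also have "\<dots> = (\<integral>\<^sup>+p. h p \<partial>prior)" by (rule nn_integral_prior[symmetric]) measurable
 finally show ?thesis .
qed

text \<open>Once an atom is in front it is split off by \<open>nn_integral_prior_step\<close>, and
  the induction hypothesis applies to the fresh copy of the prior behind it.\<close>

lemma nn_integral_prior_atoms_to_front:
 assumes [measurable]: "h \<in> borel_measurable prior"
 shows "(\<integral>\<^sup>+p. ennreal (front_weight is (fst p)) * h (sticks_to_front is (fst p), atoms_to_front is (snd p)) \<partial>prior) \<le> (\<integral>\<^sup>+p. h p \<partial>prior)"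
 using assms
proof (induction "is" arbitrary: h)
 case (Cons i "is")
 note [measurable] = Cons.prems
 define g where "g p = ennreal (front_weight is (fst p \<circ> Suc)) * h (case_nat (fst p 0) (sticks_to_front is (fst p \<circ> Suc)),
  case_nat (snd p 0) (atoms_to_front is (snd p \<circ> Suc)))" for p :: "'a sticks"
 have [measurable]: "g \<in> borel_measurable prior"
  unfolding g_def comp_def by measurable
 have "(\<integral>\<^sup>+p. ennreal (front_weight (i # is) (fst p)) * h (sticks_to_front (i # is) (fst p), atoms_to_front (i # is) (snd p)) \<partial>prior) =
   (\<integral>\<^sup>+p. ennreal (rem_mass (fst p) i) * g (stick_to_front i (fst p), snd p \<circ> front i) \<partial>prior)"
 proof (intro nn_integral_cong_AE)
  show "AE p in prior. ennreal (front_weight (i # is) (fst p)) * h (sticks_to_front (i # is) (fst p), atoms_to_front (i # is) (snd p)) =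
   ennreal (rem_mass (fst p) i) * g (stick_to_front i (fst p), snd p \<circ> front i)"
   using AE_proper
  proof eventually_elim
   case (elim p)
   hence "0 \<le> rem_mass (fst p) i" by (simp add: rem_mass_pos less_imp_le)
   moreover have "(snd p \<circ> front i) \<circ> Suc = snd p \<circ> skip i" by (auto simp: fun_eq_iff)
   ultimately show ?case by (simp add: g_def ennreal_mult' mult.assoc)
  qed
 qed
 also have "\<dots> \<le> (\<integral>\<^sup>+p. g p \<partial>prior)"
  by (rule nn_integral_prior_to_front) measurable
 also have "\<dots> = (\<integral>\<^sup>+a. \<integral>\<^sup>+t. \<integral>\<^sup>+p. ennreal (front_weight is (fst p)) * h (case_nat a (sticks_to_front is (fst p)),
   case_nat t (atoms_to_front is (snd p))) \<partial>prior \<partial>P0 \<partial>\<beta>)"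
  by (subst nn_integral_prior_step) (auto simp: g_def comp_def)
 also have "\<dots> \<le> (\<integral>\<^sup>+a. \<integral>\<^sup>+t. \<integral>\<^sup>+p. h (case_nat a (fst p), case_nat t (snd p)) \<partial>prior \<partial>P0 \<partial>\<beta>)"
 proof -
  have "(\<integral>\<^sup>+p. ennreal (front_weight is (fst p)) * h (case_nat a (sticks_to_front is (fst p)),
    case_nat t (atoms_to_front is (snd p))) \<partial>prior) \<le> (\<integral>\<^sup>+p. h (case_nat a (fst p), case_nat t (snd p)) \<partial>prior)" for a t
   using Cons.IH[of "\<lambda>p. h (case_nat a (fst p), case_nat t (snd p))"] by simp
  thus ?thesis by (intro nn_integral_mono[of P0] nn_integral_mono[of \<beta>])
 qed
 also have "\<dots> = (\<integral>\<^sup>+p. h p \<partial>prior)"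
  by (rule nn_integral_prior_step[symmetric]) measurable
 finally show ?case .
qed simp

lemma nn_integral_rem_mass: "(\<integral>\<^sup>+p. ennreal (rem_mass (fst p) n) \<partial>prior) = ennreal ((\<alpha> / (\<alpha> + 1)) ^ n)"
proof -
 have "(\<integral>\<^sup>+p. ennreal (rem_mass (fst p) n) \<partial>prior) = (\<integral>\<^sup>+p. (\<Prod>i<n. ennreal (1 - fst p i)) \<partial>prior)"
 proof (intro nn_integral_cong_AE)
  show "AE p in prior. ennreal (rem_mass (fst p) n) = (\<Prod>i<n. ennreal (1 - fst p i))"
   using AE_proper
  proof eventually_elim
   case (elim p)
   thus ?case unfolding rem_mass_def by (subst prod_ennreal) (auto simp: proper_def less_imp_le)
  qed
 qed
 also have "\<dots> = (\<integral>\<^sup>+v. (\<Prod>i<n. ennreal (1 - v i)) \<partial>sticks_law)"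
  by (subst nn_integral_prior) (auto simp: AL.emeasure_space_1[simplified])
 also have "\<dots> = (\<integral>\<^sup>+v. ennreal (1 - v) \<partial>\<beta>) ^ n"
  unfolding sticks_law_def by (rule B.nn_integral_prod_iid) measurable
 finally show ?thesis using \<alpha>_pos by (simp add: nn_integral_one_minus_beta ennreal_power)
qed

lemma prob_rem_mass_ge:
 assumes "c > 0"
 shows "emeasure prior {p. c \<le> rem_mass (fst p) n} \<le> ennreal ((\<alpha> / (\<alpha> + 1)) ^ n / c)"
proof -
 have "emeasure prior {p. c \<le> rem_mass (fst p) n} = (\<integral>\<^sup>+p. indicator {p. c \<le> rem_mass (fst p) n} p \<partial>prior)"
  by (intro nn_integral_indicator[symmetric] sets_prior_Collect) measurable
 also have "\<dots> \<le> (\<integral>\<^sup>+p. ennreal (1 / c) * ennreal (rem_mass (fst p) n) \<partial>prior)"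
 proof (intro nn_integral_mono)
  fix p :: "'a sticks"
  show "indicator {p. c \<le> rem_mass (fst p) n} p \<le> ennreal (1 / c) * ennreal (rem_mass (fst p) n)"
   using assms by (auto simp: ennreal_mult'[symmetric] split: split_indicator)
 qed
 also have "\<dots> = ennreal ((\<alpha> / (\<alpha> + 1)) ^ n / c)"
  using assms \<alpha>_pos by (subst nn_integral_cmult) (auto simp: nn_integral_rem_mass ennreal_mult'[symmetric])
 finally show ?thesis .
qed

text \<open>The expectations form a geometric series, so almost surely the remaining masses are
  summable.\<close>

lemma AE_rem_mass_tendsto_0: "AE p in prior. (\<lambda>n. rem_mass (fst p) n) \<longlonglongrightarrow> 0"
proof -
 have "(\<integral>\<^sup>+p. (\<Sum>n. ennreal (rem_mass (fst p) n)) \<partial>prior) = (\<Sum>n. ennreal ((\<alpha> / (\<alpha> + 1)) ^ n))"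
  by (subst nn_integral_suminf) (auto simp: nn_integral_rem_mass)
 also have "\<dots> = ennreal (\<Sum>n. (\<alpha> / (\<alpha> + 1)) ^ n)"
  using \<alpha>_pos by (intro suminf_ennreal2 summable_geometric) auto
 also have "\<dots> < \<infinity>" by simp
 finally have "AE p in prior. (\<Sum>n. ennreal (rem_mass (fst p) n)) \<noteq> \<infinity>"
  by (intro nn_integral_PInf_AE) auto
 thus ?thesis using AE_proper
 proof eventually_elim
  case (elim p)
  hence "summable (\<lambda>n. rem_mass (fst p) n)"
   by (intro summable_suminf_not_top) (auto simp: rem_mass_pos less_imp_le)
  thus ?case by (rule summable_LIMSEQ_zero)
 qed
qed

lemma AE_stick_weights_sums: "AE p in prior. stick_weights (fst p) sums 1"
 using AE_rem_mass_tendsto_0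
proof eventually_elim
 case (elim p)
 have "(\<lambda>n. 1 - rem_mass (fst p) n) \<longlonglongrightarrow> 1 - 0" by (intro tendsto_intros elim)
 thus ?case by (simp add: sums_def sum_stick_weights)
qed

lemma AE_atoms:
 assumes [measurable]: "\<Theta> \<in> sets borel" and "AE \<theta> in P0. \<theta> \<in> \<Theta>"
 shows "AE p in prior. \<forall>i. snd p i \<in> \<Theta>"
proof (subst AE_all_countable, intro allI)
 show "AE p in prior. snd p i \<in> \<Theta>" for i
 proof (rule AE_prior_snd)
  show "AE \<theta> in atoms_law. \<theta> i \<in> \<Theta>"
   unfolding atoms_law_def using assms by (intro T.AE_component) auto
 qed measurable
qed

end

section \<open>Small ball probabilities of means\<close>

context dirichlet_process
begin

context
 fixes q :: "'a \<Rightarrow> real" and b A :: real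
 assumes q_meas [measurable]: "q \<in> borel_measurable borel"
  and q_nonneg: "\<And>t. 0 \<le> q t" and q_le: "\<And>t. q t \<le> b"
  and A: "A \<ge> 0" and q_small: "\<And>y. y > 0 \<Longrightarrow> emeasure P0 {t. q t \<le> y} \<le> ennreal (A * sqrt y)"
begin

definition mean_cdf :: "real \<Rightarrow> ennreal" where
 "mean_cdf x = emeasure prior {p. sp_mean q (fst p) (snd p) \<le> x}"

text \<open>A bootstrap: if \<open>v * q t + (1 - v) * M\<close> is at most \<open>x\<close>, where
  \<open>M\<close> is the mean under the fresh copy, then \<open>q t\<close> is at most
  \<open>x / v\<close> and \<open>M\<close> at most \<open>x / (1 - v)\<close>. The first event
  contributes the exponent 1/2, the second the exponent already known.\<close>

lemma mean_cdf_step: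
 assumes a: "0 \<le> a" "a < \<alpha>" and C: "C > 0"
  and bound: "\<And>x. x > 0 \<Longrightarrow> mean_cdf x \<le> ennreal (C * x powr a)"
 shows "\<exists>C'>0. \<forall>x>0. mean_cdf x \<le> ennreal (C' * x powr (a + 1/2))"
proof -
 define I where "I = enn2real (\<integral>\<^sup>+v. ennreal (v powr (-1/2) * (1 - v) powr (- a)) \<partial>\<beta>)"
 have I: "(\<integral>\<^sup>+v. ennreal (v powr (-1/2) * (1 - v) powr (- a)) \<partial>\<beta>) = ennreal I"
  unfolding I_def using nn_integral_beta_powr_finite[OF a(2)] by simp
 have I0: "0 \<le> I" by (simp add: I_def)
 show ?thesis
 proof (intro exI[of _ "A * C * I + 1"] conjI allI impI)
  show "0 < A * C * I + 1" using A C I0 by (intro add_nonneg_pos mult_nonneg_nonneg) auto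
  fix x :: real assume x: "x > 0"
  have meas [measurable]: "{p. sp_mean q (fst p) (snd p) \<le> y} \<in> sets prior" for y
   by (rule sets_prior_Collect) measurable
  have [measurable]: "{t. q t \<le> y} \<in> sets borel" for y
   using borel_measurable_le[OF q_meas borel_measurable_const[of y]] by simp
  have "mean_cdf x = (\<integral>\<^sup>+p. indicator {p. sp_mean q (fst p) (snd p) \<le> x} p \<partial>prior)"
   unfolding mean_cdf_def by (rule nn_integral_indicator[symmetric]) (rule meas)
  also have "\<dots> = (\<integral>\<^sup>+v. \<integral>\<^sup>+t. \<integral>\<^sup>+p. indicator {p. sp_mean q (fst p) (snd p) \<le> x}
    (case_nat v (fst p), case_nat t (snd p)) \<partial>prior \<partial>P0 \<partial>\<beta>)"
   by (rule nn_integral_prior_step) measurable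
  also have "\<dots> \<le> (\<integral>\<^sup>+v. ennreal (A * C * x powr (a + 1/2)) * ennreal (v powr (-1/2) * (1 - v) powr (- a)) \<partial>\<beta>)"
  proof (intro nn_integral_mono_AE)
   show "AE v in \<beta>. (\<integral>\<^sup>+t. \<integral>\<^sup>+p. indicator {p. sp_mean q (fst p) (snd p) \<le> x}
    (case_nat v (fst p), case_nat t (snd p)) \<partial>prior \<partial>P0) \<le> ennreal (A * C * x powr (a + 1/2)) * ennreal (v powr (-1/2) * (1 - v) powr (- a))"
    using AE_beta
   proof eventually_elim
    case (elim v)
    have inner: "(\<integral>\<^sup>+p. indicator {p. sp_mean q (fst p) (snd p) \<le> x} (case_nat v (fst p), case_nat t (snd p)) \<partial>prior) \<le>
      indicator {t. q t \<le> x / v} t * mean_cdf (x / (1 - v))" for t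
    proof -
     have "(\<integral>\<^sup>+p. indicator {p. sp_mean q (fst p) (snd p) \<le> x} (case_nat v (fst p), case_nat t (snd p)) \<partial>prior) \<le>
      (\<integral>\<^sup>+p. indicator {t. q t \<le> x / v} t * indicator {p. sp_mean q (fst p) (snd p) \<le> x / (1 - v)} p \<partial>prior)"
     proof (intro nn_integral_mono_AE)
      show "AE p in prior. indicator {p. sp_mean q (fst p) (snd p) \<le> x} (case_nat v (fst p), case_nat t (snd p)) \<le>
       (indicator {t. q t \<le> x / v} t * indicator {p. sp_mean q (fst p) (snd p) \<le> x / (1 - v)} p :: ennreal)"
       using AE_proper
      proof eventually_elim
       case p: (elim p)
       have e: "sp_mean q (case_nat v (fst p)) (case_nat t (snd p)) = v * q t + (1 - v) * sp_mean q (fst p) (snd p)"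
        using p elim q_nonneg q_le by (intro sp_mean_case_nat[where b = b]) auto
       have n: "0 \<le> sp_mean q (fst p) (snd p)"
        using p q_nonneg q_le by (rule sp_mean_nonneg)
       have "q t \<le> x / v \<and> sp_mean q (fst p) (snd p) \<le> x / (1 - v)"
        if "v * q t + (1 - v) * sp_mean q (fst p) (snd p) \<le> x"
       proof -
        have "0 \<le> v * q t" "0 \<le> (1 - v) * sp_mean q (fst p) (snd p)" using elim n q_nonneg by auto
        hence "v * q t \<le> x" "(1 - v) * sp_mean q (fst p) (snd p) \<le> x" using that by linarith+
        thus ?thesis using elim by (simp add: pos_le_divide_eq mult.commute)
       qed
       thus ?case using e by (auto split: split_indicator)
      qed
     qed
     also have "\<dots> = indicator {t. q t \<le> x / v} t * mean_cdf (x / (1 - v))"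
      by (simp add: nn_integral_cmult mean_cdf_def)
     finally show ?thesis .
    qed
    have "(\<integral>\<^sup>+t. \<integral>\<^sup>+p. indicator {p. sp_mean q (fst p) (snd p) \<le> x} (case_nat v (fst p), case_nat t (snd p)) \<partial>prior \<partial>P0) \<le>
      (\<integral>\<^sup>+t. indicator {t. q t \<le> x / v} t * mean_cdf (x / (1 - v)) \<partial>P0)"
     by (intro nn_integral_mono inner)
    also have "\<dots> = emeasure P0 {t. q t \<le> x / v} * mean_cdf (x / (1 - v))"
     by (simp add: nn_integral_multc)
    also have "\<dots> \<le> ennreal (A * sqrt (x / v)) * ennreal (C * (x / (1 - v)) powr a)"
     using elim x by (intro mult_mono q_small bound) auto
    also have "\<dots> = ennreal (A * C * x powr (a + 1/2)) * ennreal (v powr (-1/2) * (1 - v) powr (- a))"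
    proof -
     have "sqrt (x / v) = x powr (1/2) * v powr (-1/2)"
      using x elim by (simp add: powr_half_sqrt[symmetric] powr_divide powr_minus_divide)
     moreover have "(x / (1 - v)) powr a = x powr a * (1 - v) powr (- a)"
      using x elim by (simp add: powr_divide powr_minus_divide)
     ultimately have "A * sqrt (x / v) * (C * (x / (1 - v)) powr a) =
      A * C * x powr (a + 1/2) * (v powr (-1/2) * (1 - v) powr (- a))"
      by (simp add: powr_add)
     moreover have "ennreal (A * sqrt (x / v)) * ennreal (C * (x / (1 - v)) powr a) =
      ennreal (A * sqrt (x / v) * (C * (x / (1 - v)) powr a))"
      using A x elim by (intro ennreal_mult'[symmetric]) auto
     ultimately show ?thesis
      using A C by (simp only: ennreal_mult'[symmetric] mult_nonneg_nonneg powr_ge_zero less_imp_le)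
    qed
    finally show ?case .
   qed
  qed
  also have "\<dots> = ennreal (A * C * x powr (a + 1/2)) * ennreal I"
   by (simp add: nn_integral_cmult I[symmetric])
  also have "\<dots> \<le> ennreal ((A * C * I + 1) * x powr (a + 1/2))"
   using A C I0 by (simp add: ennreal_mult'[symmetric] algebra_simps)
  finally show "mean_cdf x \<le> ennreal ((A * C * I + 1) * x powr (a + 1/2))" .
 qed
qed

text \<open>Below 1 a smaller exponent is weaker; above 1 the bound is at least 1 and hence trivial,
  which is why the constant is \<open>max 1 C\<close>.\<close>

lemma mean_cdf_weaken:
 assumes "C > 0" "0 \<le> a'" "a' \<le> a" and bound: "\<And>x. x > 0 \<Longrightarrow> mean_cdf x \<le> ennreal (C * x powr a)"
 shows "\<exists>C'>0. \<forall>x>0. mean_cdf x \<le> ennreal (C' * x powr a')"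
proof (intro exI[of _ "max 1 C"] conjI allI impI)
 fix x :: real assume x: "x > 0"
 show "mean_cdf x \<le> ennreal (max 1 C * x powr a')"
 proof (cases "x \<le> 1")
  case True
  have "mean_cdf x \<le> ennreal (C * x powr a)" by (rule bound[OF x])
  also have "\<dots> \<le> ennreal (max 1 C * x powr a')"
   using True x assms by (intro ennreal_leI mult_mono powr_mono') auto
  finally show ?thesis .
 next
  case False
  have "mean_cdf x \<le> 1" unfolding mean_cdf_def by (rule PR.emeasure_le_1)
  also have "\<dots> \<le> ennreal (max 1 C * x powr a')"
  proof -
   have "1 * 1 \<le> max 1 C * x powr a'"
    using False assms by (intro mult_mono ge_one_powr_ge_zero) auto
   thus ?thesis by simp
  qed
  finally show ?thesis .
 qed
qed auto

text \<open>An exponent strictly above \<open>\<alpha>\<close> is the source of the gain for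
  measures with too much leftover mass.\<close>

lemma mean_cdf_bound: "\<exists>C>0. \<forall>x>0. mean_cdf x \<le> ennreal (C * x powr (\<alpha> + 1/4))"
proof -
 have iter: "(real k - 1) / 2 < \<alpha> \<Longrightarrow> \<exists>C>0. \<forall>x>0. mean_cdf x \<le> ennreal (C * x powr (real k / 2))" for k
 proof (induction k)
  case 0
  show ?case
   by (intro exI[of _ 1]) (auto simp: mean_cdf_def PR.emeasure_le_1)
 next
  case (Suc k)
  then obtain C where "C > 0" "\<And>x. x > 0 \<Longrightarrow> mean_cdf x \<le> ennreal (C * x powr (real k / 2))"
   by fastforce
  hence "\<exists>C'>0. \<forall>x>0. mean_cdf x \<le> ennreal (C' * x powr (real k / 2 + 1/2))"
   using Suc.prems by (intro mean_cdf_step[of "real k / 2" C]) auto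
  thus ?case by (simp add: add_divide_distrib add.commute)
 qed
 define k where "k = nat \<lceil>2 * (\<alpha> - 1/4)\<rceil>"
 define a where "a = max 0 (\<alpha> - 1/4)"
 have k: "a \<le> real k / 2"
 proof -
  have "2 * (\<alpha> - 1/4) \<le> real k" unfolding k_def by (rule real_nat_ceiling_ge)
  thus ?thesis unfolding a_def max_def by auto
 qed
 have "(real k - 1) / 2 < \<alpha>"
 proof (cases "\<lceil>2 * (\<alpha> - 1/4)\<rceil> \<ge> 0")
  case True
  hence "real k = real_of_int \<lceil>2 * (\<alpha> - 1/4)\<rceil>" unfolding k_def by simp
  also have "\<dots> \<le> 2 * (\<alpha> - 1/4) + 1" by (rule of_int_ceiling_le_add_one)
  finally show ?thesis by simp
 next
  case False
  hence "k = 0" unfolding k_def by simp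
  thus ?thesis using \<alpha>_pos by simp
 qed
 from iter[OF this] obtain C where C: "C > 0" "\<And>x. x > 0 \<Longrightarrow> mean_cdf x \<le> ennreal (C * x powr (real k / 2))"
  by blast
 then obtain C where C: "C > 0" "\<And>x. x > 0 \<Longrightarrow> mean_cdf x \<le> ennreal (C * x powr a)"
  using mean_cdf_weaken[OF C(1) _ k C(2)] by (auto simp: a_def)
 then obtain C where C: "C > 0" "\<And>x. x > 0 \<Longrightarrow> mean_cdf x \<le> ennreal (C * x powr (a + 1/2))"
  using mean_cdf_step[of a C] \<alpha>_pos by (auto simp: a_def)
 show ?thesis
  by (rule mean_cdf_weaken[OF C(1) _ _ C(2)]) (use \<alpha>_pos in \<open>auto simp: a_def\<close>)
qed

end

end

section \<open>Prior mass near the truth when the first atoms are heavy\<close>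

context dirichlet_process
begin

lemma measurable_comb_seq_sticks [measurable]:
 assumes f: "f \<in> measurable N sticks_law" and g: "g \<in> measurable N sticks_law"
 shows "(\<lambda>x. comb_seq n (f x) (g x)) \<in> measurable N sticks_law"
 using measurable_comb_seq'[OF f[unfolded sticks_law_def] g[unfolded sticks_law_def]]
 unfolding sticks_law_def .

lemma measurable_comb_seq_atoms [measurable]:
 assumes f: "f \<in> measurable N atoms_law" and g: "g \<in> measurable N atoms_law"
 shows "(\<lambda>x. comb_seq n (f x) (g x)) \<in> measurable N atoms_law"
 using measurable_comb_seq'[OF f[unfolded atoms_law_def] g[unfolded atoms_law_def]]
 unfolding atoms_law_def .

text \<open>Redraws the first \<open>n\<close> sticks and atoms with the tail \<open>p\<close>
  frozen, so that conditions on the tail alone factor out.\<close>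

lemma nn_integral_prior_comb_seq:
 assumes [measurable]: "h \<in> borel_measurable prior"
 shows "(\<integral>\<^sup>+p. h p \<partial>prior) =
  (\<integral>\<^sup>+p. \<integral>\<^sup>+v. \<integral>\<^sup>+\<theta>. h (comb_seq n v (fst p), comb_seq n \<theta> (snd p)) \<partial>atoms_law \<partial>sticks_law \<partial>prior)"
proof -
 have st: "(\<integral>\<^sup>+v. f v \<partial>sticks_law) = (\<integral>\<^sup>+v'. \<integral>\<^sup>+v. f (comb_seq n v v') \<partial>sticks_law \<partial>sticks_law)"
  if "f \<in> borel_measurable sticks_law" for f
  using that unfolding sticks_law_def by (rule B.nn_integral_comb_seq)
 have at: "(\<integral>\<^sup>+v. f v \<partial>atoms_law) = (\<integral>\<^sup>+v'. \<integral>\<^sup>+v. f (comb_seq n v v') \<partial>atoms_law \<partial>atoms_law)"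
  if "f \<in> borel_measurable atoms_law" for f
  using that unfolding atoms_law_def by (rule T.nn_integral_comb_seq)
 have "(\<integral>\<^sup>+p. h p \<partial>prior) = (\<integral>\<^sup>+v. \<integral>\<^sup>+\<theta>. h (v, \<theta>) \<partial>atoms_law \<partial>sticks_law)"
  by (rule nn_integral_prior) fact
 also have "\<dots> = (\<integral>\<^sup>+v. \<integral>\<^sup>+\<theta>'. \<integral>\<^sup>+\<theta>. h (v, comb_seq n \<theta> \<theta>') \<partial>atoms_law \<partial>atoms_law \<partial>sticks_law)"
  by (intro nn_integral_cong at) measurable
 also have "\<dots> = (\<integral>\<^sup>+v'. \<integral>\<^sup>+v. \<integral>\<^sup>+\<theta>'. \<integral>\<^sup>+\<theta>. h (comb_seq n v v', comb_seq n \<theta> \<theta>') \<partial>atoms_law \<partial>atoms_law \<partial>sticks_law \<partial>sticks_law)"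
  by (rule st) measurable
 also have "\<dots> = (\<integral>\<^sup>+v'. \<integral>\<^sup>+\<theta>'. \<integral>\<^sup>+v. \<integral>\<^sup>+\<theta>. h (comb_seq n v v', comb_seq n \<theta> \<theta>') \<partial>atoms_law \<partial>sticks_law \<partial>atoms_law \<partial>sticks_law)"
 proof -
  have "(\<integral>\<^sup>+v. \<integral>\<^sup>+\<theta>'. \<integral>\<^sup>+\<theta>. h (comb_seq n v v', comb_seq n \<theta> \<theta>') \<partial>atoms_law \<partial>atoms_law \<partial>sticks_law) =
   (\<integral>\<^sup>+\<theta>'. \<integral>\<^sup>+v. \<integral>\<^sup>+\<theta>. h (comb_seq n v v', comb_seq n \<theta> \<theta>') \<partial>atoms_law \<partial>sticks_law \<partial>atoms_law)" for v'
  proof (rule pair_sigma_finite.Fubini'[of atoms_law sticks_law])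
   show "pair_sigma_finite atoms_law sticks_law"
    by (intro pair_sigma_finite.intro AL.sigma_finite_measure_axioms SL.sigma_finite_measure_axioms)
   show "(\<lambda>(\<theta>', v). \<integral>\<^sup>+\<theta>. h (comb_seq n v v', comb_seq n \<theta> \<theta>') \<partial>atoms_law) \<in> borel_measurable (atoms_law \<Otimes>\<^sub>M sticks_law)"
    by measurable
  qed
  thus ?thesis by (simp only:)
 qed
 also have "\<dots> = (\<integral>\<^sup>+p. \<integral>\<^sup>+v. \<integral>\<^sup>+\<theta>. h (comb_seq n v (fst p), comb_seq n \<theta> (snd p)) \<partial>atoms_law \<partial>sticks_law \<partial>prior)"
  by (subst nn_integral_prior) auto
 finally show ?thesis .
qed

lemma emeasure_atoms_Collect:
 assumes "\<And>k. k < n \<Longrightarrow> X k \<in> sets borel"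
 shows "emeasure atoms_law {\<theta>. \<forall>k<n. \<theta> k \<in> X k} = (\<Prod>k<n. emeasure P0 (X k))"
 using T.emeasure_PiM_Collect[of "{..<n}" X] assms
 by (auto simp: atoms_law_def sets_P0 space_PiM Ball_def)

lemma emeasure_sticks_Collect:
 assumes "\<And>k. k < n \<Longrightarrow> X k \<in> sets borel"
 shows "emeasure sticks_law {\<theta>. \<forall>k<n. \<theta> k \<in> X k} = (\<Prod>k<n. emeasure \<beta> (X k))"
 using B.emeasure_PiM_Collect[of "{..<n}" X] assms
 by (auto simp: sticks_law_def space_PiM Ball_def)

end

text \<open>The mean value theorem; for \<open>\<alpha> < 1\<close> the intermediate point is at
  least half of \<open>l + 1\<close>, which costs a factor 2. The summand 1 in the constant covers
  \<open>l = 0\<close>.\<close>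

lemma powr_Suc_diff_le:
 fixes \<alpha> :: real assumes "\<alpha> > 0"
 shows "(real l + 1) powr \<alpha> - real l powr \<alpha> \<le> (1 + 2 * \<alpha>) * (real l + 1) powr (\<alpha> - 1)"
proof (cases "l = 0")
 case False
 have "\<exists>z. real l < z \<and> z < real l + 1 \<and> (real l + 1) powr \<alpha> - real l powr \<alpha> = (real l + 1 - real l) * (\<alpha> * z powr (\<alpha> - 1))"
  using False by (intro MVT2) (auto intro!: has_real_derivative_powr)
 then obtain z where z: "real l < z" "z < real l + 1" "(real l + 1) powr \<alpha> - real l powr \<alpha> = \<alpha> * z powr (\<alpha> - 1)"
  by auto
 have "z powr (\<alpha> - 1) \<le> 2 * (real l + 1) powr (\<alpha> - 1)"
 proof (cases "\<alpha> \<ge> 1")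
  case True
  hence "z powr (\<alpha> - 1) \<le> (real l + 1) powr (\<alpha> - 1)"
   using z by (intro powr_mono2) auto
  thus ?thesis using powr_ge_zero[of "real l + 1" "\<alpha> - 1"] by linarith
 next
  case a: False
  have "z powr (\<alpha> - 1) \<le> ((real l + 1) / 2) powr (\<alpha> - 1)"
   using z a False by (intro powr_mono2') auto
  also have "\<dots> = (real l + 1) powr (\<alpha> - 1) * 2 powr (1 - \<alpha>)"
   by (simp add: powr_divide powr_diff)
  also have "\<dots> \<le> (real l + 1) powr (\<alpha> - 1) * 2 powr 1"
   using assms by (intro mult_left_mono powr_mono) auto
  finally show ?thesis by (simp add: mult.commute)
 qed
 hence "\<alpha> * z powr (\<alpha> - 1) \<le> \<alpha> * (2 * (real l + 1) powr (\<alpha> - 1))"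
  using assms by (intro mult_left_mono) auto
 also have "\<dots> \<le> (1 + 2 * \<alpha>) * (real l + 1) powr (\<alpha> - 1)" by (simp add: algebra_simps)
 finally show ?thesis using z by simp
qed (use assms in auto)

text \<open>Exactly what the prior estimates need of the test functions. \<open>V k\<close> isolates
  the \<open>k\<close>-th true atom. As \<open>q\<close> behaves like a squared distance,
  \<open>q \<le> y\<close> confines an atom to balls of radius of order \<open>sqrt y\<close>; the
  bound \<open>A * sqrt y\<close> then holds in every dimension.\<close>

locale true_mixture_prior = dirichlet_process \<alpha> P0
 for \<alpha> :: real and P0 :: "'a::euclidean_space measure" +
 fixes K :: nat and ws :: "nat \<Rightarrow> real" and \<theta>s :: "nat \<Rightarrow> 'a" and V :: "nat \<Rightarrow> 'a set"
  and q :: "'a \<Rightarrow> real" and b A B :: real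
 assumes K_pos: "K > 0" and ws_pos: "\<And>k. k < K \<Longrightarrow> ws k > 0" and ws_sum: "(\<Sum>k<K. ws k) = 1"
  and V_meas [measurable]: "\<And>k. V k \<in> sets borel"
  and V_disj: "\<And>i j. i < K \<Longrightarrow> j < K \<Longrightarrow> i \<noteq> j \<Longrightarrow> V i \<inter> V j = {}"
  and b_ge_1: "b \<ge> 1" and V_bounded: "\<And>k t j. k < K \<Longrightarrow> t \<in> V k \<Longrightarrow> j \<in> Basis \<Longrightarrow> \<bar>(t - \<theta>s k) \<bullet> j\<bar> \<le> b"
  and q_meas [measurable]: "q \<in> borel_measurable borel"
  and q_nonneg: "\<And>t. 0 \<le> q t" and q_le: "\<And>t. q t \<le> b"
  and A_nonneg: "A \<ge> 0" and q_small: "\<And>y. y > 0 \<Longrightarrow> emeasure P0 {t. q t \<le> y} \<le> ennreal (A * sqrt y)"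
  and B_nonneg: "B \<ge> 0"
  and box_small: "\<And>x r. r \<ge> 0 \<Longrightarrow> emeasure P0 {t. \<forall>j\<in>Basis. \<bar>t \<bullet> j - x \<bullet> j\<bar> \<le> r} \<le> ennreal (B * r ^ DIM('a))"
begin

definition offset :: "nat \<Rightarrow> 'a \<Rightarrow> 'a \<Rightarrow> real" where
 "offset k j t = indicator (V k) t * ((t - \<theta>s k) \<bullet> j)"

text \<open>The interface between data and prior: tests force it, and the prior mass of it is
  estimated. The targets are the means under the true mixing measure, where \<open>q\<close> and the
  offsets have mean 0.\<close>

definition near :: "real \<Rightarrow> (nat \<Rightarrow> real) \<Rightarrow> (nat \<Rightarrow> 'a) \<Rightarrow> bool" where
 "near \<epsilon> v \<theta> \<longleftrightarrow> \<bar>sp_mean q v \<theta>\<bar> \<le> \<epsilon> \<and>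
  (\<forall>k<K. \<bar>sp_mean (indicator (V k)) v \<theta> - ws k\<bar> \<le> \<epsilon> \<and> (\<forall>j\<in>Basis. \<bar>sp_mean (offset k j) v \<theta>\<bar> \<le> \<epsilon>))"

text \<open>Counts constraints: \<open>K - 1\<close> free weights, exponent \<open>\<alpha>\<close>
  for the mass left over, and one per coordinate of each of the \<open>K\<close> atoms.\<close>

definition prior_exponent :: real where
 "prior_exponent = real K - 1 + \<alpha> + real (K * DIM('a))"

lemma measurable_offset [measurable]: "offset k j \<in> borel_measurable borel"
 unfolding offset_def[abs_def] by measurable

lemma measurable_near [measurable]: "Measurable.pred prior (\<lambda>p. near \<epsilon> (fst p) (snd p))"
 unfolding near_def by measurable

lemma measurable_proper [measurable]: "Measurable.pred sticks_law proper"
 unfolding proper_def[abs_def] by measurable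

lemma abs_q_le: "\<bar>q t\<bar> \<le> b"
 using q_nonneg[of t] q_le[of t] by simp

lemma abs_indicator_le: "\<bar>indicator (V k) t\<bar> \<le> b"
 using b_ge_1 by (auto split: split_indicator)

lemma abs_offset_le: "k < K \<Longrightarrow> j \<in> Basis \<Longrightarrow> \<bar>offset k j t\<bar> \<le> b"
 using b_ge_1 V_bounded by (auto simp: offset_def split: split_indicator)

definition front_event :: "real \<Rightarrow> real \<Rightarrow> real \<Rightarrow> 'a sticks set" where
 "front_event c \<epsilon> \<rho> = {p. proper (fst p) \<and> near \<epsilon> (fst p) (snd p) \<and>
   (\<forall>k<K. c \<le> stick_weights (fst p) k \<and> snd p k \<in> V k) \<and> \<rho> < rem_mass (fst p) K}"

lemma sets_front_event [measurable]: "front_event c \<epsilon> \<rho> \<in> sets prior"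
 unfolding front_event_def by (rule sets_prior_Collect) measurable

context
 fixes c \<epsilon> :: real and l :: nat
 assumes c: "0 < c" "c \<le> 1" and \<epsilon>: "0 < \<epsilon>"
begin

text \<open>The condition on stick \<open>k\<close> given its predecessors. The last of the
  \<open>K\<close> sticks has no window around a target; it fixes the cell of width
  \<open>\<epsilon>\<close> that contains the leftover mass.\<close>

definition weight_cell :: "(nat \<Rightarrow> real) \<Rightarrow> nat \<Rightarrow> (nat \<Rightarrow> real) \<Rightarrow> bool" where
 "weight_cell a k v \<longleftrightarrow> c \<le> rem_mass v k \<and>
   (if k = K - 1 then real l * \<epsilon> < rem_mass v k * (1 - v k) \<and> rem_mass v k * (1 - v k) \<le> (real l + 1) * \<epsilon>
   else c \<le> 1 - v k \<and> \<bar>v k * rem_mass v k - a k\<bar> \<le> 2 * \<epsilon>)"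

lemma measurable_weight_cell [measurable]: "Measurable.pred sticks_law (weight_cell a k)"
 unfolding weight_cell_def[abs_def] by measurable

text \<open>Each of the first \<open>K - 1\<close> sticks lies in an interval of length at most
  \<open>4 * \<epsilon> / c\<close>, where its density is at most \<open>\<alpha> / c\<close>; the
  last contributes the distribution function of \<open>1 - v\<close> across one cell.\<close>

lemma emeasure_weight_cell:
 "emeasure sticks_law {v. \<forall>k<K. weight_cell a k v} \<le>
  ennreal ((4 * \<alpha> * \<epsilon> / c\<^sup>2) ^ (K - 1) * ((\<epsilon> / c) powr \<alpha> * ((real l + 1) powr \<alpha> - real l powr \<alpha>)))"
proof -
 define bd where "bd k = ennreal (if k = K - 1 then (\<epsilon> / c) powr \<alpha> * ((real l + 1) powr \<alpha> - real l powr \<alpha>) else 4 * \<alpha> * \<epsilon> / c\<^sup>2)" for k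
 have nn: "0 \<le> (real l + 1) powr \<alpha> - real l powr \<alpha>" using \<alpha>_pos by (simp add: powr_mono2)
 have rm: "rem_mass (fun_upd v k x) k = rem_mass v k" for v k and x :: real
  unfolding rem_mass_def by (intro prod.cong) auto
 have "emeasure (\<Pi>\<^sub>M i\<in>UNIV. \<beta>) {v\<in>space (\<Pi>\<^sub>M i\<in>UNIV. \<beta>). \<forall>k<K. weight_cell a k v} \<le> (\<Prod>k<K. bd k)"
 proof (rule B.emeasure_seq_adapted_le)
  show "Measurable.pred (\<Pi>\<^sub>M i\<in>UNIV. \<beta>) (weight_cell a k)" for k
   using measurable_weight_cell[of a k] by (simp add: sticks_law_def)
  show "weight_cell a k v = weight_cell a k v'" if "\<And>j. j \<le> k \<Longrightarrow> v j = v' j" for k v v'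
  proof -
   have "rem_mass v k = rem_mass v' k" unfolding rem_mass_def using that by (intro prod.cong) auto
   moreover have "v k = v' k" using that by simp
   ultimately show ?thesis unfolding weight_cell_def by (simp only:)
  qed
  fix k and v :: "nat \<Rightarrow> real"
  define R where "R = rem_mass v k"
  have wc: "weight_cell a k (fun_upd v k x) \<longleftrightarrow> c \<le> R \<and>
    (if k = K - 1 then real l * \<epsilon> < R * (1 - x) \<and> R * (1 - x) \<le> (real l + 1) * \<epsilon>
     else c \<le> 1 - x \<and> \<bar>x * R - a k\<bar> \<le> 2 * \<epsilon>)" for x
   unfolding weight_cell_def rm R_def by simp
  show "emeasure \<beta> {x\<in>space \<beta>. weight_cell a k (fun_upd v k x)} \<le> bd k"
  proof (cases "c \<le> R")
   case False
   hence "{x\<in>space \<beta>. weight_cell a k (fun_upd v k x)} = {}"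
    by (auto simp: wc)
   thus ?thesis by simp
  next
   case R: True
   show ?thesis
   proof (cases "k = K - 1")
    case True
    have "{x\<in>space \<beta>. weight_cell a k (fun_upd v k x)} \<subseteq> {x. real l * \<epsilon> / R < 1 - x \<and> 1 - x \<le> (real l + 1) * \<epsilon> / R}"
    proof
     fix x assume "x \<in> {x\<in>space \<beta>. weight_cell a k (fun_upd v k x)}"
     hence "real l * \<epsilon> < R * (1 - x) \<and> R * (1 - x) \<le> (real l + 1) * \<epsilon>"
      using True wc[of x] by simp
     thus "x \<in> {x. real l * \<epsilon> / R < 1 - x \<and> 1 - x \<le> (real l + 1) * \<epsilon> / R}"
      using R c by (simp add: pos_divide_less_eq pos_le_divide_eq mult.commute)
    qed
    hence "emeasure \<beta> {x\<in>space \<beta>. weight_cell a k (fun_upd v k x)} \<le>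
     emeasure \<beta> {x. real l * \<epsilon> / R < 1 - x \<and> 1 - x \<le> (real l + 1) * \<epsilon> / R}"
     by (rule emeasure_mono) auto
    also have "\<dots> \<le> ennreal (((real l + 1) * \<epsilon> / R) powr \<alpha> - (real l * \<epsilon> / R) powr \<alpha>)"
     using R c \<epsilon> by (intro emeasure_beta_cell divide_right_mono mult_right_mono) auto
    also have "((real l + 1) * \<epsilon> / R) powr \<alpha> - (real l * \<epsilon> / R) powr \<alpha> =
      (\<epsilon> / R) powr \<alpha> * ((real l + 1) powr \<alpha> - real l powr \<alpha>)"
    proof -
     have "(\<epsilon> / R * (real l + 1)) powr \<alpha> = (\<epsilon> / R) powr \<alpha> * (real l + 1) powr \<alpha>"
      "(\<epsilon> / R * real l) powr \<alpha> = (\<epsilon> / R) powr \<alpha> * real l powr \<alpha>"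
      using R c \<epsilon> by (intro powr_mult; simp)+
     thus ?thesis by (simp add: mult.commute right_diff_distrib)
    qed
    also have "\<dots> \<le> (\<epsilon> / c) powr \<alpha> * ((real l + 1) powr \<alpha> - real l powr \<alpha>)"
     using R c \<epsilon> \<alpha>_pos nn by (intro mult_right_mono powr_mono2 divide_left_mono) auto
    finally have "emeasure \<beta> {x\<in>space \<beta>. weight_cell a k (fun_upd v k x)} \<le>
     ennreal ((\<epsilon> / c) powr \<alpha> * ((real l + 1) powr \<alpha> - real l powr \<alpha>))"
     by (simp only: ennreal_leI)
    thus ?thesis unfolding bd_def if_P[OF True] .
   next
    case False
    have "{x\<in>space \<beta>. weight_cell a k (fun_upd v k x)} \<subseteq> {x. (a k - 2 * \<epsilon>) / R \<le> x \<and> x \<le> (a k + 2 * \<epsilon>) / R \<and> c \<le> 1 - x}"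
    proof
     fix x assume "x \<in> {x\<in>space \<beta>. weight_cell a k (fun_upd v k x)}"
     hence "c \<le> 1 - x \<and> \<bar>x * R - a k\<bar> \<le> 2 * \<epsilon>"
      using False wc[of x] by simp
     thus "x \<in> {x. (a k - 2 * \<epsilon>) / R \<le> x \<and> x \<le> (a k + 2 * \<epsilon>) / R \<and> c \<le> 1 - x}"
      using R c by (simp add: pos_divide_le_eq pos_le_divide_eq abs_le_iff)
    qed
    hence "emeasure \<beta> {x\<in>space \<beta>. weight_cell a k (fun_upd v k x)} \<le>
     emeasure \<beta> {x. (a k - 2 * \<epsilon>) / R \<le> x \<and> x \<le> (a k + 2 * \<epsilon>) / R \<and> c \<le> 1 - x}"
     by (rule emeasure_mono) auto
    also have "\<dots> \<le> ennreal (\<alpha> / c * ((a k + 2 * \<epsilon>) / R - (a k - 2 * \<epsilon>) / R))"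
     using R c \<epsilon> by (intro emeasure_beta_interval_le divide_right_mono) auto
    also have "(a k + 2 * \<epsilon>) / R - (a k - 2 * \<epsilon>) / R = 4 * \<epsilon> / R"
     using R c by (simp add: field_simps)
    also have "\<alpha> / c * (4 * \<epsilon> / R) \<le> \<alpha> / c * (4 * \<epsilon> / c)"
     using R c \<epsilon> \<alpha>_pos by (intro mult_left_mono divide_left_mono) auto
    also have "\<alpha> / c * (4 * \<epsilon> / c) = 4 * \<alpha> * \<epsilon> / c\<^sup>2" by (simp add: power2_eq_square)
    finally have "emeasure \<beta> {x\<in>space \<beta>. weight_cell a k (fun_upd v k x)} \<le> ennreal (4 * \<alpha> * \<epsilon> / c\<^sup>2)"
     by (simp only: ennreal_leI)
    thus ?thesis unfolding bd_def if_not_P[OF False] .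
   qed
  qed
 qed
 also have "(\<Prod>k<K. bd k) = (\<Prod>k<K - 1. bd k) * bd (K - 1)"
  using K_pos by (cases K) auto
 also have "(\<Prod>k<K - 1. bd k) = (\<Prod>k<K - 1. ennreal (4 * \<alpha> * \<epsilon> / c\<^sup>2))"
  by (intro prod.cong) (auto simp: bd_def)
 also have "\<dots> * bd (K - 1) = ennreal ((4 * \<alpha> * \<epsilon> / c\<^sup>2) ^ (K - 1) * ((\<epsilon> / c) powr \<alpha> * ((real l + 1) powr \<alpha> - real l powr \<alpha>)))"
  using \<alpha>_pos \<epsilon> c nn by (simp add: bd_def ennreal_power ennreal_mult')
 finally show ?thesis by (simp add: sticks_law_def space_PiM)
qed

text \<open>With the tail \<open>p\<close> frozen and the leftover mass known up to one cell, being
  near confines every weight to a window and every atom to a box, of sizes independent of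
  \<open>p\<close>. What remains is a condition on \<open>p\<close> alone: its mean of
  \<open>q\<close>, scaled by the leftover mass, is at most \<open>\<epsilon>\<close>.\<close>

lemma front_event_cell:
 "emeasure prior (front_event c \<epsilon> \<rho> \<inter> {p. real l * \<epsilon> < rem_mass (fst p) K \<and> rem_mass (fst p) K \<le> (real l + 1) * \<epsilon>}) \<le>
  ennreal ((4 * \<alpha> * \<epsilon> / c\<^sup>2) ^ (K - 1) * ((\<epsilon> / c) powr \<alpha> * ((real l + 1) powr \<alpha> - real l powr \<alpha>)) * (B * (\<epsilon> / c) ^ DIM('a)) ^ K)
   * emeasure prior {p. real l * sp_mean q (fst p) (snd p) \<le> 1}" (is "emeasure prior ?E \<le> ennreal ?bd * emeasure prior ?X")
proof -
 have [measurable]: "?E \<in> sets prior" "?X \<in> sets prior"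
  by (intro sets.Int sets_front_event sets_prior_Collect; measurable)+
 \<comment> \<open>The weight required of atom \<open>k\<close> once the tail's mass in
   \<open>V k\<close> is deducted. The leftover mass is replaced by the lower end of its cell, so
   that the target depends on \<open>p\<close> only; the error is at most \<open>\<epsilon>\<close>
   and doubles the window.\<close>
 define a where "a p k = ws k - real l * \<epsilon> * sp_mean (indicator (V k)) (fst p) (snd p)"
  for k and p :: "'a sticks"
 \<comment> \<open>The atom must compensate the tail's mean offset, which shifts the centre of its
   box. The centre depends on the sticks, but the atoms are integrated first and the bound for a box
   is uniform in its centre.\<close>
 define ctr where "ctr p v k = \<theta>s k - (\<Sum>j\<in>Basis. (rem_mass v K * sp_mean (offset k j) (fst p) (snd p) / stick_weights v k) *\<^sub>R j)"
  for k v and p :: "'a sticks"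
 define box where "box x = {t::'a. \<forall>j\<in>Basis. \<bar>t \<bullet> j - x \<bullet> j\<bar> \<le> \<epsilon> / c}" for x
 have box_meas [measurable]: "box x \<in> sets borel" for x
  unfolding box_def by measurable
 have incl: "indicator ?E (comb_seq K v (fst p), comb_seq K \<theta> (snd p)) \<le>
   indicator ?X p * (indicator {v. \<forall>k<K. weight_cell (a p) k v} v * (indicator {\<theta>. \<forall>k<K. \<theta> k \<in> box (ctr p v k)} \<theta>) :: ennreal)"
  if p: "proper (fst p)" for p v \<theta>
 proof (cases "(comb_seq K v (fst p), comb_seq K \<theta> (snd p)) \<in> ?E")
  case True
  define u where "u = comb_seq K v (fst p)"
  define \<eta> where "\<eta> = comb_seq K \<theta> (snd p)"
  define R where "R = rem_mass v K"
  have u: "proper u" and nr: "near \<epsilon> u \<eta>" using True by (auto simp: front_event_def u_def \<eta>_def)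
  have v01: "0 < v k" "v k < 1" if "k < K" for k
   using u that unfolding proper_def u_def by (metis comb_seq_less)+
  have rmu: "rem_mass u k = rem_mass v k" if "k \<le> K" for k
   unfolding rem_mass_def u_def using that by (intro prod.cong) (auto simp: comb_seq_less)
  have su: "stick_weights u k = stick_weights v k" if "k < K" for k
   using that rmu[of k] by (simp add: stick_weights_eq u_def comb_seq_less)
  have R: "real l * \<epsilon> < R" "R \<le> (real l + 1) * \<epsilon>" "0 < R"
   using True rmu[of K] rem_mass_pos[OF u, of K] by (auto simp: u_def R_def)
  have S: "c \<le> stick_weights v k" "\<theta> k \<in> V k" if "k < K" for k
   using True that su[OF that] by (auto simp: front_event_def u_def comb_seq_less)
  have spl: "sp_mean \<phi> u \<eta> = (\<Sum>k<K. stick_weights v k * \<phi> (\<theta> k)) + R * sp_mean \<phi> (fst p) (snd p)"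
   if "\<And>x. \<bar>\<phi> x\<bar> \<le> b" for \<phi>
  proof -
   have "sp_mean \<phi> u \<eta> = (\<Sum>k<K. stick_weights u k * \<phi> (\<eta> k)) + rem_mass u K * sp_mean \<phi> (\<lambda>i. u (i + K)) (\<lambda>i. \<eta> (i + K))"
    using u that by (rule sp_mean_split)
   thus ?thesis by (simp add: su rmu R_def) (simp add: u_def \<eta>_def comb_seq_add comb_seq_less)
  qed
  have cell: "weight_cell (a p) k v" if k: "k < K" for k
  proof -
   have rc: "c \<le> rem_mass v k"
    using S(1)[OF k] stick_weights_le_rem_mass[OF u, of k k] rmu[of k] su[of k] k by simp
   show ?thesis
   proof (cases "k = K - 1")
    case True
    hence "rem_mass v k * (1 - v k) = R" using k by (simp add: R_def flip: rem_mass_Suc)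
    thus ?thesis using True rc R by (simp add: weight_cell_def)
   next
    case False
    hence k1: "Suc k < K" using k by simp
    have "c \<le> rem_mass v (Suc k)"
     using S(1)[OF k1] stick_weights_le_rem_mass[OF u, of "Suc k" "Suc k"] rmu[of "Suc k"] su[of "Suc k"] k1 by simp
    also have "\<dots> = rem_mass v k * (1 - v k)" by (rule rem_mass_Suc)
    also have "\<dots> \<le> 1 - v k"
     using rem_mass_le_1[OF u, of k] rem_mass_pos[OF u, of k] rmu[of k] k v01[OF k] by (intro mult_left_le_one_le) auto
    finally have v1: "c \<le> 1 - v k" .
    define M where "M = sp_mean (indicator (V k)) (fst p) (snd p)"
    have M: "0 \<le> M" "M \<le> 1"
     using sp_mean_nonneg[OF p, where \<phi> = "indicator (V k)" and b = 1 and \<theta> = "snd p"]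
      abs_sp_mean_le[OF p, where \<phi> = "indicator (V k)" and b = 1 and \<theta> = "snd p"]
     by (auto simp: M_def split: split_indicator)
    have "(\<Sum>i<K. stick_weights v i * indicator (V k) (\<theta> i)) = (\<Sum>i<K. if i = k then stick_weights v k else 0)"
     using S(2) V_disj k by (intro sum.cong) (auto split: split_indicator)
    hence "\<bar>stick_weights v k + R * M - ws k\<bar> \<le> \<epsilon>"
     using nr k spl[of "indicator (V k)", OF abs_indicator_le] by (auto simp: near_def M_def)
    moreover have "0 \<le> (R - real l * \<epsilon>) * M" "(R - real l * \<epsilon>) * M \<le> \<epsilon>"
    proof -
     show "0 \<le> (R - real l * \<epsilon>) * M" using M R by auto
     have "(R - real l * \<epsilon>) * M \<le> \<epsilon> * 1"
      using M R \<epsilon> by (intro mult_mono) (auto simp: algebra_simps)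
     thus "(R - real l * \<epsilon>) * M \<le> \<epsilon>" by simp
    qed
    moreover have "stick_weights v k + R * M - ws k = stick_weights v k - a p k + (R - real l * \<epsilon>) * M"
     by (simp add: a_def M_def algebra_simps)
    ultimately have "\<bar>stick_weights v k - a p k\<bar> \<le> 2 * \<epsilon>" by linarith
    thus ?thesis using False rc v1 by (simp add: weight_cell_def stick_weights_eq)
   qed
  qed
  have bx: "\<theta> k \<in> box (ctr p v k)" if k: "k < K" for k
   unfolding box_def
  proof (intro CollectI ballI)
   fix j :: 'a assume j: "j \<in> Basis"
   define N where "N = sp_mean (offset k j) (fst p) (snd p)"
   have sm: "(\<Sum>i<K. stick_weights v i * offset k j (\<theta> i)) = (\<Sum>i<K. if i = k then stick_weights v k * ((\<theta> k - \<theta>s k) \<bullet> j) else 0)"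
    using S(2) V_disj k by (intro sum.cong) (auto simp: offset_def split: split_indicator)
   have *: "\<bar>stick_weights v k * ((\<theta> k - \<theta>s k) \<bullet> j) + R * N\<bar> \<le> \<epsilon>"
   proof -
    have "\<bar>sp_mean (offset k j) u \<eta>\<bar> \<le> \<epsilon>" using nr k j unfolding near_def by blast
    thus ?thesis
     using spl[of "offset k j", OF abs_offset_le[OF k j]] sm k by (simp add: N_def)
   qed
   have s0: "0 < stick_weights v k" using S(1)[OF k] c by linarith
   have "ctr p v k \<bullet> j = \<theta>s k \<bullet> j - R * N / stick_weights v k"
    using j by (simp add: ctr_def inner_diff_left inner_sum_left inner_Basis R_def N_def sum.delta if_distrib cong: if_cong)
   hence "\<theta> k \<bullet> j - ctr p v k \<bullet> j = (stick_weights v k * ((\<theta> k - \<theta>s k) \<bullet> j) + R * N) / stick_weights v k"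
    using s0 by (simp add: field_simps inner_diff_left)
   hence "\<bar>\<theta> k \<bullet> j - ctr p v k \<bullet> j\<bar> = \<bar>stick_weights v k * ((\<theta> k - \<theta>s k) \<bullet> j) + R * N\<bar> / stick_weights v k"
    using s0 by simp
   also have "\<dots> \<le> \<epsilon> / stick_weights v k"
    using * s0 by (intro divide_right_mono) auto
   also have "\<dots> \<le> \<epsilon> / c" using S(1)[OF k] c \<epsilon> by (intro divide_left_mono) auto
   finally show "\<bar>\<theta> k \<bullet> j - ctr p v k \<bullet> j\<bar> \<le> \<epsilon> / c" .
  qed
  \<comment> \<open>The leftover mass exceeds \<open>real l * \<epsilon>\<close>, and its product
    with the tail's mean of \<open>q\<close> is at most \<open>\<epsilon>\<close>.\<close>
  have X: "p \<in> ?X"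
  proof -
   define X where "X = sp_mean q (fst p) (snd p)"
   have X0: "0 \<le> X" unfolding X_def using p q_nonneg q_le by (rule sp_mean_nonneg)
   have "0 \<le> (\<Sum>k<K. stick_weights v k * q (\<theta> k))"
    using S(1) c q_nonneg by (intro sum_nonneg mult_nonneg_nonneg) (auto intro: order_trans[OF less_imp_le[OF c(1)]])
   hence "R * X \<le> \<epsilon>" using nr spl[of q, OF abs_q_le] by (auto simp: near_def X_def)
   moreover have "real l * \<epsilon> * X \<le> R * X" using R X0 by (intro mult_right_mono) auto
   ultimately have "real l * X * \<epsilon> \<le> 1 * \<epsilon>" by (simp add: mult_ac)
   thus ?thesis using \<epsilon> by (simp add: X_def)
  qed
  show ?thesis using X cell bx by (auto split: split_indicator)
 qed auto
 have "emeasure prior ?E = (\<integral>\<^sup>+p. indicator ?E p \<partial>prior)" by (rule nn_integral_indicator[symmetric]) measurable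
 also have "\<dots> = (\<integral>\<^sup>+p. \<integral>\<^sup>+v. \<integral>\<^sup>+\<theta>. indicator ?E (comb_seq K v (fst p), comb_seq K \<theta> (snd p)) \<partial>atoms_law \<partial>sticks_law \<partial>prior)"
  by (rule nn_integral_prior_comb_seq) measurable
 also have "\<dots> \<le> (\<integral>\<^sup>+p. indicator ?X p * ennreal ?bd \<partial>prior)"
 proof (intro nn_integral_mono_AE)
  show "AE p in prior. (\<integral>\<^sup>+v. \<integral>\<^sup>+\<theta>. indicator ?E (comb_seq K v (fst p), comb_seq K \<theta> (snd p)) \<partial>atoms_law \<partial>sticks_law) \<le> indicator ?X p * ennreal ?bd"
   using AE_proper
  proof eventually_elim
   case (elim p)
   have th: "{\<theta>. \<forall>k<K. \<theta> k \<in> box (ctr p v k)} \<in> sets atoms_law" for v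
   proof -
    have "Measurable.pred atoms_law (\<lambda>\<theta>. \<forall>k<K. \<theta> k \<in> box (ctr p v k))" by measurable
    thus ?thesis by (simp add: pred_def)
   qed
   have wc: "{v. \<forall>k<K. weight_cell (a p) k v} \<in> sets sticks_law"
   proof -
    have "Measurable.pred sticks_law (\<lambda>v. \<forall>k<K. weight_cell (a p) k v)" by measurable
    thus ?thesis by (simp add: pred_def)
   qed
   have bnd: "emeasure atoms_law {\<theta>. \<forall>k<K. \<theta> k \<in> box (ctr p v k)} \<le> ennreal ((B * (\<epsilon> / c) ^ DIM('a)) ^ K)" for v
   proof -
    have "emeasure atoms_law {\<theta>. \<forall>k<K. \<theta> k \<in> box (ctr p v k)} = (\<Prod>k<K. emeasure P0 (box (ctr p v k)))"
     by (rule emeasure_atoms_Collect) measurable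
    also have "\<dots> \<le> (\<Prod>k<K. ennreal (B * (\<epsilon> / c) ^ DIM('a)))"
     unfolding box_def using c \<epsilon> by (intro prod_mono_ennreal box_small) auto
    also have "\<dots> = ennreal ((B * (\<epsilon> / c) ^ DIM('a)) ^ K)"
     using B_nonneg c \<epsilon> by (simp add: ennreal_power)
    finally show ?thesis .
   qed
   have "(\<integral>\<^sup>+v. \<integral>\<^sup>+\<theta>. indicator ?E (comb_seq K v (fst p), comb_seq K \<theta> (snd p)) \<partial>atoms_law \<partial>sticks_law) \<le>
    (\<integral>\<^sup>+v. \<integral>\<^sup>+\<theta>. (indicator ?X p * indicator {v. \<forall>k<K. weight_cell (a p) k v} v) * indicator {\<theta>. \<forall>k<K. \<theta> k \<in> box (ctr p v k)} \<theta> \<partial>atoms_law \<partial>sticks_law)"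
    using incl[OF elim] by (intro nn_integral_mono) (simp add: mult.assoc)
   also have "\<dots> = (\<integral>\<^sup>+v. indicator ?X p * indicator {v. \<forall>k<K. weight_cell (a p) k v} v * emeasure atoms_law {\<theta>. \<forall>k<K. \<theta> k \<in> box (ctr p v k)} \<partial>sticks_law)"
    by (intro nn_integral_cong) (simp add: nn_integral_cmult th)
   also have "\<dots> \<le> (\<integral>\<^sup>+v. indicator ?X p * indicator {v. \<forall>k<K. weight_cell (a p) k v} v * ennreal ((B * (\<epsilon> / c) ^ DIM('a)) ^ K) \<partial>sticks_law)"
    by (intro nn_integral_mono mult_left_mono bnd) auto
   also have "\<dots> = indicator ?X p * (emeasure sticks_law {v. \<forall>k<K. weight_cell (a p) k v} * ennreal ((B * (\<epsilon> / c) ^ DIM('a)) ^ K))"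
    using wc by (simp add: nn_integral_cmult nn_integral_multc mult.assoc)
   also have "\<dots> \<le> indicator ?X p * (ennreal ((4 * \<alpha> * \<epsilon> / c\<^sup>2) ^ (K - 1) * ((\<epsilon> / c) powr \<alpha> * ((real l + 1) powr \<alpha> - real l powr \<alpha>))) * ennreal ((B * (\<epsilon> / c) ^ DIM('a)) ^ K))"
    by (intro mult_left_mono mult_right_mono emeasure_weight_cell) auto
   also have "\<dots> = indicator ?X p * ennreal ?bd"
    using B_nonneg c \<epsilon> by (subst ennreal_mult''[symmetric]) (auto simp: mult.assoc)
   finally show ?case .
  qed
 qed
 also have "\<dots> = ennreal ?bd * emeasure prior ?X"
  by (simp add: nn_integral_multc mult.commute)
 finally show ?thesis .
qed

end

end

section \<open>Prior mass near the truth\<close>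

lemma suminf_powr_Suc_summable: "summable (\<lambda>l. (real l + 1) powr (-9/8))"
proof -
 have "summable (\<lambda>l. real (Suc l) powr (-9/8))"
  using summable_Suc_iff[of "\<lambda>l. real l powr (-9/8)"] summable_real_powr_iff[of "-9/8"] by simp
 thus ?thesis by (simp add: add.commute)
qed

context dirichlet_process
begin

text \<open>Stick \<open>j\<close> is independent of all other sticks and atoms, and those,
  renumbered, again follow the prior.\<close>

lemma nn_integral_delete:
 assumes [measurable]: "N \<in> sets prior"
 shows "emeasure prior {p. fst p j \<le> x \<and> (fst p \<circ> skip j, snd p \<circ> skip j) \<in> N} = emeasure \<beta> {v. v \<le> x} * emeasure prior N"
proof -
 have [measurable]: "(\<lambda>v. v \<circ> skip j) \<in> measurable sticks_law sticks_law" "(\<lambda>v. v \<circ> skip j) \<in> measurable atoms_law atoms_law"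
  "(\<lambda>v. v \<circ> Suc) \<in> measurable sticks_law sticks_law"
  using measurable_shift_sticks[of "skip j"] measurable_shift_atoms[of "skip j"] measurable_shift_sticks[of Suc]
  by (simp_all add: comp_def)
 define f :: "(nat \<Rightarrow> real) \<Rightarrow> ennreal" where
  "f v = indicator {..x} (v 0) * (\<integral>\<^sup>+\<theta>. indicator N (v \<circ> Suc, \<theta>) \<partial>atoms_law)" for v
 have [measurable]: "f \<in> borel_measurable sticks_law" unfolding f_def by measurable
 have "emeasure prior {p. fst p j \<le> x \<and> (fst p \<circ> skip j, snd p \<circ> skip j) \<in> N} =
  (\<integral>\<^sup>+p. indicator {p. fst p j \<le> x \<and> (fst p \<circ> skip j, snd p \<circ> skip j) \<in> N} p \<partial>prior)"
  by (intro nn_integral_indicator[symmetric] sets_prior_Collect) measurable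
 also have "\<dots> = (\<integral>\<^sup>+p. indicator {..x} (fst p j) * indicator N (fst p \<circ> skip j, snd p \<circ> skip j) \<partial>prior)"
  by (intro nn_integral_cong) (auto split: split_indicator)
 also have "\<dots> = (\<integral>\<^sup>+v. indicator {..x} (v j) * (\<integral>\<^sup>+\<theta>. indicator N (v \<circ> skip j, \<theta> \<circ> skip j) \<partial>atoms_law) \<partial>sticks_law)"
  by (subst nn_integral_prior) (auto simp: nn_integral_cmult)
 also have "\<dots> = (\<integral>\<^sup>+v. indicator {..x} (v j) * (\<integral>\<^sup>+\<theta>. indicator N (v \<circ> skip j, \<theta>) \<partial>atoms_law) \<partial>sticks_law)"
 proof -
  have "(\<integral>\<^sup>+\<theta>. indicator N (v \<circ> skip j, \<theta> \<circ> skip j) \<partial>atoms_law) = (\<integral>\<^sup>+\<theta>. indicator N (v \<circ> skip j, \<theta>) \<partial>atoms_law)" for v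
   using T.nn_integral_reindex[of "\<lambda>\<theta>. indicator N (v \<circ> skip j, \<theta>)" "skip j"] inj_skip
   by (simp add: atoms_law_def[symmetric])
  thus ?thesis by (simp only:)
 qed
 also have "\<dots> = (\<integral>\<^sup>+v. f (v \<circ> front j) \<partial>sticks_law)"
  by (intro nn_integral_cong) (simp add: f_def comp_def)
 also have "\<dots> = (\<integral>\<^sup>+v. f v \<partial>sticks_law)"
  using B.nn_integral_reindex[of f "front j"] inj_front by (simp add: sticks_law_def[symmetric])
 also have "\<dots> = (\<integral>\<^sup>+a. \<integral>\<^sup>+v. f (case_nat a v) \<partial>sticks_law \<partial>\<beta>)"
  by (rule nn_integral_sticks_step) measurable
 also have "\<dots> = (\<integral>\<^sup>+a. indicator {..x} a * (\<integral>\<^sup>+v. \<integral>\<^sup>+\<theta>. indicator N (v, \<theta>) \<partial>atoms_law \<partial>sticks_law) \<partial>\<beta>)"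
  by (intro nn_integral_cong) (simp add: f_def comp_def nn_integral_cmult)
 also have "(\<integral>\<^sup>+v. \<integral>\<^sup>+\<theta>. indicator N (v, \<theta>) \<partial>atoms_law \<partial>sticks_law) = (\<integral>\<^sup>+p. indicator N p \<partial>prior)"
  by (rule nn_integral_prior[symmetric]) measurable
 also have "(\<integral>\<^sup>+a. indicator {..x} a * (\<integral>\<^sup>+p. indicator N p \<partial>prior) \<partial>\<beta>) = emeasure \<beta> {v. v \<le> x} * emeasure prior N"
  by (simp add: nn_integral_multc atMost_def)
 finally show ?thesis .
qed

lemma emeasure_beta_le: "0 \<le> x \<Longrightarrow> x \<le> 1/2 \<Longrightarrow> emeasure \<beta> {v. v \<le> x} \<le> ennreal (2 * \<alpha> * x)"
proof -
 assume x: "0 \<le> x" "x \<le> 1/2"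
 have "emeasure \<beta> {v. v \<le> x} = emeasure \<beta> {v. 0 \<le> v \<and> v \<le> x \<and> 1/2 \<le> 1 - v}"
  using AE_beta by (intro emeasure_eq_AE) (use x in \<open>auto elim!: eventually_mono\<close>)
 also have "\<dots> \<le> ennreal (\<alpha> / (1/2) * (x - 0))"
  using x by (intro emeasure_beta_interval_le) auto
 finally show ?thesis by (simp add: mult_ac)
qed

end

text \<open>Both measures share the atoms before \<open>j\<close> and the normalised tail
  \<open>T\<close> after it; they differ by \<open>rem_mass v j * v j\<close> times the difference
  of \<open>T\<close> and \<open>\<phi> (\<theta> j)\<close>.\<close>

lemma sp_mean_delete:
 assumes v: "proper v" and \<phi>: "\<And>x. \<bar>\<phi> x\<bar> \<le> b"
 shows "\<bar>sp_mean \<phi> (v \<circ> skip j) (\<theta> \<circ> skip j) - sp_mean \<phi> v \<theta>\<bar> \<le> 2 * b * v j"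
proof -
 define T where "T = sp_mean \<phi> (\<lambda>i. v (Suc i + j)) (\<lambda>i. \<theta> (Suc i + j))"
 have pv: "proper (v \<circ> skip j)" using v by (auto simp: proper_def)
 have pt: "proper (\<lambda>i. v (Suc i + j))" using v by (auto simp: proper_def)
 have vj: "0 < v j" "v j < 1" using v by (auto simp: proper_def)
 have R: "rem_mass (v \<circ> skip j) k = rem_mass v k" if "k \<le> j" for k
  unfolding rem_mass_def using that by (intro prod.cong) (auto simp: skip_def)
 have "sp_mean \<phi> (v \<circ> skip j) (\<theta> \<circ> skip j) = (\<Sum>k<j. stick_weights (v \<circ> skip j) k * \<phi> ((\<theta> \<circ> skip j) k)) +
   rem_mass (v \<circ> skip j) j * sp_mean \<phi> (\<lambda>i. (v \<circ> skip j) (i + j)) (\<lambda>i. (\<theta> \<circ> skip j) (i + j))"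
  by (rule sp_mean_split[OF pv \<phi>])
 also have "(\<Sum>k<j. stick_weights (v \<circ> skip j) k * \<phi> ((\<theta> \<circ> skip j) k)) = (\<Sum>k<j. stick_weights v k * \<phi> (\<theta> k))"
  by (intro sum.cong) (auto simp: stick_weights_eq R, simp_all add: skip_def)
 also have "sp_mean \<phi> (\<lambda>i. (v \<circ> skip j) (i + j)) (\<lambda>i. (\<theta> \<circ> skip j) (i + j)) = T"
  by (simp add: T_def skip_def)
 finally have 1: "sp_mean \<phi> (v \<circ> skip j) (\<theta> \<circ> skip j) = (\<Sum>k<j. stick_weights v k * \<phi> (\<theta> k)) + rem_mass v j * T"
  by (simp only: R order_refl)
 have "sp_mean \<phi> (\<lambda>i. v (i + j)) (\<lambda>i. \<theta> (i + j)) = sp_mean \<phi> (case_nat (v j) (\<lambda>i. v (Suc i + j))) (case_nat (\<theta> j) (\<lambda>i. \<theta> (Suc i + j)))"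
  by (intro arg_cong2[where f = "sp_mean \<phi>"]) (auto simp: fun_eq_iff split: nat.split)
 also have "\<dots> = v j * \<phi> (\<theta> j) + (1 - v j) * T"
  unfolding T_def using pt vj \<phi> by (rule sp_mean_case_nat)
 finally have 2: "sp_mean \<phi> v \<theta> = (\<Sum>k<j. stick_weights v k * \<phi> (\<theta> k)) + rem_mass v j * (v j * \<phi> (\<theta> j) + (1 - v j) * T)"
  using sp_mean_split[OF v \<phi>, where \<theta> = \<theta> and n = j] by simp
 have "sp_mean \<phi> (v \<circ> skip j) (\<theta> \<circ> skip j) - sp_mean \<phi> v \<theta> = rem_mass v j * (v j * (T - \<phi> (\<theta> j)))"
  unfolding 1 2 by (simp add: algebra_simps)
 hence "\<bar>sp_mean \<phi> (v \<circ> skip j) (\<theta> \<circ> skip j) - sp_mean \<phi> v \<theta>\<bar> = rem_mass v j * (v j * \<bar>T - \<phi> (\<theta> j)\<bar>)"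
  using rem_mass_pos[OF v, of j] vj by (simp add: abs_mult)
 also have "\<dots> \<le> 1 * (v j * (2 * b))"
 proof (intro mult_mono)
  have "\<bar>T\<bar> \<le> b" unfolding T_def by (rule abs_sp_mean_le[OF pt \<phi>])
  thus "\<bar>T - \<phi> (\<theta> j)\<bar> \<le> 2 * b" using \<phi>[of "\<theta> j"] by linarith
 qed (use rem_mass_le_1[OF v] vj \<phi>[of undefined] in auto)
 finally show ?thesis by (simp add: mult_ac)
qed

section \<open>Upper bounds for the prior mass of near measures with leftover mass\<close>

context true_mixture_prior
begin

text \<open>Summation over the cells of the leftover mass. The hypothesis on \<open>\<zeta>\<close>
  expresses the gain: only cells beyond \<open>\<rho>\<close> occur, and there a spare factor
  l^(-1/8) is at most \<open>\<zeta>\<close>.\<close>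

lemma front_event_bound:
 obtains D m where "D > 0" "m \<ge> 0"
  "\<And>c \<epsilon> \<rho> \<zeta>. 0 < c \<Longrightarrow> c \<le> 1 \<Longrightarrow> 0 < \<epsilon> \<Longrightarrow> 0 \<le> \<zeta> \<Longrightarrow>
   (\<And>l. \<rho> < (real l + 1) * \<epsilon> \<Longrightarrow> (real l + 1) powr (-1/8) \<le> \<zeta>) \<Longrightarrow>
   emeasure prior (front_event c \<epsilon> \<rho>) \<le> ennreal (D * c powr (- m) * \<epsilon> powr prior_exponent * \<zeta>)"
proof -
 obtain C where C: "C > 0" "\<And>x. x > 0 \<Longrightarrow> mean_cdf q x \<le> ennreal (C * x powr (\<alpha> + 1/4))"
  using mean_cdf_bound[OF q_meas q_nonneg q_le A_nonneg q_small] by blast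
 define C2 where "C2 = max 1 (C * 2 powr (\<alpha> + 1/4))"
 define S9 where "S9 = (\<Sum>l. (real l + 1) powr (-9/8))"
 define m where "m = 2 * real (K - 1) + \<alpha> + real (K * DIM('a))"
 define D1 where "D1 = (4 * \<alpha>) ^ (K - 1) * (1 + 2 * \<alpha>) * B ^ K * C2"
 have C2: "C2 \<ge> 1" by (simp add: C2_def)
 have D1: "D1 \<ge> 0" using \<alpha>_pos B_nonneg C2 by (simp add: D1_def)
 have S9: "S9 \<ge> 0" unfolding S9_def by (intro suminf_nonneg suminf_powr_Suc_summable) auto
 have X: "emeasure prior {p. real l * sp_mean q (fst p) (snd p) \<le> 1} \<le> ennreal (C2 * (real l + 1) powr (- (\<alpha> + 1/4)))" for l
 proof (cases "l = 0")
  case True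
  have "emeasure prior {p. real l * sp_mean q (fst p) (snd p) \<le> 1} \<le> 1" by (rule PR.emeasure_le_1)
  thus ?thesis using True C2 by (auto intro: order_trans)
 next
  case False
  have "{p. real l * sp_mean q (fst p) (snd p) \<le> 1} = {p. sp_mean q (fst p) (snd p) \<le> 1 / real l}"
   using False by (auto simp: field_simps)
  hence "emeasure prior {p. real l * sp_mean q (fst p) (snd p) \<le> 1} = mean_cdf q (1 / real l)"
   by (simp add: mean_cdf_def[OF q_meas q_nonneg q_le A_nonneg q_small])
  also have "\<dots> \<le> ennreal (C * (1 / real l) powr (\<alpha> + 1/4))"
   using False by (intro C) auto
  also have "\<dots> \<le> ennreal (C2 * (real l + 1) powr (- (\<alpha> + 1/4)))"
  proof (rule ennreal_leI)
   have "C * (1 / real l) powr (\<alpha> + 1/4) \<le> C * (2 / (real l + 1)) powr (\<alpha> + 1/4)"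
    using False C \<alpha>_pos by (intro mult_left_mono powr_mono2) (auto simp: field_simps)
   also have "\<dots> = C * 2 powr (\<alpha> + 1/4) * (real l + 1) powr (- (\<alpha> + 1/4))"
    by (subst powr_minus_divide) (simp add: powr_divide)
   also have "\<dots> \<le> C2 * (real l + 1) powr (- (\<alpha> + 1/4))"
    by (intro mult_right_mono) (auto simp: C2_def)
   finally show "C * (1 / real l) powr (\<alpha> + 1/4) \<le> C2 * (real l + 1) powr (- (\<alpha> + 1/4))" .
  qed
  finally show ?thesis .
 qed
 have main: "emeasure prior (front_event c \<epsilon> \<rho>) \<le> ennreal ((D1 * S9 + 1) * c powr (- m) * \<epsilon> powr prior_exponent * \<zeta>)"
  if c: "0 < c" "c \<le> 1" and \<epsilon>: "0 < \<epsilon>" and \<zeta>: "0 \<le> \<zeta>"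
   and gain: "\<And>l. \<rho> < (real l + 1) * \<epsilon> \<Longrightarrow> (real l + 1) powr (-1/8) \<le> \<zeta>" for c \<epsilon> \<rho> \<zeta>
 proof -
  define cell where "cell l = front_event c \<epsilon> \<rho> \<inter> {p. real l * \<epsilon> < rem_mass (fst p) K \<and> rem_mass (fst p) K \<le> (real l + 1) * \<epsilon>}" for l
  have [measurable]: "cell l \<in> sets prior" for l
   unfolding cell_def by (intro sets.Int sets_front_event sets_prior_Collect) measurable
  define Q where "Q = D1 * c powr (- m) * \<epsilon> powr prior_exponent * \<zeta>"
  have Q: "Q \<ge> 0" using D1 \<zeta> by (simp add: Q_def)
  have cb: "emeasure prior (cell l) \<le> ennreal (Q * (real l + 1) powr (-9/8))" for l
  proof (cases "\<rho> < (real l + 1) * \<epsilon>")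
   case False
   hence "cell l = {}" by (auto simp: cell_def front_event_def)
   thus ?thesis by simp
  next
   case True
   define G where "G = (4 * \<alpha> * \<epsilon> / c\<^sup>2) ^ (K - 1) * ((\<epsilon> / c) powr \<alpha> * ((real l + 1) powr \<alpha> - real l powr \<alpha>)) * (B * (\<epsilon> / c) ^ DIM('a)) ^ K"
   define E where "E = \<epsilon> ^ (K - 1) * \<epsilon> powr \<alpha> * \<epsilon> ^ (K * DIM('a))"
   define c' where "c' = (1 / c\<^sup>2) ^ (K - 1) * (1 / c) powr \<alpha> * (1 / c) ^ (K * DIM('a))"
   have Ee: "E = \<epsilon> powr prior_exponent"
    using \<epsilon> K_pos by (simp add: E_def prior_exponent_def powr_add powr_diff powr_realpow[symmetric] of_nat_diff)
   have "(1 / c\<^sup>2) ^ (K - 1) = c powr (- (2 * real (K - 1)))"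
   proof -
    have "(1 / c\<^sup>2) ^ (K - 1) = 1 / c ^ (2 * (K - 1))" by (simp add: power_divide power_mult)
    also have "\<dots> = c powr (- (2 * real (K - 1)))"
     using c powr_realpow[of c "2 * (K - 1)"] by (simp add: powr_minus_divide)
    finally show ?thesis .
   qed
   moreover have "(1 / c) powr \<alpha> = c powr (- \<alpha>)"
    using c by (simp add: powr_divide powr_minus_divide)
   moreover have "(1 / c) ^ (K * DIM('a)) = c powr (- real (K * DIM('a)))"
    using c powr_realpow[of c "K * DIM('a)"] by (simp add: powr_minus_divide power_divide)
   ultimately have ce: "c' = c powr (- m)"
    unfolding c'_def m_def by (simp add: powr_add[symmetric])
   have split1: "(4 * \<alpha> * \<epsilon> / c\<^sup>2) ^ (K - 1) = (4 * \<alpha>) ^ (K - 1) * \<epsilon> ^ (K - 1) * (1 / c\<^sup>2) ^ (K - 1)"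
    by (simp add: power_mult_distrib power_divide)
   have split2: "(\<epsilon> / c) powr \<alpha> = \<epsilon> powr \<alpha> * (1 / c) powr \<alpha>"
    using c \<epsilon> by (simp add: powr_divide)
   have split3: "(B * (\<epsilon> / c) ^ DIM('a)) ^ K = B ^ K * \<epsilon> ^ (K * DIM('a)) * (1 / c) ^ (K * DIM('a))"
    by (simp add: power_mult_distrib power_divide power_mult[symmetric] mult.commute)
   have "G = ((4 * \<alpha>) ^ (K - 1) * B ^ K) * E * c' * ((real l + 1) powr \<alpha> - real l powr \<alpha>)"
    unfolding G_def split1 split2 split3 E_def c'_def by (simp only: mult_ac)
   also have "\<dots> \<le> ((4 * \<alpha>) ^ (K - 1) * B ^ K) * E * c' * ((1 + 2 * \<alpha>) * (real l + 1) powr (\<alpha> - 1))"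
    using \<alpha>_pos B_nonneg c \<epsilon> by (intro mult_left_mono powr_Suc_diff_le) (auto simp: Ee ce)
   finally have G: "G \<le> ((4 * \<alpha>) ^ (K - 1) * B ^ K) * E * c' * ((1 + 2 * \<alpha>) * (real l + 1) powr (\<alpha> - 1))" .
   have "emeasure prior (cell l) \<le> ennreal G * emeasure prior {p. real l * sp_mean q (fst p) (snd p) \<le> 1}"
    unfolding cell_def G_def by (rule front_event_cell[OF c \<epsilon>])
   also have "\<dots> \<le> ennreal (((4 * \<alpha>) ^ (K - 1) * B ^ K) * E * c' * ((1 + 2 * \<alpha>) * (real l + 1) powr (\<alpha> - 1)))
     * ennreal (C2 * (real l + 1) powr (- (\<alpha> + 1/4)))"
    using G by (intro mult_mono X ennreal_leI) auto
   also have "\<dots> = ennreal (((4 * \<alpha>) ^ (K - 1) * B ^ K) * E * c' * ((1 + 2 * \<alpha>) * (real l + 1) powr (\<alpha> - 1)) * (C2 * (real l + 1) powr (- (\<alpha> + 1/4))))"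
    using C2 by (intro ennreal_mult''[symmetric]) simp
   also have "((4 * \<alpha>) ^ (K - 1) * B ^ K) * E * c' * ((1 + 2 * \<alpha>) * (real l + 1) powr (\<alpha> - 1)) * (C2 * (real l + 1) powr (- (\<alpha> + 1/4))) =
     D1 * E * c' * ((real l + 1) powr (\<alpha> - 1) * (real l + 1) powr (- (\<alpha> + 1/4)))"
    by (simp add: D1_def mult_ac)
   \<comment> \<open>The total exponent is -5/4. The part -9/8 is kept for summability and -1/8 is
     given to \<open>\<zeta>\<close>.\<close>
   also have "(real l + 1) powr (\<alpha> - 1) * (real l + 1) powr (- (\<alpha> + 1/4)) = (real l + 1) powr (-1/8) * (real l + 1) powr (-9/8)"
    by (simp add: powr_add[symmetric])
   also have "ennreal (D1 * E * c' * ((real l + 1) powr (-1/8) * (real l + 1) powr (-9/8))) \<le>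
    ennreal (D1 * E * c' * (\<zeta> * (real l + 1) powr (-9/8)))"
    using gain[OF True] D1 by (intro ennreal_leI mult_left_mono mult_right_mono) (auto simp: Ee ce)
   also have "\<dots> = ennreal (Q * (real l + 1) powr (-9/8))"
    by (simp add: Q_def Ee ce mult_ac)
   finally show ?thesis .
  qed
  have cover: "front_event c \<epsilon> \<rho> \<subseteq> (\<Union>l. cell l)"
  proof
   fix p assume p: "p \<in> front_event c \<epsilon> \<rho>"
   define R where "R = rem_mass (fst p) K"
   have R: "R > 0" using p rem_mass_pos by (auto simp: front_event_def R_def)
   \<comment> \<open>Cells are open on the left and closed on the right, hence the ceiling minus
     1.\<close>
   define l where "l = nat (\<lceil>R / \<epsilon>\<rceil> - 1)"
   have "1 \<le> \<lceil>R / \<epsilon>\<rceil>" using R \<epsilon> by simp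
   hence "real l = real_of_int \<lceil>R / \<epsilon>\<rceil> - 1" unfolding l_def by simp
   hence "real l < R / \<epsilon>" "R / \<epsilon> \<le> real l + 1" by linarith+
   hence "p \<in> cell l" using p \<epsilon> by (auto simp: cell_def R_def field_simps)
   thus "p \<in> (\<Union>l. cell l)" by blast
  qed
  have "emeasure prior (front_event c \<epsilon> \<rho>) \<le> emeasure prior (\<Union>l. cell l)"
   using cover by (rule emeasure_mono) measurable
  also have "\<dots> \<le> (\<Sum>l. emeasure prior (cell l))"
   by (rule emeasure_subadditive_countably) auto
  also have "\<dots> \<le> (\<Sum>l. ennreal (Q * (real l + 1) powr (-9/8)))"
   by (intro suminf_le cb summableI)
  also have "\<dots> = ennreal (\<Sum>l. Q * (real l + 1) powr (-9/8))"
   using Q by (intro suminf_ennreal2 summable_mult suminf_powr_Suc_summable) auto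
  also have "(\<Sum>l. Q * (real l + 1) powr (-9/8)) = Q * S9"
   unfolding S9_def by (rule suminf_mult[OF suminf_powr_Suc_summable])
  also have "Q * S9 \<le> (D1 * S9 + 1) * c powr (- m) * \<epsilon> powr prior_exponent * \<zeta>"
   using \<zeta> by (simp add: Q_def algebra_simps)
  finally show ?thesis by (simp add: ennreal_leI)
 qed
 show thesis
  by (rule that[of "D1 * S9 + 1" m]) (use D1 S9 main \<alpha>_pos in \<open>auto simp: m_def add_nonneg_pos\<close>)
qed

text \<open>Like \<open>front_event\<close>, but with the heavy atoms anywhere among the first
  \<open>n\<close> positions. Here \<open>n\<close> truncates the sequence of atoms; it is not the
  sample size.\<close>

definition heavy_event :: "nat \<Rightarrow> real \<Rightarrow> real \<Rightarrow> real \<Rightarrow> 'a sticks set" where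
 "heavy_event n c \<epsilon> \<rho> = {p. proper (fst p) \<and> near \<epsilon> (fst p) (snd p) \<and>
  (\<exists>Is. length Is = K \<and> distinct Is \<and> set Is \<subseteq> {..<n} \<and>
   (\<forall>k<K. c \<le> stick_weights (fst p) (Is ! k) \<and> snd p (Is ! k) \<in> V k) \<and>
   \<rho> < 1 - (\<Sum>i\<in>set Is. stick_weights (fst p) i))}"

text \<open>Bringing the heavy atoms to the front costs at most the factor \<open>1 / c\<close> per atom.\<close>

lemma heavy_event_cover:
 assumes c: "0 < c"
 obtains E where "E \<in> sets prior" "heavy_event n c \<epsilon> \<rho> \<subseteq> E"
  "emeasure prior E \<le> ennreal (real n ^ K / c ^ K) * emeasure prior (front_event c \<epsilon> \<rho>)"
proof -
 define Ls where "Ls = {is. set is \<subseteq> {..<n} \<and> length is = K}"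
 have fin: "finite Ls" unfolding Ls_def by (rule finite_lists_length_eq) simp
 have card: "card Ls = n ^ K" unfolding Ls_def by (subst card_lists_length_eq) auto
 \<comment> \<open>One measurable event for each of the \<open>n ^ K\<close> lists of moves. On it
   \<open>front_weight\<close> is at least \<open>c ^ K\<close>, so inserting that weight costs at
   most \<open>1 / c ^ K\<close>.\<close>
 define E where "E is = {p. c ^ K \<le> front_weight is (fst p) \<and> (sticks_to_front is (fst p), atoms_to_front is (snd p)) \<in> front_event c \<epsilon> \<rho>}" for "is"
 have E_meas [measurable]: "E is \<in> sets prior" for "is"
  unfolding E_def by (rule sets_prior_Collect) measurable
 have "emeasure prior (E is) \<le> ennreal (1 / c ^ K) * emeasure prior (front_event c \<epsilon> \<rho>)" for "is"
 proof -
  have "emeasure prior (E is) = (\<integral>\<^sup>+p. indicator (E is) p \<partial>prior)" by (rule nn_integral_indicator[symmetric]) measurable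
  also have "\<dots> \<le> (\<integral>\<^sup>+p. ennreal (1 / c ^ K) * (ennreal (front_weight is (fst p)) * indicator (front_event c \<epsilon> \<rho>) (sticks_to_front is (fst p), atoms_to_front is (snd p))) \<partial>prior)"
  proof (intro nn_integral_mono)
   fix p :: "'a sticks"
   show "indicator (E is) p \<le> ennreal (1 / c ^ K) * (ennreal (front_weight is (fst p)) * indicator (front_event c \<epsilon> \<rho>) (sticks_to_front is (fst p), atoms_to_front is (snd p)))"
    using c by (auto simp: E_def ennreal_mult'[symmetric] split: split_indicator)
  qed
  also have "\<dots> = ennreal (1 / c ^ K) * (\<integral>\<^sup>+p. ennreal (front_weight is (fst p)) * indicator (front_event c \<epsilon> \<rho>) (sticks_to_front is (fst p), atoms_to_front is (snd p)) \<partial>prior)"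
   by (rule nn_integral_cmult) measurable
  also have "\<dots> \<le> ennreal (1 / c ^ K) * (\<integral>\<^sup>+p. indicator (front_event c \<epsilon> \<rho>) p \<partial>prior)"
   by (intro mult_left_mono nn_integral_prior_atoms_to_front) auto
  finally show ?thesis by simp
 qed
 hence "emeasure prior (\<Union>is\<in>Ls. E is) \<le> (\<Sum>is\<in>Ls. ennreal (1 / c ^ K) * emeasure prior (front_event c \<epsilon> \<rho>))"
  using fin by (intro order_trans[OF emeasure_subadditive_finite] sum_mono) auto
 also have "\<dots> = ennreal (real n ^ K / c ^ K) * emeasure prior (front_event c \<epsilon> \<rho>)"
 proof -
  have "ennreal (real n ^ K / c ^ K) = of_nat (n ^ K) * ennreal (1 / c ^ K)"
   using c by (simp add: ennreal_of_nat_eq_real_of_nat ennreal_mult'[symmetric])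
  thus ?thesis by (simp add: card mult.assoc)
 qed
 finally have bd: "emeasure prior (\<Union>is\<in>Ls. E is) \<le> ennreal (real n ^ K / c ^ K) * emeasure prior (front_event c \<epsilon> \<rho>)" .
 have sub: "heavy_event n c \<epsilon> \<rho> \<subseteq> (\<Union>is\<in>Ls. E is)"
 proof
  fix p assume p: "p \<in> heavy_event n c \<epsilon> \<rho>"
  then obtain Is where Is: "length Is = K" "distinct Is" "set Is \<subseteq> {..<n}"
   "\<And>k. k < K \<Longrightarrow> c \<le> stick_weights (fst p) (Is ! k)" "\<And>k. k < K \<Longrightarrow> snd p (Is ! k) \<in> V k"
   "\<rho> < 1 - (\<Sum>i\<in>set Is. stick_weights (fst p) i)" and pp: "proper (fst p)" and nr: "near \<epsilon> (fst p) (snd p)"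
   by (auto simp: heavy_event_def)
  have "c \<le> stick_weights (fst p) i" if "i \<in> set Is" for i
   using that Is(1,4) by (auto simp: in_set_conv_nth)
  from sticks_to_front_exists[OF pp Is(2,3) c this, where ?'a = 'a] obtain "is" where I:
   "length is = K" "set is \<subseteq> {..<n}" "c ^ K \<le> front_weight is (fst p)" "proper (sticks_to_front is (fst p))"
   "\<And>k. k < K \<Longrightarrow> stick_weights (sticks_to_front is (fst p)) k = stick_weights (fst p) (Is ! k)"
   "\<And>(\<theta>::nat \<Rightarrow> 'a) k. k < K \<Longrightarrow> atoms_to_front is \<theta> k = \<theta> (Is ! k)"
   "\<And>(\<theta>::nat \<Rightarrow> 'a) \<phi> B. (\<And>x. \<bar>\<phi> x\<bar> \<le> B) \<Longrightarrow> sp_mean \<phi> (sticks_to_front is (fst p)) (atoms_to_front is \<theta>) = sp_mean \<phi> (fst p) \<theta>"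
   unfolding Is(1) by blast
  have inv: "sp_mean \<phi> (sticks_to_front is (fst p)) (atoms_to_front is (snd p)) = sp_mean \<phi> (fst p) (snd p)"
   if "\<And>x. \<bar>\<phi> x\<bar> \<le> b" for \<phi> using that by (rule I(7))
  have "near \<epsilon> (sticks_to_front is (fst p)) (atoms_to_front is (snd p))"
   using nr unfolding near_def
   by (simp add: inv abs_q_le abs_offset_le inv[of "indicator (V k)" for k, OF abs_indicator_le])
  moreover have "rem_mass (sticks_to_front is (fst p)) K = 1 - (\<Sum>i\<in>set Is. stick_weights (fst p) i)"
  proof -
   have "(\<Sum>k<K. stick_weights (sticks_to_front is (fst p)) k) = (\<Sum>k<K. stick_weights (fst p) (Is ! k))"
    by (intro sum.cong) (auto simp: I(5))
   also have "\<dots> = (\<Sum>i\<in>set Is. stick_weights (fst p) i)"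
    using Is(1,2) by (intro sum.reindex_bij_betw bij_betw_nth) auto
   finally show ?thesis by (simp add: sum_stick_weights)
  qed
  ultimately have "p \<in> E is"
   using I Is by (auto simp: E_def front_event_def)
  thus "p \<in> (\<Union>is\<in>Ls. E is)" using I(1,2) by (auto simp: Ls_def)
 qed
 show thesis
  by (rule that[of "\<Union>is\<in>Ls. E is"]) (use fin sub bd in \<open>auto intro!: sets.finite_UN\<close>)
qed

definition w_min :: real where
 "w_min = Min (ws ` {..<K})"

lemma w_min_pos: "0 < w_min" and w_min_le: "k < K \<Longrightarrow> w_min \<le> ws k" and w_min_le_1: "w_min \<le> 1"
proof -
 have ne: "ws ` {..<K} \<noteq> {}" "finite (ws ` {..<K})" using K_pos by auto
 show "0 < w_min" unfolding w_min_def using ne ws_pos by (subst Min_gr_iff) auto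
 show le: "w_min \<le> ws k" if "k < K" for k unfolding w_min_def using that by (intro Min_le) auto
 have "ws 0 \<le> (\<Sum>k<K. ws k)" using K_pos ws_pos by (intro member_le_sum) (auto intro: less_imp_le)
 thus "w_min \<le> 1" using le[OF K_pos] ws_sum by linarith
qed

text \<open>Pigeonhole: the mass in \<open>V k\<close> is at least half of \<open>w_min\<close>, the
  atoms from \<open>n\<close> on carry less than a quarter, so one of the first \<open>n\<close>
  atoms in \<open>V k\<close> has weight at least \<open>w_min / (4 * real n)\<close>. Disjointness
  of the \<open>V k\<close> makes the chosen indices distinct.\<close>

lemma heavy_exists:
 assumes p: "proper v" and nr: "near \<epsilon> v \<theta>" and \<epsilon>: "\<epsilon> \<le> w_min / 2"
  and rem: "rem_mass v n < w_min / 4" and n: "n > 0" and c: "c \<le> w_min / (4 * real n)"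
 obtains Is where "length Is = K" "distinct Is" "set Is \<subseteq> {..<n}"
  "\<And>k. k < K \<Longrightarrow> c \<le> stick_weights v (Is ! k)" "\<And>k. k < K \<Longrightarrow> \<theta> (Is ! k) \<in> V k"
proof -
 have "\<exists>i<n. c \<le> stick_weights v i \<and> \<theta> i \<in> V k" if k: "k < K" for k
 proof (rule ccontr)
  assume "\<not> ?thesis"
  hence lt: "stick_weights v i * indicator (V k) (\<theta> i) \<le> w_min / (4 * real n)" if "i < n" for i
  proof (cases "\<theta> i \<in> V k")
   case True
   hence "\<not> c \<le> stick_weights v i" using \<open>\<not> (\<exists>i<n. c \<le> stick_weights v i \<and> \<theta> i \<in> V k)\<close> that by blast
   thus ?thesis using c True by simp
  qed (use w_min_pos in auto)
  have "(\<Sum>i<n. stick_weights v i * indicator (V k) (\<theta> i)) \<le> (\<Sum>i<n. w_min / (4 * real n))"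
   using lt by (intro sum_mono) auto
  also have "\<dots> = w_min / 4" using n by simp
  finally have 1: "(\<Sum>i<n. stick_weights v i * indicator (V k) (\<theta> i)) \<le> w_min / 4" .
  have pt: "proper (\<lambda>i. v (i + n))" using p by (auto simp: proper_def)
  define M where "M = sp_mean (indicator (V k)) (\<lambda>i. v (i + n)) (\<lambda>i. \<theta> (i + n))"
  have "M \<le> 1" using abs_sp_mean_le[OF pt, where \<phi> = "indicator (V k)" and b = 1 and \<theta> = "\<lambda>i. \<theta> (i + n)"]
   by (auto simp: M_def split: split_indicator)
  hence "rem_mass v n * M \<le> rem_mass v n * 1"
   using rem_mass_pos[OF p, of n] by (intro mult_left_mono) auto
  moreover have "sp_mean (indicator (V k)) v \<theta> = (\<Sum>i<n. stick_weights v i * indicator (V k) (\<theta> i)) + rem_mass v n * M"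
   unfolding M_def using p abs_indicator_le by (rule sp_mean_split)
  ultimately have "sp_mean (indicator (V k)) v \<theta> < w_min / 2" using 1 rem by linarith
  moreover have "ws k - \<epsilon> \<le> sp_mean (indicator (V k)) v \<theta>" using nr k unfolding near_def by (auto simp: abs_le_iff)
  ultimately show False using \<epsilon> w_min_le[OF k] by linarith
 qed
 then obtain i where i: "\<And>k. k < K \<Longrightarrow> i k < n" "\<And>k. k < K \<Longrightarrow> c \<le> stick_weights v (i k)" "\<And>k. k < K \<Longrightarrow> \<theta> (i k) \<in> V k"
  by metis
 have "inj_on i {..<K}"
 proof (rule inj_onI)
  fix k l assume kl: "k \<in> {..<K}" "l \<in> {..<K}" "i k = i l"
  hence "\<theta> (i k) \<in> V k" "\<theta> (i k) \<in> V l" using i(3)[of k] i(3)[of l] by auto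
  thus "k = l" using V_disj[of k l] kl by auto
 qed
 thus thesis
  using i by (intro that[of "map i [0..<K]"]) (auto simp: distinct_map lessThan_atLeast0)
qed

lemma near_delete:
 assumes "proper v" "near \<epsilon> v \<theta>" "v j \<le> x"
 shows "near (\<epsilon> + 2 * b * x) (v \<circ> skip j) (\<theta> \<circ> skip j)"
proof -
 have x: "2 * b * v j \<le> 2 * b * x" using assms(3) b_ge_1 by simp
 have d: "\<bar>sp_mean \<phi> (v \<circ> skip j) (\<theta> \<circ> skip j) - sp_mean \<phi> v \<theta>\<bar> \<le> 2 * b * x" if "\<And>t. \<bar>\<phi> t\<bar> \<le> b" for \<phi>
  using sp_mean_delete[where \<phi> = \<phi> and b = b and j = j and \<theta> = \<theta>, OF assms(1) that] x by linarith
 have t: "\<bar>a - w\<bar> \<le> \<epsilon> + y" if "\<bar>a - a'\<bar> \<le> y" "\<bar>a' - w\<bar> \<le> \<epsilon>" for a a' w y :: real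
  using that by linarith
 show ?thesis
  unfolding near_def
 proof (intro conjI allI impI ballI)
  show "\<bar>sp_mean q (v \<circ> skip j) (\<theta> \<circ> skip j)\<bar> \<le> \<epsilon> + 2 * b * x"
   using t[OF d[of q, OF abs_q_le], of 0] assms(2) unfolding near_def by simp
  fix k assume k: "k < K"
  show "\<bar>sp_mean (indicator (V k)) (v \<circ> skip j) (\<theta> \<circ> skip j) - ws k\<bar> \<le> \<epsilon> + 2 * b * x"
   using t[OF d[of "indicator (V k)", OF abs_indicator_le], of "ws k"] assms(2) k unfolding near_def by blast
  fix i :: 'a assume i: "i \<in> Basis"
  show "\<bar>sp_mean (offset k i) (v \<circ> skip j) (\<theta> \<circ> skip j)\<bar> \<le> \<epsilon> + 2 * b * x"
   using t[OF d[of "offset k i", OF abs_offset_le[OF k i]], of 0] assms(2) k i unfolding near_def by simp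
 qed
qed

end

section \<open>Light atoms among the first sticks, and matching of the first \<open>K\<close>
  atoms\<close>

context true_mixture_prior
begin

lemma sum_stick_weights_le_1:
 assumes "proper v" "finite I" shows "(\<Sum>i\<in>I. stick_weights v i) < 1"
proof -
 obtain n where "I \<subseteq> {..<n}" using assms(2) finite_nat_iff_bounded by blast
 hence "(\<Sum>i\<in>I. stick_weights v i) \<le> (\<Sum>i<n. stick_weights v i)"
  using stick_weights_pos[OF assms(1)] by (intro sum_mono2) (auto intro: less_imp_le)
 thus ?thesis using rem_mass_pos[OF assms(1), of n] by (simp add: sum_stick_weights)
qed

text \<open>Markov's bound for the event that \<open>n\<close> sticks leave at least
  \<open>w_min / 4\<close>, the failure case of \<open>heavy_exists\<close>.\<close>

definition tail_bound :: "nat \<Rightarrow> real" where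
 "tail_bound n = (\<alpha> / (\<alpha> + 1)) ^ n / (w_min / 4)"

lemma tail_bound_nonneg: "0 \<le> tail_bound n"
 using \<alpha>_pos w_min_pos by (simp add: tail_bound_def)

text \<open>The heavy atoms cannot be the first \<open>K\<close>, as these leave more mass. So some
  \<open>j < K\<close> is not heavy while a heavy atom comes after it. The weight of
  \<open>j\<close> belongs to the at most \<open>\<rho>\<close> outside the heavy atoms, and the
  later heavy atom forces \<open>rem_mass v j\<close> to be at least \<open>c\<close>.\<close>

lemma light_atom_before_heavy:
 assumes p: "proper v" and Is: "length Is = K" "distinct Is"
  and c: "\<And>i. i \<in> set Is \<Longrightarrow> c \<le> stick_weights v i" "0 < c"
  and T: "1 - (\<Sum>i\<in>set Is. stick_weights v i) \<le> \<rho>" and R: "\<rho> < rem_mass v K"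
 obtains j where "j < K" "v j \<le> \<rho> / c"
proof -
 have card: "card (set Is) = K" using Is by (simp add: distinct_card)
 have "\<not> {..<K} \<subseteq> set Is"
 proof
  assume "{..<K} \<subseteq> set Is"
  hence "set Is = {..<K}" using card by (intro card_subset_eq[symmetric]) auto
  thus False using T R by (simp add: sum_stick_weights)
 qed
 then obtain j where j: "j < K" "j \<notin> set Is" by auto
 have "\<not> set Is \<subseteq> {..<j}"
 proof
  assume "set Is \<subseteq> {..<j}"
  hence "card (set Is) \<le> j" using card_mono[of "{..<j}" "set Is"] by simp
  thus False using card j by simp
 qed
 then obtain i where i: "i \<in> set Is" "j \<le> i" by (metis subsetI lessThan_iff not_le)
 have Rj: "c \<le> rem_mass v j" using c(1)[OF i(1)] stick_weights_le_rem_mass[OF p i(2)] by linarith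
 have "(\<Sum>i\<in>insert j (set Is). stick_weights v i) < 1" using p by (rule sum_stick_weights_le_1) simp
 hence "stick_weights v j \<le> \<rho>" using j T by simp
 moreover have "v j * c \<le> v j * rem_mass v j" using Rj p by (intro mult_left_mono) (auto simp: proper_def less_imp_le)
 ultimately have "v j \<le> \<rho> / c" using c(2) by (simp add: stick_weights_eq pos_le_divide_eq)
 thus thesis using j that by blast
qed

text \<open>Three cases: \<open>n\<close> sticks leave too much mass; \<open>K\<close> heavy atoms
  leave more than \<open>\<rho>\<close>, where reordering applies with gain \<open>\<zeta>\<close>;
  or only the first \<open>K\<close> sticks leave more than \<open>\<rho>\<close>. In the last case
  a light atom is deleted, which yields the factor \<open>2 * \<alpha> * (\<rho> / c)\<close> times
  the mass of a wider \<open>near\<close> event.\<close>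

lemma prior_near_bound:
 obtains D m where "D > 0" "m \<ge> 0"
  "\<And>n c \<epsilon> \<rho> \<zeta>. 0 < n \<Longrightarrow> 0 < c \<Longrightarrow> c \<le> w_min / (4 * real n) \<Longrightarrow> 0 < \<epsilon> \<Longrightarrow> \<epsilon> \<le> \<rho> \<Longrightarrow>
   (1 + 2 * b) * \<rho> / c \<le> w_min / 2 \<Longrightarrow> 0 \<le> \<zeta> \<Longrightarrow>
   (\<And>l. \<rho> < (real l + 1) * \<epsilon> \<Longrightarrow> (real l + 1) powr (-1/8) \<le> \<zeta>) \<Longrightarrow>
   emeasure prior {p. proper (fst p) \<and> near \<epsilon> (fst p) (snd p) \<and> \<rho> < rem_mass (fst p) K} \<le>
    ennreal (tail_bound n + real n ^ K / c ^ K * (D * c powr (- m) * \<epsilon> powr prior_exponent * \<zeta>) +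
     real K * (2 * \<alpha> * (\<rho> / c)) *
      (tail_bound n + real n ^ K / c ^ K * (D * c powr (- m) * ((1 + 2 * b) * \<rho> / c) powr prior_exponent)))"
proof -
 obtain D m where D: "D > 0" "m \<ge> 0" and fb: "\<And>c \<epsilon> \<rho> \<zeta>. 0 < c \<Longrightarrow> c \<le> 1 \<Longrightarrow> 0 < \<epsilon> \<Longrightarrow> 0 \<le> \<zeta> \<Longrightarrow>
   (\<And>l. \<rho> < (real l + 1) * \<epsilon> \<Longrightarrow> (real l + 1) powr (-1/8) \<le> \<zeta>) \<Longrightarrow>
   emeasure prior (front_event c \<epsilon> \<rho>) \<le> ennreal (D * c powr (- m) * \<epsilon> powr prior_exponent * \<zeta>)"
  by (rule front_event_bound) blast
 show thesis
 proof (rule that[OF D])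
  fix n c \<epsilon> \<rho> \<zeta>
  assume n: "0 < n" and c: "0 < c" "c \<le> w_min / (4 * real n)" and \<epsilon>: "0 < \<epsilon>" "\<epsilon> \<le> \<rho>"
   and \<rho>: "(1 + 2 * b) * \<rho> / c \<le> w_min / 2" and \<zeta>: "0 \<le> \<zeta>"
   and gain: "\<And>l. \<rho> < (real l + 1) * \<epsilon> \<Longrightarrow> (real l + 1) powr (-1/8) \<le> \<zeta>"
  \<comment> \<open>The accuracy that survives the deletion of an atom whose stick is at most
    \<open>\<rho> / c\<close>.\<close>
  define \<epsilon>2 where "\<epsilon>2 = (1 + 2 * b) * \<rho> / c"
  have c1: "c \<le> 1"
  proof -
   have "w_min / (4 * real n) \<le> 1" using n w_min_le_1 by (simp add: divide_le_eq)
   thus ?thesis using c by linarith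
  qed
  have \<rho>0: "0 < \<rho>" using \<epsilon> by linarith
  have \<epsilon>2: "0 < \<epsilon>2" using \<rho>0 c b_ge_1 by (simp add: \<epsilon>2_def)
  have rc: "\<rho> \<le> \<rho> / c" using c c1 \<rho>0 by (simp add: le_divide_eq)
  have e2: "\<epsilon> + 2 * b * (\<rho> / c) \<le> \<epsilon>2"
  proof -
   have "\<epsilon> + 2 * b * (\<rho> / c) \<le> \<rho> / c + 2 * b * (\<rho> / c)" using rc \<epsilon> by linarith
   thus ?thesis by (simp add: \<epsilon>2_def algebra_simps add_divide_distrib)
  qed
  have rc2: "\<rho> / c \<le> 1/2"
  proof -
   have "1 * (\<rho> / c) \<le> (1 + 2 * b) * (\<rho> / c)" using b_ge_1 c \<rho>0 by (intro mult_right_mono) auto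
   thus ?thesis using \<rho> w_min_le_1 by simp
  qed
  have ew: "\<epsilon> \<le> w_min / 2"
  proof -
   have "\<rho> \<le> \<epsilon>2" using rc e2 \<epsilon> b_ge_1 c \<rho>0 mult_right_mono[of 1 "2 * b" "\<rho> / c"] by auto
   thus ?thesis using \<epsilon>(2) \<rho> unfolding \<epsilon>2_def by linarith
  qed
  define Bad where "Bad = {p::'a sticks. w_min / 4 \<le> rem_mass (fst p) n}"
  have [measurable]: "Bad \<in> sets prior" unfolding Bad_def by (rule sets_prior_Collect) measurable
  have Bad: "emeasure prior Bad \<le> ennreal (tail_bound n)"
   unfolding Bad_def tail_bound_def using w_min_pos by (intro prob_rem_mass_ge) auto
  obtain E1 where E1 [measurable]: "E1 \<in> sets prior" and E1s: "heavy_event n c \<epsilon> \<rho> \<subseteq> E1"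
   and E1b: "emeasure prior E1 \<le> ennreal (real n ^ K / c ^ K) * emeasure prior (front_event c \<epsilon> \<rho>)"
   using heavy_event_cover[OF c(1)] by blast
  obtain E2 where E2 [measurable]: "E2 \<in> sets prior" and E2s: "heavy_event n c \<epsilon>2 0 \<subseteq> E2"
   and E2b: "emeasure prior E2 \<le> ennreal (real n ^ K / c ^ K) * emeasure prior (front_event c \<epsilon>2 0)"
   using heavy_event_cover[OF c(1)] by blast
  define N where "N = {p. proper (fst p) \<and> near \<epsilon>2 (fst p) (snd p)}"
  have [measurable]: "N \<in> sets prior" unfolding N_def by (rule sets_prior_Collect) measurable
  define Del where "Del j = {p. fst p j \<le> \<rho> / c \<and> (fst p \<circ> skip j, snd p \<circ> skip j) \<in> N}" for j
  have [measurable]: "(\<lambda>v. v \<circ> skip j) \<in> measurable sticks_law sticks_law" "(\<lambda>v. v \<circ> skip j) \<in> measurable atoms_law atoms_law" for j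
   using measurable_shift_sticks[of "skip j"] measurable_shift_atoms[of "skip j"] by (simp_all add: comp_def)
  have [measurable]: "Del j \<in> sets prior" for j unfolding Del_def by (rule sets_prior_Collect) measurable
  have Nsub: "N \<subseteq> Bad \<union> E2"
  proof
   fix p assume p: "p \<in> N"
   show "p \<in> Bad \<union> E2"
   proof (cases "p \<in> Bad")
    case False
    then obtain Is where Is: "length Is = K" "distinct Is" "set Is \<subseteq> {..<n}"
     "\<And>k. k < K \<Longrightarrow> c \<le> stick_weights (fst p) (Is ! k)" "\<And>k. k < K \<Longrightarrow> snd p (Is ! k) \<in> V k"
     using heavy_exists[of "fst p" \<epsilon>2 "snd p" n c] p n c \<rho> by (auto simp: N_def Bad_def \<epsilon>2_def)
    hence "p \<in> heavy_event n c \<epsilon>2 0"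
     using p sum_stick_weights_le_1[of "fst p" "set Is"] by (auto simp: heavy_event_def N_def)
    thus ?thesis using E2s by blast
   qed simp
  qed
  \<comment> \<open>Here nothing is known about the leftover mass, so the bound is used with
    threshold 0 and without gain, \<open>\<zeta> = 1\<close>.\<close>
  have Nb: "emeasure prior N \<le> ennreal (tail_bound n + real n ^ K / c ^ K * (D * c powr (- m) * \<epsilon>2 powr prior_exponent))"
  proof -
   have "emeasure prior N \<le> emeasure prior (Bad \<union> E2)" using Nsub by (rule emeasure_mono) measurable
   also have "\<dots> \<le> emeasure prior Bad + emeasure prior E2" by (rule emeasure_subadditive) measurable
   also have "\<dots> \<le> ennreal (tail_bound n) + ennreal (real n ^ K / c ^ K) * ennreal (D * c powr (- m) * \<epsilon>2 powr prior_exponent * 1)"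
   proof (intro add_mono Bad order_trans[OF E2b] mult_left_mono fb c c1 \<epsilon>2)
    show "(real l + 1) powr (-1/8) \<le> 1" for l
    proof -
     have "(real l + 1) powr (-1/8) \<le> (real l + 1) powr 0" by (intro powr_mono) auto
     thus ?thesis by simp
    qed
   qed auto
   also have "\<dots> = ennreal (tail_bound n + real n ^ K / c ^ K * (D * c powr (- m) * \<epsilon>2 powr prior_exponent))"
    using tail_bound_nonneg[of n] c D by (simp add: ennreal_mult'[symmetric] ennreal_plus[symmetric] del: ennreal_plus)
   finally show ?thesis .
  qed
  define W where "W = {p. proper (fst p) \<and> near \<epsilon> (fst p) (snd p) \<and> \<rho> < rem_mass (fst p) K}"
  have sub: "W \<subseteq> Bad \<union> E1 \<union> (\<Union>j<K. Del j)"
  proof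
   fix p assume p: "p \<in> W"
   show "p \<in> Bad \<union> E1 \<union> (\<Union>j<K. Del j)"
   proof (cases "p \<in> Bad")
    case False
    then obtain Is where Is: "length Is = K" "distinct Is" "set Is \<subseteq> {..<n}"
     "\<And>k. k < K \<Longrightarrow> c \<le> stick_weights (fst p) (Is ! k)" "\<And>k. k < K \<Longrightarrow> snd p (Is ! k) \<in> V k"
     using heavy_exists[of "fst p" \<epsilon> "snd p" n c] p n c ew by (auto simp: W_def Bad_def)
    show ?thesis
    proof (cases "\<rho> < 1 - (\<Sum>i\<in>set Is. stick_weights (fst p) i)")
     case True
     hence "p \<in> heavy_event n c \<epsilon> \<rho>" using p Is by (auto simp: heavy_event_def W_def)
     thus ?thesis using E1s by blast
    next
     case T: False
     have "c \<le> stick_weights (fst p) i" if "i \<in> set Is" for i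
      using that Is(1,4) by (auto simp: in_set_conv_nth)
     from light_atom_before_heavy[OF _ Is(1,2) this c(1), of \<rho>] T p
     obtain j where j: "j < K" "fst p j \<le> \<rho> / c" by (auto simp: W_def)
     have "near (\<epsilon> + 2 * b * (\<rho> / c)) (fst p \<circ> skip j) (snd p \<circ> skip j)"
      using p j by (intro near_delete) (auto simp: W_def)
     hence "near \<epsilon>2 (fst p \<circ> skip j) (snd p \<circ> skip j)"
      using e2 unfolding near_def by (meson order_trans)
     moreover have "proper (fst p \<circ> skip j)" using p by (auto simp: W_def proper_def)
     ultimately have "p \<in> Del j" using j by (simp add: Del_def N_def)
     thus ?thesis using j by blast
    qed
   qed simp
  qed
  have "emeasure prior W \<le> emeasure prior (Bad \<union> E1 \<union> (\<Union>j<K. Del j))"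
   using sub by (rule emeasure_mono) measurable
  also have "\<dots> \<le> emeasure prior Bad + emeasure prior E1 + (\<Sum>j<K. emeasure prior (Del j))"
  proof -
   have "emeasure prior (\<Union>j<K. Del j) \<le> (\<Sum>j<K. emeasure prior (Del j))"
    by (rule emeasure_subadditive_finite) auto
   moreover have "emeasure prior (Bad \<union> E1 \<union> (\<Union>j<K. Del j)) \<le> emeasure prior (Bad \<union> E1) + emeasure prior (\<Union>j<K. Del j)"
    by (rule emeasure_subadditive) measurable
   moreover have "emeasure prior (Bad \<union> E1) \<le> emeasure prior Bad + emeasure prior E1"
    by (rule emeasure_subadditive) measurable
   ultimately show ?thesis by (meson add_mono order_trans)
  qed
  also have "\<dots> \<le> ennreal (tail_bound n) + ennreal (real n ^ K / c ^ K) * ennreal (D * c powr (- m) * \<epsilon> powr prior_exponent * \<zeta>) +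
    (\<Sum>j<K. ennreal (2 * \<alpha> * (\<rho> / c)) * ennreal (tail_bound n + real n ^ K / c ^ K * (D * c powr (- m) * \<epsilon>2 powr prior_exponent)))"
  proof (intro add_mono Bad order_trans[OF E1b] mult_left_mono fb c c1 \<epsilon> \<zeta> gain sum_mono)
   fix j
   have "emeasure prior (Del j) = emeasure \<beta> {v. v \<le> \<rho> / c} * emeasure prior N"
    unfolding Del_def by (rule nn_integral_delete) measurable
   also have "\<dots> \<le> ennreal (2 * \<alpha> * (\<rho> / c)) * ennreal (tail_bound n + real n ^ K / c ^ K * (D * c powr (- m) * \<epsilon>2 powr prior_exponent))"
    using rc2 \<rho>0 c by (intro mult_mono Nb emeasure_beta_le) auto
   finally show "emeasure prior (Del j) \<le> ennreal (2 * \<alpha> * (\<rho> / c)) * ennreal (tail_bound n + real n ^ K / c ^ K * (D * c powr (- m) * \<epsilon>2 powr prior_exponent))" .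
  qed auto
  also have "\<dots> = ennreal (tail_bound n + real n ^ K / c ^ K * (D * c powr (- m) * \<epsilon> powr prior_exponent * \<zeta>) +
     real K * (2 * \<alpha> * (\<rho> / c)) * (tail_bound n + real n ^ K / c ^ K * (D * c powr (- m) * \<epsilon>2 powr prior_exponent)))"
   using tail_bound_nonneg[of n] c D \<zeta> \<alpha>_pos \<rho>0
   by (simp add: ennreal_mult'[symmetric] ennreal_plus[symmetric] ennreal_of_nat_eq_real_of_nat mult.assoc del: ennreal_plus)
  finally show "emeasure prior {p. proper (fst p) \<and> near \<epsilon> (fst p) (snd p) \<and> \<rho> < rem_mass (fst p) K} \<le>
    ennreal (tail_bound n + real n ^ K / c ^ K * (D * c powr (- m) * \<epsilon> powr prior_exponent * \<zeta>) +
     real K * (2 * \<alpha> * (\<rho> / c)) *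
      (tail_bound n + real n ^ K / c ^ K * (D * c powr (- m) * ((1 + 2 * b) * \<rho> / c) powr prior_exponent)))"
   by (simp only: W_def \<epsilon>2_def)
 qed
qed

text \<open>Away from the event of the previous lemma the first \<open>K\<close> sticks are matched one-to-one with the
 neighbourhoods \<open>V k\<close>.\<close>

lemma near_matching:
 assumes p: "proper v" and nr: "near \<epsilon> v \<theta>" and \<epsilon>: "\<epsilon> \<le> \<rho>" and R: "rem_mass v K \<le> \<rho>"
  and \<rho>: "(2 * b + 2) * \<rho> < w_min / 2"
 obtains \<sigma> where "\<sigma> permutes {..<K}"
  "\<And>k. k < K \<Longrightarrow> norm (\<theta>s k - \<theta> (\<sigma> k)) \<le> real DIM('a) * (2 * (b + 1) / w_min) * \<rho>"
  "\<And>k. k < K \<Longrightarrow> \<bar>ws k - stick_weights v (\<sigma> k)\<bar> \<le> 2 * \<rho>"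
proof -
 have R0: "0 < rem_mass v K" using p by (rule rem_mass_pos)
 have \<rho>0: "0 < \<rho>" using R R0 by linarith
 have pt: "proper (\<lambda>i. v (i + K))" using p by (auto simp: proper_def)
 define tl where "tl \<phi> = sp_mean \<phi> (\<lambda>i. v (i + K)) (\<lambda>i. \<theta> (i + K))" for \<phi>
 have spl: "sp_mean \<phi> v \<theta> = (\<Sum>i<K. stick_weights v i * \<phi> (\<theta> i)) + rem_mass v K * tl \<phi>" if "\<And>x. \<bar>\<phi> x\<bar> \<le> b" for \<phi>
  unfolding tl_def using p that by (rule sp_mean_split)
 have tlb: "\<bar>rem_mass v K * tl \<phi>\<bar> \<le> \<rho> * b'" if "\<And>x. \<bar>\<phi> x\<bar> \<le> b'" for \<phi> b'
 proof -
  have "\<bar>tl \<phi>\<bar> \<le> b'" unfolding tl_def by (rule abs_sp_mean_le[OF pt that])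
  thus ?thesis using R R0 by (auto simp: abs_mult intro!: mult_mono)
 qed
 have ind: "\<bar>(\<Sum>i<K. stick_weights v i * indicator (V k) (\<theta> i)) - ws k\<bar> \<le> 2 * \<rho>" if k: "k < K" for k
 proof -
  have "\<bar>rem_mass v K * tl (indicator (V k))\<bar> \<le> \<rho> * 1" by (rule tlb) (auto split: split_indicator)
  moreover have "\<bar>sp_mean (indicator (V k)) v \<theta> - ws k\<bar> \<le> \<epsilon>" using nr k unfolding near_def by blast
  ultimately show ?thesis using spl[of "indicator (V k)", OF abs_indicator_le] \<epsilon> by linarith
 qed
 \<comment> \<open>Up to \<open>2 * \<rho>\<close> the first \<open>K\<close> atoms alone carry the
   mass of every \<open>V k\<close>, so each \<open>V k\<close> is hit; \<open>K\<close> atoms and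
   \<open>K\<close> disjoint sets leave only a bijection.\<close>
 have "\<exists>i<K. \<theta> i \<in> V k" if k: "k < K" for k
 proof (rule ccontr)
  assume "\<not> ?thesis"
  hence "(\<Sum>i<K. stick_weights v i * indicator (V k) (\<theta> i)) = 0" by (intro sum.neutral) auto
  hence "ws k \<le> 2 * \<rho>" using ind[OF k] by simp
  moreover have "2 * \<rho> \<le> (2 * b + 2) * \<rho>" using b_ge_1 \<rho>0 by (intro mult_right_mono) auto
  ultimately show False using \<rho> w_min_le[OF k] w_min_pos by linarith
 qed
 then obtain i where i: "\<And>k. k < K \<Longrightarrow> i k < K" "\<And>k. k < K \<Longrightarrow> \<theta> (i k) \<in> V k" by metis
 have inj: "inj_on i {..<K}"
 proof (rule inj_onI)
  fix k l assume kl: "k \<in> {..<K}" "l \<in> {..<K}" "i k = i l"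
  hence "\<theta> (i k) \<in> V k" "\<theta> (i k) \<in> V l" using i(2)[of k] i(2)[of l] by auto
  thus "k = l" using V_disj[of k l] kl by auto
 qed
 have bij: "i ` {..<K} = {..<K}" using i inj by (intro endo_inj_surj) auto
 define \<sigma> where "\<sigma> k = (if k < K then i k else k)" for k
 have perm: "\<sigma> permutes {..<K}"
 proof (rule bij_imp_permutes)
  have "bij_betw i {..<K} {..<K}" using inj bij by (simp add: bij_betw_def)
  thus "bij_betw \<sigma> {..<K} {..<K}" by (subst bij_betw_cong[of _ _ i]) (auto simp: \<sigma>_def)
 qed (simp add: \<sigma>_def)
 have only: "\<theta> l \<in> V k \<longleftrightarrow> l = i k" if "k < K" "l < K" for k l
 proof
  assume "\<theta> l \<in> V k"
  from that bij obtain k' where k': "k' < K" "l = i k'" by (metis imageE lessThan_iff)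
  hence "k' = k" using i(2)[of k'] \<open>\<theta> l \<in> V k\<close> V_disj[of k' k] that by auto
  thus "l = i k" using k' by simp
 qed (use that i in auto)
 have sumi: "(\<Sum>l<K. stick_weights v l * (indicator (V k) (\<theta> l) * g l)) = stick_weights v (i k) * g (i k)" if k: "k < K" for k g
 proof -
  have "(\<Sum>l<K. stick_weights v l * (indicator (V k) (\<theta> l) * g l)) = (\<Sum>l<K. if l = i k then stick_weights v (i k) * g (i k) else 0)"
   using only[OF k] by (intro sum.cong) (auto split: split_indicator)
  thus ?thesis using i(1)[OF k] by simp
 qed
 have w: "\<bar>ws k - stick_weights v (i k)\<bar> \<le> 2 * \<rho>" if k: "k < K" for k
  using ind[OF k] sumi[OF k, of "\<lambda>_. 1"] by (simp add: abs_minus_commute)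
 have th: "norm (\<theta>s k - \<theta> (i k)) \<le> real DIM('a) * (2 * (b + 1) / w_min) * \<rho>" if k: "k < K" for k
 proof -
  have wk: "w_min / 2 \<le> stick_weights v (i k)"
  proof -
   have "2 * \<rho> \<le> (2 * b + 2) * \<rho>" using b_ge_1 \<rho>0 by (intro mult_right_mono) auto
   thus ?thesis using w[OF k] \<rho> w_min_le[OF k] by linarith
  qed
  \<comment> \<open>Among the first \<open>K\<close> atoms only \<open>i k\<close> contributes to
    this offset, and the tail contributes at most \<open>\<rho> * b\<close>; division by the weight
    of the atom gives its position.\<close>
  have comp: "\<bar>(\<theta>s k - \<theta> (i k)) \<bullet> j\<bar> \<le> 2 * (b + 1) / w_min * \<rho>" if j: "j \<in> Basis" for j
  proof -
   have "\<bar>rem_mass v K * tl (offset k j)\<bar> \<le> \<rho> * b" by (rule tlb) (rule abs_offset_le[OF k j])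
   moreover have "\<bar>sp_mean (offset k j) v \<theta>\<bar> \<le> \<epsilon>" using nr k j unfolding near_def by blast
   moreover have "(\<Sum>l<K. stick_weights v l * offset k j (\<theta> l)) = stick_weights v (i k) * ((\<theta> (i k) - \<theta>s k) \<bullet> j)"
    using sumi[OF k, of "\<lambda>l. (\<theta> l - \<theta>s k) \<bullet> j"] by (simp add: offset_def)
   ultimately have "\<bar>stick_weights v (i k) * ((\<theta> (i k) - \<theta>s k) \<bullet> j)\<bar> \<le> \<rho> * b + \<rho>"
    using spl[of "offset k j", OF abs_offset_le[OF k j]] \<epsilon> by linarith
   hence "stick_weights v (i k) * \<bar>(\<theta> (i k) - \<theta>s k) \<bullet> j\<bar> \<le> \<rho> * (b + 1)"
    using stick_weights_pos[OF p, of "i k"] unfolding abs_mult distrib_left by simp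
   moreover have "w_min / 2 * \<bar>(\<theta> (i k) - \<theta>s k) \<bullet> j\<bar> \<le> stick_weights v (i k) * \<bar>(\<theta> (i k) - \<theta>s k) \<bullet> j\<bar>"
    using wk by (intro mult_right_mono) auto
   ultimately have "w_min / 2 * \<bar>(\<theta> (i k) - \<theta>s k) \<bullet> j\<bar> \<le> \<rho> * (b + 1)" by linarith
   hence "\<bar>(\<theta> (i k) - \<theta>s k) \<bullet> j\<bar> \<le> 2 * (b + 1) / w_min * \<rho>"
    using w_min_pos by (simp add: field_simps)
   thus ?thesis by (simp add: inner_diff_left abs_minus_commute)
  qed
  have "norm (\<theta>s k - \<theta> (i k)) \<le> (\<Sum>j\<in>Basis. \<bar>(\<theta>s k - \<theta> (i k)) \<bullet> j\<bar>)" by (rule norm_le_l1)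
  also have "\<dots> \<le> (\<Sum>j\<in>(Basis::'a set). 2 * (b + 1) / w_min * \<rho>)" using comp by (rule sum_mono)
  finally show ?thesis by simp
 qed
 show thesis by (rule that[OF perm]) (use w th in \<open>auto simp: \<sigma>_def\<close>)
qed

end

section \<open>Lower bound for the prior mass around the true mixing measure\<close>

context true_mixture_prior
begin

text \<open>The weights get the tolerance \<open>real K * \<epsilon>\<close>, because errors of size
  \<open>\<epsilon>\<close> in up to \<open>K\<close> sticks accumulate in them.\<close>

definition good_nbhd :: "real \<Rightarrow> 'a sticks set" where
 "good_nbhd \<epsilon> = {p. proper (fst p) \<and> (\<forall>k<K. \<bar>stick_weights (fst p) k - ws k\<bar> \<le> real K * \<epsilon>) \<and>
   rem_mass (fst p) K \<le> \<epsilon> \<and> (\<forall>k<K. dist (\<theta>s k) (snd p k) \<le> \<epsilon>)}"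

lemma sets_good_nbhd [measurable]: "good_nbhd \<epsilon> \<in> sets prior"
 unfolding good_nbhd_def by (rule sets_prior_Collect) measurable

text \<open>Inverts stick-breaking for the finite vector \<open>ws\<close>; the last of its
  \<open>K\<close> sticks is 1.\<close>

definition true_stick :: "nat \<Rightarrow> real" where
 "true_stick k = ws k / (1 - (\<Sum>j<k. ws j))"

lemma partial_ws_sum: "k < K \<Longrightarrow> 0 < 1 - (\<Sum>j<k. ws j)" "Suc k < K \<Longrightarrow> ws k < 1 - (\<Sum>j<k. ws j)"
proof -
 have s: "(\<Sum>j<K. ws j) = (\<Sum>j<k. ws j) + (\<Sum>j\<in>{k..<K}. ws j)" if "k < K" for k
  using that sum.atLeastLessThan_concat[of 0 k K ws] by (simp add: atLeast0LessThan)
 have pos: "0 < (\<Sum>j\<in>{k..<K}. ws j)" if "k < K" for k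
  using that ws_pos by (intro sum_pos) auto
 show 1: "0 < 1 - (\<Sum>j<k. ws j)" if "k < K" for k using s[OF that] pos[OF that] ws_sum by linarith
 show "ws k < 1 - (\<Sum>j<k. ws j)" if "Suc k < K" using 1[OF that] by simp
qed

lemma rem_mass_true_stick: "k \<le> K \<Longrightarrow> rem_mass true_stick k = 1 - (\<Sum>j<k. ws j)"
proof (induction k)
 case (Suc k)
 define d where "d = 1 - (\<Sum>j<k. ws j)"
 have "0 < d" using Suc partial_ws_sum(1)[of k] by (simp add: d_def)
 moreover have "rem_mass true_stick (Suc k) = d * (1 - ws k / d)"
  using Suc by (simp add: rem_mass_Suc true_stick_def[of k] d_def)
 ultimately have "rem_mass true_stick (Suc k) = d - ws k" by (simp add: right_diff_distrib)
 thus ?case by (simp add: d_def)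
qed simp

lemma stick_weights_true_stick: "k < K \<Longrightarrow> stick_weights true_stick k = ws k"
 using rem_mass_true_stick[of k] partial_ws_sum(1)[of k] by (simp add: stick_weights_eq true_stick_def)

lemma true_stick_bounds: "k < K \<Longrightarrow> 0 < true_stick k" "Suc k < K \<Longrightarrow> true_stick k < 1" "true_stick (K - 1) = 1"
proof -
 show "0 < true_stick k" if "k < K" using that partial_ws_sum(1)[OF that] ws_pos[OF that] by (simp add: true_stick_def)
 show "true_stick k < 1" if "Suc k < K" using partial_ws_sum(2)[OF that] partial_ws_sum(1)[of k] that by (simp add: true_stick_def)
 have "(\<Sum>j<K. ws j) = (\<Sum>j<K - 1. ws j) + ws (K - 1)" using K_pos by (cases K) auto
 thus "true_stick (K - 1) = 1" using partial_ws_sum(1)[of "K - 1"] K_pos ws_sum by (simp add: true_stick_def)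
qed

lemma good_nbhd_superset:
 assumes "proper v" "\<And>k. k < K \<Longrightarrow> \<bar>v k - true_stick k\<bar> \<le> \<epsilon>" "\<And>k. k < K \<Longrightarrow> \<theta> k \<in> cball (\<theta>s k) \<epsilon>"
 shows "(v, \<theta>) \<in> good_nbhd \<epsilon>"
proof -
 have \<epsilon>: "0 \<le> \<epsilon>" using assms(2)[OF K_pos] by linarith
 have v01: "0 < v j" "v j < 1" for j using assms(1) by (auto simp: proper_def)
 have t01: "0 \<le> true_stick j \<and> true_stick j \<le> 1" if "j < K" for j
 proof (cases "Suc j < K")
  case True thus ?thesis using true_stick_bounds(1,2)[of j] that by auto
 next
  case False hence "j = K - 1" using that by simp
  thus ?thesis using true_stick_bounds(3) by simp
 qed
 have rem: "\<bar>rem_mass v k - rem_mass true_stick k\<bar> \<le> real k * \<epsilon>" if "k \<le> K" for k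
 proof -
  have "norm (rem_mass v k - rem_mass true_stick k) \<le> (\<Sum>j<k. norm ((1 - v j) - (1 - true_stick j)))"
   unfolding rem_mass_def using v01 t01 that by (intro norm_prod_diff) (auto simp: abs_le_iff less_imp_le intro: order_trans[OF less_imp_le])
  also have "\<dots> \<le> (\<Sum>j<k. \<epsilon>)"
   using assms(2) that by (intro sum_mono) (auto simp: abs_minus_commute)
  finally show ?thesis by simp
 qed
 have "\<bar>stick_weights v k - ws k\<bar> \<le> real K * \<epsilon>" if k: "k < K" for k
 proof -
  have "stick_weights v k - ws k = (v k - true_stick k) * rem_mass v k + true_stick k * (rem_mass v k - rem_mass true_stick k)"
   using stick_weights_true_stick[OF k] by (simp add: stick_weights_eq algebra_simps)
  hence "\<bar>stick_weights v k - ws k\<bar> \<le> \<bar>v k - true_stick k\<bar> * \<bar>rem_mass v k\<bar> + \<bar>true_stick k\<bar> * \<bar>rem_mass v k - rem_mass true_stick k\<bar>"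
   by (simp add: abs_mult[symmetric])
  also have "\<dots> \<le> \<epsilon> * 1 + 1 * (real k * \<epsilon>)"
   using assms(2)[OF k] rem[of k] t01[OF k] k rem_mass_pos[OF assms(1), of k] rem_mass_le_1[OF assms(1), of k] \<epsilon>
   by (intro add_mono mult_mono) auto
  also have "\<dots> = real (Suc k) * \<epsilon>" by (simp add: algebra_simps)
  also have "\<dots> \<le> real K * \<epsilon>" using k \<epsilon> by (intro mult_right_mono) auto
  finally show ?thesis .
 qed
 moreover have "rem_mass v K \<le> \<epsilon>"
 proof -
  have "rem_mass v K = rem_mass v (K - 1) * (1 - v (K - 1))"
   using K_pos by (cases K) (auto simp: rem_mass_Suc)
  also have "\<dots> \<le> 1 * \<epsilon>"
   using assms(2)[of "K - 1"] K_pos true_stick_bounds(3) rem_mass_le_1[OF assms(1)] rem_mass_pos[OF assms(1), of "K - 1"] v01[of "K - 1"]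
   by (intro mult_mono) auto
  finally show ?thesis by simp
 qed
 ultimately show ?thesis using assms(1,3) by (simp add: good_nbhd_def)
qed

text \<open>A product event of sticks and atoms inside the neighbourhood. Its factors are an
  interval of length \<open>\<epsilon>\<close> for each of \<open>K - 1\<close> sticks, an upper end
  interval of mass \<open>\<epsilon> powr \<alpha>\<close> for the last one, and a ball for each
  atom; together they give \<open>prior_exponent\<close>.\<close>

lemma good_nbhd_lower:
 assumes ball: "\<And>k. k < K \<Longrightarrow> \<exists>c>0. \<exists>\<rho>0>0. \<forall>\<rho>. 0 < \<rho> \<and> \<rho> \<le> \<rho>0 \<longrightarrow> ennreal (c * \<rho> ^ DIM('a)) \<le> emeasure P0 (cball (\<theta>s k) \<rho>)"
 obtains c \<epsilon>0 where "c > 0" "\<epsilon>0 > 0"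
  "\<And>\<epsilon>. 0 < \<epsilon> \<Longrightarrow> \<epsilon> \<le> \<epsilon>0 \<Longrightarrow> ennreal (c * \<epsilon> powr prior_exponent) \<le> emeasure prior (good_nbhd \<epsilon>)"
proof -
 obtain cb \<rho>b where cb: "\<And>k. k < K \<Longrightarrow> cb k > 0" "\<And>k. k < K \<Longrightarrow> \<rho>b k > 0"
  "\<And>k \<rho>. k < K \<Longrightarrow> 0 < \<rho> \<Longrightarrow> \<rho> \<le> \<rho>b k \<Longrightarrow> ennreal (cb k * \<rho> ^ DIM('a)) \<le> emeasure P0 (cball (\<theta>s k) \<rho>)"
  using ball by metis
 \<comment> \<open>Half the gap between a true stick and 1. While \<open>\<epsilon>\<close> is below
   it, the interval above the true stick stays away from 1, where the density may vanish.\<close>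
 define g where "g k = (1 - true_stick k) / 2" for k
 have g: "Suc k < K \<Longrightarrow> 0 < g k" for k using true_stick_bounds(2) by (simp add: g_def)
 define \<epsilon>0 where "\<epsilon>0 = Min (insert 1 (\<rho>b ` {..<K} \<union> g ` {..<K - 1}))"
 have \<epsilon>0: "\<epsilon>0 > 0" "\<epsilon>0 \<le> 1" "\<And>k. k < K \<Longrightarrow> \<epsilon>0 \<le> \<rho>b k" "\<And>k. Suc k < K \<Longrightarrow> \<epsilon>0 \<le> g k"
 proof -
  show "\<epsilon>0 > 0" unfolding \<epsilon>0_def using cb(2) g by (subst Min_gr_iff) (auto simp: less_diff_conv)
  show "\<epsilon>0 \<le> 1" "\<And>k. k < K \<Longrightarrow> \<epsilon>0 \<le> \<rho>b k" "\<And>k. Suc k < K \<Longrightarrow> \<epsilon>0 \<le> g k"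
   unfolding \<epsilon>0_def by (intro Min_le; simp add: less_diff_conv)+
 qed
 define cg where "cg k = (if k = K - 1 then 1 else \<alpha> * min 1 (g k powr (\<alpha> - 1)))" for k
 have cg: "cg k > 0" if "k < K" for k
 proof (cases "k = K - 1")
  case False
  hence "0 < g k" using that by (intro g) simp
  hence "0 < g k powr (\<alpha> - 1)" by simp
  thus ?thesis using False \<alpha>_pos by (simp add: cg_def min_def)
 qed (simp add: cg_def)
 define c where "c = (\<Prod>k<K. cg k) * (\<Prod>k<K. cb k)"
 have c: "c > 0" unfolding c_def using cg cb(1) by (intro mult_pos_pos prod_pos) auto
 show thesis
 proof (rule that[OF c \<epsilon>0(1)])
  fix \<epsilon> :: real assume \<epsilon>: "0 < \<epsilon>" "\<epsilon> \<le> \<epsilon>0"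
  define I where "I k = (if k = K - 1 then {v. 1 - v \<le> \<epsilon>} else {true_stick k..true_stick k + \<epsilon>})" for k
  have [measurable]: "I k \<in> sets borel" for k unfolding I_def by auto
  define e where "e k = (if k = K - 1 then \<epsilon> powr \<alpha> else cg k * \<epsilon>)" for k
  have Ib: "ennreal (e k) \<le> emeasure \<beta> (I k)" if k: "k < K" for k
  proof (cases "k = K - 1")
   case True
   thus ?thesis using \<epsilon> \<epsilon>0(2) emeasure_beta_upper[of \<epsilon>] by (simp add: I_def e_def)
  next
   case False
   hence k1: "Suc k < K" using k by simp
   have "ennreal (\<alpha> * min 1 (g k powr (\<alpha> - 1)) * ((true_stick k + \<epsilon>) - true_stick k)) \<le> emeasure \<beta> {true_stick k..true_stick k + \<epsilon>}"
    using true_stick_bounds(1)[OF k] \<epsilon> \<epsilon>0(4)[OF k1] g[OF k1]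
    by (intro emeasure_beta_interval_ge) (auto simp: g_def field_simps)
   thus ?thesis using False by (simp add: I_def e_def cg_def)
  qed
  have e0: "0 \<le> e k" if "k < K" for k using cg[OF that] \<epsilon> by (simp add: e_def)
  define SV where "SV = {v. \<forall>k<K. v k \<in> I k}"
  define ST where "ST = {\<theta>::nat \<Rightarrow> 'a. \<forall>k<K. \<theta> k \<in> cball (\<theta>s k) \<epsilon>}"
  have SVm [measurable]: "SV \<in> sets sticks_law"
  proof -
   have "Measurable.pred sticks_law (\<lambda>v. \<forall>k<K. v k \<in> I k)" by measurable
   thus ?thesis by (simp add: pred_def SV_def)
  qed
  have STm [measurable]: "ST \<in> sets atoms_law"
  proof -
   have "Measurable.pred atoms_law (\<lambda>v. \<forall>k<K. dist (\<theta>s k) (v k) \<le> \<epsilon>)" by measurable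
   thus ?thesis by (simp add: pred_def ST_def)
  qed
  have ex: "(\<Prod>k<K. e k) = (\<Prod>k<K. cg k) * \<epsilon> ^ (K - 1) * \<epsilon> powr \<alpha>"
  proof -
   obtain K' where K': "K = Suc K'" using K_pos by (cases K) auto
   have "(\<Prod>k<K'. e k) = (\<Prod>k<K'. cg k * \<epsilon>)" by (intro prod.cong) (auto simp: e_def K')
   thus ?thesis by (simp add: K' e_def cg_def prod.distrib)
  qed
  have "ennreal (c * \<epsilon> powr prior_exponent) = ennreal ((\<Prod>k<K. e k) * (\<Prod>k<K. cb k * \<epsilon> ^ DIM('a)))"
  proof -
   have "\<epsilon> powr prior_exponent = \<epsilon> ^ (K - 1) * \<epsilon> powr \<alpha> * \<epsilon> ^ (K * DIM('a))"
    using \<epsilon> K_pos by (simp add: prior_exponent_def powr_add powr_diff powr_realpow[symmetric] of_nat_diff)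
   moreover have "(\<Prod>k<K. cb k * \<epsilon> ^ DIM('a)) = (\<Prod>k<K. cb k) * \<epsilon> ^ (K * DIM('a))"
    by (simp add: prod.distrib power_mult[symmetric] mult.commute)
   ultimately show ?thesis unfolding ex c_def by (simp only: mult_ac)
  qed
  also have "\<dots> = (\<Prod>k<K. ennreal (e k)) * (\<Prod>k<K. ennreal (cb k * \<epsilon> ^ DIM('a)))"
  proof -
   have "(\<Prod>k<K. ennreal (e k)) = ennreal (\<Prod>k<K. e k)" by (rule prod_ennreal) (use e0 in simp)
   moreover have "(\<Prod>k<K. ennreal (cb k * \<epsilon> ^ DIM('a))) = ennreal (\<Prod>k<K. cb k * \<epsilon> ^ DIM('a))"
    by (rule prod_ennreal) (use cb(1) \<epsilon> in \<open>auto intro!: mult_nonneg_nonneg less_imp_le\<close>)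
   moreover have "0 \<le> (\<Prod>k<K. e k)" by (rule prod_nonneg) (use e0 in simp)
   ultimately show ?thesis by (simp only: ennreal_mult')
  qed
  also have "\<dots> \<le> (\<Prod>k<K. emeasure \<beta> (I k)) * (\<Prod>k<K. emeasure P0 (cball (\<theta>s k) \<epsilon>))"
  proof (intro mult_mono prod_mono_ennreal)
   show "ennreal (cb k * \<epsilon> ^ DIM('a)) \<le> emeasure P0 (cball (\<theta>s k) \<epsilon>)" if "k \<in> {..<K}" for k
    using that \<epsilon> \<epsilon>0(3)[of k] by (intro cb(3)) auto
  qed (use Ib in auto)
  also have "\<dots> = emeasure sticks_law SV * emeasure atoms_law ST"
   using emeasure_sticks_Collect[of K I] emeasure_atoms_Collect[of K "\<lambda>k. cball (\<theta>s k) \<epsilon>"]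
   by (simp add: SV_def ST_def)
  also have "\<dots> = emeasure prior (SV \<times> ST)"
   unfolding prior_def by (rule AL.emeasure_pair_measure_Times[symmetric]) measurable
  also have "\<dots> \<le> emeasure prior (good_nbhd \<epsilon>)"
  proof (rule emeasure_mono_AE)
   show "AE p in prior. p \<in> SV \<times> ST \<longrightarrow> p \<in> good_nbhd \<epsilon>"
    using AE_proper
   proof eventually_elim
    case (elim p)
    show ?case
    proof
     assume p: "p \<in> SV \<times> ST"
     have "\<bar>fst p k - true_stick k\<bar> \<le> \<epsilon>" if k: "k < K" for k
     proof (cases "k = K - 1")
      case True
      have "fst p k < 1" using elim by (simp add: proper_def)
      thus ?thesis using p k True true_stick_bounds(3) by (auto simp: SV_def I_def)
     next
      case False
      hence "fst p k \<in> {true_stick k..true_stick k + \<epsilon>}" using p k by (auto simp: SV_def I_def)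
      thus ?thesis by auto
     qed
     hence "(fst p, snd p) \<in> good_nbhd \<epsilon>"
      using elim p by (intro good_nbhd_superset) (auto simp: ST_def)
     thus "p \<in> good_nbhd \<epsilon>" by simp
    qed
   qed
  qed measurable
  finally show "ennreal (c * \<epsilon> powr prior_exponent) \<le> emeasure prior (good_nbhd \<epsilon>)" .
 qed
qed

end

section \<open>Trigonometric test functions\<close>

text \<open>The real span of cosines and sines of frequency at most \<open>t\<close>. The frequency
  is tracked because products raise it, while deconvolution is possible only where the
  characteristic function of \<open>f\<close> does not vanish.\<close>

inductive trig_poly :: "real \<Rightarrow> ('a::euclidean_space \<Rightarrow> real) \<Rightarrow> bool" for t where
 trig_cos: "norm u \<le> t \<Longrightarrow> trig_poly t (\<lambda>x. cos (u \<bullet> x))"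
| trig_sin: "norm u \<le> t \<Longrightarrow> trig_poly t (\<lambda>x. sin (u \<bullet> x))"
| trig_add: "trig_poly t g \<Longrightarrow> trig_poly t h \<Longrightarrow> trig_poly t (\<lambda>x. g x + h x)"
| trig_scale: "trig_poly t g \<Longrightarrow> trig_poly t (\<lambda>x. c * g x)"

lemma trig_poly_mono: "trig_poly s g \<Longrightarrow> s \<le> t \<Longrightarrow> trig_poly t g"
 by (induction rule: trig_poly.induct) (auto intro: trig_poly.intros)

lemma trig_poly_const: "0 \<le> t \<Longrightarrow> trig_poly t (\<lambda>x::'a::euclidean_space. c)"
 using trig_scale[OF trig_cos[of "0::'a" t], of c] by simp

lemma trig_poly_diff: "trig_poly t g \<Longrightarrow> trig_poly t h \<Longrightarrow> trig_poly t (\<lambda>x. g x - h x)"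
 using trig_add[of t g "\<lambda>x. (-1) * h x"] trig_scale[of t h "-1"] by simp

lemma trig_poly_sum: "0 \<le> t \<Longrightarrow> (\<And>i. i \<in> I \<Longrightarrow> trig_poly t (g i)) \<Longrightarrow> trig_poly t (\<lambda>x. \<Sum>i\<in>I. g i x)"
 by (induction I rule: infinite_finite_induct) (auto intro: trig_poly_const trig_add)

text \<open>Product-to-sum formulas: frequencies \<open>u\<close> and \<open>v\<close> turn into
  \<open>u - v\<close> and \<open>u + v\<close>.\<close>

lemma trig_poly_mult:
 assumes "trig_poly s g" "trig_poly t h"
 shows "trig_poly (s + t) (\<lambda>x. g x * h x)"
 using assms(1)
proof (induction rule: trig_poly.induct)
 case (trig_cos u)
 show ?case using assms(2)
 proof (induction rule: trig_poly.induct)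
  case (trig_cos v)
  have "norm (u - v) \<le> s + t" "norm (u + v) \<le> s + t"
   using \<open>norm u \<le> s\<close> trig_cos norm_triangle_ineq4[of u v] norm_triangle_ineq[of u v] by linarith+
  hence "trig_poly (s + t) (\<lambda>x. (1/2) * (cos ((u - v) \<bullet> x) + cos ((u + v) \<bullet> x)))"
   by (intro trig_poly.intros)
  thus ?case by (simp add: cos_times_cos inner_diff_left inner_add_left)
 next
  case (trig_sin v)
  have "norm (u - v) \<le> s + t" "norm (u + v) \<le> s + t"
   using \<open>norm u \<le> s\<close> trig_sin norm_triangle_ineq4[of u v] norm_triangle_ineq[of u v] by linarith+
  hence "trig_poly (s + t) (\<lambda>x. (1/2) * (sin ((u + v) \<bullet> x) - sin ((u - v) \<bullet> x)))"
   by (intro trig_scale trig_poly_diff trig_poly.trig_sin)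
  thus ?case by (simp add: cos_times_sin inner_diff_left inner_add_left)
 next
  case (trig_add g h)
  thus ?case using trig_poly.trig_add[of "s + t" "\<lambda>x. cos (u \<bullet> x) * g x" "\<lambda>x. cos (u \<bullet> x) * h x"]
   by (simp add: distrib_left)
 next
  case (trig_scale g c)
  thus ?case using trig_poly.trig_scale[of "s + t" "\<lambda>x. cos (u \<bullet> x) * g x" c]
   by (simp add: mult_ac)
 qed
next
 case (trig_sin u)
 show ?case using assms(2)
 proof (induction rule: trig_poly.induct)
  case (trig_cos v)
  have "norm (u - v) \<le> s + t" "norm (u + v) \<le> s + t"
   using \<open>norm u \<le> s\<close> trig_cos norm_triangle_ineq4[of u v] norm_triangle_ineq[of u v] by linarith+
  hence "trig_poly (s + t) (\<lambda>x. (1/2) * (sin ((u + v) \<bullet> x) + sin ((u - v) \<bullet> x)))"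
   by (intro trig_poly.intros)
  thus ?case by (simp add: sin_times_cos inner_diff_left inner_add_left)
 next
  case (trig_sin v)
  have "norm (u - v) \<le> s + t" "norm (u + v) \<le> s + t"
   using \<open>norm u \<le> s\<close> trig_sin norm_triangle_ineq4[of u v] norm_triangle_ineq[of u v] by linarith+
  hence "trig_poly (s + t) (\<lambda>x. (1/2) * (cos ((u - v) \<bullet> x) - cos ((u + v) \<bullet> x)))"
   by (intro trig_scale trig_poly_diff trig_poly.trig_cos)
  thus ?case by (simp add: sin_times_sin inner_diff_left inner_add_left)
 next
  case (trig_add g h)
  thus ?case using trig_poly.trig_add[of "s + t" "\<lambda>x. sin (u \<bullet> x) * g x" "\<lambda>x. sin (u \<bullet> x) * h x"]
   by (simp add: distrib_left)
 next
  case (trig_scale g c)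
  thus ?case using trig_poly.trig_scale[of "s + t" "\<lambda>x. sin (u \<bullet> x) * g x" c]
   by (simp add: mult_ac)
 qed
next
 case (trig_add g1 g2)
 thus ?case using trig_poly.trig_add[of "s + t" "\<lambda>x. g1 x * h x" "\<lambda>x. g2 x * h x"]
  by (simp add: distrib_right)
next
 case (trig_scale g c)
 thus ?case using trig_poly.trig_scale[of "s + t" "\<lambda>x. g x * h x" c]
  by (simp add: mult_ac)
qed

lemma trig_poly_prod:
 assumes "finite I" "0 \<le> t" "\<And>i. i \<in> I \<Longrightarrow> trig_poly t (g i)"
 shows "trig_poly (real (card I) * t) (\<lambda>x. \<Prod>i\<in>I. g i x)"
 using assms
proof (induction I rule: finite_induct)
 case (insert i I)
 hence "trig_poly (t + real (card I) * t) (\<lambda>x. g i x * (\<Prod>i\<in>I. g i x))"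
  by (intro trig_poly_mult) auto
 thus ?case using insert by (simp add: algebra_simps)
qed (auto intro: trig_poly_const)

lemma trig_poly_cos_shift:
 assumes "norm u \<le> t" shows "trig_poly t (\<lambda>x. cos (u \<bullet> (x - y)))"
proof -
 have "trig_poly t (\<lambda>x. cos (u \<bullet> y) * cos (u \<bullet> x) + sin (u \<bullet> y) * sin (u \<bullet> x))"
  using assms by (intro trig_poly.intros)
 thus ?thesis by (simp add: inner_diff_right cos_diff mult.commute)
qed

lemma trig_poly_sin_shift:
 assumes "norm u \<le> t" shows "trig_poly t (\<lambda>x. sin (u \<bullet> (x - y)))"
proof -
 have "trig_poly t (\<lambda>x. cos (u \<bullet> y) * sin (u \<bullet> x) - sin (u \<bullet> y) * cos (u \<bullet> x))"
  using assms by (intro trig_poly_diff trig_poly.intros)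
 thus ?thesis by (simp add: inner_diff_right sin_diff mult.commute)
qed

lemma trig_poly_continuous: "trig_poly t g \<Longrightarrow> continuous_on UNIV g"
 by (induction rule: trig_poly.induct) (auto intro!: continuous_intros)

section \<open>Test functions that are convolution images of bounded functions\<close>

definition test_dual :: "('a::euclidean_space \<Rightarrow> real) \<Rightarrow> ('a \<Rightarrow> real) \<Rightarrow> bool" where
 "test_dual f q \<longleftrightarrow> (\<exists>g B. g \<in> borel_measurable borel \<and> (\<forall>x. \<bar>g x\<bar> \<le> B) \<and> (\<forall>\<theta>. q \<theta> = (\<integral>x. g x * f (x - \<theta>) \<partial>lborel)))"

lemma integrable_lborel_shift:
 fixes f :: "'a::euclidean_space \<Rightarrow> real"
 assumes "integrable lborel f" shows "integrable lborel (\<lambda>x. f (x - \<theta>))"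
proof -
 have "integrable (distr lborel borel ((+) (- \<theta>))) f" using assms by (simp add: lborel_distr_plus)
 hence "integrable lborel (\<lambda>x. f (- \<theta> + x))" by (subst (asm) integrable_distr_eq) (use assms in auto)
 thus ?thesis by simp
qed

lemma integral_lborel_shift:
 fixes f :: "'a::euclidean_space \<Rightarrow> real"
 assumes [measurable]: "f \<in> borel_measurable borel" shows "(\<integral>x. f (\<theta> + x) \<partial>lborel) = (\<integral>x. f x \<partial>lborel)"
proof -
 have "(\<integral>x. f x \<partial>lborel) = (\<integral>x. f x \<partial>distr lborel borel ((+) \<theta>))" by (simp add: lborel_distr_plus)
 also have "\<dots> = (\<integral>x. f (\<theta> + x) \<partial>lborel)" by (rule integral_distr) auto
 finally show ?thesis by simp
qed

lemma cos_le_quartic: "cos x \<le> 1 - x\<^sup>2 / 2 + x ^ 4 / (24::real)"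
proof -
 obtain t where "cos x = (\<Sum>m<4. cos_coeff m * x ^ m) + (cos (t + 1/2 * real 4 * pi) / fact 4) * x ^ 4"
  using Maclaurin_cos_expansion[of x 4] by blast
 moreover have "(\<Sum>m<4. cos_coeff m * x ^ m) = 1 - x\<^sup>2 / 2"
  by (simp add: eval_nat_numeral cos_coeff_Suc sin_coeff_Suc)
 moreover have "(cos (t + 1/2 * real 4 * pi) / fact 4) * x ^ 4 \<le> (1 / 24) * x ^ 4"
  by (intro mult_right_mono) (auto simp: fact_numeral)
 ultimately show ?thesis by simp
qed

lemma one_minus_cos_bounds:
 fixes x :: real
 shows "1 - cos x \<le> x\<^sup>2 / 2" "\<bar>x\<bar> \<le> 1 \<Longrightarrow> x\<^sup>2 / 4 \<le> 1 - cos x"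
proof -
 obtain t where t: "cos x = (\<Sum>m<2. cos_coeff m * x ^ m) + (cos (t + 1/2 * real 2 * pi) / fact 2) * x ^ 2"
  using Maclaurin_cos_expansion[of x 2] by blast
 have "(-1 / 2) * x\<^sup>2 \<le> (cos (t + 1/2 * real 2 * pi) / fact 2) * x\<^sup>2"
  by (intro mult_right_mono) (auto simp: fact_numeral)
 moreover have "(\<Sum>m<2. cos_coeff m * x ^ m) = 1" by (simp add: eval_nat_numeral cos_coeff_def)
 ultimately show "1 - cos x \<le> x\<^sup>2 / 2" using t by simp
 assume "\<bar>x\<bar> \<le> 1"
 hence "x\<^sup>2 \<le> 1" by (simp add: abs_square_le_1)
 hence "x\<^sup>2 * x\<^sup>2 \<le> x\<^sup>2 * 1" by (intro mult_left_mono) auto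
 hence "x ^ 4 \<le> x\<^sup>2" by (simp add: power2_eq_square power4_eq_xxxx mult.assoc)
 thus "x\<^sup>2 / 4 \<le> 1 - cos x" using cos_le_quartic[of x] zero_le_power2[of x] by linarith
qed

lemma abs_sin_minus_id_le: "\<bar>sin x - x\<bar> \<le> x\<^sup>2 / (2::real)"
proof -
 obtain t where t: "sin x = (\<Sum>m<2. sin_coeff m * x ^ m) + (sin (t + 1/2 * real 2 * pi) / fact 2) * x ^ 2"
  using Maclaurin_sin_expansion[of x 2] by blast
 moreover have "(\<Sum>m<2. sin_coeff m * x ^ m) = x" by (simp add: eval_nat_numeral sin_coeff_def)
 ultimately have "\<bar>sin x - x\<bar> = \<bar>sin (t + 1/2 * real 2 * pi)\<bar> / 2 * x\<^sup>2" by (simp add: abs_mult fact_numeral)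
 also have "\<dots> \<le> 1 / 2 * x\<^sup>2" by (intro mult_right_mono) auto
 finally show ?thesis by simp
qed

lemma abs_cos_diff_le: "\<bar>cos x - cos y\<bar> \<le> \<bar>x - y :: real\<bar>"
proof -
 have "\<bar>cos x - cos y\<bar> = 2 * (\<bar>sin ((x + y) / 2)\<bar> * \<bar>sin ((y - x) / 2)\<bar>)"
  by (simp add: cos_diff_cos abs_mult)
 also have "\<dots> \<le> 2 * (1 * \<bar>(y - x) / 2\<bar>)"
  by (intro mult_left_mono mult_mono abs_sin_x_le_abs_x) auto
 finally show ?thesis by simp
qed

locale prob_density =
 fixes f :: "'a::euclidean_space \<Rightarrow> real"
 assumes f_nonneg: "\<And>x. 0 \<le> f x" and f_int [simp]: "integrable lborel f" and f_1: "(\<integral>x. f x \<partial>lborel) = 1"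
begin

lemma f_meas [measurable]: "f \<in> borel_measurable borel"
 using borel_measurable_integrable[OF f_int] by simp

lemma integrable_bounded_mult:
 assumes [measurable]: "g \<in> borel_measurable borel" and "\<And>x. \<bar>g x\<bar> \<le> B" and "integrable lborel h"
 shows "integrable lborel (\<lambda>x. g x * h x :: real)"
proof (rule Bochner_Integration.integrable_bound)
 show "integrable lborel (\<lambda>x. B * h x)" using assms(3) by simp
 have "B \<ge> 0" using assms(2)[of undefined] by simp
 thus "AE x in lborel. norm (g x * h x) \<le> norm (B * h x)"
  using assms(2) by (auto simp: abs_mult intro!: mult_right_mono)
qed (use assms(3) in auto)

lemma test_dual_add: "test_dual f q \<Longrightarrow> test_dual f q' \<Longrightarrow> test_dual f (\<lambda>\<theta>. q \<theta> + q' \<theta>)"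
proof -
 assume "test_dual f q" "test_dual f q'"
 then obtain g B g' B' where g: "g \<in> borel_measurable borel" "\<And>x. \<bar>g x\<bar> \<le> B" "\<And>\<theta>. q \<theta> = (\<integral>x. g x * f (x - \<theta>) \<partial>lborel)"
  and g': "g' \<in> borel_measurable borel" "\<And>x. \<bar>g' x\<bar> \<le> B'" "\<And>\<theta>. q' \<theta> = (\<integral>x. g' x * f (x - \<theta>) \<partial>lborel)"
  unfolding test_dual_def by blast
 show ?thesis unfolding test_dual_def
 proof (intro exI[of _ "\<lambda>x. g x + g' x"] exI[of _ "B + B'"] conjI allI)
  show "(\<lambda>x. g x + g' x) \<in> borel_measurable borel" using g(1) g'(1) by measurable
  show "\<bar>g x + g' x\<bar> \<le> B + B'" for x using g(2)[of x] g'(2)[of x] by linarith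
  show "q \<theta> + q' \<theta> = (\<integral>x. (g x + g' x) * f (x - \<theta>) \<partial>lborel)" for \<theta>
   unfolding distrib_right g(3) g'(3)
   by (rule Bochner_Integration.integral_add[symmetric])
     (intro integrable_bounded_mult[OF g(1,2)] integrable_bounded_mult[OF g'(1,2)] integrable_lborel_shift f_int)+
 qed
qed

lemma test_dual_scale: "test_dual f q \<Longrightarrow> test_dual f (\<lambda>\<theta>. c * q \<theta>)"
proof -
 assume "test_dual f q"
 then obtain g B where g: "g \<in> borel_measurable borel" "\<And>x. \<bar>g x\<bar> \<le> B" "\<And>\<theta>. q \<theta> = (\<integral>x. g x * f (x - \<theta>) \<partial>lborel)"
  unfolding test_dual_def by blast
 show ?thesis unfolding test_dual_def
 proof (intro exI[of _ "\<lambda>x. c * g x"] exI[of _ "\<bar>c\<bar> * B"] conjI allI)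
  show "(\<lambda>x. c * g x) \<in> borel_measurable borel" using g(1) by measurable
  show "\<bar>c * g x\<bar> \<le> \<bar>c\<bar> * B" for x using g(2)[of x] by (simp add: abs_mult mult_left_mono)
  show "c * q \<theta> = (\<integral>x. c * g x * f (x - \<theta>) \<partial>lborel)" for \<theta>
   by (simp add: g(3) mult.assoc)
 qed
qed

text \<open>Convolution with \<open>f\<close> acts on the span of \<open>cos (u \<bullet> x)\<close> and \<open>sin (u \<bullet> x)\<close> as multiplication by
 the characteristic function, which does not vanish for small frequencies \<open>u\<close>.\<close>

lemma char_fun_near_0:
 obtains t where "t > 0" "\<And>u. norm u \<le> t \<Longrightarrow> 0 < (\<integral>y. cos (u \<bullet> y) * f y \<partial>lborel)"
proof (rule ccontr)
 assume "\<not> thesis"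
 hence "\<exists>u. norm u \<le> 1 / real (Suc n) \<and> \<not> 0 < (\<integral>y. cos (u \<bullet> y) * f y \<partial>lborel)" for n
  using that[of "1 / real (Suc n)"] by auto
 then obtain u where u: "\<And>n. norm (u n) \<le> 1 / real (Suc n)" "\<And>n. \<not> 0 < (\<integral>y. cos (u n \<bullet> y) * f y \<partial>lborel)"
  by metis
 have "u \<longlonglongrightarrow> 0"
 proof (rule tendsto_norm_zero_cancel, rule tendsto_sandwich[of "\<lambda>_. 0"])
  show "(\<lambda>n. 1 / real (Suc n)) \<longlonglongrightarrow> 0" using LIMSEQ_inverse_real_of_nat by (simp add: inverse_eq_divide)
 qed (use u(1) in auto)
 have "(\<lambda>n. \<integral>y. cos (u n \<bullet> y) * f y \<partial>lborel) \<longlonglongrightarrow> (\<integral>y. f y \<partial>lborel)"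
 proof (rule integral_dominated_convergence[where w = f])
  show "AE y in lborel. (\<lambda>n. cos (u n \<bullet> y) * f y) \<longlonglongrightarrow> f y"
  proof (rule AE_I2)
   fix y
   have "(\<lambda>n. cos (u n \<bullet> y) * f y) \<longlonglongrightarrow> cos (0 \<bullet> y) * f y"
    using \<open>u \<longlonglongrightarrow> 0\<close> by (intro tendsto_intros)
   thus "(\<lambda>n. cos (u n \<bullet> y) * f y) \<longlonglongrightarrow> f y" by simp
  qed
  show "AE y in lborel. norm (cos (u n \<bullet> y) * f y) \<le> f y" for n
  proof (rule AE_I2)
   fix y
   have "\<bar>cos (u n \<bullet> y)\<bar> * f y \<le> 1 * f y" using f_nonneg by (intro mult_right_mono) auto
   thus "norm (cos (u n \<bullet> y) * f y) \<le> f y" using f_nonneg by (simp add: abs_mult)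
  qed
 qed auto
 hence "(\<integral>y. f y \<partial>lborel) \<le> 0"
  using u(2) by (intro LIMSEQ_le_const2) (auto simp: not_less)
 thus False by (simp add: f_1)
qed

text \<open>On the plane spanned by the cosine and the sine of one frequency, convolution is a
  rotation combined with a scaling, invertible as soon as the characteristic function is nonzero
  there.\<close>

lemma trig_poly_test_dual:
 obtains t where "t > 0" "\<And>h. trig_poly t h \<Longrightarrow> test_dual f h"
proof -
 obtain t where t: "t > 0" "\<And>u. norm u \<le> t \<Longrightarrow> 0 < (\<integral>y. cos (u \<bullet> y) * f y \<partial>lborel)"
  by (rule char_fun_near_0) blast
 have base: "test_dual f (\<lambda>\<theta>. cos (u \<bullet> \<theta>)) \<and> test_dual f (\<lambda>\<theta>. sin (u \<bullet> \<theta>))" if u: "norm u \<le> t" for u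
 proof -
  define a where "a = (\<integral>y. cos (u \<bullet> y) * f y \<partial>lborel)"
  define b where "b = (\<integral>y. sin (u \<bullet> y) * f y \<partial>lborel)"
  have a: "0 < a" unfolding a_def by (rule t(2)[OF u])
  have ic: "integrable lborel (\<lambda>y. cos (u \<bullet> y) * f y)" "integrable lborel (\<lambda>y. sin (u \<bullet> y) * f y)"
   by (rule integrable_bounded_mult[where B = 1]; auto)+
  have c: "(\<integral>x. cos (u \<bullet> x) * f (x - \<theta>) \<partial>lborel) = cos (u \<bullet> \<theta>) * a - sin (u \<bullet> \<theta>) * b" for \<theta>
  proof -
   have "(\<integral>x. cos (u \<bullet> x) * f (x - \<theta>) \<partial>lborel) = (\<integral>x. cos (u \<bullet> (\<theta> + x)) * f (\<theta> + x - \<theta>) \<partial>lborel)"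
    by (rule integral_lborel_shift[symmetric]) measurable
   also have "\<dots> = (\<integral>x. cos (u \<bullet> \<theta>) * (cos (u \<bullet> x) * f x) - sin (u \<bullet> \<theta>) * (sin (u \<bullet> x) * f x) \<partial>lborel)"
    by (simp add: inner_add_right cos_add algebra_simps)
   finally show ?thesis using ic by (simp add: a_def b_def)
  qed
  have s: "(\<integral>x. sin (u \<bullet> x) * f (x - \<theta>) \<partial>lborel) = sin (u \<bullet> \<theta>) * a + cos (u \<bullet> \<theta>) * b" for \<theta>
  proof -
   have "(\<integral>x. sin (u \<bullet> x) * f (x - \<theta>) \<partial>lborel) = (\<integral>x. sin (u \<bullet> (\<theta> + x)) * f (\<theta> + x - \<theta>) \<partial>lborel)"
    by (rule integral_lborel_shift[symmetric]) measurable
   also have "\<dots> = (\<integral>x. sin (u \<bullet> \<theta>) * (cos (u \<bullet> x) * f x) + cos (u \<bullet> \<theta>) * (sin (u \<bullet> x) * f x) \<partial>lborel)"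
    by (simp add: inner_add_right sin_add algebra_simps)
   finally show ?thesis using ic by (simp add: a_def b_def)
  qed
  have qc: "test_dual f (\<lambda>\<theta>. cos (u \<bullet> \<theta>) * a - sin (u \<bullet> \<theta>) * b)"
   unfolding test_dual_def by (intro exI[of _ "\<lambda>x. cos (u \<bullet> x)"] exI[of _ 1]) (simp add: c)
  have qs: "test_dual f (\<lambda>\<theta>. sin (u \<bullet> \<theta>) * a + cos (u \<bullet> \<theta>) * b)"
   unfolding test_dual_def by (intro exI[of _ "\<lambda>x. sin (u \<bullet> x)"] exI[of _ 1]) (simp add: s)
  \<comment> \<open>The determinant of the 2 by 2 system; the coefficients below are the entries of
    the inverse matrix.\<close>
  define n where "n = a\<^sup>2 + b\<^sup>2"
  have n: "n > 0" using a by (simp add: n_def add_pos_nonneg)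
  have "a / n * (cos (u \<bullet> \<theta>) * a - sin (u \<bullet> \<theta>) * b) + b / n * (sin (u \<bullet> \<theta>) * a + cos (u \<bullet> \<theta>) * b) =
    (a\<^sup>2 + b\<^sup>2) / n * cos (u \<bullet> \<theta>)" for \<theta>
   by (simp add: power2_eq_square add_divide_distrib diff_divide_distrib algebra_simps)
  hence 1: "(\<lambda>\<theta>. a / n * (cos (u \<bullet> \<theta>) * a - sin (u \<bullet> \<theta>) * b) + b / n * (sin (u \<bullet> \<theta>) * a + cos (u \<bullet> \<theta>) * b)) = (\<lambda>\<theta>. cos (u \<bullet> \<theta>))"
   using n by (simp add: n_def[symmetric])
  have "(- b) / n * (cos (u \<bullet> \<theta>) * a - sin (u \<bullet> \<theta>) * b) + a / n * (sin (u \<bullet> \<theta>) * a + cos (u \<bullet> \<theta>) * b) =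
    (a\<^sup>2 + b\<^sup>2) / n * sin (u \<bullet> \<theta>)" for \<theta>
   by (simp add: power2_eq_square add_divide_distrib diff_divide_distrib algebra_simps)
  hence 2: "(\<lambda>\<theta>. (- b) / n * (cos (u \<bullet> \<theta>) * a - sin (u \<bullet> \<theta>) * b) + a / n * (sin (u \<bullet> \<theta>) * a + cos (u \<bullet> \<theta>) * b)) = (\<lambda>\<theta>. sin (u \<bullet> \<theta>))"
   using n by (simp add: n_def[symmetric])
  show ?thesis
   using test_dual_add[OF test_dual_scale[OF qc, of "a / n"] test_dual_scale[OF qs, of "b / n"]]
    test_dual_add[OF test_dual_scale[OF qc, of "(- b) / n"] test_dual_scale[OF qs, of "a / n"]]
   unfolding 1 2 by blast
 qed
 have "test_dual f h" if "trig_poly t h" for h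
  using that
 proof (induction rule: trig_poly.induct)
  case (trig_add g h)
  thus ?case using test_dual_add by blast
 next
  case (trig_scale g c)
  thus ?case using test_dual_scale by blast
 qed (use base in auto)
 thus thesis using t(1) that by blast
qed

text \<open>The function \<open>q\<close> is comparable to the squared distance to the true atoms, and \<open>a k\<close>, \<open>h k j\<close>
 replace the indicator of the ball around the \<open>k\<close>-th true atom and the \<open>j\<close>-th coordinate of the offset
 there up to an error \<open>O(q)\<close>.\<close>

lemma test_functions:
 fixes \<Theta> :: "'a set" and \<theta>s :: "nat \<Rightarrow> 'a" and K :: nat
 assumes K: "0 < K" and bdd: "bounded \<Theta>" and inj: "inj_on \<theta>s {..<K}" and in\<Theta>: "\<And>k. k < K \<Longrightarrow> \<theta>s k \<in> \<Theta>"
 obtains q a h r C b where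
  "0 < r" "r \<le> 1" "0 \<le> C" "\<And>k l. k < K \<Longrightarrow> l < K \<Longrightarrow> k \<noteq> l \<Longrightarrow> ball (\<theta>s k) r \<inter> ball (\<theta>s l) r = {}"
  "continuous_on UNIV q" "\<And>x. 0 \<le> q x" "\<And>x. q x \<le> b"
  "test_dual f q" "\<And>k. k < K \<Longrightarrow> test_dual f (a k)" "\<And>k j. k < K \<Longrightarrow> j \<in> Basis \<Longrightarrow> test_dual f (h k j)"
  "\<And>k. k < K \<Longrightarrow> q (\<theta>s k) = 0" "\<And>k l. k < K \<Longrightarrow> l < K \<Longrightarrow> a k (\<theta>s l) = (if l = k then 1 else 0)"
  "\<And>k l j. k < K \<Longrightarrow> l < K \<Longrightarrow> j \<in> Basis \<Longrightarrow> h k j (\<theta>s l) = 0"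
  "\<And>k x. k < K \<Longrightarrow> x \<in> \<Theta> \<Longrightarrow> \<bar>indicator (ball (\<theta>s k) r) x - a k x\<bar> \<le> C * q x"
  "\<And>k j x. k < K \<Longrightarrow> j \<in> Basis \<Longrightarrow> x \<in> \<Theta> \<Longrightarrow> \<bar>indicator (ball (\<theta>s k) r) x * ((x - \<theta>s k) \<bullet> j) - h k j x\<bar> \<le> C * q x"
  "\<And>x. x \<in> \<Theta> \<Longrightarrow> \<exists>k<K. (dist x (\<theta>s k))\<^sup>2 \<le> C * q x"
proof -
 obtain t where t: "t > 0" "\<And>h. trig_poly t h \<Longrightarrow> test_dual f h" by (rule trig_poly_test_dual) blast
 obtain L0 where L0: "\<And>x. x \<in> \<Theta> \<Longrightarrow> norm x \<le> L0" using bdd unfolding bounded_iff by blast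
 define L where "L = 2 * \<bar>L0\<bar> + 1"
 have L: "L \<ge> 1" "\<And>x y. x \<in> \<Theta> \<Longrightarrow> y \<in> \<Theta> \<Longrightarrow> norm (x - y) \<le> L"
 proof -
  show "L \<ge> 1" by (simp add: L_def)
  fix x y assume "x \<in> \<Theta>" "y \<in> \<Theta>"
  hence "norm x \<le> L0" "norm y \<le> L0" using L0 by auto
  thus "norm (x - y) \<le> L" using norm_triangle_ineq4[of x y] by (simp add: L_def)
 qed
 \<comment> \<open>The bound \<open>1 / L\<close> keeps all arguments within 1, where
   \<open>one_minus_cos_bounds\<close> holds; the other one keeps the frequency of
   \<open>a k\<close>, which reaches \<open>2 * real (K - 1) * s\<close>, within the budget
   \<open>t\<close>.\<close>
 define s where "s = min (1 / L) (t / (2 * real K))"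
 have s: "s > 0" "s * L \<le> 1" "2 * real K * s \<le> t"
 proof -
  show "s > 0" using L(1) t(1) K by (simp add: s_def)
  have "s \<le> 1 / L" by (simp add: s_def)
  thus "s * L \<le> 1" using L(1) by (simp add: pos_le_divide_eq)
  have "s \<le> t / (2 * real K)" by (simp add: s_def)
  thus "2 * real K * s \<le> t" using K by (simp add: pos_le_divide_eq mult_ac)
 qed
 define r where "r = Min (insert 1 ((\<lambda>(k, l). dist (\<theta>s k) (\<theta>s l) / 4) ` {(k, l). k < K \<and> l < K \<and> k \<noteq> l}))"
 have fin: "finite {(k, l). k < K \<and> l < K \<and> k \<noteq> (l::nat)}"
  by (rule finite_subset[of _ "{..<K} \<times> {..<K}"]) auto
 have r: "0 < r" "r \<le> 1" "\<And>k l. k < K \<Longrightarrow> l < K \<Longrightarrow> k \<noteq> l \<Longrightarrow> 4 * r \<le> dist (\<theta>s k) (\<theta>s l)"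
 proof -
  show "0 < r" unfolding r_def using fin inj by (subst Min_gr_iff) (auto simp: inj_on_def)
  show "r \<le> 1" unfolding r_def using fin by (intro Min_le) auto
  fix k l assume "k < K" "l < K" "k \<noteq> l"
  hence "r \<le> dist (\<theta>s k) (\<theta>s l) / 4" unfolding r_def using fin by (intro Min_le) auto
  thus "4 * r \<le> dist (\<theta>s k) (\<theta>s l)" by simp
 qed
 \<comment> \<open>A trigonometric substitute for the squared distance to the \<open>k\<close>-th
   true atom: zero at the atom, and on \<open>\<Theta>\<close> bounded below by a multiple of the
   squared distance.\<close>
 define d where "d k x = (\<Sum>j\<in>Basis. 1 - cos ((s *\<^sub>R j) \<bullet> (x - \<theta>s k)))" for k x
 define m where "m k x = (\<Prod>l\<in>{..<K} - {k}. d l x)" for k x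
 define q where "q x = (\<Prod>l<K. d l x)" for x
 define Dm where "Dm = 2 * real DIM('a)"
 define \<kappa> where "\<kappa> = s\<^sup>2 / 4 * r\<^sup>2"
 define N where "N = 1 / \<kappa> ^ (K - 1)"
 define G where "G = Dm ^ (K - 1) * N"
 define H where "H = N * Dm ^ (K - 1) * real K * real DIM('a) * s"
 define mt where "mt k x = m k x / m k (\<theta>s k)" for k x
 \<comment> \<open>Chosen so that \<open>1 - a k x\<close> is the square of
   \<open>1 - mt k x\<close>. Near the atom \<open>mt k\<close> is 1 only up to first order, and
   squaring makes the error quadratic, as comparison with \<open>q\<close> requires.\<close>
 define a where "a k x = mt k x * (2 - mt k x)" for k x
 \<comment> \<open>The rescaled sine is the coordinate up to second order. The first-order error of
   \<open>mt k\<close> is harmless here, since it is multiplied by the coordinate itself.\<close>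
 define h where "h k j x = 1 / s * sin ((s *\<^sub>R j) \<bullet> (x - \<theta>s k)) * mt k x" for k j x
 have Dm: "Dm \<ge> 2" by (simp add: Dm_def)
 have kap: "0 < \<kappa>" using s r by (simp add: \<kappa>_def)
 have N0: "0 < N" using kap by (simp add: N_def)
 have G0: "0 \<le> G" and H0: "0 \<le> H" using Dm N0 s by (auto simp: G_def H_def)
 have norm_s: "norm (s *\<^sub>R j) = s" if "j \<in> Basis" for j :: 'a using s(1) that by simp
 have d_trig: "trig_poly s (d k)" for k
  unfolding d_def[abs_def] using s(1)
  by (intro trig_poly_sum trig_poly_diff trig_poly_const trig_poly_cos_shift) (auto simp: norm_s)
 have d_nonneg: "0 \<le> d k x" for k x unfolding d_def by (intro sum_nonneg) simp
 have d_le: "d k x \<le> Dm" for k x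
 proof -
  have c: "- 1 \<le> cos y" for y :: real by simp
  have "d k x \<le> (\<Sum>j\<in>(Basis::'a set). 2)" unfolding d_def
   by (intro sum_mono) (smt (verit) c)
  thus ?thesis by (simp add: Dm_def)
 qed
 have d_self: "d k (\<theta>s k) = 0" for k by (simp add: d_def)
 have norm2: "(\<Sum>j\<in>Basis. (z \<bullet> j)\<^sup>2) = (norm z)\<^sup>2" for z :: 'a
  unfolding power2_norm_eq_inner by (subst euclidean_inner) (simp add: power2_eq_square)
 have d_lower: "s\<^sup>2 / 4 * (norm (x - \<theta>s k))\<^sup>2 \<le> d k x" if "x \<in> \<Theta>" "k < K" for x k
 proof -
  have "s\<^sup>2 / 4 * (norm (x - \<theta>s k))\<^sup>2 = (\<Sum>j\<in>Basis. ((s *\<^sub>R j) \<bullet> (x - \<theta>s k))\<^sup>2 / 4)"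
   unfolding norm2[symmetric] sum_distrib_left
   by (intro sum.cong) (auto simp: power_mult_distrib inner_commute)
  also have "\<dots> \<le> d k x" unfolding d_def
  proof (intro sum_mono one_minus_cos_bounds(2))
   fix j :: 'a assume j: "j \<in> Basis"
   have "\<bar>(s *\<^sub>R j) \<bullet> (x - \<theta>s k)\<bar> \<le> norm (s *\<^sub>R j) * norm (x - \<theta>s k)" by (rule Cauchy_Schwarz_ineq2)
   also have "\<dots> \<le> s * L" unfolding norm_s[OF j] using L(2)[OF that(1) in\<Theta>[OF that(2)]] s(1) by (intro mult_left_mono) auto
   finally show "\<bar>(s *\<^sub>R j) \<bullet> (x - \<theta>s k)\<bar> \<le> 1" using s(2) by linarith
  qed
  finally show ?thesis .
 qed
 have d_far: "\<kappa> \<le> d k x" if "x \<in> \<Theta>" "k < K" "r \<le> dist x (\<theta>s k)" for x k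
 proof -
  have "\<kappa> \<le> s\<^sup>2 / 4 * (norm (x - \<theta>s k))\<^sup>2"
   unfolding \<kappa>_def using that(3) r(1) by (intro mult_left_mono power_mono) (auto simp: dist_norm)
  thus ?thesis using d_lower[OF that(1,2)] by linarith
 qed
 have far: "r \<le> dist x (\<theta>s l)" if "x \<in> ball (\<theta>s k) r" "k < K" "l < K" "l \<noteq> k" for x k l
  using that(1) r(3)[of k l] r(1) that dist_triangle[of "\<theta>s k" "\<theta>s l" x] by (auto simp: dist_commute)
 have card1: "card ({..<K} - {k}) = K - 1" if "k < K" for k using that by simp
 have m_lower: "\<kappa> ^ (K - 1) \<le> m k x" if "x \<in> \<Theta>" "x \<in> ball (\<theta>s k) r" "k < K" for x k
 proof -
  have "(\<Prod>l\<in>{..<K} - {k}. \<kappa>) \<le> m k x" unfolding m_def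
   using that far kap by (intro prod_mono conjI d_far) (auto intro: less_imp_le)
  thus ?thesis using card1[OF that(3)] by simp
 qed
 have mk: "1 / m k (\<theta>s k) \<le> N" "0 < m k (\<theta>s k)" if "k < K" for k
 proof -
  have ml: "\<kappa> ^ (K - 1) \<le> m k (\<theta>s k)" using that r(1) by (intro m_lower in\<Theta>) auto
  thus "0 < m k (\<theta>s k)" using kap by (meson order_less_le_trans zero_less_power)
  show "1 / m k (\<theta>s k) \<le> N" unfolding N_def using ml kap by (intro divide_left_mono) (auto intro: mult_pos_pos less_le_trans[OF zero_less_power[OF kap]])
 qed
 have m_nonneg: "0 \<le> m k x" for k x unfolding m_def by (intro prod_nonneg) (auto simp: d_nonneg)
 have m_le: "m k x \<le> Dm ^ (K - 1)" if "k < K" for k x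
 proof -
  have "m k x \<le> (\<Prod>l\<in>{..<K} - {k}. Dm)" unfolding m_def by (intro prod_mono) (auto simp: d_nonneg d_le)
  thus ?thesis using card1[OF that] by simp
 qed
 have mt_m: "mt k x \<le> N * m k x" "0 \<le> mt k x" if "k < K" for k x
  using mult_right_mono[OF mk(1)[OF that] m_nonneg[of k x]] mk(2)[OF that] m_nonneg[of k x] by (auto simp: mt_def)
 have mt_G: "mt k x \<le> G" if "k < K" for k x
 proof -
  have "N * m k x \<le> N * Dm ^ (K - 1)" using N0 by (intro mult_left_mono m_le that) simp
  thus ?thesis using mt_m(1)[OF that, of x] unfolding G_def by (simp only: mult.commute)
 qed
 have q_eq: "q x = d k x * m k x" if "k < K" for k x
  unfolding q_def m_def using that by (subst prod.remove[of _ k]) auto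
 have q_nonneg: "0 \<le> q x" for x unfolding q_def by (intro prod_nonneg) (auto simp: d_nonneg)
 have q_le: "q x \<le> Dm ^ K" for x
 proof -
  have "q x \<le> (\<Prod>l<K. Dm)" unfolding q_def by (intro prod_mono) (auto simp: d_nonneg d_le)
  thus ?thesis by simp
 qed
 have d_lip: "\<bar>d l x - d l y\<bar> \<le> real DIM('a) * s * norm (x - y)" for l x y
 proof -
  have "\<bar>d l x - d l y\<bar> \<le> (\<Sum>j\<in>(Basis::'a set). \<bar>cos ((s *\<^sub>R j) \<bullet> (y - \<theta>s l)) - cos ((s *\<^sub>R j) \<bullet> (x - \<theta>s l))\<bar>)"
   unfolding d_def sum_subtractf[symmetric] by (rule order_trans[OF sum_abs]) simp
  also have "\<dots> \<le> (\<Sum>j\<in>(Basis::'a set). s * norm (x - y))"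
  proof (intro sum_mono)
   fix j :: 'a assume j: "j \<in> Basis"
   have "\<bar>cos ((s *\<^sub>R j) \<bullet> (y - \<theta>s l)) - cos ((s *\<^sub>R j) \<bullet> (x - \<theta>s l))\<bar> \<le> \<bar>(s *\<^sub>R j) \<bullet> (y - \<theta>s l) - (s *\<^sub>R j) \<bullet> (x - \<theta>s l)\<bar>"
    by (rule abs_cos_diff_le)
   also have "\<dots> = \<bar>(s *\<^sub>R j) \<bullet> (y - x)\<bar>" by (simp only: inner_diff_right)
   also have "\<dots> \<le> norm (s *\<^sub>R j) * norm (y - x)" by (rule Cauchy_Schwarz_ineq2)
   finally show "\<bar>cos ((s *\<^sub>R j) \<bullet> (y - \<theta>s l)) - cos ((s *\<^sub>R j) \<bullet> (x - \<theta>s l))\<bar> \<le> s * norm (x - y)"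
    unfolding norm_s[OF j] by (simp add: norm_minus_commute)
  qed
  finally show ?thesis by simp
 qed
 have mt_lip: "\<bar>1 - mt k x\<bar> \<le> H * norm (x - \<theta>s k)" if k: "k < K" for k x
 proof -
  \<comment> \<open>Factors rescaled into the unit interval, so that a difference of products is at
    most the sum of the differences.\<close>
  define g where "g l y = d l y / Dm" for l y
  have mg: "m k y = Dm ^ (K - 1) * (\<Prod>l\<in>{..<K} - {k}. g l y)" for y
  proof -
   have "(\<Prod>l\<in>{..<K} - {k}. g l y) = m k y / Dm ^ (K - 1)"
    unfolding g_def m_def using card1[OF k] by (simp add: prod_dividef)
   thus ?thesis using Dm by simp
  qed
  have "norm ((\<Prod>l\<in>{..<K} - {k}. g l x) - (\<Prod>l\<in>{..<K} - {k}. g l (\<theta>s k))) \<le> (\<Sum>l\<in>{..<K} - {k}. norm (g l x - g l (\<theta>s k)))"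
   using Dm d_nonneg d_le by (intro norm_prod_diff) (auto simp: g_def divide_le_eq)
  also have "\<dots> \<le> (\<Sum>l\<in>{..<K} - {k}. real DIM('a) * s * norm (x - \<theta>s k))"
  proof (intro sum_mono)
   fix l
   have "norm (g l x - g l (\<theta>s k)) = \<bar>d l x - d l (\<theta>s k)\<bar> / Dm"
    using Dm by (simp add: g_def diff_divide_distrib[symmetric])
   also have "\<dots> \<le> \<bar>d l x - d l (\<theta>s k)\<bar> / 1" using Dm by (intro divide_left_mono) auto
   also have "\<dots> \<le> real DIM('a) * s * norm (x - \<theta>s k)" using d_lip by simp
   finally show "norm (g l x - g l (\<theta>s k)) \<le> real DIM('a) * s * norm (x - \<theta>s k)" .
  qed
  also have "\<dots> = real (K - 1) * (real DIM('a) * s * norm (x - \<theta>s k))" using card1[OF k] by simp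
  also have "\<dots> \<le> real K * (real DIM('a) * s * norm (x - \<theta>s k))" using s(1) by (intro mult_right_mono) auto
  finally have e0: "\<bar>m k x - m k (\<theta>s k)\<bar> \<le> Dm ^ (K - 1) * (real K * (real DIM('a) * s * norm (x - \<theta>s k)))"
   unfolding mg right_diff_distrib[symmetric] abs_mult real_norm_def using Dm by (simp add: mult_left_mono)
  have "1 - mt k x = (m k (\<theta>s k) - m k x) * (1 / m k (\<theta>s k))"
   using mk(2)[OF k] by (simp add: mt_def diff_divide_distrib)
  hence e1: "\<bar>1 - mt k x\<bar> = \<bar>m k x - m k (\<theta>s k)\<bar> * (1 / m k (\<theta>s k))"
   using mk(2)[OF k] by (simp add: abs_mult abs_minus_commute)
  have "\<bar>1 - mt k x\<bar> \<le> (Dm ^ (K - 1) * (real K * (real DIM('a) * s * norm (x - \<theta>s k)))) * N"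
   unfolding e1 by (intro mult_mono e0 mk(1)[OF k]) (use mk(2)[OF k] Dm s(1) in auto)
  thus ?thesis by (simp add: H_def mult_ac)
 qed
 define C1 where "C1 = 4 / s\<^sup>2 * N"
 \<comment> \<open>One nonnegative summand for each case below, so that \<open>C\<close> dominates
   every constant that occurs.\<close>
 define C where "C = H\<^sup>2 * C1 + (s / 2 * G + H) * C1 + N * (2 + G) / \<kappa> + N / (s * \<kappa>) + C1 + L\<^sup>2 / \<kappa> ^ K"
 have C1: "0 \<le> C1" using N0 by (simp add: C1_def)
 have Cs: "0 \<le> H\<^sup>2 * C1" "0 \<le> (s / 2 * G + H) * C1" "0 \<le> N * (2 + G) / \<kappa>" "0 \<le> N / (s * \<kappa>)" "0 \<le> L\<^sup>2 / \<kappa> ^ K"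
  using C1 G0 H0 N0 kap s(1) by auto
 have Cge: "H\<^sup>2 * C1 \<le> C" "(s / 2 * G + H) * C1 \<le> C" "N * (2 + G) / \<kappa> \<le> C" "N / (s * \<kappa>) \<le> C" "C1 \<le> C" "L\<^sup>2 / \<kappa> ^ K \<le> C" "0 \<le> C"
  unfolding C_def using Cs C1 by linarith+
 have up: "y * q x \<le> C * q x" if "y \<le> C" for y x using that q_nonneg by (rule mult_right_mono)
 have near: "(norm (x - \<theta>s k))\<^sup>2 \<le> C1 * q x" if "x \<in> \<Theta>" "x \<in> ball (\<theta>s k) r" "k < K" for x k
 proof -
  have "(norm (x - \<theta>s k))\<^sup>2 = 4 / s\<^sup>2 * (s\<^sup>2 / 4 * (norm (x - \<theta>s k))\<^sup>2)" using s(1) by simp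
  also have "\<dots> \<le> 4 / s\<^sup>2 * d k x" using d_lower[OF that(1,3)] by (intro mult_left_mono) auto
  also have "d k x * 1 \<le> d k x * (N * m k x)"
   using m_lower[OF that] kap by (intro mult_left_mono d_nonneg) (auto simp: N_def)
  hence "4 / s\<^sup>2 * d k x \<le> 4 / s\<^sup>2 * (d k x * (N * m k x))" by (intro mult_left_mono) auto
  also have "\<dots> = C1 * q x" by (simp add: q_eq[OF that(3)] C1_def mult_ac)
  finally show ?thesis .
 qed
 have off: "m k x \<le> q x / \<kappa>" if "x \<in> \<Theta>" "x \<notin> ball (\<theta>s k) r" "k < K" for x k
 proof -
  have "\<kappa> * m k x \<le> d k x * m k x"
   using that by (intro mult_right_mono d_far m_nonneg) (auto simp: dist_commute)
  thus ?thesis using kap by (simp add: q_eq[OF that(3)] pos_le_divide_eq mult.commute)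
 qed
 show thesis
 proof (rule that[of r C q "Dm ^ K" a h])
  show "ball (\<theta>s k) r \<inter> ball (\<theta>s l) r = {}" if "k < K" "l < K" "k \<noteq> l" for k l
   using far[of _ k l] that r(1) by (force simp: dist_commute)
  have qt: "trig_poly (real K * s) q"
   using trig_poly_prod[of "{..<K}" s d] s(1) d_trig by (simp add: q_def[abs_def])
  thus "continuous_on UNIV q" by (rule trig_poly_continuous)
  have "0 \<le> real K * s" using s(1) by simp
  hence "real K * s \<le> t" using s(3) unfolding mult.assoc by linarith
  thus "test_dual f q" using qt by (intro t(2)) (rule trig_poly_mono)
  have mt_t: "trig_poly (real (K - 1) * s) (mt k)" if "k < K" for k
  proof -
   have "trig_poly (real (K - 1) * s) (m k)"
    using trig_poly_prod[of "{..<K} - {k}" s d] s(1) d_trig card1[OF that] by (simp add: m_def[abs_def])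
   from trig_scale[OF this, of "1 / m k (\<theta>s k)"] show ?thesis by (simp add: mt_def[abs_def])
  qed
  show "test_dual f (a k)" if "k < K" for k
  proof (rule t(2), rule trig_poly_mono)
   show "trig_poly (real (K - 1) * s + real (K - 1) * s) (a k)"
    unfolding a_def[abs_def] using mt_t[OF that] s(1) by (intro trig_poly_mult trig_poly_diff trig_poly_const) auto
   have "real (K - 1) * s \<le> real K * s" using s(1) by (intro mult_right_mono) auto
   thus "real (K - 1) * s + real (K - 1) * s \<le> t" using s(3) unfolding mult.assoc by linarith
  qed
  show "test_dual f (h k j)" if "k < K" "j \<in> Basis" for k j
  proof (rule t(2), rule trig_poly_mono)
   show "trig_poly (s + real (K - 1) * s) (h k j)"
    unfolding h_def[abs_def] using mt_t[OF that(1)] that(2) less_imp_le[OF s(1)]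
    by (intro trig_poly_mult trig_scale trig_poly_sin_shift) (auto simp: norm_s)
   have "s + real (K - 1) * s = real K * s" using K by (cases K) (auto simp: algebra_simps)
   thus "s + real (K - 1) * s \<le> t" using s(1,3) \<open>real K * s \<le> t\<close> by simp
  qed
  show q0: "q (\<theta>s k) = 0" if "k < K" for k using that by (simp add: q_eq d_self)
  have ml0: "m k (\<theta>s l) = 0" if "k < K" "l < K" "l \<noteq> k" for k l
   unfolding m_def using that by (intro prod_zero bexI[of _ l]) (auto simp: d_self)
  show "a k (\<theta>s l) = (if l = k then 1 else 0)" if "k < K" "l < K" for k l
   using that ml0[of k l] mk(2)[of k] by (auto simp: a_def mt_def)
  show "h k j (\<theta>s l) = 0" if "k < K" "l < K" "j \<in> Basis" for k l j
   using that ml0[of k l] by (cases "l = k") (auto simp: h_def mt_def)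
  show "\<bar>indicator (ball (\<theta>s k) r) x - a k x\<bar> \<le> C * q x" if k: "k < K" and x: "x \<in> \<Theta>" for k x
  proof (cases "x \<in> ball (\<theta>s k) r")
   case True
   have "1 - a k x = (1 - mt k x)\<^sup>2" by (simp add: a_def power2_eq_square algebra_simps)
   hence "\<bar>1 - a k x\<bar> = \<bar>1 - mt k x\<bar>\<^sup>2" by simp
   also have "\<dots> \<le> (H * norm (x - \<theta>s k))\<^sup>2" using mt_lip[OF k] by (intro power_mono) auto
   also have "\<dots> \<le> H\<^sup>2 * (C1 * q x)" unfolding power_mult_distrib using near[OF x True k] by (intro mult_left_mono) auto
   also have "\<dots> \<le> C * q x" using up[OF Cge(1)] by (simp add: mult.assoc)
   finally show ?thesis using True by simp
  next
   case False
   have "\<bar>a k x\<bar> = mt k x * \<bar>2 - mt k x\<bar>" using mt_m(2)[OF k] by (simp add: a_def abs_mult)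
   also have "\<dots> \<le> (N * (q x / \<kappa>)) * (2 + G)"
   proof (intro mult_mono)
    show "mt k x \<le> N * (q x / \<kappa>)"
     using mt_m(1)[OF k, of x] mult_left_mono[OF off[OF x False k], of N] N0 by linarith
    show "\<bar>2 - mt k x\<bar> \<le> 2 + G" using mt_G[OF k, of x] mt_m(2)[OF k, of x] G0 by linarith
   qed (use N0 q_nonneg kap in auto)
   also have "\<dots> \<le> C * q x" using up[OF Cge(3)] by (simp add: mult_ac)
   finally show ?thesis using False by simp
  qed
  show "\<bar>indicator (ball (\<theta>s k) r) x * ((x - \<theta>s k) \<bullet> j) - h k j x\<bar> \<le> C * q x"
   if k: "k < K" and j: "j \<in> Basis" and x: "x \<in> \<Theta>" for k j x
  proof -
   define z where "z = (x - \<theta>s k) \<bullet> j"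
   have sz: "(s *\<^sub>R j) \<bullet> (x - \<theta>s k) = s * z" by (simp add: z_def inner_commute)
   have zn: "\<bar>z\<bar> \<le> norm (x - \<theta>s k)" unfolding z_def using Basis_le_norm[OF j] by simp
   show ?thesis
   proof (cases "x \<in> ball (\<theta>s k) r")
    case True
    have "z - h k j x = (z - sin (s * z) / s) * mt k x + z * (1 - mt k x)"
     unfolding h_def sz by (simp add: algebra_simps)
    hence "\<bar>z - h k j x\<bar> \<le> \<bar>z - sin (s * z) / s\<bar> * mt k x + \<bar>z\<bar> * \<bar>1 - mt k x\<bar>"
     using abs_triangle_ineq[of "(z - sin (s * z) / s) * mt k x" "z * (1 - mt k x)"] mt_m(2)[OF k, of x]
     by (simp add: abs_mult)
    also have "\<dots> \<le> (s / 2 * (norm (x - \<theta>s k))\<^sup>2) * G + norm (x - \<theta>s k) * (H * norm (x - \<theta>s k))"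
    proof (intro add_mono mult_mono mt_G mt_lip zn k)
     have "\<bar>z - sin (s * z) / s\<bar> = \<bar>sin (s * z) - s * z\<bar> / s"
      using s(1) by (simp add: field_simps abs_minus_commute flip: abs_mult_pos)
     also have "\<dots> \<le> (s * z)\<^sup>2 / 2 / s" using s(1) by (intro divide_right_mono abs_sin_minus_id_le) auto
     also have "\<dots> = s / 2 * \<bar>z\<bar>\<^sup>2" using s(1) by (simp add: power2_eq_square)
     also have "\<dots> \<le> s / 2 * (norm (x - \<theta>s k))\<^sup>2" using zn s(1) by (intro mult_left_mono power_mono) auto
     finally show "\<bar>z - sin (s * z) / s\<bar> \<le> s / 2 * (norm (x - \<theta>s k))\<^sup>2" .
    qed (use s(1) mt_m[OF k, of x] H0 in auto)
    also have "\<dots> = (s / 2 * G + H) * (norm (x - \<theta>s k))\<^sup>2" by (simp add: power2_eq_square algebra_simps)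
    also have "\<dots> \<le> (s / 2 * G + H) * (C1 * q x)"
     using near[OF x True k] s(1) G0 H0 by (intro mult_left_mono) auto
    also have "\<dots> \<le> C * q x" using up[OF Cge(2)] by (simp add: mult.assoc)
    finally show ?thesis using True by (simp add: z_def)
   next
    case False
    have "\<bar>h k j x\<bar> = 1 / s * \<bar>sin (s * z)\<bar> * mt k x" unfolding h_def sz using s(1) mt_m(2)[OF k, of x] by (simp add: abs_mult)
    also have "\<dots> \<le> 1 / s * 1 * (N * (q x / \<kappa>))"
     using mt_m[OF k, of x] mult_left_mono[OF off[OF x False k], of N] N0 s(1) by (intro mult_mono) auto
    also have "\<dots> \<le> C * q x" using up[OF Cge(4)] by simp
    finally show ?thesis using False by simp
   qed
  qed
  show "\<exists>k<K. (dist x (\<theta>s k))\<^sup>2 \<le> C * q x" if x: "x \<in> \<Theta>" for x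
  proof (cases "\<exists>k<K. x \<in> ball (\<theta>s k) r")
   case True
   then obtain k where k: "k < K" "x \<in> ball (\<theta>s k) r" by auto
   have "(dist x (\<theta>s k))\<^sup>2 \<le> C * q x" using near[OF x k(2,1)] up[OF Cge(5)] by (auto simp: dist_norm intro: order_trans)
   thus ?thesis using k by blast
  next
   \<comment> \<open>Outside all the balls \<open>q\<close> is at least \<open>\<kappa> ^ K\<close>,
     so a constant multiple of it exceeds the squared diameter bound \<open>L\<^sup>2\<close>, and
     any true atom will do.\<close>
   case False
   have fr: "r \<le> dist x (\<theta>s l)" if "l < K" for l
   proof -
    have "x \<notin> ball (\<theta>s l) r" using False that by blast
    thus ?thesis by (simp add: dist_commute)
   qed
   have "(\<Prod>l<K. \<kappa>) \<le> q x" unfolding q_def using kap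
    by (intro prod_mono conjI d_far x fr) auto
   hence "L\<^sup>2 / \<kappa> ^ K * \<kappa> ^ K \<le> L\<^sup>2 / \<kappa> ^ K * q x" using Cs(5) by (intro mult_left_mono) auto
   hence "L\<^sup>2 \<le> C * q x" using kap up[OF Cge(6), of x] by simp
   moreover have "(dist x (\<theta>s 0))\<^sup>2 \<le> L\<^sup>2" using L(2)[OF x in\<Theta>[OF K]] by (intro power_mono) (auto simp: dist_norm)
   ultimately show ?thesis using K by (intro exI[of _ 0]) auto
  qed
 qed (use r Cge(7) q_nonneg q_le in auto)
qed

end

section \<open>Mixture densities and the likelihood\<close>

text \<open>\<open>ennreal\<close> turns negative weights into 0, hence the maximum; the formula is
  valid for arbitrary real weights.\<close>

lemma mixture_discrete_measure:
 fixes f :: "'a::euclidean_space \<Rightarrow> real"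
 assumes [measurable]: "f \<in> borel_measurable borel"
 shows "mixture f (discrete_measure I w \<theta>) x = (\<integral>k. max 0 (w k) * f (x - \<theta> k) \<partial>count_space I)"
proof -
 have "mixture f (discrete_measure I w \<theta>) x = (\<integral>k. f (x - \<theta> k) \<partial>density (count_space I) (\<lambda>k. ennreal (w k)))"
  unfolding mixture_def discrete_measure_def by (rule integral_distr) auto
 also have "density (count_space I) (\<lambda>k. ennreal (w k)) = density (count_space I) (\<lambda>k. ennreal (max 0 (w k)))"
  by (simp add: ennreal_max_0)
 also have "(\<integral>k. f (x - \<theta> k) \<partial>density (count_space I) (\<lambda>k. ennreal (max 0 (w k)))) = (\<integral>k. max 0 (w k) * f (x - \<theta> k) \<partial>count_space I)"
  by (subst integral_density) auto
 finally show ?thesis .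
qed

locale mixture_model = dirichlet_process \<alpha> P0 + prob_density f
 for \<alpha> :: real and P0 :: "'a::euclidean_space measure" and f :: "'a \<Rightarrow> real" +
 fixes F :: real and K :: nat and ws :: "nat \<Rightarrow> real" and \<theta>s :: "nat \<Rightarrow> 'a"
 assumes f_pos: "\<And>x. 0 < f x" and f_le: "\<And>x. f x \<le> F"
  and K_pos: "K > 0" and ws_pos: "\<And>k. k < K \<Longrightarrow> ws k > 0" and ws_sum: "(\<Sum>k<K. ws k) = 1"
begin

definition true_dens :: "'a \<Rightarrow> real" where
 "true_dens x = (\<Sum>k<K. ws k * f (x - \<theta>s k))"

definition dens :: "'a sticks \<Rightarrow> 'a \<Rightarrow> real" where
 "dens p x = sp_mean (\<lambda>t. f (x - t)) (fst p) (snd p)"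

text \<open>The almost sure event on which the mixture really is a probability density and agrees
  pointwise with \<open>dens\<close>.\<close>

definition regular :: "'a sticks \<Rightarrow> bool" where
 "regular p \<longleftrightarrow> proper (fst p) \<and> stick_weights (fst p) sums 1"

lemma AE_regular: "AE p in prior. regular p"
 using AE_proper AE_stick_weights_sums by eventually_elim (simp add: regular_def)

lemma F_pos: "0 < F"
 using f_pos[of 0] f_le[of 0] by linarith

lemma abs_f_le: "\<bar>f x\<bar> \<le> F"
 using f_pos[of x] f_le[of x] by simp

lemma measurable_true_dens [measurable]: "true_dens \<in> borel_measurable borel"
 unfolding true_dens_def by measurable

lemma true_dens_pos: "0 < true_dens x"
 unfolding true_dens_def using K_pos ws_pos f_pos by (intro sum_pos) auto

lemma mixture_true: "mixture f (discrete_measure {..<K} ws \<theta>s) x = true_dens x"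
 unfolding mixture_discrete_measure[OF f_meas] true_dens_def
 using ws_pos by (subst lebesgue_integral_count_space_finite) (auto intro!: sum.cong simp: max_def less_imp_le not_le)

lemma nn_integral_f_shift: "(\<integral>\<^sup>+x. ennreal (f (x - \<theta>)) \<partial>lborel) = 1"
proof -
 have "(\<integral>\<^sup>+x. ennreal (f (x - \<theta>)) \<partial>lborel) = ennreal (\<integral>x. f (x - \<theta>) \<partial>lborel)"
  by (intro nn_integral_eq_integral integrable_lborel_shift) (auto simp: f_nonneg)
 also have "(\<integral>x. f (x - \<theta>) \<partial>lborel) = (\<integral>x. f x \<partial>lborel)"
  using integral_lborel_shift[of f "- \<theta>"] by (simp add: algebra_simps)
 finally show ?thesis by (simp add: f_1)
qed

lemma nn_integral_true_dens: "(\<integral>\<^sup>+x. ennreal (true_dens x) \<partial>lborel) = 1"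
proof -
 have "(\<integral>\<^sup>+x. ennreal (true_dens x) \<partial>lborel) = (\<integral>\<^sup>+x. (\<Sum>k<K. ennreal (ws k) * ennreal (f (x - \<theta>s k))) \<partial>lborel)"
  unfolding true_dens_def using ws_pos f_nonneg
  by (intro nn_integral_cong) (subst sum_ennreal[symmetric], auto simp: ennreal_mult' less_imp_le)
 also have "\<dots> = (\<Sum>k<K. ennreal (ws k))"
  by (subst nn_integral_sum) (auto simp: nn_integral_cmult nn_integral_f_shift)
 also have "\<dots> = 1" using ws_pos ws_sum by (subst sum_ennreal) (auto simp: less_imp_le)
 finally show ?thesis .
qed

lemma regular_dens:
 assumes "regular p"
 shows "(\<lambda>j. stick_weights (fst p) j * f (x - snd p j)) sums dens p x"
  and "0 < dens p x" and "dens p x \<le> F"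
  and "mixture f (discrete_measure UNIV (stick_weights (fst p)) (snd p)) x = dens p x"
proof -
 have p: "proper (fst p)" and one: "stick_weights (fst p) sums 1" using assms by (auto simp: regular_def)
 note sm = summable_sp_mean[OF p, where \<phi> = "\<lambda>t. f (x - t)" and b = F and \<theta> = "snd p", OF abs_f_le]
 show s: "(\<lambda>j. stick_weights (fst p) j * f (x - snd p j)) sums dens p x"
  unfolding dens_def sp_mean_def using sm by (rule summable_sums)
 show "0 < dens p x"
  unfolding dens_def sp_mean_def using sm stick_weights_pos[OF p] f_pos
  by (intro suminf_pos) auto
 show "dens p x \<le> F"
  using abs_sp_mean_le[OF p, where \<phi> = "\<lambda>t. f (x - t)" and b = F and \<theta> = "snd p", OF abs_f_le] by (simp add: dens_def)
 have mx: "max 0 (stick_weights (fst p) j) = stick_weights (fst p) j" for j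
  using stick_weights_pos[OF p, of j] by simp
 have "integrable (count_space UNIV) (\<lambda>j. stick_weights (fst p) j * f (x - snd p j))"
  unfolding integrable_count_space_nat_iff using sm stick_weights_pos[OF p] f_pos
  by (simp add: abs_mult less_imp_le)
 hence "(\<integral>k. stick_weights (fst p) k * f (x - snd p k) \<partial>count_space UNIV) = dens p x"
  by (subst integral_count_space_nat) (auto simp: dens_def sp_mean_def)
 thus "mixture f (discrete_measure UNIV (stick_weights (fst p)) (snd p)) x = dens p x"
  unfolding mixture_discrete_measure[OF f_meas] mx .
qed

lemma measurable_dens [measurable]:
 "(\<lambda>(p, x). dens p x) \<in> borel_measurable (prior \<Otimes>\<^sub>M borel)"
proof -
 have "(\<lambda>x. snd (fst x)) \<in> measurable (prior \<Otimes>\<^sub>M borel) atoms_law" by measurable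
 note [measurable] = measurable_atoms_component'[OF this]
 show ?thesis unfolding dens_def sp_mean_def split_beta' by measurable
qed

lemma measurable_dens' [measurable (raw)]:
 assumes "g \<in> measurable N prior" "h \<in> borel_measurable N"
 shows "(\<lambda>x. dens (g x) (h x)) \<in> borel_measurable N"
 using measurable_compose[OF measurable_Pair[OF assms] measurable_dens] by simp

lemma nn_integral_dens:
 assumes "regular p" shows "(\<integral>\<^sup>+x. ennreal (dens p x) \<partial>lborel) = 1"
proof -
 have p: "proper (fst p)" and one: "stick_weights (fst p) sums 1" using assms by (auto simp: regular_def)
 have s0: "0 \<le> stick_weights (fst p) j" for j using stick_weights_pos[OF p] by (simp add: less_imp_le)
 have "(\<integral>\<^sup>+x. ennreal (dens p x) \<partial>lborel) = (\<integral>\<^sup>+x. (\<Sum>j. ennreal (stick_weights (fst p) j) * ennreal (f (x - snd p j))) \<partial>lborel)"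
 proof (intro nn_integral_cong)
  fix x
  have "(\<Sum>j. ennreal (stick_weights (fst p) j * f (x - snd p j))) = ennreal (dens p x)"
   using regular_dens(1)[OF assms, of x] s0 f_nonneg by (intro suminf_ennreal_eq) auto
  thus "ennreal (dens p x) = (\<Sum>j. ennreal (stick_weights (fst p) j) * ennreal (f (x - snd p j)))"
   using s0 f_nonneg by (simp add: ennreal_mult')
 qed
 also have "\<dots> = (\<Sum>j. ennreal (stick_weights (fst p) j))"
  by (subst nn_integral_suminf) (auto simp: nn_integral_cmult nn_integral_f_shift)
 also have "\<dots> = 1" using one s0 by (subst suminf_ennreal_eq[where x = 1]) auto
 finally show ?thesis .
qed

text \<open>The duality behind the tests: a bounded statistic of the data density is a mean of its
  convolved version under the mixing measure. Dominated summation justifies the exchange.\<close>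

lemma integral_dens_mult:
 assumes p: "regular p" and g: "g \<in> borel_measurable borel" "\<And>x. \<bar>g x\<bar> \<le> B"
 shows "(\<integral>x. g x * dens p x \<partial>lborel) = sp_mean (\<lambda>\<theta>. \<integral>x. g x * f (x - \<theta>) \<partial>lborel) (fst p) (snd p)"
proof -
 have pp: "proper (fst p)" and one: "stick_weights (fst p) sums 1" using p by (auto simp: regular_def)
 have s0: "0 \<le> stick_weights (fst p) j" for j using stick_weights_pos[OF pp] by (simp add: less_imp_le)
 have B: "0 \<le> B" using g(2)[of undefined] by simp
 define G where "G j x = stick_weights (fst p) j * (g x * f (x - snd p j))" for j x
 have ig: "integrable lborel (\<lambda>x. g x * f (x - \<theta>))" for \<theta>
  by (intro integrable_bounded_mult[OF g] integrable_lborel_shift f_int)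
 have iG: "integrable lborel (G j)" for j unfolding G_def using ig by simp
 have bd: "norm (G j x) \<le> B * (stick_weights (fst p) j * f (x - snd p j))" for j x
  using mult_right_mono[OF g(2)[of x], of "stick_weights (fst p) j * f (x - snd p j)"] s0[of j] f_nonneg[of "x - snd p j"]
  by (simp add: G_def abs_mult mult_ac)
 have sm: "summable (\<lambda>j. stick_weights (fst p) j * f (x - snd p j))" for x
  using regular_dens(1)[OF p] by (auto simp: sums_iff)
 have "(\<integral>x. (\<Sum>j. G j x) \<partial>lborel) = (\<Sum>j. \<integral>x. G j x \<partial>lborel)"
 proof (rule integral_suminf[OF iG])
  show "AE x in lborel. summable (\<lambda>j. norm (G j x))"
   by (intro AE_I2 summable_comparison_test'[OF summable_mult[OF sm, of B]]) (use bd in auto)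
  show "summable (\<lambda>j. \<integral>x. norm (G j x) \<partial>lborel)"
  proof (rule summable_comparison_test'[where N = 0])
   show "summable (\<lambda>j. B * stick_weights (fst p) j)" using one by (intro summable_mult) (simp add: sums_iff)
   fix j
   have fs: "integrable lborel (\<lambda>x. f (x - snd p j))" by (rule integrable_lborel_shift) simp
   have "(\<integral>x. f (x - snd p j) \<partial>lborel) = 1"
    using integral_lborel_shift[of f "- snd p j"] f_1 by (simp add: algebra_simps)
   moreover have "(\<integral>x. norm (G j x) \<partial>lborel) \<le> (\<integral>x. B * (stick_weights (fst p) j * f (x - snd p j)) \<partial>lborel)"
    using bd iG fs by (intro integral_mono) auto
   ultimately show "norm (\<integral>x. norm (G j x) \<partial>lborel) \<le> B * stick_weights (fst p) j" by simp
  qed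
 qed
 moreover have "(\<Sum>j. G j x) = g x * dens p x" for x
 proof -
  have "(\<lambda>j. g x * (stick_weights (fst p) j * f (x - snd p j))) sums (g x * dens p x)"
   by (rule sums_mult[OF regular_dens(1)[OF p]])
  thus ?thesis by (simp add: G_def sums_iff mult_ac)
 qed
 moreover have "(\<integral>x. G j x \<partial>lborel) = stick_weights (fst p) j * (\<integral>x. g x * f (x - snd p j) \<partial>lborel)" for j
  unfolding G_def by simp
 ultimately show ?thesis by (simp add: sp_mean_def)
qed

lemma integral_true_dens_mult:
 assumes g: "g \<in> borel_measurable borel" "\<And>x. \<bar>g x\<bar> \<le> B"
 shows "(\<integral>x. g x * true_dens x \<partial>lborel) = (\<Sum>k<K. ws k * (\<integral>x. g x * f (x - \<theta>s k) \<partial>lborel))"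
proof -
 have ig: "integrable lborel (\<lambda>x. g x * f (x - \<theta>))" for \<theta>
  by (intro integrable_bounded_mult[OF g] integrable_lborel_shift f_int)
 have "(\<integral>x. g x * true_dens x \<partial>lborel) = (\<integral>x. (\<Sum>k<K. ws k * (g x * f (x - \<theta>s k))) \<partial>lborel)"
  by (simp add: true_dens_def sum_distrib_left mult_ac)
 also have "\<dots> = (\<Sum>k<K. ws k * (\<integral>x. g x * f (x - \<theta>s k) \<partial>lborel))"
  using ig by (subst Bochner_Integration.integral_sum) auto
 finally show ?thesis .
qed

section \<open>The law of the data\<close>

definition true_law :: "'a measure" where
 "true_law = density lborel (\<lambda>x. ennreal (true_dens x))"

definition data_law :: "(nat \<Rightarrow> 'a) measure" where
 "data_law = (\<Pi>\<^sub>M i\<in>UNIV. true_law)"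

lemma sets_true_law [simp, measurable_cong]: "sets true_law = sets borel"
 and space_true_law [simp]: "space true_law = UNIV"
 by (auto simp: true_law_def)

lemma prob_space_density:
 assumes "d \<in> borel_measurable borel" "(\<integral>\<^sup>+x. ennreal (d x) \<partial>lborel) = 1"
 shows "prob_space (density lborel (\<lambda>x. ennreal (d x :: real)))"
proof
 show "emeasure (density lborel (\<lambda>x. ennreal (d x))) (space (density lborel (\<lambda>x. ennreal (d x)))) = 1"
  using assms by (simp add: emeasure_density)
qed

sublocale TL: prob_space true_law
 unfolding true_law_def by (rule prob_space_density) (auto simp: nn_integral_true_dens)

sublocale X: sequence_space true_law
 by unfold_locales

sublocale DL: prob_space data_law
 unfolding data_law_def by unfold_locales

lemma space_data_law [simp]: "space data_law = UNIV"
 by (auto simp: data_law_def space_PiM)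

lemma UNIV_data_law [simp]: "UNIV \<in> sets data_law"
 using sets.top[of data_law] by simp

lemma measurable_data_component [measurable (raw)]: "(\<lambda>X. X i) \<in> borel_measurable data_law"
proof -
 have "(\<lambda>X. X i) \<in> measurable data_law true_law"
  unfolding data_law_def by (rule measurable_component_singleton) simp
 thus ?thesis by (simp cong: measurable_cong_sets)
qed

lemma measurable_data_component' [measurable_dest]:
 "g \<in> measurable N data_law \<Longrightarrow> (\<lambda>x. g x i) \<in> borel_measurable N"
 using measurable_compose[OF _ measurable_data_component[of i]] .

lemma nn_integral_data_prod:
 assumes [measurable]: "g \<in> borel_measurable borel"
 shows "(\<integral>\<^sup>+X. (\<Prod>i<n. g (X i)) \<partial>data_law) = (\<integral>\<^sup>+x. ennreal (true_dens x) * g x \<partial>lborel) ^ n"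
proof -
 have "(\<integral>\<^sup>+X. (\<Prod>i<n. g (X i)) \<partial>data_law) = (\<integral>\<^sup>+x. g x \<partial>true_law) ^ n"
  unfolding data_law_def by (rule X.nn_integral_prod_iid) measurable
 thus ?thesis by (simp add: true_law_def nn_integral_density)
qed

text \<open>Normalised by the true density, so that its expectation under the data is 1 for regular
  \<open>p\<close>; the normalisation cancels in the posterior.\<close>

definition lik_ratio :: "nat \<Rightarrow> (nat \<Rightarrow> 'a) \<Rightarrow> 'a sticks \<Rightarrow> real" where
 "lik_ratio n X p = (\<Prod>i<n. dens p (X i) / true_dens (X i))"

abbreviation evidence :: "nat \<Rightarrow> (nat \<Rightarrow> 'a) \<Rightarrow> ennreal" where
 "evidence n X \<equiv> \<integral>\<^sup>+p. ennreal (lik_ratio n X p) \<partial>prior"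

abbreviation evidence_on :: "'a sticks set \<Rightarrow> nat \<Rightarrow> (nat \<Rightarrow> 'a) \<Rightarrow> ennreal" where
 "evidence_on H n X \<equiv> \<integral>\<^sup>+p. indicator H p * ennreal (lik_ratio n X p) \<partial>prior"

text \<open>One plus the chi-square divergence of the true density from \<open>dens p\<close>; its
  \<open>n\<close>-th power is the expected inverse likelihood ratio under the data law.\<close>

abbreviation chi2 :: "'a sticks \<Rightarrow> ennreal" where
 "chi2 p \<equiv> \<integral>\<^sup>+x. ennreal ((true_dens x)\<^sup>2 / dens p x) \<partial>lborel"

lemma measurable_lik_ratio [measurable (raw)]:
 assumes [measurable]: "g \<in> measurable N data_law" "h \<in> measurable N prior"
 shows "(\<lambda>x. lik_ratio n (g x) (h x)) \<in> borel_measurable N"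
 unfolding lik_ratio_def by measurable

lemma lik_ratio_pos: "regular p \<Longrightarrow> 0 < lik_ratio n X p"
 unfolding lik_ratio_def using regular_dens(2) true_dens_pos by (intro prod_pos) auto

lemma pair_sigma_finite_data_prior: "pair_sigma_finite data_law prior"
 by (intro pair_sigma_finite.intro DL.sigma_finite_measure_axioms PR.sigma_finite_measure_axioms)

lemma fubini_data_prior:
 assumes "(\<lambda>(X, p). g X p) \<in> borel_measurable (data_law \<Otimes>\<^sub>M prior)"
 shows "(\<integral>\<^sup>+X. \<integral>\<^sup>+p. g X p \<partial>prior \<partial>data_law) = (\<integral>\<^sup>+p. \<integral>\<^sup>+X. g X p \<partial>data_law \<partial>prior)"
 using pair_sigma_finite.Fubini'[OF pair_sigma_finite_data_prior assms] by simp

text \<open>Instead of a Kullback-Leibler bound the evidence is bounded from below through inverse moments of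
 the likelihood ratio, with the inequality \<open>1 \<le> (t r + 1 / (t r)) / 2\<close>.\<close>

lemma evidence_lower_bound:
 assumes [measurable]: "N \<in> sets prior" and N: "0 < emeasure prior N" and t: "0 < t" and c: "0 \<le> c"
  and chi: "\<And>p. p \<in> N \<Longrightarrow> regular p \<Longrightarrow> chi2 p ^ n \<le> ennreal c"
 shows "emeasure data_law {X. ennreal t * evidence n X < emeasure prior N} \<le> ennreal (c / t)"
proof -
 define Z' where "Z' X = (\<integral>\<^sup>+p. indicator N p * ennreal (1 / lik_ratio n X p) \<partial>prior)" for X
 define Z where "Z X = evidence n X" for X
 have [measurable]: "Z \<in> borel_measurable data_law" "Z' \<in> borel_measurable data_law"
  unfolding Z_def Z'_def by measurable
 have NF: "emeasure prior N \<noteq> \<infinity>" by simp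
 have amgm: "2 * emeasure prior N \<le> ennreal t * Z X + ennreal (1 / t) * Z' X" for X
 proof -
  have "2 * emeasure prior N = (\<integral>\<^sup>+p. 2 * indicator N p \<partial>prior)"
   by (simp add: nn_integral_cmult)
  also have "\<dots> \<le> (\<integral>\<^sup>+p. ennreal t * ennreal (lik_ratio n X p) + ennreal (1 / t) * (indicator N p * ennreal (1 / lik_ratio n X p)) \<partial>prior)"
  proof (intro nn_integral_mono_AE)
   show "AE p in prior. 2 * indicator N p \<le> ennreal t * ennreal (lik_ratio n X p) + ennreal (1 / t) * (indicator N p * ennreal (1 / lik_ratio n X p))"
    using AE_regular
   proof eventually_elim
    case (elim p)
    define r where "r = t * lik_ratio n X p"
    have r: "0 < r" unfolding r_def using t lik_ratio_pos[OF elim] by simp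
    have "2 \<le> r + 1 / r"
    proof -
     have "0 \<le> (r - 1)\<^sup>2" by simp
     hence "2 * r \<le> r * r + 1" by (simp add: power2_eq_square algebra_simps)
     thus ?thesis using r by (simp add: field_simps)
    qed
    hence "ennreal 2 \<le> ennreal (t * lik_ratio n X p + 1 / t * (1 / lik_ratio n X p))"
     by (intro ennreal_leI) (simp add: r_def)
    also have "\<dots> = ennreal t * ennreal (lik_ratio n X p) + ennreal (1 / t) * ennreal (1 / lik_ratio n X p)"
    proof -
     have "0 \<le> t" "0 \<le> 1 / t" "0 \<le> lik_ratio n X p" "0 \<le> 1 / lik_ratio n X p"
      using t lik_ratio_pos[OF elim, of n X] by (auto simp: less_imp_le)
     thus ?thesis by (simp only: ennreal_plus ennreal_mult mult_nonneg_nonneg)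
    qed
    finally show ?case by (auto split: split_indicator)
   qed
  qed
  also have "\<dots> = ennreal t * Z X + ennreal (1 / t) * Z' X"
   unfolding Z_def Z'_def by (simp add: nn_integral_add nn_integral_cmult)
  finally show ?thesis .
 qed
 have EZ': "(\<integral>\<^sup>+X. Z' X \<partial>data_law) \<le> emeasure prior N * ennreal c"
 proof -
  have "(\<integral>\<^sup>+X. Z' X \<partial>data_law) = (\<integral>\<^sup>+p. \<integral>\<^sup>+X. indicator N p * ennreal (1 / lik_ratio n X p) \<partial>data_law \<partial>prior)"
   unfolding Z'_def by (rule fubini_data_prior) (unfold split_beta', measurable)
  also have "\<dots> \<le> (\<integral>\<^sup>+p. indicator N p * ennreal c \<partial>prior)"
  proof (intro nn_integral_mono_AE)
   show "AE p in prior. (\<integral>\<^sup>+X. indicator N p * ennreal (1 / lik_ratio n X p) \<partial>data_law) \<le> indicator N p * ennreal c"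
    using AE_regular
   proof eventually_elim
    case (elim p)
    have [measurable]: "dens p \<in> borel_measurable borel" by measurable
    have "(\<integral>\<^sup>+X. ennreal (1 / lik_ratio n X p) \<partial>data_law) = (\<integral>\<^sup>+X. (\<Prod>i<n. ennreal (true_dens (X i) / dens p (X i))) \<partial>data_law)"
     unfolding lik_ratio_def using regular_dens(2)[OF elim] true_dens_pos
     by (intro nn_integral_cong) (subst prod_ennreal, auto simp: prod_dividef less_imp_le)
    also have "\<dots> = (\<integral>\<^sup>+x. ennreal (true_dens x) * ennreal (true_dens x / dens p x) \<partial>lborel) ^ n"
     by (rule nn_integral_data_prod) measurable
    also have "(\<integral>\<^sup>+x. ennreal (true_dens x) * ennreal (true_dens x / dens p x) \<partial>lborel) = chi2 p"
     using true_dens_pos by (intro nn_integral_cong) (simp add: ennreal_mult'[symmetric] less_imp_le power2_eq_square)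
    finally show ?case using chi[OF _ elim] by (auto simp: nn_integral_cmult split: split_indicator)
   qed
  qed
  also have "\<dots> = emeasure prior N * ennreal c" by (simp add: nn_integral_multc)
  finally show ?thesis .
 qed
 \<comment> \<open>If the evidence falls short, at least half of the left side of
   \<open>amgm\<close> must come from the inverse moment \<open>Z'\<close>, to which Markov's
   inequality applies.\<close>
 have sub: "{X. ennreal t * Z X < emeasure prior N} \<subseteq> {X. ennreal t * emeasure prior N \<le> Z' X}"
 proof
  fix X assume "X \<in> {X. ennreal t * Z X < emeasure prior N}"
  hence 1: "ennreal t * Z X < emeasure prior N" by simp
  show "X \<in> {X. ennreal t * emeasure prior N \<le> Z' X}"
  proof (rule ccontr)
   assume "X \<notin> {X. ennreal t * emeasure prior N \<le> Z' X}"
   hence "Z' X \<le> ennreal t * emeasure prior N" by auto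
   hence "ennreal (1 / t) * Z' X \<le> ennreal (1 / t) * (ennreal t * emeasure prior N)" by (intro mult_left_mono) auto
   also have "\<dots> = emeasure prior N" using t by (simp add: mult.assoc[symmetric] ennreal_mult'[symmetric])
   finally have "ennreal t * Z X + ennreal (1 / t) * Z' X < emeasure prior N + emeasure prior N"
   proof -
    assume y: "ennreal (1 / t) * Z' X \<le> emeasure prior N"
    obtain n where n: "emeasure prior N = ennreal n" "0 \<le> n" using NF by (cases "emeasure prior N") auto
    obtain x where x: "ennreal t * Z X = ennreal x" "0 \<le> x" using 1 n by (cases "ennreal t * Z X") auto
    obtain y where "ennreal (1 / t) * Z' X = ennreal y" "0 \<le> y" using y n by (cases "ennreal (1 / t) * Z' X") (auto simp: top_unique)
    thus ?thesis using x n 1 y by (simp add: ennreal_plus[symmetric] ennreal_less_iff del: ennreal_plus)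
   qed
   thus False using amgm[of X] by (simp add: mult_2 not_le[symmetric])
  qed
 qed
 have "emeasure data_law {X. ennreal t * Z X < emeasure prior N} \<le> emeasure data_law {X\<in>space data_law. 1 \<le> (1 / (ennreal t * emeasure prior N)) * Z' X}"
 proof (rule emeasure_mono)
  have ne: "ennreal t * emeasure prior N \<noteq> 0" "ennreal t * emeasure prior N \<noteq> \<infinity>"
   using t N by (auto simp: ennreal_mult_eq_top_iff)
  show "{X. ennreal t * Z X < emeasure prior N} \<subseteq> {X\<in>space data_law. 1 \<le> (1 / (ennreal t * emeasure prior N)) * Z' X}"
  proof
   fix X assume "X \<in> {X. ennreal t * Z X < emeasure prior N}"
   hence "ennreal t * emeasure prior N \<le> Z' X" using sub by auto
   hence "(ennreal t * emeasure prior N) / (ennreal t * emeasure prior N) \<le> Z' X / (ennreal t * emeasure prior N)"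
    by (rule divide_right_mono_ennreal)
   thus "X \<in> {X\<in>space data_law. 1 \<le> (1 / (ennreal t * emeasure prior N)) * Z' X}"
    using ne ennreal_divide_self[of "ennreal t * emeasure prior N"]
    by (simp add: divide_ennreal_def mult.commute top.not_eq_extremum)
  qed
 qed measurable
 also have "\<dots> \<le> (1 / (ennreal t * emeasure prior N)) * (\<integral>\<^sup>+X. Z' X * indicator (space data_law) X \<partial>data_law)"
  by (rule nn_integral_Markov_inequality) auto
 also have "\<dots> \<le> (1 / (ennreal t * emeasure prior N)) * (emeasure prior N * ennreal c)"
  using EZ' by (intro mult_left_mono) auto
 also have "\<dots> = ennreal (c / t)"
 proof -
  obtain x where x: "emeasure prior N = ennreal x" "0 < x"
   using N NF by (cases "emeasure prior N") auto
  show ?thesis unfolding x using t c x(2)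
   by (simp add: ennreal_mult'[symmetric] divide_ennreal ennreal_1[symmetric] del: ennreal_1)
 qed
 finally show ?thesis by (simp add: Z_def)
qed

end

section \<open>Tests\<close>

text \<open>Hoeffding's lemma for a variable with range of width \<open>2 * b\<close>.\<close>

lemma exp_moment_bounded:
 fixes d g :: "'a::euclidean_space \<Rightarrow> real"
 assumes [measurable]: "d \<in> borel_measurable borel" "g \<in> borel_measurable borel"
  and d: "\<And>x. 0 \<le> d x" "(\<integral>\<^sup>+x. ennreal (d x) \<partial>lborel) = 1" and b: "\<And>x. \<bar>g x\<bar> \<le> b" and l: "0 < l"
 shows "(\<integral>\<^sup>+x. ennreal (d x) * ennreal (exp (l * (g x - (\<integral>x. g x * d x \<partial>lborel)))) \<partial>lborel) \<le> ennreal (exp (l\<^sup>2 * b\<^sup>2 / 2))"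
proof -
 define M where "M = density lborel (\<lambda>x. ennreal (d x))"
 interpret prob_space M
  by standard (use d in \<open>simp add: M_def emeasure_density\<close>)
 interpret interval_bounded_random_variable M g "-b" b
 proof
  show "random_variable borel g" by (simp add: M_def)
  show "AE x in M. g x \<in> {-b..b}" using b by (intro AE_I2) (auto simp: abs_le_iff minus_le_iff)
 qed
 have E: "expectation g = (\<integral>x. g x * d x \<partial>lborel)"
  unfolding M_def using d(1) by (subst integral_density) (auto simp: mult.commute)
 have "(\<integral>\<^sup>+x. ennreal (exp (l * (g x - expectation g))) \<partial>M) \<le> ennreal (exp (l\<^sup>2 * (b - (- b))\<^sup>2 / 8))"
  using Hoeffdings_lemma_nn_integral[OF l] by simp
 also have "l\<^sup>2 * (b - (- b))\<^sup>2 / 8 = l\<^sup>2 * b\<^sup>2 / 2" by (simp add: power2_eq_square)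
 finally show ?thesis unfolding E unfolding M_def by (subst (asm) nn_integral_density) auto
qed

context mixture_model
begin

definition mean_true :: "('a \<Rightarrow> real) \<Rightarrow> real" where
 "mean_true g = (\<integral>x. g x * true_dens x \<partial>lborel)"

definition mean_dens :: "('a \<Rightarrow> real) \<Rightarrow> 'a sticks \<Rightarrow> real" where
 "mean_dens g p = (\<integral>x. g x * dens p x \<partial>lborel)"

lemma nn_integral_lik_ratio:
 assumes p: "regular p" and [measurable]: "k \<in> borel_measurable borel"
 shows "(\<integral>\<^sup>+X. ennreal (lik_ratio n X p) * (\<Prod>i<n. k (X i)) \<partial>data_law) = (\<integral>\<^sup>+x. ennreal (dens p x) * k x \<partial>lborel) ^ n"
proof -
 have [measurable]: "dens p \<in> borel_measurable borel" by measurable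
 have "(\<integral>\<^sup>+X. ennreal (lik_ratio n X p) * (\<Prod>i<n. k (X i)) \<partial>data_law) = (\<integral>\<^sup>+X. (\<Prod>i<n. ennreal (dens p (X i) / true_dens (X i)) * k (X i)) \<partial>data_law)"
  unfolding lik_ratio_def using regular_dens(2)[OF p] true_dens_pos
  by (intro nn_integral_cong) (simp add: prod.distrib prod_ennreal less_imp_le)
 also have "\<dots> = (\<integral>\<^sup>+x. ennreal (true_dens x) * (ennreal (dens p x / true_dens x) * k x) \<partial>lborel) ^ n"
  by (rule nn_integral_data_prod) measurable
 also have "(\<integral>\<^sup>+x. ennreal (true_dens x) * (ennreal (dens p x / true_dens x) * k x) \<partial>lborel) = (\<integral>\<^sup>+x. ennreal (dens p x) * k x \<partial>lborel)"
 proof (intro nn_integral_cong)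
  fix x
  have "ennreal (true_dens x) * ennreal (dens p x / true_dens x) = ennreal (dens p x)"
   using true_dens_pos[of x] by (simp add: ennreal_mult'[symmetric] less_imp_le)
  thus "ennreal (true_dens x) * (ennreal (dens p x / true_dens x) * k x) = ennreal (dens p x) * k x"
   by (simp add: mult.assoc[symmetric])
 qed
 finally show ?thesis .
qed

lemma nn_integral_lik_ratio_1: "regular p \<Longrightarrow> (\<integral>\<^sup>+X. ennreal (lik_ratio n X p) \<partial>data_law) = 1"
 using nn_integral_lik_ratio[of p "\<lambda>_. 1" n] by (simp add: nn_integral_dens)

context
 fixes g :: "'a \<Rightarrow> real" and b \<tau> :: real
 assumes g [measurable]: "g \<in> borel_measurable borel" and gb: "\<And>x. \<bar>g x\<bar> \<le> b" and b: "0 < b" and \<tau>: "0 < \<tau>"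
begin

text \<open>The parameter \<open>\<tau> / b\<^sup>2\<close> minimises the exponent, a linear term
  from the threshold plus the quadratic one from Hoeffding's lemma.\<close>

lemma chernoff_bound:
 assumes d: "d \<in> borel_measurable borel" "\<And>x. 0 \<le> d x" "(\<integral>\<^sup>+x. ennreal (d x) \<partial>lborel) = 1"
  and h: "h \<in> borel_measurable borel" "\<And>x. \<bar>h x\<bar> \<le> b"
 shows "(\<integral>\<^sup>+x. ennreal (d x) * ennreal (exp (\<tau> / b\<^sup>2 * (h x - (\<integral>x. h x * d x \<partial>lborel) - \<tau>))) \<partial>lborel) ^ n \<le> ennreal (exp (- (real n * \<tau>\<^sup>2 / (2 * b\<^sup>2))))"
proof -
 define \<mu> where "\<mu> = (\<integral>x. h x * d x \<partial>lborel)"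
 define l where "l = \<tau> / b\<^sup>2"
 note [measurable] = d(1) h(1)
 have l: "0 < l" using b \<tau> by (simp add: l_def)
 have "(\<integral>\<^sup>+x. ennreal (d x) * ennreal (exp (l * (h x - \<mu> - \<tau>))) \<partial>lborel) =
   (\<integral>\<^sup>+x. ennreal (exp (- l * \<tau>)) * (ennreal (d x) * ennreal (exp (l * (h x - \<mu>)))) \<partial>lborel)"
  by (intro nn_integral_cong) (simp add: ennreal_mult'[symmetric] mult.left_commute exp_add[symmetric] algebra_simps)
 also have "\<dots> = ennreal (exp (- l * \<tau>)) * (\<integral>\<^sup>+x. ennreal (d x) * ennreal (exp (l * (h x - \<mu>))) \<partial>lborel)"
  by (rule nn_integral_cmult) measurable
 also have "\<dots> \<le> ennreal (exp (- l * \<tau>)) * ennreal (exp (l\<^sup>2 * b\<^sup>2 / 2))"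
  unfolding \<mu>_def by (intro mult_left_mono exp_moment_bounded d h l) auto
 also have "\<dots> = ennreal (exp (- (\<tau>\<^sup>2 / (2 * b\<^sup>2))))"
 proof -
  have "- l * \<tau> + l\<^sup>2 * b\<^sup>2 / 2 = - (\<tau>\<^sup>2 / (2 * b\<^sup>2))"
   using b by (simp add: l_def power2_eq_square field_simps)
  thus ?thesis by (simp add: ennreal_mult'[symmetric] exp_add[symmetric])
 qed
 finally have "(\<integral>\<^sup>+x. ennreal (d x) * ennreal (exp (l * (h x - \<mu> - \<tau>))) \<partial>lborel) ^ n \<le> ennreal (exp (- (\<tau>\<^sup>2 / (2 * b\<^sup>2)))) ^ n"
  by (rule power_mono) simp
 also have "\<dots> = ennreal (exp (- (real n * \<tau>\<^sup>2 / (2 * b\<^sup>2))))"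
  by (simp add: ennreal_power exp_of_nat_mult[symmetric])
 finally show ?thesis by (simp add: \<mu>_def l_def)
qed

lemma exp_sum_indicator:
 "indicator {X. real n * c < (\<Sum>i<n. h (X i))} X \<le> (\<Prod>i<n. ennreal (exp (\<tau> / b\<^sup>2 * (h (X i) - c))))"
proof -
 have s: "(\<Sum>i<n. \<tau> / b\<^sup>2 * (h (X i) - c)) = \<tau> / b\<^sup>2 * ((\<Sum>i<n. h (X i)) - real n * c)"
  unfolding sum_distrib_left[symmetric] sum_subtractf by simp
 have "(\<Prod>i<n. ennreal (exp (\<tau> / b\<^sup>2 * (h (X i) - c)))) = ennreal (exp (\<tau> / b\<^sup>2 * ((\<Sum>i<n. h (X i)) - real n * c)))"
  unfolding s[symmetric] by (subst prod_ennreal) (simp_all add: exp_sum)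
 moreover have "1 \<le> exp (\<tau> / b\<^sup>2 * ((\<Sum>i<n. h (X i)) - real n * c))" if "real n * c < (\<Sum>i<n. h (X i))"
  using that \<tau> b by simp
 ultimately show ?thesis by (auto split: split_indicator)
qed

lemma test_type1:
 "emeasure data_law {X. real n * (mean_true g + \<tau>) < (\<Sum>i<n. g (X i))} \<le> ennreal (exp (- (real n * \<tau>\<^sup>2 / (2 * b\<^sup>2))))"
proof -
 have "Measurable.pred data_law (\<lambda>X. real n * (mean_true g + \<tau>) < (\<Sum>i<n. g (X i)))" by measurable
 hence "emeasure data_law {X. real n * (mean_true g + \<tau>) < (\<Sum>i<n. g (X i))} =
   (\<integral>\<^sup>+X. indicator {X. real n * (mean_true g + \<tau>) < (\<Sum>i<n. g (X i))} X \<partial>data_law)"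
  by (intro nn_integral_indicator[symmetric]) (simp add: pred_def)
 also have "\<dots> \<le> (\<integral>\<^sup>+X. (\<Prod>i<n. ennreal (exp (\<tau> / b\<^sup>2 * (g (X i) - (mean_true g + \<tau>))))) \<partial>data_law)"
  by (intro nn_integral_mono exp_sum_indicator)
 also have "\<dots> = (\<integral>\<^sup>+x. ennreal (true_dens x) * ennreal (exp (\<tau> / b\<^sup>2 * (g x - (mean_true g + \<tau>)))) \<partial>lborel) ^ n"
  by (rule nn_integral_data_prod) measurable
 also have "\<dots> \<le> ennreal (exp (- (real n * \<tau>\<^sup>2 / (2 * b\<^sup>2))))"
  using chernoff_bound[of true_dens g n] true_dens_pos gb nn_integral_true_dens
  by (simp add: mean_true_def less_imp_le diff_diff_eq)
 finally show ?thesis .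
qed

text \<open>Weighting by the likelihood ratio integrates against the density of \<open>p\<close>.
  Its mean lies more than \<open>\<tau>\<close> above the threshold, so acceptance is a deviation of
  the statistic \<open>- g\<close>.\<close>

lemma test_type2:
 assumes p: "regular p" and far: "mean_true g + 2 * \<tau> < mean_dens g p"
 shows "(\<integral>\<^sup>+X. ennreal (lik_ratio n X p) * indicator {X. (\<Sum>i<n. g (X i)) \<le> real n * (mean_true g + \<tau>)} X \<partial>data_law) \<le> ennreal (exp (- (real n * \<tau>\<^sup>2 / (2 * b\<^sup>2))))"
\<comment> \<open>Without data the comparison with the threshold is not strict; the bound is then
  simply 1.\<close>
proof (cases "n = 0")
 case True
 have "(\<integral>\<^sup>+X. ennreal (lik_ratio n X p) * indicator {X. (\<Sum>i<n. g (X i)) \<le> real n * (mean_true g + \<tau>)} X \<partial>data_law) \<le> (\<integral>\<^sup>+X. ennreal (lik_ratio n X p) \<partial>data_law)"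
  by (intro nn_integral_mono) (auto split: split_indicator)
 thus ?thesis using True nn_integral_lik_ratio_1[OF p, of 0] by simp
next
 case False
 have [measurable]: "dens p \<in> borel_measurable borel" by measurable
 define \<mu> where "\<mu> = mean_dens g p"
 have "(\<integral>\<^sup>+X. ennreal (lik_ratio n X p) * indicator {X. (\<Sum>i<n. g (X i)) \<le> real n * (mean_true g + \<tau>)} X \<partial>data_law) \<le>
  (\<integral>\<^sup>+X. ennreal (lik_ratio n X p) * (\<Prod>i<n. ennreal (exp (\<tau> / b\<^sup>2 * (- g (X i) - (\<tau> - \<mu>))))) \<partial>data_law)"
 proof (intro nn_integral_mono mult_left_mono)
  fix X
  have "real n * (mean_true g + \<tau>) < real n * (\<mu> - \<tau>)" using far False by (intro mult_strict_left_mono) (auto simp: \<mu>_def)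
  hence "indicator {X. (\<Sum>i<n. g (X i)) \<le> real n * (mean_true g + \<tau>)} X \<le> (indicator {X. real n * (\<tau> - \<mu>) < (\<Sum>i<n. - g (X i))} X :: ennreal)"
   by (auto simp: sum_negf right_diff_distrib split: split_indicator)
  also have "\<dots> \<le> (\<Prod>i<n. ennreal (exp (\<tau> / b\<^sup>2 * (- g (X i) - (\<tau> - \<mu>)))))"
   by (rule exp_sum_indicator)
  finally show "indicator {X. (\<Sum>i<n. g (X i)) \<le> real n * (mean_true g + \<tau>)} X \<le> (\<Prod>i<n. ennreal (exp (\<tau> / b\<^sup>2 * (- g (X i) - (\<tau> - \<mu>)))))" .
 qed simp
 also have "\<dots> = (\<integral>\<^sup>+x. ennreal (dens p x) * ennreal (exp (\<tau> / b\<^sup>2 * (- g x - (\<tau> - \<mu>)))) \<partial>lborel) ^ n"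
  by (rule nn_integral_lik_ratio[OF p]) measurable
 also have "\<dots> \<le> ennreal (exp (- (real n * \<tau>\<^sup>2 / (2 * b\<^sup>2))))"
  using chernoff_bound[of "dens p" "\<lambda>x. - g x" n] regular_dens(2)[OF p] gb nn_integral_dens[OF p]
  by (simp add: \<mu>_def mean_dens_def less_imp_le algebra_simps)
 finally show ?thesis .
qed

end

lemma measurable_mean_dens [measurable]:
 assumes [measurable]: "g \<in> borel_measurable borel"
 shows "mean_dens g \<in> borel_measurable prior"
 unfolding mean_dens_def[abs_def] by measurable

text \<open>If the ratio is large, then the evidence is small, or some test rejects although the
  truth holds, or the numerator is large although all tests accept. The three summands bound these
  events; in the third, \<open>Us\<close> collects the parameters which the tests cannot exclude but
  which have small prior mass.\<close>

lemma posterior_numerator_bound: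
 assumes fin: "finite \<G>" and gm: "\<And>g. g \<in> \<G> \<Longrightarrow> g \<in> borel_measurable borel" and gb: "\<And>g x. g \<in> \<G> \<Longrightarrow> \<bar>g x\<bar> \<le> b"
  and b: "0 < b" and \<tau>: "0 < \<tau>" and e: "0 < e" and t: "0 < t" and l: "0 < l" and c: "0 \<le> c" and u: "0 \<le> u"
  and Gc [measurable]: "Gc \<in> sets prior" and Us [measurable]: "Us \<in> sets prior" and N [measurable]: "N \<in> sets prior"
  and split: "AE p in prior. p \<in> Gc \<longrightarrow> (\<exists>g\<in>\<G>. mean_true g + 2 * \<tau> < mean_dens g p) \<or> p \<in> Us"
  and Us_le: "emeasure prior Us \<le> ennreal u" and N_ge: "ennreal l \<le> emeasure prior N"
  and chi: "\<And>p. p \<in> N \<Longrightarrow> regular p \<Longrightarrow> chi2 p ^ n \<le> ennreal c"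
 defines "\<rho> \<equiv> exp (- (real n * \<tau>\<^sup>2 / (2 * b\<^sup>2)))"
 shows "emeasure data_law {X. ennreal e * evidence n X < evidence_on Gc n X}
  \<le> ennreal (c / t + real (card \<G>) * \<rho> + (real (card \<G>) * \<rho> + u) * t / (e * l))"
proof -
 define Z where "Z X = evidence n X" for X
 define U where "U X = evidence_on Gc n X" for X
 have [measurable]: "Z \<in> borel_measurable data_law" "U \<in> borel_measurable data_law"
  unfolding Z_def U_def by measurable
 define Tg where "Tg g = {X. (\<Sum>i<n. g (X i)) \<le> real n * (mean_true g + \<tau>)}" for g
 have Tg [measurable]: "Tg g \<in> sets data_law" if "g \<in> \<G>" for g
 proof -
  note [measurable] = gm[OF that]
  have "Measurable.pred data_law (\<lambda>X. (\<Sum>i<n. g (X i)) \<le> real n * (mean_true g + \<tau>))" by measurable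
  thus ?thesis by (simp add: pred_def Tg_def)
 qed
 have cTg: "- Tg g = {X. real n * (mean_true g + \<tau>) < (\<Sum>i<n. g (X i))}" for g by (auto simp: Tg_def)
 \<comment> \<open>The data for which every test accepts.\<close>
 define T where "T = (\<Inter>g\<in>\<G>. Tg g)"
 have cT: "- T = (\<Union>g\<in>\<G>. - Tg g)" by (auto simp: T_def)
 have cTg_sets: "- Tg g \<in> sets data_law" if "g \<in> \<G>" for g
  using sets.compl_sets[OF Tg[OF that]] by (simp add: Compl_eq_Diff_UNIV)
 have cT_sets: "- T \<in> sets data_law" unfolding cT using fin cTg_sets by (intro sets.finite_UN) auto
 have T_sets [measurable]: "T \<in> sets data_law" using sets.compl_sets[OF cT_sets] by (simp add: Compl_eq_Diff_UNIV[symmetric])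
 have \<rho>0: "0 \<le> \<rho>" by (simp add: \<rho>_def)
 have P1: "emeasure data_law (- T) \<le> ennreal (real (card \<G>) * \<rho>)"
 proof -
  have "emeasure data_law (- T) \<le> (\<Sum>g\<in>\<G>. emeasure data_law (- Tg g))"
   unfolding cT using fin cTg_sets by (intro emeasure_subadditive_finite) auto
  also have "\<dots> \<le> (\<Sum>g\<in>\<G>. ennreal \<rho>)"
   unfolding cTg \<rho>_def by (intro sum_mono test_type1 gm gb b \<tau>)
  also have "\<dots> = ennreal (real (card \<G>) * \<rho>)" using \<rho>0 by (simp add: ennreal_mult' ennreal_of_nat_eq_real_of_nat)
  finally show ?thesis .
 qed
 have P2: "emeasure data_law {X. ennreal t * Z X < emeasure prior N} \<le> ennreal (c / t)"
  unfolding Z_def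
 proof (rule evidence_lower_bound[OF N _ t c chi])
  show "0 < emeasure prior N" using less_le_trans[OF _ N_ge] l by simp
 qed
 \<comment> \<open>After exchanging the integrals, a parameter in \<open>Gc\<close> either is
   rejected by some test with error \<open>\<rho>\<close>, or lies in \<open>Us\<close> and
   contributes at most its prior mass.\<close>
 have EU: "(\<integral>\<^sup>+X. indicator T X * U X \<partial>data_law) \<le> ennreal (real (card \<G>) * \<rho> + u)"
 proof -
  have "(\<integral>\<^sup>+X. indicator T X * U X \<partial>data_law) = (\<integral>\<^sup>+X. \<integral>\<^sup>+p. indicator T X * (indicator Gc p * ennreal (lik_ratio n X p)) \<partial>prior \<partial>data_law)"
   unfolding U_def by (intro nn_integral_cong nn_integral_cmult[symmetric]) measurable
  also have "\<dots> = (\<integral>\<^sup>+p. \<integral>\<^sup>+X. indicator T X * (indicator Gc p * ennreal (lik_ratio n X p)) \<partial>data_law \<partial>prior)"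
   by (rule fubini_data_prior) (unfold split_beta', measurable)
  also have "\<dots> \<le> (\<integral>\<^sup>+p. ennreal (real (card \<G>) * \<rho>) + indicator Us p \<partial>prior)"
  proof (intro nn_integral_mono_AE)
   show "AE p in prior. (\<integral>\<^sup>+X. indicator T X * (indicator Gc p * ennreal (lik_ratio n X p)) \<partial>data_law) \<le> ennreal (real (card \<G>) * \<rho>) + indicator Us p"
    using split AE_regular
   proof eventually_elim
    case (elim p)
    consider "p \<notin> Gc" | "p \<in> Us" | g where "g \<in> \<G>" "mean_true g + 2 * \<tau> < mean_dens g p"
     using elim(1) by blast
    thus ?case
    proof cases
     case 2
     have "(\<integral>\<^sup>+X. indicator T X * (indicator Gc p * ennreal (lik_ratio n X p)) \<partial>data_law) \<le> (\<integral>\<^sup>+X. ennreal (lik_ratio n X p) \<partial>data_law)"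
      by (intro nn_integral_mono) (auto split: split_indicator)
     also have "\<dots> = 1" by (rule nn_integral_lik_ratio_1[OF elim(2)])
     finally show ?thesis using 2 by (simp add: add_increasing)
    next
     case (3 g)
     have "(\<integral>\<^sup>+X. indicator T X * (indicator Gc p * ennreal (lik_ratio n X p)) \<partial>data_law) \<le>
      (\<integral>\<^sup>+X. ennreal (lik_ratio n X p) * indicator (Tg g) X \<partial>data_law)"
      using 3 by (intro nn_integral_mono) (auto simp: T_def split: split_indicator)
     also have "\<dots> \<le> ennreal \<rho>"
      unfolding Tg_def \<rho>_def by (rule test_type2[OF gm[OF 3(1)] gb[OF 3(1)] b \<tau> elim(2) 3(2)])
     also have "\<dots> \<le> ennreal (real (card \<G>) * \<rho>)"
     proof (rule ennreal_leI)
      have "1 \<le> real (card \<G>)" using 3 fin by (simp add: Suc_le_eq card_gt_0_iff) auto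
      thus "\<rho> \<le> real (card \<G>) * \<rho>" using \<rho>0 mult_right_mono[of 1 "real (card \<G>)" \<rho>] by simp
     qed
     finally show ?thesis by (simp add: add_increasing2)
    qed simp
   qed
  qed
  also have "\<dots> = ennreal (real (card \<G>) * \<rho>) + emeasure prior Us"
   by (simp add: nn_integral_add PR.emeasure_space_1[simplified])
  also have "\<dots> \<le> ennreal (real (card \<G>) * \<rho>) + ennreal u" using Us_le by (rule add_left_mono)
  also have "\<dots> = ennreal (real (card \<G>) * \<rho> + u)" using \<rho>0 u by (simp add: ennreal_plus)
  finally show ?thesis .
 qed
 \<comment> \<open>The level \<open>e * l / t\<close> is what the numerator must reach when the
   evidence is at least \<open>l / t\<close>.\<close>
 define S where "S = {X\<in>space data_law. 1 \<le> ennreal (t / (e * l)) * (indicator T X * U X)}"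
 have [measurable]: "S \<in> sets data_law" unfolding S_def by measurable
 have P3: "emeasure data_law S \<le> ennreal ((real (card \<G>) * \<rho> + u) * t / (e * l))"
 proof -
  have "emeasure data_law S \<le> ennreal (t / (e * l)) * (\<integral>\<^sup>+X. indicator T X * U X * indicator (space data_law) X \<partial>data_law)"
   unfolding S_def by (rule nn_integral_Markov_inequality) auto
  also have "\<dots> \<le> ennreal (t / (e * l)) * ennreal (real (card \<G>) * \<rho> + u)"
   using EU by (intro mult_left_mono) auto
  also have "\<dots> = ennreal ((real (card \<G>) * \<rho> + u) * t / (e * l))"
   using t e l by (simp add: ennreal_mult'[symmetric] mult.commute)
  finally show ?thesis .
 qed
 have [measurable]: "{X. ennreal t * Z X < emeasure prior N} \<in> sets data_law"
 proof -
  have "Measurable.pred data_law (\<lambda>X. ennreal t * Z X < emeasure prior N)" by measurable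
  thus ?thesis by (simp add: pred_def)
 qed
 have sub: "{X. ennreal e * Z X < U X} \<subseteq> {X. ennreal t * Z X < emeasure prior N} \<union> - T \<union> S"
 proof
  fix X assume X: "X \<in> {X. ennreal e * Z X < U X}"
  show "X \<in> {X. ennreal t * Z X < emeasure prior N} \<union> - T \<union> S"
  proof (cases "X \<in> T \<and> emeasure prior N \<le> ennreal t * Z X")
   case True
   hence "ennreal l \<le> ennreal t * Z X" using N_ge by auto
   hence "ennreal (e / t) * ennreal l \<le> ennreal (e / t) * (ennreal t * Z X)" by (intro mult_left_mono) auto
   also have "\<dots> = ennreal e * Z X" using t e by (simp add: mult.assoc[symmetric] ennreal_mult'[symmetric])
   also have "\<dots> \<le> U X" using X by simp
   finally have "ennreal (t / (e * l)) * (ennreal (e / t) * ennreal l) \<le> ennreal (t / (e * l)) * U X" by (intro mult_left_mono) auto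
   moreover have "ennreal (t / (e * l)) * (ennreal (e / t) * ennreal l) = 1"
    using t e l by (simp add: ennreal_mult'[symmetric])
   ultimately show ?thesis using True by (simp add: S_def)
  qed auto
 qed
 have "emeasure data_law {X. ennreal e * Z X < U X} \<le> emeasure data_law ({X. ennreal t * Z X < emeasure prior N} \<union> - T \<union> S)"
  using sub cT_sets by (intro emeasure_mono) auto
 also have "\<dots> \<le> emeasure data_law ({X. ennreal t * Z X < emeasure prior N} \<union> - T) + emeasure data_law S"
  using cT_sets by (intro emeasure_subadditive) auto
 also have "\<dots> \<le> (emeasure data_law {X. ennreal t * Z X < emeasure prior N} + emeasure data_law (- T)) + emeasure data_law S"
  using cT_sets by (intro add_right_mono emeasure_subadditive) auto
 also have "\<dots> \<le> (ennreal (c / t) + ennreal (real (card \<G>) * \<rho>)) + ennreal ((real (card \<G>) * \<rho> + u) * t / (e * l))"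
  by (intro add_mono P1 P2 P3)
 also have "\<dots> = ennreal (c / t + real (card \<G>) * \<rho> + (real (card \<G>) * \<rho> + u) * t / (e * l))"
  using \<rho>0 t e l c u by (simp add: ennreal_plus[symmetric] del: ennreal_plus)
 finally show ?thesis by (simp add: Z_def U_def)
qed

end

section \<open>Chi-square bounds from the logarithmic gradient\<close>

text \<open>Mean value inequality for \<open>ln \<circ> f\<close> on the ball of radius
  \<open>norm x + T\<close>, together with
  \<open>1 + norm x + T \<le> (1 + T) * (1 + norm x)\<close>, which separates \<open>x\<close> from
  the bound for the shifts.\<close>

lemma ln_shift_bound:
 fixes f :: "'a::euclidean_space \<Rightarrow> real"
 assumes pos: "\<And>x. 0 < f x" and diff: "\<And>x. f differentiable (at x)"
  and grad: "\<And>x. norm (total_deriv (\<lambda>y. ln (f y)) x) \<le> R * (1 + norm x) powr \<gamma>"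
  and R: "0 \<le> R" and \<gamma>: "0 \<le> \<gamma>" and T: "norm a \<le> T" "norm b \<le> T"
 shows "\<bar>ln (f (x - a)) - ln (f (x - b))\<bar> \<le> R * (1 + T) powr \<gamma> * (1 + norm x) powr \<gamma> * norm (a - b)"
proof -
 define g where "g y = ln (f y)" for y
 have T0: "0 \<le> T" using T(1) norm_ge_zero order_trans by blast
 have "(g has_derivative (\<lambda>h. frechet_derivative f (at y) h * inverse (f y))) (at y)" for y
  unfolding g_def using diff[of y] pos[of y]
  by (auto intro!: derivative_eq_intros simp: frechet_derivative_works[symmetric] field_simps)
 hence gd: "g differentiable (at y)" for y by (auto simp: differentiable_def)
 have "norm (g (x - a) - g (x - b)) \<le> R * (1 + (norm x + T)) powr \<gamma> * norm ((x - a) - (x - b))"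
 proof (rule differentiable_bound[of "cball 0 (norm x + T)" g "\<lambda>y. blinfun_apply (total_deriv g y)"])
  show "(g has_derivative blinfun_apply (total_deriv g y)) (at y within cball 0 (norm x + T))" for y
   using has_derivative_total_deriv[OF gd] by (rule has_derivative_at_withinI)
  fix y :: 'a assume "y \<in> cball 0 (norm x + T)"
  hence "R * (1 + norm y) powr \<gamma> \<le> R * (1 + (norm x + T)) powr \<gamma>"
   using R \<gamma> by (intro mult_left_mono powr_mono2) auto
  thus "onorm (blinfun_apply (total_deriv g y)) \<le> R * (1 + (norm x + T)) powr \<gamma>"
   using grad[of y] unfolding norm_blinfun.rep_eq g_def[abs_def] by linarith
 next
  show "x - a \<in> cball 0 (norm x + T)" "x - b \<in> cball 0 (norm x + T)"
   using T norm_triangle_ineq4[of x a] norm_triangle_ineq4[of x b] by auto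
 qed simp
 hence 1: "\<bar>g (x - a) - g (x - b)\<bar> \<le> R * (1 + (norm x + T)) powr \<gamma> * norm (a - b)"
  by (simp add: norm_minus_commute)
 have "(1 + (norm x + T)) powr \<gamma> \<le> ((1 + T) * (1 + norm x)) powr \<gamma>"
  using T0 \<gamma> by (intro powr_mono2) (auto simp: algebra_simps)
 also have "((1 + T) * (1 + norm x)) powr \<gamma> = (1 + T) powr \<gamma> * (1 + norm x) powr \<gamma>"
  by (rule powr_mult)
 finally have "R * (1 + (norm x + T)) powr \<gamma> * norm (a - b) \<le> R * ((1 + T) powr \<gamma> * (1 + norm x) powr \<gamma>) * norm (a - b)"
  using R by (intro mult_right_mono mult_left_mono) auto
 thus ?thesis using 1 unfolding g_def mult.assoc by linarith
qed

lemma one_plus_powr_le: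
 fixes t \<gamma> :: real assumes "0 \<le> t" "0 \<le> \<gamma>"
 shows "(1 + t) powr \<gamma> \<le> 2 powr \<gamma> * (1 + t powr \<gamma>)"
proof (cases "t \<le> 1")
 case True
 have "(1 + t) powr \<gamma> \<le> 2 powr \<gamma>" using True assms by (intro powr_mono2) auto
 also have "\<dots> \<le> 2 powr \<gamma> * (1 + t powr \<gamma>)" by (simp add: algebra_simps)
 finally show ?thesis .
next
 case False
 have "(1 + t) powr \<gamma> \<le> (2 * t) powr \<gamma>" using False assms by (intro powr_mono2) auto
 also have "\<dots> = 2 powr \<gamma> * t powr \<gamma>" by (rule powr_mult)
 also have "\<dots> \<le> 2 powr \<gamma> * (1 + t powr \<gamma>)" by (intro mult_left_mono) auto
 finally show ?thesis .
qed

text \<open>Adapts the moment condition to the weight \<open>(1 + norm x) powr \<gamma>\<close> of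
  the gradient bound, at the price of a larger \<open>M\<close>.\<close>

lemma integrable_exp_one_plus:
 fixes f :: "'a::euclidean_space \<Rightarrow> real"
 assumes [measurable]: "f \<in> borel_measurable borel" and f: "\<And>x. 0 \<le> f x" and \<gamma>: "0 \<le> \<gamma>" and M: "0 < M"
  and mom: "\<And>M. 0 < M \<Longrightarrow> integrable lborel (\<lambda>x. exp (M * norm x powr \<gamma>) * f x)"
 shows "integrable lborel (\<lambda>x. exp (M * (1 + norm x) powr \<gamma>) * f x)"
proof (rule Bochner_Integration.integrable_bound)
 define M' where "M' = M * 2 powr \<gamma>"
 have M': "0 < M'" using M by (simp add: M'_def)
 show "integrable lborel (\<lambda>x. exp M' * (exp (M' * norm x powr \<gamma>) * f x))"
  using mom[OF M'] by simp
 show "AE x in lborel. norm (exp (M * (1 + norm x) powr \<gamma>) * f x) \<le> norm (exp M' * (exp (M' * norm x powr \<gamma>) * f x))"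
 proof (rule AE_I2)
  fix x :: 'a
  have "M * (1 + norm x) powr \<gamma> \<le> M * (2 powr \<gamma> * (1 + norm x powr \<gamma>))"
   using M \<gamma> by (intro mult_left_mono one_plus_powr_le) auto
  also have "\<dots> = M' + M' * norm x powr \<gamma>" by (simp add: M'_def algebra_simps)
  finally have "exp (M * (1 + norm x) powr \<gamma>) \<le> exp M' * exp (M' * norm x powr \<gamma>)"
   by (simp add: exp_add[symmetric])
  hence "exp (M * (1 + norm x) powr \<gamma>) * f x \<le> exp M' * exp (M' * norm x powr \<gamma>) * f x"
   using f by (intro mult_right_mono) auto
  thus "norm (exp (M * (1 + norm x) powr \<gamma>) * f x) \<le> norm (exp M' * (exp (M' * norm x powr \<gamma>) * f x))"
   using f[of x] by (simp add: abs_mult mult.assoc)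
 qed
qed measurable

text \<open>The bounds are required at the atoms only, where the support of the prior supplies them;
  clamping \<open>\<phi>\<close> to the interval from 0 to \<open>c\<close> makes the global
  versions applicable.\<close>

lemma sp_mean_le:
 assumes v: "proper v" and \<phi>: "\<And>j. 0 \<le> \<phi> (\<theta> j)" "\<And>j. \<phi> (\<theta> j) \<le> c"
 shows "0 \<le> sp_mean \<phi> v \<theta>" "sp_mean \<phi> v \<theta> \<le> c"
proof -
 have c: "0 \<le> c" using \<phi>[of 0] by linarith
 define \<psi> where "\<psi> t = max 0 (min c (\<phi> t))" for t
 have "sp_mean \<phi> v \<theta> = sp_mean \<psi> v \<theta>"
  unfolding sp_mean_def \<psi>_def using \<phi> by (simp add: min_absorb2)
 moreover have "0 \<le> sp_mean \<psi> v \<theta>" using c by (intro sp_mean_nonneg[OF v, where b = c]) (auto simp: \<psi>_def)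
 moreover have "\<bar>sp_mean \<psi> v \<theta>\<bar> \<le> c" using c by (intro abs_sp_mean_le[OF v]) (auto simp: \<psi>_def)
 ultimately show "0 \<le> sp_mean \<phi> v \<theta>" "sp_mean \<phi> v \<theta> \<le> c" by auto
qed

lemma abs_exp_minus_1_le: "\<bar>exp y - 1\<bar> \<le> \<bar>y\<bar> * exp \<bar>y::real\<bar>"
proof (cases "y \<ge> 0")
 case True
 have "(1 + - y) * exp y \<le> exp (- y) * exp y" by (intro mult_right_mono exp_ge_add_one_self) auto
 thus ?thesis using True by (simp add: exp_minus algebra_simps)
next
 case False
 have "1 - exp y \<le> - y" using exp_ge_add_one_self[of y] by linarith
 also have "\<dots> \<le> \<bar>y\<bar> * exp \<bar>y\<bar>" using False mult_left_mono[of 1 "exp (- y)" "- y"] by simp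
 finally show ?thesis using False by simp
qed

section \<open>The chi-square divergence on neighbourhoods of the truth\<close>

context mixture_model
begin

text \<open>Logarithmic Lipschitz bounds make all shifts of \<open>f\<close> comparable up to a
  factor \<open>e x\<close>. The density of \<open>p\<close> then differs from the true one by order
  \<open>\<epsilon>\<close> times \<open>e x\<close>, relatively, and is at least a multiple of it
  divided by \<open>e x\<close>; the squared error is integrable because three factors
  \<open>e x\<close> have a finite mean.\<close>

lemma chi_square_bound:
 fixes u :: "'a \<Rightarrow> real" and R T wm :: real
 assumes u [measurable]: "u \<in> borel_measurable borel" and u1: "\<And>x. 1 \<le> u x" and R: "0 < R" and T: "0 \<le> T"
  and lnb: "\<And>x a b. norm a \<le> T \<Longrightarrow> norm b \<le> T \<Longrightarrow> \<bar>ln (f (x - a)) - ln (f (x - b))\<bar> \<le> R * u x * norm (a - b)"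
  and mom: "\<And>M. 0 < M \<Longrightarrow> integrable lborel (\<lambda>x. exp (M * u x) * f x)"
  and \<theta>sT: "\<And>k. k < K \<Longrightarrow> norm (\<theta>s k) \<le> T" and wm: "0 < wm" "\<And>k. k < K \<Longrightarrow> wm \<le> ws k"
 obtains C where "0 \<le> C"
  "\<And>p \<epsilon>. regular p \<Longrightarrow> 0 < \<epsilon> \<Longrightarrow> real K * \<epsilon> \<le> wm / 2 \<Longrightarrow> (\<And>j. norm (snd p j) \<le> T) \<Longrightarrow>
   (\<And>k. k < K \<Longrightarrow> \<bar>stick_weights (fst p) k - ws k\<bar> \<le> real K * \<epsilon>) \<Longrightarrow> rem_mass (fst p) K \<le> \<epsilon> \<Longrightarrow>
   (\<And>k. k < K \<Longrightarrow> dist (\<theta>s k) (snd p k) \<le> \<epsilon>) \<Longrightarrow>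
   chi2 p \<le> ennreal (1 + C * \<epsilon>\<^sup>2)"
proof -
 \<comment> \<open>The part \<open>2 * T\<close> bounds the distance of two shifts; the extra 1 pays
   for bounding \<open>R * u x\<close> by its exponential in \<open>r2\<close>.\<close>
 define M1 where "M1 = (2 * T + 1) * R"
 define e where "e x = exp (M1 * u x)" for x
 have M1: "0 < M1" using R T by (simp add: M1_def)
 have [measurable]: "e \<in> borel_measurable borel" unfolding e_def by measurable
 have e1: "1 \<le> e x" for x using M1 u1[of x] by (simp add: e_def)
 have r1: "f (x - a) \<le> e x * f (x - b)" if "norm a \<le> T" "norm b \<le> T" for x a b
 proof -
  have "norm (a - b) \<le> 2 * T" using that norm_triangle_ineq4[of a b] by linarith
  hence "R * u x * norm (a - b) \<le> R * u x * (2 * T + 1)"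
   using R u1[of x] by (intro mult_left_mono) auto
  hence "ln (f (x - a)) \<le> M1 * u x + ln (f (x - b))"
   using lnb[OF that, of x] by (simp add: M1_def mult_ac abs_le_iff)
  hence "exp (ln (f (x - a))) \<le> exp (M1 * u x + ln (f (x - b)))" by simp
  thus ?thesis using f_pos by (simp add: exp_add e_def)
 qed
 have r2: "\<bar>f (x - a) - f (x - b)\<bar> \<le> norm (a - b) * e x * f (x - b)" if "norm a \<le> T" "norm b \<le> T" for x a b
 proof -
  define y where "y = ln (f (x - a)) - ln (f (x - b))"
  have "exp (ln (f (x - a))) = exp (y + ln (f (x - b)))" by (simp add: y_def)
  hence fa: "f (x - a) = exp y * f (x - b)" using f_pos by (simp add: exp_add)
  have y: "\<bar>y\<bar> \<le> R * u x * norm (a - b)" unfolding y_def by (rule lnb[OF that])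
  have "norm (a - b) \<le> 2 * T" using that norm_triangle_ineq4[of a b] by linarith
  hence "R * u x * norm (a - b) \<le> R * u x * (2 * T)"
   using R u1[of x] by (intro mult_left_mono) auto
  hence y2: "\<bar>y\<bar> \<le> R * u x * (2 * T)" using y by linarith
  have "\<bar>exp y - 1\<bar> \<le> \<bar>y\<bar> * exp \<bar>y\<bar>" by (rule abs_exp_minus_1_le)
  also have "\<dots> \<le> (exp (R * u x) * norm (a - b)) * exp (R * u x * (2 * T))"
  proof (intro mult_mono)
   have "R * u x \<le> exp (R * u x)" using exp_ge_add_one_self[of "R * u x"] by linarith
   hence "R * u x * norm (a - b) \<le> exp (R * u x) * norm (a - b)" by (intro mult_right_mono) auto
   thus "\<bar>y\<bar> \<le> exp (R * u x) * norm (a - b)" using y by linarith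
  qed (use y2 in auto)
  also have "\<dots> = norm (a - b) * e x" by (simp add: e_def M1_def exp_add[symmetric] algebra_simps)
  finally have "\<bar>exp y - 1\<bar> * f (x - b) \<le> norm (a - b) * e x * f (x - b)"
   using f_nonneg by (intro mult_right_mono) auto
  moreover have "f (x - a) - f (x - b) = (exp y - 1) * f (x - b)" by (simp add: fa algebra_simps)
  ultimately show ?thesis using f_nonneg by (simp add: abs_mult)
 qed
 \<comment> \<open>Moving the atoms contributes 2, since weights at most double; changing the
   weights contributes \<open>real K / wm\<close>, and the leftover mass
   \<open>1 / wm\<close>.\<close>
 define C' where "C' = 2 + real K / wm + 1 / wm"
 have C': "0 \<le> C'" using wm(1) by (simp add: C'_def)
 \<comment> \<open>A fourth factor \<open>e x\<close> replaces the shifts to the true atoms by the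
   shift 0, where the moment assumption is available.\<close>
 have int3: "integrable lborel (\<lambda>x. e x ^ 3 * true_dens x)"
 proof -
  have ik: "integrable lborel (\<lambda>x. e x ^ 3 * f (x - \<theta>s k))" if k: "k < K" for k
  proof (rule Bochner_Integration.integrable_bound)
   show "integrable lborel (\<lambda>x. exp (4 * M1 * u x) * f x)" using M1 by (intro mom) simp
   show "AE x in lborel. norm (e x ^ 3 * f (x - \<theta>s k)) \<le> norm (exp (4 * M1 * u x) * f x)"
   proof (rule AE_I2)
    fix x
    have "e x ^ 3 * f (x - \<theta>s k) \<le> e x ^ 3 * (e x * f (x - 0))"
     using e1[of x] by (intro mult_left_mono r1 \<theta>sT[OF k]) (use T in auto)
    also have "\<dots> = exp (4 * M1 * u x) * f x"
    proof -
     have "exp (4 * M1 * u x) = exp (of_nat 4 * (M1 * u x))" by (simp add: mult.assoc)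
     also have "\<dots> = e x ^ 4" by (simp only: exp_of_nat_mult e_def)
     finally show ?thesis by (simp add: power4_eq_xxxx power3_eq_cube mult_ac)
    qed
    finally show "norm (e x ^ 3 * f (x - \<theta>s k)) \<le> norm (exp (4 * M1 * u x) * f x)"
     using f_nonneg e1[of x] by (simp add: abs_mult)
   qed
  qed measurable
  have "integrable lborel (\<lambda>x. \<Sum>k<K. ws k * (e x ^ 3 * f (x - \<theta>s k)))"
   using ik by (intro Bochner_Integration.integrable_sum integrable_mult_right) auto
  thus ?thesis by (simp add: true_dens_def sum_distrib_left mult_ac)
 qed
 define I3 where "I3 = (\<integral>x. e x ^ 3 * true_dens x \<partial>lborel)"
 have I3: "0 \<le> I3" unfolding I3_def using e1 true_dens_pos
  by (intro integral_nonneg_AE AE_I2) (auto intro!: mult_nonneg_nonneg less_imp_le[OF true_dens_pos] simp: e_def)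
 show thesis
 proof (rule that[of "2 * C'\<^sup>2 * I3"])
  show "0 \<le> 2 * C'\<^sup>2 * I3" using I3 by simp
  fix p :: "'a sticks" and \<epsilon> :: real
  assume p: "regular p" and \<epsilon>: "0 < \<epsilon>" and \<epsilon>w: "real K * \<epsilon> \<le> wm / 2" and aT: "\<And>j. norm (snd p j) \<le> T"
   and Sw: "\<And>k. k < K \<Longrightarrow> \<bar>stick_weights (fst p) k - ws k\<bar> \<le> real K * \<epsilon>" and rem: "rem_mass (fst p) K \<le> \<epsilon>"
   and dst: "\<And>k. k < K \<Longrightarrow> dist (\<theta>s k) (snd p k) \<le> \<epsilon>"
  have pp: "proper (fst p)" using p by (simp add: regular_def)
  have [measurable]: "dens p \<in> borel_measurable borel" by measurable
  define S where "S k = stick_weights (fst p) k" for k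
  have S: "ws k / 2 \<le> S k" "S k \<le> 2 * ws k" "\<bar>S k - ws k\<bar> \<le> real K * \<epsilon> / wm * ws k" if k: "k < K" for k
  proof -
   show "ws k / 2 \<le> S k" "S k \<le> 2 * ws k" using Sw[OF k] \<epsilon>w wm(2)[OF k] ws_pos[OF k] by (auto simp: S_def abs_le_iff)
   have "real K * \<epsilon> * 1 \<le> real K * \<epsilon> * (ws k / wm)"
    using wm(1) wm(2)[OF k] \<epsilon> by (intro mult_left_mono) (auto simp: le_divide_eq)
   thus "\<bar>S k - ws k\<bar> \<le> real K * \<epsilon> / wm * ws k" using Sw[OF k] by (simp add: S_def)
  qed
  \<comment> \<open>With \<open>d\<close> for the density and \<open>h\<close> for the truth,
    \<open>(d - h)\<^sup>2 / d\<close> equals \<open>h\<^sup>2 / d + d - 2 * h\<close>. It is stated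
    without subtraction so that nonnegative integrals apply; as \<open>d\<close> and
    \<open>h\<close> have integral 1, they contribute 1 and 2.\<close>
  have key: "((true_dens x)\<^sup>2 / dens p x) + dens p x \<le> 2 * C'\<^sup>2 * \<epsilon>\<^sup>2 * (e x ^ 3 * true_dens x) + 2 * true_dens x" for x
  proof -
   define h where "h = true_dens x"
   define d where "d = dens p x"
   define tl where "tl = rem_mass (fst p) K * sp_mean (\<lambda>t. f (x - t)) (\<lambda>i. fst p (i + K)) (\<lambda>i. snd p (i + K))"
   have h0: "0 < h" unfolding h_def by (rule true_dens_pos)
   have ex: "1 \<le> e x" by (rule e1)
   have dsplit: "d = (\<Sum>k<K. S k * f (x - snd p k)) + tl"
    unfolding d_def dens_def tl_def S_def by (rule sp_mean_split[OF pp abs_f_le])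
   have pt: "proper (\<lambda>i. fst p (i + K))" using pp by (auto simp: proper_def)
   have wf: "wm * f (x - \<theta>s 0) \<le> h"
   proof -
    have "wm * f (x - \<theta>s 0) \<le> ws 0 * f (x - \<theta>s 0)" using wm(2)[OF K_pos] f_nonneg by (intro mult_right_mono) auto
    also have "\<dots> \<le> h" unfolding h_def true_dens_def using K_pos ws_pos f_nonneg
     by (intro member_le_sum[of 0 _ "\<lambda>k. ws k * f (x - \<theta>s k)"]) (auto intro: less_imp_le mult_nonneg_nonneg)
    finally show ?thesis .
   qed
   have tl: "0 \<le> tl" "tl \<le> \<epsilon> * (e x * h / wm)"
   proof -
    have "f (x - snd p j) \<le> e x * h / wm" for j
    proof -
     have "f (x - snd p j) \<le> e x * f (x - \<theta>s 0)" by (rule r1[OF aT \<theta>sT[OF K_pos]])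
     also have "\<dots> \<le> e x * (h / wm)" using wf ex wm(1) by (intro mult_left_mono) (auto simp: le_divide_eq mult.commute)
     finally show ?thesis by simp
    qed
    hence "0 \<le> sp_mean (\<lambda>t. f (x - t)) (\<lambda>i. fst p (i + K)) (\<lambda>i. snd p (i + K))"
     "sp_mean (\<lambda>t. f (x - t)) (\<lambda>i. fst p (i + K)) (\<lambda>i. snd p (i + K)) \<le> e x * h / wm"
     using f_nonneg sp_mean_le[OF pt, where \<phi> = "\<lambda>t. f (x - t)" and \<theta> = "\<lambda>i. snd p (i + K)" and c = "e x * h / wm"]
     by auto
    note sp = this
    show "0 \<le> tl" unfolding tl_def using sp(1) rem_mass_pos[OF pp, of K] by (intro mult_nonneg_nonneg) auto
    show "tl \<le> \<epsilon> * (e x * h / wm)" unfolding tl_def by (rule mult_mono[OF rem sp(2)]) (use \<epsilon> sp(1) in auto)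
   qed
   have d_lower: "h / (2 * e x) \<le> d"
   proof -
    have "h / (2 * e x) = (\<Sum>k<K. ws k / 2 * (f (x - \<theta>s k) / e x))"
     unfolding h_def true_dens_def sum_divide_distrib by (intro sum.cong) auto
    also have "\<dots> \<le> (\<Sum>k<K. S k * f (x - snd p k))"
    proof (intro sum_mono mult_mono)
     fix k assume "k \<in> {..<K}"
     hence k: "k < K" by simp
     show "ws k / 2 \<le> S k" by (rule S(1)[OF k])
     show "f (x - \<theta>s k) / e x \<le> f (x - snd p k)"
      using r1[OF \<theta>sT[OF k] aT, of x k] ex by (simp add: divide_le_eq mult.commute)
     show "0 \<le> S k" using S(1)[OF k] ws_pos[OF k] by linarith
     show "0 \<le> f (x - \<theta>s k) / e x" using f_nonneg ex by (intro divide_nonneg_nonneg) auto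
    qed
    finally show ?thesis using dsplit tl(1) by linarith
   qed
   have d0: "0 < d" unfolding d_def by (rule regular_dens(2)[OF p])
   have diff: "\<bar>d - h\<bar> \<le> C' * \<epsilon> * (e x * h)"
   proof -
    have "d - h = (\<Sum>k<K. S k * (f (x - snd p k) - f (x - \<theta>s k)) + (S k - ws k) * f (x - \<theta>s k)) + tl"
     unfolding dsplit h_def true_dens_def by (simp add: sum.distrib[symmetric] sum_subtractf[symmetric] algebra_simps)
    also have "\<bar>\<dots>\<bar> \<le> (\<Sum>k<K. \<bar>S k * (f (x - snd p k) - f (x - \<theta>s k)) + (S k - ws k) * f (x - \<theta>s k)\<bar>) + tl"
     using tl(1) by (intro order_trans[OF abs_triangle_ineq] add_mono sum_abs) simp
    also have "\<dots> \<le> (\<Sum>k<K. (2 + real K / wm) * \<epsilon> * e x * (ws k * f (x - \<theta>s k))) + \<epsilon> * (e x * h / wm)"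
    proof (intro add_mono sum_mono tl(2))
     fix k assume "k \<in> {..<K}"
     hence k: "k < K" by simp
     have S0: "0 \<le> S k" using S(1)[OF k] ws_pos[OF k] by linarith
     have "\<bar>S k * (f (x - snd p k) - f (x - \<theta>s k)) + (S k - ws k) * f (x - \<theta>s k)\<bar> \<le>
      S k * \<bar>f (x - snd p k) - f (x - \<theta>s k)\<bar> + \<bar>S k - ws k\<bar> * f (x - \<theta>s k)"
      using S0 f_nonneg[of "x - \<theta>s k"] by (intro order_trans[OF abs_triangle_ineq]) (simp add: abs_mult)
     also have "\<dots> \<le> (2 * ws k) * (\<epsilon> * e x * f (x - \<theta>s k)) + (real K * \<epsilon> / wm * ws k) * (e x * f (x - \<theta>s k))"
     proof (intro add_mono mult_mono S(2,3) k)
      have "\<bar>f (x - snd p k) - f (x - \<theta>s k)\<bar> \<le> norm (snd p k - \<theta>s k) * e x * f (x - \<theta>s k)" by (rule r2[OF aT \<theta>sT[OF k]])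
      also have "\<dots> \<le> \<epsilon> * e x * f (x - \<theta>s k)"
       using dst[OF k] f_nonneg ex by (intro mult_right_mono) (auto simp: dist_norm norm_minus_commute)
      finally show "\<bar>f (x - snd p k) - f (x - \<theta>s k)\<bar> \<le> \<epsilon> * e x * f (x - \<theta>s k)" .
      show "f (x - \<theta>s k) \<le> e x * f (x - \<theta>s k)" using ex f_nonneg[of "x - \<theta>s k"] mult_right_mono[of 1 "e x" "f (x - \<theta>s k)"] by simp
     qed (use ws_pos[OF k] \<epsilon> wm(1) f_nonneg in auto)
     also have "\<dots> = (2 + real K / wm) * \<epsilon> * e x * (ws k * f (x - \<theta>s k))" by (simp add: algebra_simps)
     finally show "\<bar>S k * (f (x - snd p k) - f (x - \<theta>s k)) + (S k - ws k) * f (x - \<theta>s k)\<bar> \<le> (2 + real K / wm) * \<epsilon> * e x * (ws k * f (x - \<theta>s k))" .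
    qed
    also have "\<dots> = C' * \<epsilon> * (e x * h)"
     unfolding sum_distrib_left[symmetric] h_def[unfolded true_dens_def, symmetric] by (simp add: C'_def algebra_simps)
    finally show ?thesis .
   qed
   have "(d - h)\<^sup>2 / d \<le> (C' * \<epsilon> * (e x * h))\<^sup>2 / (h / (2 * e x))"
   proof (intro frac_le)
    show "(d - h)\<^sup>2 \<le> (C' * \<epsilon> * (e x * h))\<^sup>2" using diff power_mono[of "\<bar>d - h\<bar>" _ 2] by simp
   qed (use d_lower h0 ex in auto)
   also have "\<dots> = 2 * C'\<^sup>2 * \<epsilon>\<^sup>2 * (e x ^ 3 * h)"
    using h0 ex by (simp add: power2_eq_square power3_eq_cube field_simps)
   finally have "(d - h)\<^sup>2 / d \<le> 2 * C'\<^sup>2 * \<epsilon>\<^sup>2 * (e x ^ 3 * h)" .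
   moreover have "(d - h)\<^sup>2 / d = h\<^sup>2 / d + d - 2 * h" using d0 by (simp add: power2_eq_square field_simps)
   ultimately show ?thesis by (simp add: h_def d_def)
  qed
  have "chi2 p + 1 =
    (\<integral>\<^sup>+x. ennreal ((true_dens x)\<^sup>2 / dens p x + dens p x) \<partial>lborel)"
   using regular_dens(2)[OF p]
   by (subst nn_integral_dens[OF p, symmetric], subst nn_integral_add[symmetric])
     (auto simp: less_imp_le intro!: nn_integral_cong ennreal_plus[symmetric] divide_nonneg_nonneg)
  also have "\<dots> \<le> (\<integral>\<^sup>+x. ennreal (2 * C'\<^sup>2 * \<epsilon>\<^sup>2) * ennreal (e x ^ 3 * true_dens x) + 2 * ennreal (true_dens x) \<partial>lborel)"
  proof (intro nn_integral_mono)
   fix x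
   have "ennreal ((true_dens x)\<^sup>2 / dens p x + dens p x) \<le> ennreal (2 * C'\<^sup>2 * \<epsilon>\<^sup>2 * (e x ^ 3 * true_dens x) + 2 * true_dens x)"
    by (intro ennreal_leI key)
   also have "\<dots> = ennreal (2 * C'\<^sup>2 * \<epsilon>\<^sup>2) * ennreal (e x ^ 3 * true_dens x) + ennreal (2 * true_dens x)"
   proof -
    have nn: "0 \<le> e x ^ 3 * true_dens x" "0 \<le> 2 * true_dens x" "0 \<le> 2 * C'\<^sup>2 * \<epsilon>\<^sup>2"
     using e1[of x] true_dens_pos[of x] by auto
    thus ?thesis by (simp only: ennreal_plus ennreal_mult mult_nonneg_nonneg)
   qed
   also have "ennreal (2 * true_dens x) = 2 * ennreal (true_dens x)"
    using true_dens_pos[of x] by (simp add: ennreal_mult' less_imp_le)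
   finally show "ennreal ((true_dens x)\<^sup>2 / dens p x + dens p x) \<le> ennreal (2 * C'\<^sup>2 * \<epsilon>\<^sup>2) * ennreal (e x ^ 3 * true_dens x) + 2 * ennreal (true_dens x)" .
  qed
  also have "\<dots> = ennreal (2 * C'\<^sup>2 * \<epsilon>\<^sup>2) * ennreal I3 + 2"
  proof -
   have "(\<integral>\<^sup>+x. ennreal (e x ^ 3 * true_dens x) \<partial>lborel) = ennreal I3"
    unfolding I3_def using int3 e1 true_dens_pos
    by (intro nn_integral_eq_integral) (auto intro!: AE_I2 mult_nonneg_nonneg less_imp_le[OF true_dens_pos] simp: e_def)
   thus ?thesis by (simp add: nn_integral_add nn_integral_cmult nn_integral_true_dens)
  qed
  also have "\<dots> = ennreal (1 + 2 * C'\<^sup>2 * I3 * \<epsilon>\<^sup>2) + 1"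
  proof -
   have "ennreal (2 * C'\<^sup>2 * \<epsilon>\<^sup>2) * ennreal I3 + 2 = ennreal (2 * C'\<^sup>2 * \<epsilon>\<^sup>2 * I3 + 2)"
    using I3 by (simp add: ennreal_mult ennreal_plus)
   also have "2 * C'\<^sup>2 * \<epsilon>\<^sup>2 * I3 + 2 = (1 + 2 * C'\<^sup>2 * I3 * \<epsilon>\<^sup>2) + 1" by simp
   also have "ennreal \<dots> = ennreal (1 + 2 * C'\<^sup>2 * I3 * \<epsilon>\<^sup>2) + 1" using I3 by (subst ennreal_plus) auto
   finally show ?thesis .
  qed
  finally show "chi2 p \<le> ennreal (1 + 2 * C'\<^sup>2 * I3 * \<epsilon>\<^sup>2)"
   by (simp add: add.commute[of _ 1])
 qed
qed

end

section \<open>Wasserstein distance between matched discrete measures\<close>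

lemma emeasure_discrete_measure:
 assumes "A \<in> sets borel"
 shows "emeasure (discrete_measure I w \<theta>) A = (\<integral>\<^sup>+k. ennreal (w k) * indicator A (\<theta> k) \<partial>count_space I)"
proof -
 have "emeasure (discrete_measure I w \<theta>) A = emeasure (density (count_space I) (\<lambda>k. ennreal (w k))) (\<theta> -` A \<inter> I)"
  unfolding discrete_measure_def using assms by (subst emeasure_distr) auto
 also have "\<dots> = (\<integral>\<^sup>+k. ennreal (w k) * indicator (\<theta> -` A \<inter> I) k \<partial>count_space I)"
  by (rule emeasure_density) auto
 also have "\<dots> = (\<integral>\<^sup>+k. ennreal (w k) * indicator A (\<theta> k) \<partial>count_space I)"
  by (intro nn_integral_cong) (auto split: split_indicator)
 finally show ?thesis .
qed

text \<open>An explicit coupling: the mass common to matched atoms travels at most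
  \<open>\<rho>\<close>; the excess, at most \<open>real K * \<rho>\<close> in total, is coupled
  independently and travels at most \<open>L\<close>.\<close>

lemma wasserstein1_matched_le:
 fixes \<theta>s \<theta> :: "nat \<Rightarrow> 'a::euclidean_space"
 assumes ws: "\<And>k. k < K \<Longrightarrow> 0 \<le> ws k" "(\<Sum>k<K. ws k) = 1" and w: "\<And>k. 0 \<le> w k" "w sums 1"
  and \<sigma>: "\<sigma> permutes {..<K}"
  and \<rho>: "\<And>k. k < K \<Longrightarrow> norm (\<theta>s k - \<theta> (\<sigma> k)) \<le> \<rho>" "\<And>k. k < K \<Longrightarrow> \<bar>ws k - w (\<sigma> k)\<bar> \<le> \<rho>" "0 \<le> \<rho>"
  and L: "\<And>k j. k < K \<Longrightarrow> norm (\<theta>s k - \<theta> j) \<le> L" "0 \<le> L"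
 shows "wasserstein1 (discrete_measure {..<K} ws \<theta>s) (discrete_measure UNIV w \<theta>) \<le> ennreal (\<rho> + real K * \<rho> * L)"
proof -
 define m where "m k = (if k < K then min (ws k) (w (\<sigma> k)) else 0)" for k
 define a where "a k = (if k < K then ws k - m k else 0)" for k
 define \<tau> where "\<tau> = inv \<sigma>"
 have \<sigma>K: "\<sigma> k < K \<longleftrightarrow> k < K" for k using permutes_in_image[OF \<sigma>, of k] by simp
 have \<tau>: "\<tau> (\<sigma> k) = k" "\<sigma> (\<tau> k) = k" for k
  using permutes_inverses[OF \<sigma>] by (auto simp: \<tau>_def)
 have \<tau>K: "\<tau> j < K \<longleftrightarrow> j < K" for j using \<sigma>K[of "\<tau> j"] by (simp add: \<tau>)
 define b where "b j = w j - m (\<tau> j)" for j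
 define A where "A = (\<Sum>k<K. a k)"
 have m0: "0 \<le> m k" for k using ws(1) w(1) by (simp add: m_def)
 have a0: "0 \<le> a k" for k by (simp add: a_def m_def)
 have b0: "0 \<le> b j" for j using w(1)[of j] by (auto simp: b_def m_def \<tau> min_le_iff_disj)
 have A0: "0 \<le> A" unfolding A_def using a0 by (intro sum_nonneg) auto
 have sm: "(\<Sum>k<K. m k) = 1 - A"
 proof -
  have "A = (\<Sum>k<K. ws k) - (\<Sum>k<K. m k)" unfolding A_def a_def by (simp add: sum_subtractf)
  thus ?thesis using ws(2) by simp
 qed
 have bs: "b sums A"
 proof -
  have "(\<lambda>j. m (\<tau> j)) sums (\<Sum>j<K. m (\<tau> j))" by (rule sums_finite) (auto simp: m_def \<tau>K)
  moreover have "(\<Sum>j<K. m (\<tau> j)) = (\<Sum>k<K. m k)"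
   using sum.permute[OF permutes_inv[OF \<sigma>], of m] by (simp add: \<tau>_def comp_def)
  ultimately have "(\<lambda>j. w j - m (\<tau> j)) sums (1 - (\<Sum>k<K. m k))" using w(2) by (intro sums_diff) auto
  thus ?thesis by (simp add: sm b_def[abs_def])
 qed
 \<comment> \<open>If \<open>A\<close> is 0 then so is every \<open>a k\<close>, and division by 0
   yields 0; no separate case is needed later on.\<close>
 have aA: "a k * A / A = a k" for k
 proof (cases "A = 0")
  case True
  hence "\<forall>k\<in>{..<K}. a k = 0" using a0 unfolding A_def by (subst (asm) sum_nonneg_eq_0_iff) auto
  hence "a k = 0" by (cases "k < K") (auto simp: a_def)
  thus ?thesis by simp
 qed simp
 have bA: "b j * A / A = b j" for j
 proof (cases "A = 0")
  case True
  have "b j \<le> suminf b" using sum_le_suminf[of b "{j}"] bs b0 by (auto simp: sums_iff)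
  hence "b j = 0" using True bs b0[of j] by (simp add: sums_iff)
  thus ?thesis by simp
 qed simp
 \<comment> \<open>The coupling matrix: common mass on matched pairs plus the normalised product of
   the excesses \<open>a\<close> and \<open>b\<close>.\<close>
 define c where "c k j = (if k < K \<and> j = \<sigma> k then m k else 0) + a k * b j / A" for k j
 have c0: "0 \<le> c k j" for k j using m0 a0 b0 A0 by (simp add: c_def)
 define C where "C = density (count_space (UNIV :: (nat \<times> nat) set)) (\<lambda>(k, j). ennreal (c k j))"
 define \<gamma> where "\<gamma> = distr C (borel \<Otimes>\<^sub>M borel) (\<lambda>(k, j). (\<theta>s k, \<theta> j))"
 have mC [measurable]: "h \<in> measurable C N" if "\<And>x. h x \<in> space N" for h :: "nat \<times> nat \<Rightarrow> 'b" and N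
  using that by (auto simp: C_def measurable_def)
 have map_meas: "(\<lambda>(k, j). (\<theta>s k, \<theta> j)) \<in> measurable C (borel \<Otimes>\<^sub>M borel)"
  by (rule mC) (auto simp: space_pair_measure)
 have nnC: "(\<integral>\<^sup>+x. h x \<partial>C) = (\<integral>\<^sup>+k. \<integral>\<^sup>+j. ennreal (c k j) * h (k, j) \<partial>count_space UNIV \<partial>count_space UNIV)" for h
 proof -
  have "(\<integral>\<^sup>+x. h x \<partial>C) = (\<integral>\<^sup>+x. (case x of (k, j) \<Rightarrow> ennreal (c k j)) * h x \<partial>count_space UNIV)"
   unfolding C_def by (rule nn_integral_density) auto
  also have "\<dots> = (\<integral>\<^sup>+k. \<integral>\<^sup>+j. ennreal (c k j) * h (k, j) \<partial>count_space UNIV \<partial>count_space UNIV)"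
   by (subst nn_integral_fst_count_space[symmetric]) simp
  finally show ?thesis .
 qed
 have sum1: "(\<integral>\<^sup>+j. ennreal (c k j) \<partial>count_space UNIV) = (if k < K then ennreal (ws k) else 0)" for k
 proof -
  have "(\<lambda>j. c k j) sums ((if k < K then m k else 0) + a k * A / A)"
   unfolding c_def
  proof (rule sums_add)
   show "(\<lambda>j. if k < K \<and> j = \<sigma> k then m k else 0) sums (if k < K then m k else 0)"
    using sums_single[of "\<sigma> k" "\<lambda>_. m k"] by (cases "k < K") auto
   show "(\<lambda>j. a k * b j / A) sums (a k * A / A)"
    by (rule sums_divide[OF sums_mult[OF bs]])
  qed
  hence "(\<lambda>j. c k j) sums (if k < K then ws k else 0)"
   unfolding aA by (cases "k < K") (auto simp: a_def)
  hence "(\<Sum>j. ennreal (c k j)) = ennreal (if k < K then ws k else 0)"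
   using c0 by (intro suminf_ennreal_eq)
  thus ?thesis by (auto simp: nn_integral_count_space_nat)
 qed
 have sum2: "(\<integral>\<^sup>+k. ennreal (c k j) \<partial>count_space UNIV) = ennreal (w j)" for j
 proof -
  have "(\<lambda>k. c k j) sums (m (\<tau> j) + A * b j / A)"
   unfolding c_def
  proof (rule sums_add)
   have "(\<lambda>k. if k = \<tau> j then m k else 0) sums m (\<tau> j)" by (rule sums_single)
   moreover have "(\<lambda>k. if k = \<tau> j then m k else 0) = (\<lambda>k. if k < K \<and> j = \<sigma> k then m k else 0)"
   proof
    fix k
    have "k = \<tau> j \<longleftrightarrow> j = \<sigma> k" using \<tau> by metis
    thus "(if k = \<tau> j then m k else 0) = (if k < K \<and> j = \<sigma> k then m k else 0)" by (auto simp: m_def)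
   qed
   ultimately show "(\<lambda>k. if k < K \<and> j = \<sigma> k then m k else 0) sums m (\<tau> j)" by simp
   have "a sums A" unfolding A_def by (rule sums_finite) (auto simp: a_def)
   thus "(\<lambda>k. a k * b j / A) sums (A * b j / A)" by (intro sums_divide sums_mult2)
  qed
  also have "m (\<tau> j) + A * b j / A = w j" using bA[of j] by (simp add: b_def mult.commute)
  finally have "(\<Sum>k. ennreal (c k j)) = ennreal (w j)" using c0 by (intro suminf_ennreal_eq)
  thus ?thesis by (simp add: nn_integral_count_space_nat)
 qed
 have coup: "\<gamma> \<in> couplings (discrete_measure {..<K} ws \<theta>s) (discrete_measure UNIV w \<theta>)"
  unfolding couplings_def
 proof (intro CollectI conjI)
  show "sets \<gamma> = sets (borel \<Otimes>\<^sub>M borel)" by (simp add: \<gamma>_def)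
  have d1: "distr \<gamma> borel fst = distr C borel (\<lambda>(k, j). \<theta>s k)"
   unfolding \<gamma>_def by (subst distr_distr[OF _ map_meas]) (auto simp: comp_def split_beta')
  have d2: "distr \<gamma> borel snd = distr C borel (\<lambda>(k, j). \<theta> j)"
   unfolding \<gamma>_def by (subst distr_distr[OF _ map_meas]) (auto simp: comp_def split_beta')
  have em: "emeasure (distr C borel h) X = (\<integral>\<^sup>+k. \<integral>\<^sup>+j. ennreal (c k j) * indicator X (h (k, j)) \<partial>count_space UNIV \<partial>count_space UNIV)"
   if "X \<in> sets borel" for X and h :: "nat \<times> nat \<Rightarrow> 'a"
  proof -
   have hm: "h \<in> measurable C borel" by (rule mC) simp
   have "emeasure (distr C borel h) X = (\<integral>\<^sup>+x. indicator X x \<partial>distr C borel h)" using that by simp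
   also have "\<dots> = (\<integral>\<^sup>+x. indicator X (h x) \<partial>C)" using that hm by (intro nn_integral_distr) auto
   finally show ?thesis by (simp add: nnC)
  qed
  show "distr \<gamma> borel fst = discrete_measure {..<K} ws \<theta>s"
  proof (rule measure_eqI)
   fix X assume "X \<in> sets (distr \<gamma> borel fst)"
   hence X: "X \<in> sets borel" by simp
   have "emeasure (distr \<gamma> borel fst) X = (\<integral>\<^sup>+k. (if k < K then ennreal (ws k) else 0) * indicator X (\<theta>s k) \<partial>count_space UNIV)"
    unfolding d1 em[OF X] by (simp add: nn_integral_multc sum1)
   also have "\<dots> = (\<integral>\<^sup>+k. ennreal (ws k) * indicator X (\<theta>s k) * indicator {..<K} k \<partial>count_space UNIV)"
    by (intro nn_integral_cong) (auto split: split_indicator)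
   also have "\<dots> = emeasure (discrete_measure {..<K} ws \<theta>s) X"
    unfolding emeasure_discrete_measure[OF X] by (rule nn_integral_count_space_indicator[symmetric]) simp
   finally show "emeasure (distr \<gamma> borel fst) X = emeasure (discrete_measure {..<K} ws \<theta>s) X" .
  qed (simp add: discrete_measure_def)
  show "distr \<gamma> borel snd = discrete_measure UNIV w \<theta>"
  proof (rule measure_eqI)
   fix X assume "X \<in> sets (distr \<gamma> borel snd)"
   hence X: "X \<in> sets borel" by simp
   have "emeasure (distr \<gamma> borel snd) X = (\<integral>\<^sup>+j. \<integral>\<^sup>+k. ennreal (c k j) * indicator X (\<theta> j) \<partial>count_space UNIV \<partial>count_space UNIV)"
    unfolding d2 em[OF X]
    by (subst pair_sigma_finite.Fubini'[of "count_space UNIV" "count_space UNIV"])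
      (auto intro!: pair_sigma_finite.intro sigma_finite_measure_count_space simp: pair_measure_countable)
   also have "\<dots> = emeasure (discrete_measure UNIV w \<theta>) X"
    unfolding emeasure_discrete_measure[OF X] by (simp add: nn_integral_multc sum2)
   finally show "emeasure (distr \<gamma> borel snd) X = emeasure (discrete_measure UNIV w \<theta>) X" .
  qed (simp add: discrete_measure_def)
 qed
 have AK: "A \<le> real K * \<rho>"
 proof -
  have "A \<le> (\<Sum>k<K. \<rho>)" unfolding A_def using \<rho>(2) \<rho>(3)
   by (intro sum_mono) (auto simp: a_def m_def min_def abs_le_iff)
  thus ?thesis by simp
 qed
 have "(\<integral>\<^sup>+p. ennreal (norm (fst p - snd p)) \<partial>\<gamma>) = (\<integral>\<^sup>+x. ennreal (norm (\<theta>s (fst x) - \<theta> (snd x))) \<partial>C)"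
  unfolding \<gamma>_def by (subst nn_integral_distr[OF map_meas]) (auto simp: split_beta')
 also have "\<dots> = (\<integral>\<^sup>+k. \<integral>\<^sup>+j. ennreal (c k j) * ennreal (norm (\<theta>s k - \<theta> j)) \<partial>count_space UNIV \<partial>count_space UNIV)"
  by (simp add: nnC)
 also have "\<dots> \<le> (\<integral>\<^sup>+k. \<integral>\<^sup>+j. ennreal (if k < K \<and> j = \<sigma> k then m k * \<rho> else 0) + ennreal (a k * b j / A * L) \<partial>count_space UNIV \<partial>count_space UNIV)"
 proof (intro nn_integral_mono)
  fix k j :: nat
  have "c k j * norm (\<theta>s k - \<theta> j) \<le> (if k < K \<and> j = \<sigma> k then m k * \<rho> else 0) + a k * b j / A * L"
  proof (cases "k < K")
   case False
   thus ?thesis by (simp add: c_def a_def)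
  next
   case True
   have "a k * b j / A * norm (\<theta>s k - \<theta> j) \<le> a k * b j / A * L"
    using a0 b0 A0 L(1)[OF True] by (intro mult_left_mono) auto
   moreover have "(if k < K \<and> j = \<sigma> k then m k else 0) * norm (\<theta>s k - \<theta> j) \<le> (if k < K \<and> j = \<sigma> k then m k * \<rho> else 0)"
    using \<rho>(1)[OF True] m0 by (auto intro: mult_left_mono)
   ultimately show ?thesis unfolding c_def distrib_right by linarith
  qed
  moreover have "0 \<le> (if k < K \<and> j = \<sigma> k then m k * \<rho> else 0)" "0 \<le> a k * b j / A * L"
   using m0 \<rho>(3) a0 b0 A0 L(2) by auto
  ultimately show "ennreal (c k j) * ennreal (norm (\<theta>s k - \<theta> j)) \<le> ennreal (if k < K \<and> j = \<sigma> k then m k * \<rho> else 0) + ennreal (a k * b j / A * L)"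
   by (simp only: ennreal_mult''[symmetric] norm_ge_zero ennreal_plus[symmetric] ennreal_leI)
 qed
 also have "\<dots> = (\<integral>\<^sup>+k. ennreal (if k < K then m k * \<rho> else 0) + ennreal (a k * L) \<partial>count_space UNIV)"
 proof (intro nn_integral_cong)
  fix k :: nat
  have "(\<lambda>j. if k < K \<and> j = \<sigma> k then m k * \<rho> else 0) sums (if k < K then m k * \<rho> else 0)"
   using sums_single[of "\<sigma> k" "\<lambda>_. m k * \<rho>"] by (cases "k < K") auto
  hence "(\<Sum>j. ennreal (if k < K \<and> j = \<sigma> k then m k * \<rho> else 0)) = ennreal (if k < K then m k * \<rho> else 0)"
   using m0 \<rho>(3) by (intro suminf_ennreal_eq) auto
  moreover have "(\<lambda>j. a k * b j / A * L) sums (a k * A / A * L)"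
   by (intro sums_mult2 sums_divide sums_mult bs)
  hence "(\<Sum>j. ennreal (a k * b j / A * L)) = ennreal (a k * L)"
   using a0 b0 A0 L(2) unfolding aA by (intro suminf_ennreal_eq) auto
  ultimately show "(\<integral>\<^sup>+j. ennreal (if k < K \<and> j = \<sigma> k then m k * \<rho> else 0) + ennreal (a k * b j / A * L) \<partial>count_space UNIV) =
   ennreal (if k < K then m k * \<rho> else 0) + ennreal (a k * L)"
   by (subst nn_integral_add) (auto simp: nn_integral_count_space_nat)
 qed
 also have "\<dots> = ennreal ((\<Sum>k<K. m k) * \<rho>) + ennreal (A * L)"
 proof -
  have "(\<lambda>k. if k < K then m k * \<rho> else 0) sums (\<Sum>k<K. if k < K then m k * \<rho> else 0)" by (rule sums_finite) auto
  also have "(\<Sum>k<K. if k < K then m k * \<rho> else 0) = (\<Sum>k<K. m k) * \<rho>" by (simp add: sum_distrib_right)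
  finally have "(\<Sum>k. ennreal (if k < K then m k * \<rho> else 0)) = ennreal ((\<Sum>k<K. m k) * \<rho>)"
   using m0 \<rho>(3) by (intro suminf_ennreal_eq) auto
  moreover have "a sums A" unfolding A_def by (rule sums_finite) (auto simp: a_def)
  hence "(\<Sum>k. ennreal (a k * L)) = ennreal (A * L)"
   using a0 L(2) by (intro suminf_ennreal_eq sums_mult2) auto
  ultimately show ?thesis by (subst nn_integral_add) (auto simp: nn_integral_count_space_nat)
 qed
 also have "\<dots> \<le> ennreal (\<rho> + real K * \<rho> * L)"
 proof -
  have "(\<Sum>k<K. m k) * \<rho> \<le> 1 * \<rho>" using sm A0 \<rho>(3) by (intro mult_right_mono) auto
  moreover have "A * L \<le> real K * \<rho> * L" using AK L(2) by (rule mult_right_mono)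
  moreover have "0 \<le> (\<Sum>k<K. m k) * \<rho>" "0 \<le> A * L" using m0 \<rho>(3) A0 L(2) by (auto intro!: sum_nonneg mult_nonneg_nonneg)
  ultimately have "ennreal ((\<Sum>k<K. m k) * \<rho> + A * L) \<le> ennreal (\<rho> + real K * \<rho> * L)"
   "0 \<le> (\<Sum>k<K. m k) * \<rho>" "0 \<le> A * L" by (auto intro: ennreal_leI simp del: ennreal_plus)
  thus ?thesis by (simp only: ennreal_plus)
 qed
 finally show ?thesis unfolding wasserstein1_def by (rule INF_lower2[OF coup])
qed

section \<open>The posterior\<close>

context dirichlet_process
begin

lemma DP_prior_eq:
 "DP_prior \<alpha> P0 = distr prior ((\<Pi>\<^sub>M k\<in>UNIV. borel) \<Otimes>\<^sub>M (\<Pi>\<^sub>M k\<in>UNIV. borel)) (\<lambda>p. (stick_weights (fst p), snd p))"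
 unfolding DP_prior_def prior_def sticks_law_def atoms_law_def split_beta' ..

lemma sets_DP_prior: "sets (DP_prior \<alpha> P0) = sets ((\<Pi>\<^sub>M k\<in>UNIV. borel) \<Otimes>\<^sub>M (\<Pi>\<^sub>M k\<in>UNIV. borel))"
 by (simp add: DP_prior_eq)

lemma space_DP_prior [simp]: "space (DP_prior \<alpha> P0) = UNIV"
 using sets_eq_imp_space_eq[OF sets_DP_prior] by (simp add: space_pair_measure space_PiM)

lemma measurable_to_weights [measurable]:
 "(\<lambda>p. (stick_weights (fst p), snd p)) \<in> measurable prior ((\<Pi>\<^sub>M k\<in>UNIV. borel) \<Otimes>\<^sub>M (\<Pi>\<^sub>M k\<in>UNIV. borel))"
proof (rule measurable_Pair)
 show "(\<lambda>p. stick_weights (fst p)) \<in> measurable prior (\<Pi>\<^sub>M k\<in>UNIV. borel)"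
 proof (rule measurable_PiM_single')
  show "(\<lambda>p. stick_weights (fst p) i) \<in> borel_measurable prior" for i
   using measurable_compose[OF measurable_prior_fst measurable_stick_weights] .
 qed (auto simp: space_PiM)
 show "snd \<in> measurable prior (\<Pi>\<^sub>M k\<in>UNIV. borel)"
  using measurable_prior_snd unfolding measurable_cong_sets[OF refl sets_atoms_law] .
qed

end

section \<open>The posterior in stick coordinates\<close>

context mixture_model
begin

text \<open>Valid for all weights: an infinite sum is sent to 0 by \<open>enn2real\<close>, as is
  the integral of a function that is not integrable. This gives measurability of the likelihood on
  the whole space.\<close>

lemma mixture_eq_suminf:
 "mixture f (discrete_measure UNIV w \<theta>) x = enn2real (\<Sum>k. ennreal (max 0 (w k) * f (x - \<theta> k)))"
 unfolding mixture_discrete_measure[OF f_meas]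
 using f_nonneg by (subst integral_eq_nn_integral) (auto simp: nn_integral_count_space_nat)

lemma measurable_likelihood:
 "(\<lambda>p. likelihood f X n p) \<in> borel_measurable (DP_prior \<alpha> P0)"
proof -
 let ?M = "(\<Pi>\<^sub>M k\<in>UNIV. borel) \<Otimes>\<^sub>M (\<Pi>\<^sub>M k\<in>UNIV. borel) :: 'a sticks measure"
 have [measurable]: "(\<lambda>p. fst p k) \<in> borel_measurable ?M" "(\<lambda>p. snd p k) \<in> borel_measurable ?M" for k
  by (rule measurable_compose[OF measurable_fst measurable_component_singleton] measurable_compose[OF measurable_snd measurable_component_singleton]; simp)+
 have "(\<lambda>p. likelihood f X n p) \<in> borel_measurable ?M"
  unfolding likelihood_def split_beta' mixture_eq_suminf by measurable
 thus ?thesis unfolding measurable_cong_sets[OF sets_DP_prior refl] .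
qed

definition lik :: "nat \<Rightarrow> (nat \<Rightarrow> 'a) \<Rightarrow> 'a sticks \<Rightarrow> real" where
 "lik n X p = (\<Prod>i<n. dens p (X i))"

definition pull :: "'a sticks set \<Rightarrow> 'a sticks set" where
 "pull G = (\<lambda>p. (stick_weights (fst p), snd p)) -` G"

lemma sets_pull: "G \<in> sets (DP_prior \<alpha> P0) \<Longrightarrow> pull G \<in> sets prior"
 using measurable_sets[OF measurable_to_weights, of G] by (simp add: pull_def sets_DP_prior)

lemma measurable_lik [measurable (raw)]:
 assumes [measurable]: "g \<in> measurable N data_law" and [measurable]: "h \<in> measurable N prior"
 shows "(\<lambda>x. lik n (g x) (h x)) \<in> borel_measurable N"
 unfolding lik_def by measurable

lemma lik_bounds:
 assumes "regular p" shows "0 < lik n X p" "lik n X p \<le> F ^ n"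
proof -
 show "0 < lik n X p" unfolding lik_def using regular_dens(2)[OF assms] by (intro prod_pos) auto
 have "lik n X p \<le> (\<Prod>i<n. F)" unfolding lik_def using regular_dens(2,3)[OF assms]
  by (intro prod_mono) (auto intro: less_imp_le)
 thus "lik n X p \<le> F ^ n" by simp
qed

lemma likelihood_eq_lik: "regular p \<Longrightarrow> likelihood f X n (stick_weights (fst p), snd p) = lik n X p"
 unfolding likelihood_def lik_def by (simp add: regular_dens(4))

lemma integrable_lik:
 assumes [measurable]: "G \<in> sets prior"
 shows "integrable prior (\<lambda>p. indicator G p * lik n X p)"
proof (rule PR.integrable_const_bound)
 show "AE p in prior. norm (indicator G p * lik n X p) \<le> F ^ n"
  using AE_regular
 proof eventually_elim
  case (elim p)
  thus ?case using lik_bounds[OF elim, of n X] F_pos by (auto split: split_indicator)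
 qed
 show "(\<lambda>p. indicator G p * lik n X p) \<in> borel_measurable prior" by measurable
qed

lemma posterior_eq:
 assumes G: "G \<in> sets (DP_prior \<alpha> P0)"
 shows "posterior (DP_prior \<alpha> P0) f n X G = (\<integral>p. indicator (pull G) p * lik n X p \<partial>prior) / (\<integral>p. lik n X p \<partial>prior)"
proof -
 have lm: "likelihood f X n \<in> borel_measurable ((\<Pi>\<^sub>M k\<in>UNIV. borel) \<Otimes>\<^sub>M (\<Pi>\<^sub>M k\<in>UNIV. borel))"
  using measurable_likelihood[of X n] unfolding measurable_cong_sets[OF sets_DP_prior refl] .
 have gen: "(LINT p:H|DP_prior \<alpha> P0. likelihood f X n p) = (\<integral>p. indicator (pull H) p * lik n X p \<partial>prior)"
  if H: "H \<in> sets (DP_prior \<alpha> P0)" for H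
 proof -
  have [measurable]: "H \<in> sets ((\<Pi>\<^sub>M k\<in>UNIV. borel) \<Otimes>\<^sub>M (\<Pi>\<^sub>M k\<in>UNIV. borel))" using H by (simp add: sets_DP_prior)
  note [measurable] = lm sets_pull[OF H]
  have "(LINT p:H|DP_prior \<alpha> P0. likelihood f X n p) = (\<integral>p. indicator H (stick_weights (fst p), snd p) *\<^sub>R likelihood f X n (stick_weights (fst p), snd p) \<partial>prior)"
   unfolding set_lebesgue_integral_def DP_prior_eq by (rule integral_distr) measurable
  also have "\<dots> = (\<integral>p. indicator (pull H) p * lik n X p \<partial>prior)"
  proof (rule integral_cong_AE)
   show "AE p in prior. indicator H (stick_weights (fst p), snd p) *\<^sub>R likelihood f X n (stick_weights (fst p), snd p) = indicator (pull H) p * lik n X p"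
    using AE_regular by eventually_elim (simp add: likelihood_eq_lik pull_def indicator_def)
   show "(\<lambda>p. indicator H (stick_weights (fst p), snd p) *\<^sub>R likelihood f X n (stick_weights (fst p), snd p)) \<in> borel_measurable prior"
    using measurable_compose[OF measurable_to_weights lm] by measurable
  qed measurable
  finally show ?thesis .
 qed
 have "(LINT p|DP_prior \<alpha> P0. likelihood f X n p) = (LINT p:UNIV|DP_prior \<alpha> P0. likelihood f X n p)"
  by (simp add: set_lebesgue_integral_def)
 also have "\<dots> = (\<integral>p. indicator (pull UNIV) p * lik n X p \<partial>prior)"
  using sets.top[of "DP_prior \<alpha> P0"] by (intro gen) simp
 finally show ?thesis unfolding posterior_def gen[OF G] by (simp add: pull_def)
qed

lemma integral_lik_pos: "0 < (\<integral>p. lik n X p \<partial>prior)"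
proof -
 have i: "integrable prior (\<lambda>p. lik n X p)" using integrable_lik[of UNIV n X] sets.top[of prior] by simp
 have ae: "AE p in prior. 0 < lik n X p" using AE_regular by eventually_elim (rule lik_bounds)
 have nn: "0 \<le> (\<integral>p. lik n X p \<partial>prior)"
  by (rule integral_nonneg_AE) (use ae in \<open>auto elim: eventually_mono\<close>)
 moreover have "(\<integral>p. lik n X p \<partial>prior) \<noteq> 0"
 proof
  assume "(\<integral>p. lik n X p \<partial>prior) = 0"
  moreover have "AE p in prior. 0 \<le> lik n X p" using ae by eventually_elim simp
  ultimately have "AE p in prior. lik n X p = 0"
   using integral_nonneg_eq_0_iff_AE[OF i] by simp
  hence "AE p in prior. False" using ae by eventually_elim simp
  thus False using PR.AE_False by simp
 qed
 ultimately show ?thesis by simp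
qed

lemma measurable_posterior:
 assumes "G \<in> sets (DP_prior \<alpha> P0)"
 shows "(\<lambda>X. posterior (DP_prior \<alpha> P0) f n X G) \<in> borel_measurable data_law"
proof -
 note [measurable] = sets_pull[OF assms]
 show ?thesis unfolding posterior_eq[OF assms] by measurable
qed

lemma posterior_compl:
 assumes G: "G \<in> sets (DP_prior \<alpha> P0)"
 shows "posterior (DP_prior \<alpha> P0) f n X (- G) = 1 - posterior (DP_prior \<alpha> P0) f n X G"
proof -
 have Gc: "- G \<in> sets (DP_prior \<alpha> P0)" using sets.compl_sets[OF G] by (simp add: Compl_eq_Diff_UNIV)
 have "(\<integral>p. indicator (pull (- G)) p * lik n X p \<partial>prior) + (\<integral>p. indicator (pull G) p * lik n X p \<partial>prior) = (\<integral>p. lik n X p \<partial>prior)"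
  by (subst Bochner_Integration.integral_add[symmetric, OF integrable_lik[OF sets_pull[OF Gc]] integrable_lik[OF sets_pull[OF G]]])
    (auto intro!: Bochner_Integration.integral_cong simp: pull_def split: split_indicator)
 thus ?thesis
  using integral_lik_pos[of n X] unfolding posterior_eq[OF G] posterior_eq[OF Gc] by (simp add: field_simps)
qed

text \<open>Dividing by the likelihood of the truth turns the posterior probability of the
  complement into a quotient of \<open>evidence_on\<close> and \<open>evidence\<close>, the
  quantities bounded above.\<close>

lemma posterior_tendsto_1:
 assumes G: "\<And>n. G n \<in> sets (DP_prior \<alpha> P0)"
  and lim: "\<And>e. 0 < e \<Longrightarrow> (\<lambda>n. measure data_law {X. ennreal e * evidence n X <
    evidence_on (- pull (G n)) n X}) \<longlonglongrightarrow> 0"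
 shows "tendsto_in_prob data_law (\<lambda>n X. posterior (DP_prior \<alpha> P0) f n X (G n)) 1"
 unfolding tendsto_in_prob_def
proof (intro conjI allI impI)
 show "(\<lambda>X. posterior (DP_prior \<alpha> P0) f n X (G n)) \<in> borel_measurable data_law" for n
  by (rule measurable_posterior[OF G])
 fix e :: real assume e: "0 < e"
 have eq: "{X \<in> space data_law. \<bar>posterior (DP_prior \<alpha> P0) f n X (G n) - 1\<bar> > e} =
  {X. ennreal e * evidence n X < evidence_on (- pull (G n)) n X}" for n
 proof -
  have Gc: "- G n \<in> sets (DP_prior \<alpha> P0)" using sets.compl_sets[OF G[of n]] by (simp add: Compl_eq_Diff_UNIV)
  have "\<bar>posterior (DP_prior \<alpha> P0) f n X (G n) - 1\<bar> > e \<longleftrightarrow>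
   ennreal e * evidence n X < evidence_on (- pull (G n)) n X" for X
  proof -
   define L0 where "L0 = (\<Prod>i<n. true_dens (X i))"
   have L0: "0 < L0" unfolding L0_def using true_dens_pos by (intro prod_pos) auto
   define I where "I = (\<integral>p. lik n X p \<partial>prior)"
   define J where "J = (\<integral>p. indicator (pull (- G n)) p * lik n X p \<partial>prior)"
   have I: "0 < I" unfolding I_def by (rule integral_lik_pos)
   have ratio: "evidence_on H n X = ennreal ((\<integral>p. indicator H p * lik n X p \<partial>prior) / L0)"
    "0 \<le> (\<integral>p. indicator H p * lik n X p \<partial>prior)" if [measurable]: "H \<in> sets prior" for H
   proof -
    have nn: "AE p in prior. 0 \<le> indicator H p * lik n X p"
     using AE_regular by eventually_elim (use lik_bounds(1) in \<open>auto split: split_indicator intro: less_imp_le\<close>)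
    thus "0 \<le> (\<integral>p. indicator H p * lik n X p \<partial>prior)" by (rule integral_nonneg_AE)
    have "evidence_on H n X = (\<integral>\<^sup>+p. ennreal (indicator H p * lik n X p / L0) \<partial>prior)"
     by (intro nn_integral_cong) (auto simp: lik_ratio_def lik_def L0_def prod_dividef split: split_indicator)
    also have "\<dots> = ennreal (\<integral>p. indicator H p * lik n X p / L0 \<partial>prior)"
     using nn L0 integrable_lik[OF that, of n X] by (intro nn_integral_eq_integral) (auto elim!: eventually_mono)
    finally show "evidence_on H n X = ennreal ((\<integral>p. indicator H p * lik n X p \<partial>prior) / L0)" by simp
   qed
   have U: "evidence_on (- pull (G n)) n X = ennreal (J / L0)" and J: "0 \<le> J"
    using ratio[OF sets_pull[OF Gc]] by (simp_all add: J_def pull_def vimage_Compl)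
   have Z: "evidence n X = ennreal (I / L0)"
    using ratio(1)[of UNIV] sets.top[of prior] by (simp add: I_def)
   have "posterior (DP_prior \<alpha> P0) f n X (G n) - 1 = - (J / I)"
    using posterior_compl[OF G, of n X n] posterior_eq[OF Gc, of n X] by (simp add: I_def J_def)
   hence "\<bar>posterior (DP_prior \<alpha> P0) f n X (G n) - 1\<bar> = J / I" using I J by simp
   moreover have "e < J / I \<longleftrightarrow> e * (I / L0) < J / L0"
    using I L0 by (simp add: pos_less_divide_eq divide_less_cancel)
   moreover have "ennreal e * ennreal (I / L0) < ennreal (J / L0) \<longleftrightarrow> e * (I / L0) < J / L0"
    using e I J L0 by (simp add: ennreal_mult'[symmetric] ennreal_less_iff)
   ultimately show ?thesis unfolding U Z by simp
  qed
  thus ?thesis by simp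
 qed
 show "(\<lambda>n. measure data_law {X \<in> space data_law. \<bar>posterior (DP_prior \<alpha> P0) f n X (G n) - 1\<bar> > e}) \<longlonglongrightarrow> 0"
  unfolding eq by (rule lim[OF e])
qed

section \<open>From finitely many tests to two-sided bounds on means\<close>

lemma test_dual_bounded:
 assumes "test_dual f \<phi>" obtains B where "\<And>\<theta>. \<bar>\<phi> \<theta>\<bar> \<le> B"
proof -
 obtain g B where g: "g \<in> borel_measurable borel" "\<And>x. \<bar>g x\<bar> \<le> B" "\<And>\<theta>. \<phi> \<theta> = (\<integral>x. g x * f (x - \<theta>) \<partial>lborel)"
  using assms unfolding test_dual_def by blast
 have "\<bar>\<phi> \<theta>\<bar> \<le> B" for \<theta>
 proof -
  have fs: "integrable lborel (\<lambda>x. f (x - \<theta>))" by (rule integrable_lborel_shift) simp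
  have "\<bar>\<phi> \<theta>\<bar> \<le> (\<integral>x. \<bar>g x * f (x - \<theta>)\<bar> \<partial>lborel)" unfolding g(3) by (rule integral_abs_bound)
  also have "\<dots> \<le> (\<integral>x. B * f (x - \<theta>) \<partial>lborel)"
  proof (rule integral_mono)
   show "integrable lborel (\<lambda>x. \<bar>g x * f (x - \<theta>)\<bar>)"
    by (intro integrable_abs integrable_bounded_mult[OF g(1,2)] fs)
   show "\<bar>g x * f (x - \<theta>)\<bar> \<le> B * f (x - \<theta>)" for x
    using g(2)[of x] f_nonneg[of "x - \<theta>"] by (simp add: abs_mult mult_right_mono)
  qed (use fs in simp)
  also have "\<dots> = B" using integral_lborel_shift[of f "- \<theta>"] f_1 by (simp add: algebra_simps)
  finally show ?thesis .
 qed
 thus thesis by (rule that)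
qed

text \<open>Each preimage is used together with its negative, so that one-sided tests give two-sided
  bounds.\<close>

lemma finite_tests:
 assumes "finite \<Phi>" "\<And>\<phi>. \<phi> \<in> \<Phi> \<Longrightarrow> test_dual f \<phi>"
 obtains \<G> b where "finite \<G>" "0 < b" "\<And>g. g \<in> \<G> \<Longrightarrow> g \<in> borel_measurable borel" "\<And>g x. g \<in> \<G> \<Longrightarrow> \<bar>g x\<bar> \<le> b"
  "\<And>p \<tau>. regular p \<Longrightarrow> (\<And>g. g \<in> \<G> \<Longrightarrow> mean_dens g p \<le> mean_true g + 2 * \<tau>) \<Longrightarrow>
   (\<forall>\<phi>\<in>\<Phi>. \<bar>sp_mean \<phi> (fst p) (snd p) - (\<Sum>k<K. ws k * \<phi> (\<theta>s k))\<bar> \<le> 2 * \<tau>)"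
proof -
 have "\<forall>\<phi>\<in>\<Phi>. \<exists>g B. g \<in> borel_measurable borel \<and> (\<forall>x. \<bar>g x\<bar> \<le> B) \<and> (\<forall>\<theta>. \<phi> \<theta> = (\<integral>x. g x * f (x - \<theta>) \<partial>lborel))"
  using assms(2) unfolding test_dual_def by blast
 then obtain g B where g: "\<And>\<phi>. \<phi> \<in> \<Phi> \<Longrightarrow> g \<phi> \<in> borel_measurable borel" "\<And>\<phi> x. \<phi> \<in> \<Phi> \<Longrightarrow> \<bar>g \<phi> x\<bar> \<le> B \<phi>"
  "\<And>\<phi> \<theta>. \<phi> \<in> \<Phi> \<Longrightarrow> \<phi> \<theta> = (\<integral>x. g \<phi> x * f (x - \<theta>) \<partial>lborel)" by metis
 define b where "b = 1 + (\<Sum>\<phi>\<in>\<Phi>. \<bar>B \<phi>\<bar>)"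
 have b: "0 < b" "\<And>\<phi>. \<phi> \<in> \<Phi> \<Longrightarrow> \<bar>B \<phi>\<bar> \<le> b"
 proof -
  show "0 < b" unfolding b_def by (intro add_pos_nonneg sum_nonneg) auto
  show "\<bar>B \<phi>\<bar> \<le> b" if "\<phi> \<in> \<Phi>" for \<phi>
   unfolding b_def using member_le_sum[of \<phi> \<Phi> "\<lambda>\<phi>. \<bar>B \<phi>\<bar>"] that assms(1) by simp
 qed
 show thesis
 proof (rule that[of "g ` \<Phi> \<union> (\<lambda>\<phi> x. - g \<phi> x) ` \<Phi>" b])
  show "finite (g ` \<Phi> \<union> (\<lambda>\<phi> x. - g \<phi> x) ` \<Phi>)" using assms(1) by simp
  show "0 < b" by (rule b)
  show "k \<in> borel_measurable borel" if "k \<in> g ` \<Phi> \<union> (\<lambda>\<phi> x. - g \<phi> x) ` \<Phi>" for k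
   using that g(1) by auto
  show "\<bar>k x\<bar> \<le> b" if k: "k \<in> g ` \<Phi> \<union> (\<lambda>\<phi> x. - g \<phi> x) ` \<Phi>" for k x
  proof -
   obtain \<phi> where "\<phi> \<in> \<Phi>" "\<bar>k x\<bar> = \<bar>g \<phi> x\<bar>" using k by auto
   thus ?thesis using g(2)[of \<phi> x] b(2)[of \<phi>] by linarith
  qed
  fix p and \<tau> :: real assume p: "regular p" and t: "\<And>k. k \<in> g ` \<Phi> \<union> (\<lambda>\<phi> x. - g \<phi> x) ` \<Phi> \<Longrightarrow> mean_dens k p \<le> mean_true k + 2 * \<tau>"
  show "\<forall>\<phi>\<in>\<Phi>. \<bar>sp_mean \<phi> (fst p) (snd p) - (\<Sum>k<K. ws k * \<phi> (\<theta>s k))\<bar> \<le> 2 * \<tau>"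
  proof
   fix \<phi> assume \<phi>: "\<phi> \<in> \<Phi>"
   have 1: "mean_dens (g \<phi>) p = sp_mean \<phi> (fst p) (snd p)"
    unfolding mean_dens_def integral_dens_mult[OF p g(1,2)[OF \<phi>]] by (simp only: g(3)[OF \<phi>, symmetric])
   have 2: "mean_true (g \<phi>) = (\<Sum>k<K. ws k * \<phi> (\<theta>s k))"
    unfolding mean_true_def integral_true_dens_mult[OF g(1,2)[OF \<phi>]] by (simp only: g(3)[OF \<phi>, symmetric])
   have "mean_dens (\<lambda>x. - g \<phi> x) p = - mean_dens (g \<phi>) p" "mean_true (\<lambda>x. - g \<phi> x) = - mean_true (g \<phi>)"
    by (simp_all add: mean_dens_def mean_true_def)
   moreover have "mean_dens (\<lambda>x. - g \<phi> x) p \<le> mean_true (\<lambda>x. - g \<phi> x) + 2 * \<tau>" using \<phi> by (intro t) blast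
   moreover have "mean_dens (g \<phi>) p \<le> mean_true (g \<phi>) + 2 * \<tau>" using \<phi> by (intro t) blast
   ultimately show "\<bar>sp_mean \<phi> (fst p) (snd p) - (\<Sum>k<K. ws k * \<phi> (\<theta>s k))\<bar> \<le> 2 * \<tau>"
    using 1 2 by (simp add: abs_le_iff)
  qed
 qed
qed

end

text \<open>The comparison is needed at the atoms only, so it applies to estimates valid on
  \<open>\<Theta>\<close>.\<close>

lemma sp_mean_diff_le:
 assumes v: "proper v" and b: "\<And>x. \<bar>\<phi> x\<bar> \<le> b1" "\<And>x. \<bar>\<psi> x\<bar> \<le> b2" "\<And>x. \<bar>q x\<bar> \<le> b3"
  and le: "\<And>j. \<bar>\<phi> (\<theta> j) - \<psi> (\<theta> j)\<bar> \<le> C * q (\<theta> j)"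
 shows "\<bar>sp_mean \<phi> v \<theta> - sp_mean \<psi> v \<theta>\<bar> \<le> C * sp_mean q v \<theta>"
proof -
 note s = summable_sp_mean[OF v, where \<theta> = \<theta>, OF b(1)] summable_sp_mean[OF v, where \<theta> = \<theta>, OF b(2)]
  summable_sp_mean[OF v, where \<theta> = \<theta>, OF b(3)]
 let ?d = "\<lambda>j. stick_weights v j * \<phi> (\<theta> j) - stick_weights v j * \<psi> (\<theta> j)"
 have bd: "\<bar>?d j\<bar> \<le> C * (stick_weights v j * q (\<theta> j))" for j
 proof -
  have "\<bar>?d j\<bar> = stick_weights v j * \<bar>\<phi> (\<theta> j) - \<psi> (\<theta> j)\<bar>"
   using stick_weights_pos[OF v, of j] by (simp add: abs_mult flip: right_diff_distrib)
  also have "\<dots> \<le> stick_weights v j * (C * q (\<theta> j))" using stick_weights_pos[OF v, of j] le[of j] by (intro mult_left_mono) auto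
  finally show ?thesis by (simp add: mult_ac)
 qed
 have sa: "summable (\<lambda>j. \<bar>?d j\<bar>)"
  by (rule summable_comparison_test'[OF summable_mult[OF s(3), of C]]) (use bd in simp)
 have "sp_mean \<phi> v \<theta> - sp_mean \<psi> v \<theta> = (\<Sum>j. ?d j)"
  unfolding sp_mean_def by (rule suminf_diff[OF s(1,2)])
 also have "\<bar>\<dots>\<bar> \<le> (\<Sum>j. \<bar>?d j\<bar>)" by (rule summable_rabs[OF sa])
 also have "\<dots> \<le> (\<Sum>j. C * (stick_weights v j * q (\<theta> j)))" by (rule suminf_le[OF bd sa summable_mult[OF s(3)]])
 also have "\<dots> = C * sp_mean q v \<theta>" unfolding sp_mean_def by (rule suminf_mult[OF s(3)])
 finally show ?thesis .
qed

section \<open>Rates\<close>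

lemma powr_exp_tendsto_0:
 fixes L \<sigma> p :: real
 assumes L: "0 < L" and \<sigma>: "0 < \<sigma>"
 shows "(\<lambda>n. real n powr p * exp (- (L * real n powr \<sigma>))) \<longlonglongrightarrow> 0"
proof -
 define k where "k = nat \<lceil>p / \<sigma>\<rceil>"
 have k: "p \<le> \<sigma> * real k"
  using real_nat_ceiling_ge[of "p / \<sigma>"] \<sigma> by (simp add: k_def pos_divide_le_eq mult.commute)
 define y where "y n = L * real n powr \<sigma>" for n
 have "filterlim y at_top sequentially"
  unfolding y_def using L \<sigma>
  by (intro filterlim_tendsto_pos_mult_at_top[OF tendsto_const] filterlim_compose[OF real_powr_at_top filterlim_real_sequentially]) auto
 hence "(\<lambda>n. y n ^ k / exp (y n)) \<longlonglongrightarrow> 0" by (rule filterlim_compose[OF tendsto_power_div_exp_0])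
 hence lim: "(\<lambda>n. 1 / L ^ k * (y n ^ k / exp (y n))) \<longlonglongrightarrow> 0" by (rule tendsto_mult_right_zero)
 show ?thesis
 proof (rule tendsto_sandwich[OF _ _ tendsto_const lim])
  show "\<forall>\<^sub>F n in sequentially. real n powr p * exp (- (L * real n powr \<sigma>)) \<le> 1 / L ^ k * (y n ^ k / exp (y n))"
   using eventually_ge_at_top[of 1]
  proof eventually_elim
   case (elim n)
   have "real n powr p \<le> real n powr (\<sigma> * real k)" using elim k by (intro powr_mono) auto
   also have "\<dots> = (real n powr \<sigma>) ^ k" using elim by (simp add: powr_powr[symmetric] powr_realpow)
   also have "\<dots> = 1 / L ^ k * y n ^ k" using L by (simp add: y_def power_mult_distrib)
   finally have "real n powr p * exp (- y n) \<le> 1 / L ^ k * y n ^ k * exp (- y n)" by (intro mult_right_mono) auto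
   thus ?case by (simp add: y_def exp_minus field_simps)
  qed
 qed simp
qed

lemma real_powr_tendsto_0: "e < 0 \<Longrightarrow> (\<lambda>n. real n powr e) \<longlonglongrightarrow> 0"
 by (rule tendsto_neg_powr[OF _ filterlim_real_sequentially])

context true_mixture_prior
begin

lemma prior_exponent_pos: "0 < prior_exponent"
 using K_pos \<alpha>_pos by (auto simp: prior_exponent_def intro: add_nonneg_pos add_pos_nonneg)

text \<open>The budget of exponents. Considering about \<open>real n powr \<sigma>\<close> positions
  makes the tail smaller than every power of \<open>n\<close>, while reordering costs
  \<open>real n powr ((2 * real K + m) * \<sigma>)\<close>. The gain is
  \<open>real n powr (- (\<delta>2 - \<delta>1) / 8)\<close>, so \<open>\<sigma>\<close>,
  \<open>\<delta>1\<close> and \<open>\<eta>\<close> are chosen small compared with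
  \<open>\<delta>2\<close>.\<close>

lemma prior_near_rate:
 assumes \<delta>2: "0 < \<delta>2" "\<delta>2 \<le> 1 / (4 * (prior_exponent + 1))" and c1: "0 < c1"
 obtains \<delta>1 \<eta> u where "0 < \<delta>1" "\<delta>1 < \<delta>2" "0 < \<eta>" "\<And>n. 0 \<le> u n"
  "(\<lambda>n. u n * real n powr (prior_exponent / 2 + \<eta>)) \<longlonglongrightarrow> 0"
  "\<forall>\<^sub>F n in sequentially. emeasure prior {p. proper (fst p) \<and> near (c1 * real n powr (-1/2 + \<delta>1)) (fst p) (snd p) \<and>
    real n powr (-1/2 + \<delta>2) < rem_mass (fst p) K} \<le> ennreal (u n)"
proof -
 obtain D m where Dm: "D > 0" "m \<ge> 0" and bound:
  "\<And>n c \<epsilon> \<rho> \<zeta>. 0 < n \<Longrightarrow> 0 < c \<Longrightarrow> c \<le> w_min / (4 * real n) \<Longrightarrow> 0 < \<epsilon> \<Longrightarrow> \<epsilon> \<le> \<rho> \<Longrightarrow>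
   (1 + 2 * b) * \<rho> / c \<le> w_min / 2 \<Longrightarrow> 0 \<le> \<zeta> \<Longrightarrow>
   (\<And>l. \<rho> < (real l + 1) * \<epsilon> \<Longrightarrow> (real l + 1) powr (-1/8) \<le> \<zeta>) \<Longrightarrow>
   emeasure prior {p. proper (fst p) \<and> near \<epsilon> (fst p) (snd p) \<and> \<rho> < rem_mass (fst p) K} \<le>
    ennreal (tail_bound n + real n ^ K / c ^ K * (D * c powr (- m) * \<epsilon> powr prior_exponent * \<zeta>) +
     real K * (2 * \<alpha> * (\<rho> / c)) *
      (tail_bound n + real n ^ K / c ^ K * (D * c powr (- m) * ((1 + 2 * b) * \<rho> / c) powr prior_exponent)))"
  by (rule prior_near_bound) blast
 define s where "s = prior_exponent"
 have s: "0 < s" unfolding s_def by (rule prior_exponent_pos)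
 \<comment> \<open>The exponent gained, up to the part with \<open>\<delta>1\<close>. The choices of
   \<open>\<sigma>\<close> and \<open>\<delta>1\<close> let reordering and the tolerance of the
   tests each consume at most a quarter of it.\<close>
 define \<kappa> where "\<kappa> = \<delta>2 / 8"
 define M where "M = 2 * real K + m + 1 + s"
 have M: "1 \<le> M" using Dm s by (simp add: M_def)
 define \<sigma> where "\<sigma> = \<kappa> / (4 * M)"
 define \<delta>1 where "\<delta>1 = \<kappa> / 4 / (s + 1)"
 define \<eta> where "\<eta> = \<kappa> / 8"
 have \<kappa>: "0 < \<kappa>" using \<delta>2 by (simp add: \<kappa>_def)
 have \<sigma>: "0 < \<sigma>" "M * \<sigma> = \<kappa> / 4" using \<kappa> M by (simp_all add: \<sigma>_def)
 have "s + 1 \<noteq> 0" using s by simp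
 hence "\<delta>1 * (s + 1) = \<kappa> / 4" using nonzero_eq_divide_eq[of "s + 1" \<delta>1 "\<kappa> / 4"] \<delta>1_def by blast
 moreover have "0 < \<delta>1" using \<kappa> s by (simp add: \<delta>1_def)
 ultimately have \<delta>1: "0 < \<delta>1" "(s + 1) * \<delta>1 = \<kappa> / 4" by (simp_all only: mult.commute)
 have \<eta>: "0 < \<eta>" using \<kappa> by (simp add: \<eta>_def)
 have \<delta>2s: "(s + 1) * \<delta>2 \<le> 1 / 4" using \<delta>2(2) s by (simp add: s_def[symmetric] pos_le_divide_eq mult_ac)
 have "1 * \<delta>2 \<le> (s + 1) * \<delta>2" using \<delta>2 s by (intro mult_right_mono) auto
 hence \<delta>2': "\<delta>2 \<le> 1 / 4" using \<delta>2s by simp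
 have "1 * \<delta>1 \<le> (s + 1) * \<delta>1" using \<delta>1 s by (intro mult_right_mono) auto
 hence \<delta>1': "\<delta>1 \<le> \<kappa> / 4" using \<delta>1(2) by simp
 have "1 * \<sigma> \<le> M * \<sigma>" using \<sigma> M by (intro mult_right_mono) auto
 hence \<sigma>': "\<sigma> \<le> \<kappa> / 4" using \<sigma>(2) by simp
 have M\<sigma>: "(2 * real K + m) * \<sigma> + \<sigma> + s * \<sigma> = \<kappa> / 4" using \<sigma>(2) by (simp add: M_def algebra_simps)
 have s\<delta>1: "s * \<delta>1 \<le> \<kappa> / 4" using \<delta>1 by (simp add: algebra_simps)
 have s\<delta>2: "s * \<delta>2 + \<delta>2 \<le> 1 / 4" using \<delta>2s by (simp add: algebra_simps)
 have s\<sigma>: "0 \<le> s * \<sigma>" using s \<sigma> by simp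
 define L where "L = - ln (\<alpha> / (\<alpha> + 1))"
 have L: "0 < L" using \<alpha>_pos by (simp add: L_def ln_div)
 define w where "w = w_min"
 have w: "0 < w" "w \<le> 1" unfolding w_def by (rule w_min_pos w_min_le_1)+
 define x where "x n = real n powr \<sigma>" for n :: nat
 define J where "J n = nat \<lceil>x n\<rceil>" for n
 define c where "c n = w / 8 * real n powr (- \<sigma>)" for n :: nat
 define \<epsilon> where "\<epsilon> n = c1 * real n powr (-1/2 + \<delta>1)" for n :: nat
 define \<rho> where "\<rho> n = real n powr (-1/2 + \<delta>2)" for n :: nat
 \<comment> \<open>The exponents of the reordered term with its gain, of \<open>\<rho> / c\<close>,
   and of the mass that remains after deleting a light atom.\<close>
 define p1 where "p1 = (2 * real K + m) * \<sigma> + s * (-1/2 + \<delta>1) + - (\<delta>2 - \<delta>1) / 8"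
 define p2 where "p2 = -1/2 + \<delta>2 + \<sigma>"
 define p3 where "p3 = (2 * real K + m) * \<sigma> + s * p2"
 define C0 where "C0 = 4 / w"
 define C1 where "C1 = (16 / w) ^ K * (D * (w / 8) powr (- m))"
 define C2 where "C2 = real K * (2 * \<alpha> * (8 / w))"
 define Z where "Z n = exp (- (L * x n))" for n
 define C1' where "C1' = C1 * c1 powr s * c1 powr (1/8)"
 define C3' where "C3' = C1 * ((1 + 2 * b) * (8 / w)) powr s"
 define u where "u n = C0 * Z n + C1' * real n powr p1 + C2 * real n powr p2 * (C0 * Z n + C3' * real n powr p3)" for n :: nat
 have C: "0 \<le> C0" "0 \<le> C1" "0 \<le> C2" "0 \<le> C1'" "0 \<le> C3'" "\<And>n. 0 \<le> Z n"
  using w Dm c1 \<alpha>_pos by (auto simp: C0_def C1_def C2_def C1'_def C3'_def Z_def intro!: mult_nonneg_nonneg)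
 have p2: "p2 < 0" using \<delta>2' \<sigma>' \<kappa>_def by (simp add: p2_def)
 define t where "t = s / 2 + \<eta>"
 have p1t: "p1 + t < 0"
 proof -
  have "p1 = (2 * real K + m) * \<sigma> + s * \<delta>1 - s / 2 - \<delta>2 / 8 + \<delta>1 / 8"
   unfolding p1_def by (simp add: algebra_simps diff_divide_distrib)
  thus ?thesis using M\<sigma> s\<delta>1 s\<sigma> \<sigma>(1) \<delta>1' \<kappa> \<kappa>_def t_def \<eta>_def by linarith
 qed
 \<comment> \<open>Deletion brings nearly a full factor \<open>real n powr (-1/2)\<close>; the upper
   bound assumed for \<open>\<delta>2\<close> keeps the wider tolerance from consuming it.\<close>
 have p3t: "p2 + p3 + t < 0"
  using M\<sigma> s\<delta>2 \<delta>2' \<kappa>_def \<kappa> unfolding p3_def p2_def t_def \<eta>_def by (simp add: algebra_simps)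
 have lim: "(\<lambda>n. u n * real n powr t) \<longlonglongrightarrow> 0"
 proof -
  have "(\<lambda>n. C0 * (real n powr t * exp (- (L * real n powr \<sigma>))) + C1' * real n powr (p1 + t) +
    C2 * (C0 * (real n powr (p2 + t) * exp (- (L * real n powr \<sigma>))) + C3' * real n powr (p2 + p3 + t)))
   \<longlonglongrightarrow> C0 * 0 + C1' * 0 + C2 * (C0 * 0 + C3' * 0)"
   by (intro tendsto_intros powr_exp_tendsto_0 real_powr_tendsto_0 L \<sigma> p1t p3t)
  moreover have "u n * real n powr t = C0 * (real n powr t * exp (- (L * real n powr \<sigma>))) + C1' * real n powr (p1 + t) +
    C2 * (C0 * (real n powr (p2 + t) * exp (- (L * real n powr \<sigma>))) + C3' * real n powr (p2 + p3 + t))" for n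
   unfolding u_def Z_def x_def powr_add by algebra
  ultimately show ?thesis by (simp only: mult_zero_right add_0_right)
 qed
 have ev1: "\<forall>\<^sub>F n in sequentially. c1 * real n powr (\<delta>1 - \<delta>2) < 1"
 proof (rule order_tendstoD(2))
  show "(\<lambda>n. c1 * real n powr (\<delta>1 - \<delta>2)) \<longlonglongrightarrow> c1 * 0"
   using \<delta>1' \<kappa>_def \<delta>2 by (intro tendsto_intros real_powr_tendsto_0) simp
 qed simp
 have ev2: "\<forall>\<^sub>F n in sequentially. (1 + 2 * b) * (8 / w) * real n powr p2 < w / 2"
 proof (rule order_tendstoD(2))
  show "(\<lambda>n. (1 + 2 * b) * (8 / w) * real n powr p2) \<longlonglongrightarrow> (1 + 2 * b) * (8 / w) * 0"
   by (intro tendsto_intros real_powr_tendsto_0 p2)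
 qed (use w in simp)
 show thesis
 proof (rule that)
  show "0 < \<delta>1" "0 < \<eta>" by (rule \<delta>1 \<eta>)+
  show "\<delta>1 < \<delta>2" using \<delta>1' \<kappa>_def \<delta>2 by simp
  show "0 \<le> u n" for n unfolding u_def using C by (intro add_nonneg_nonneg mult_nonneg_nonneg) auto
  show "(\<lambda>n. u n * real n powr (prior_exponent / 2 + \<eta>)) \<longlonglongrightarrow> 0" using lim by (simp add: t_def s_def)
  show "\<forall>\<^sub>F n in sequentially. emeasure prior {p. proper (fst p) \<and> near (c1 * real n powr (-1/2 + \<delta>1)) (fst p) (snd p) \<and>
    real n powr (-1/2 + \<delta>2) < rem_mass (fst p) K} \<le> ennreal (u n)"
   using ev1 ev2 eventually_ge_at_top[of 1]
  proof eventually_elim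
   case (elim n)
   have n0: "0 < real n" "1 \<le> real n" using elim by auto
   have x1: "1 \<le> x n" using n0 \<sigma> by (simp add: x_def ge_one_powr_ge_zero)
   have J: "x n \<le> real (J n)" "real (J n) \<le> 2 * x n" "0 < J n"
   proof -
    have "real (J n) = of_int \<lceil>x n\<rceil>" using x1 by (simp add: J_def)
    thus "x n \<le> real (J n)" "real (J n) \<le> 2 * x n" using x1 le_of_int_ceiling[of "x n"] of_int_ceiling_le_add_one[of "x n"] by linarith+
    thus "0 < J n" using x1 by simp
   qed
   have cx: "c n = w / (8 * x n)" by (simp add: c_def x_def powr_minus_divide)
   have c0: "0 < c n" using w x1 by (simp add: cx)
   have cJ: "c n \<le> w / (4 * real (J n))" unfolding cx using J w x1 by (intro divide_left_mono) auto
   define \<zeta> where "\<zeta> = (\<rho> n / \<epsilon> n) powr (-1/8)"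
   have \<epsilon>0: "0 < \<epsilon> n" "0 < \<rho> n" using c1 n0 by (auto simp: \<epsilon>_def \<rho>_def)
   have \<epsilon>\<rho>: "\<epsilon> n \<le> \<rho> n"
   proof -
    have "\<epsilon> n = c1 * real n powr (\<delta>1 - \<delta>2) * \<rho> n" by (simp add: \<epsilon>_def \<rho>_def mult.assoc powr_add[symmetric])
    also have "\<dots> \<le> 1 * \<rho> n" using elim \<epsilon>0 by (intro mult_right_mono) auto
    finally show ?thesis by simp
   qed
   have \<rho>c: "\<rho> n / c n = 8 / w * real n powr p2"
   proof -
    have "real n powr p2 = real n powr (-1/2 + \<delta>2) / real n powr (- \<sigma>)" by (simp add: p2_def flip: powr_diff)
    thus ?thesis by (simp add: \<rho>_def c_def)
   qed
   have \<rho>c': "(1 + 2 * b) * \<rho> n / c n = (1 + 2 * b) * (8 / w) * real n powr p2"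
    by (simp only: times_divide_eq_right[symmetric] \<rho>c mult.assoc)
   have gain: "(real l + 1) powr (-1/8) \<le> \<zeta>" if "\<rho> n < (real l + 1) * \<epsilon> n" for l
    unfolding \<zeta>_def using that \<epsilon>0 by (intro powr_mono2') (auto simp: pos_divide_le_eq)
   have \<zeta>: "\<zeta> = c1 powr (1/8) * real n powr (- (\<delta>2 - \<delta>1) / 8)"
   proof -
    have "real n powr (\<delta>2 - \<delta>1) = real n powr (-1/2 + \<delta>2) / real n powr (-1/2 + \<delta>1)"
     unfolding powr_diff[symmetric] by simp
    hence "\<rho> n / \<epsilon> n = real n powr (\<delta>2 - \<delta>1) / c1"
     unfolding \<rho>_def \<epsilon>_def by (simp only: divide_divide_eq_left mult.commute)
    hence "\<zeta> = (real n powr (\<delta>2 - \<delta>1)) powr (-1/8) / c1 powr (-1/8)"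
     unfolding \<zeta>_def by (simp only: powr_divide)
    also have "(real n powr (\<delta>2 - \<delta>1)) powr (-1/8) = real n powr (- (\<delta>2 - \<delta>1) / 8)"
     unfolding powr_powr by (rule arg_cong[where f = "\<lambda>z. real n powr z"]) (simp only: minus_divide_left[symmetric] mult_minus_right mult_minus_left times_divide_eq_right mult_1_right)
    also have "\<dots> / c1 powr (-1/8) = c1 powr (1/8) * real n powr (- (\<delta>2 - \<delta>1) / 8)"
    proof -
     have "c1 powr (1/8) * c1 powr (-1/8) = 1" using c1 by (simp flip: powr_add)
     hence "1 / c1 powr (-1/8) = c1 powr (1/8)" using c1 nonzero_eq_divide_eq[of "c1 powr (-1/8)" "c1 powr (1/8)" 1] by simp
     thus ?thesis by (simp only: divide_inverse mult_1 mult.commute)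
    qed
    finally show ?thesis .
   qed
   have tail: "tail_bound (J n) \<le> C0 * Z n"
   proof -
    have "(\<alpha> / (\<alpha> + 1)) ^ J n = exp (- (L * real (J n)))"
     using \<alpha>_pos exp_of_nat_mult[of "J n" "ln (\<alpha> / (\<alpha> + 1))"] by (simp add: L_def mult.commute)
    also have "\<dots> \<le> Z n" unfolding Z_def using J L by simp
    finally show ?thesis using w unfolding tail_bound_def C0_def w_def[symmetric] by (simp add: field_simps)
   qed
   have front: "real (J n) ^ K / c n ^ K * (D * c n powr (- m)) \<le> C1 * real n powr ((2 * real K + m) * \<sigma>)"
   proof -
    have "real (J n) ^ K / c n ^ K \<le> (16 / w * (x n)\<^sup>2) ^ K"
     unfolding power_divide[symmetric] using J c0 w x1
     by (intro power_mono) (auto simp: cx power2_eq_square field_simps)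
    also have "\<dots> = (16 / w) ^ K * real n powr (2 * real K * \<sigma>)"
    proof -
     have "((x n)\<^sup>2) ^ K = real n powr (2 * real K * \<sigma>)"
      using n0 x1 unfolding power_mult[symmetric] by (simp add: x_def powr_powr powr_realpow[symmetric] mult_ac)
     thus ?thesis by (simp only: power_mult_distrib)
    qed
    finally have "real (J n) ^ K / c n ^ K * (D * c n powr (- m)) \<le> (16 / w) ^ K * real n powr (2 * real K * \<sigma>) * (D * c n powr (- m))"
     using Dm by (intro mult_right_mono) auto
    also have "\<dots> = C1 * real n powr ((2 * real K + m) * \<sigma>)"
    proof -
     have "c n powr (- m) = (w / 8) powr (- m) * real n powr (m * \<sigma>)"
      unfolding c_def powr_mult powr_powr by (simp add: mult.commute)
     thus ?thesis by (simp only: C1_def distrib_left distrib_right powr_add mult_ac)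
    qed
    finally show ?thesis .
   qed
   have T1: "real (J n) ^ K / c n ^ K * (D * c n powr (- m) * \<epsilon> n powr s * \<zeta>) \<le> C1' * real n powr p1"
   proof -
    have "real (J n) ^ K / c n ^ K * (D * c n powr (- m)) * (\<epsilon> n powr s * \<zeta>) \<le> C1 * real n powr ((2 * real K + m) * \<sigma>) * (\<epsilon> n powr s * \<zeta>)"
     using front by (intro mult_right_mono) (auto simp: \<zeta>_def)
    also have "\<dots> = C1' * (real n powr ((2 * real K + m) * \<sigma>) * real n powr (s * (-1/2 + \<delta>1)) * real n powr (- (\<delta>2 - \<delta>1) / 8))"
    proof -
     have "\<epsilon> n powr s = c1 powr s * real n powr (s * (-1/2 + \<delta>1))"
      by (simp only: \<epsilon>_def powr_mult powr_powr mult.commute[of s])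
     thus ?thesis by (simp only: \<zeta> C1'_def mult_ac)
    qed
    also have "\<dots> = C1' * real n powr p1" by (simp only: p1_def powr_add)
    finally show ?thesis by (simp only: mult.assoc)
   qed
   have T3: "real (J n) ^ K / c n ^ K * (D * c n powr (- m) * ((1 + 2 * b) * \<rho> n / c n) powr s) \<le> C3' * real n powr p3"
   proof -
    have "real (J n) ^ K / c n ^ K * (D * c n powr (- m)) * ((1 + 2 * b) * \<rho> n / c n) powr s \<le>
     C1 * real n powr ((2 * real K + m) * \<sigma>) * ((1 + 2 * b) * \<rho> n / c n) powr s"
     using front by (intro mult_right_mono) auto
    also have "\<dots> = C3' * (real n powr ((2 * real K + m) * \<sigma>) * real n powr (s * p2))"
    proof -
     have "((1 + 2 * b) * \<rho> n / c n) powr s = ((1 + 2 * b) * (8 / w)) powr s * real n powr (s * p2)"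
      unfolding \<rho>c' by (simp only: powr_mult powr_powr mult.commute[of s])
     thus ?thesis by (simp only: C3'_def mult_ac)
    qed
    also have "\<dots> = C3' * real n powr p3" by (simp only: p3_def powr_add)
    finally show ?thesis by (simp only: mult.assoc)
   qed
   have "emeasure prior {p. proper (fst p) \<and> near (\<epsilon> n) (fst p) (snd p) \<and> \<rho> n < rem_mass (fst p) K} \<le>
    ennreal (tail_bound (J n) + real (J n) ^ K / c n ^ K * (D * c n powr (- m) * \<epsilon> n powr s * \<zeta>) +
     real K * (2 * \<alpha> * (\<rho> n / c n)) *
      (tail_bound (J n) + real (J n) ^ K / c n ^ K * (D * c n powr (- m) * ((1 + 2 * b) * \<rho> n / c n) powr s)))"
    unfolding s_def
   proof (rule bound[OF J(3) c0 _ \<epsilon>0(1) \<epsilon>\<rho> _ _ gain])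
    show "c n \<le> w_min / (4 * real (J n))" using cJ by (simp only: w_def)
    show "(1 + 2 * b) * \<rho> n / c n \<le> w_min / 2" unfolding \<rho>c' using elim by (simp only: w_def)
   qed (simp add: \<zeta>_def)
   also have "\<dots> \<le> ennreal (u n)"
   proof -
    have A: "real K * (2 * \<alpha> * (\<rho> n / c n)) \<le> C2 * real n powr p2" unfolding \<rho>c C2_def by (simp add: mult_ac)
    have B: "0 \<le> C2 * real n powr p2" using C by simp
    have B': "0 \<le> tail_bound (J n) + real (J n) ^ K / c n ^ K * (D * c n powr (- m) * ((1 + 2 * b) * \<rho> n / c n) powr s)"
     using tail_bound_nonneg Dm c0 by (intro add_nonneg_nonneg mult_nonneg_nonneg) auto
    show ?thesis unfolding u_def
     by (rule ennreal_leI[OF add_mono[OF add_mono[OF tail T1] mult_mono[OF A add_mono[OF tail T3] B B']]])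
   qed
   finally show ?case by (simp only: \<epsilon>_def \<rho>_def)
  qed
 qed
qed

end

section \<open>Posterior concentration\<close>

locale mixture_setting = mixture_model \<alpha> P0 f F K ws \<theta>s + true_mixture_prior \<alpha> P0 K ws \<theta>s V q b A B
 for \<alpha> :: real and P0 :: "'a::euclidean_space measure" and f :: "'a \<Rightarrow> real" and F :: real
  and K :: nat and ws :: "nat \<Rightarrow> real" and \<theta>s :: "nat \<Rightarrow> 'a" and V :: "nat \<Rightarrow> 'a set"
  and q :: "'a \<Rightarrow> real" and b A B :: real +
 fixes \<Theta> :: "'a set"
 assumes \<Theta>_meas [measurable]: "\<Theta> \<in> sets borel" and AE_\<Theta>: "AE \<theta> in P0. \<theta> \<in> \<Theta>"
begin

text \<open>Replacing indicators and offsets by genuine test functions costs \<open>C\<close> times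
  the mean of \<open>q\<close>, which is itself tested and at most \<open>2 * \<tau>\<close>; hence
  the constant \<open>2 + 2 * C\<close>.\<close>

lemma near_of_tests:
 fixes a :: "nat \<Rightarrow> 'a \<Rightarrow> real" and h :: "nat \<Rightarrow> 'a \<Rightarrow> 'a \<Rightarrow> real"
 assumes C: "0 \<le> C"
  and qt: "test_dual f q" and at: "\<And>k. k < K \<Longrightarrow> test_dual f (a k)" and ht: "\<And>k j. k < K \<Longrightarrow> j \<in> Basis \<Longrightarrow> test_dual f (h k j)"
  and q0: "\<And>k. k < K \<Longrightarrow> q (\<theta>s k) = 0" and a0: "\<And>k l. k < K \<Longrightarrow> l < K \<Longrightarrow> a k (\<theta>s l) = (if l = k then 1 else 0)"
  and h0: "\<And>k l j. k < K \<Longrightarrow> l < K \<Longrightarrow> j \<in> Basis \<Longrightarrow> h k j (\<theta>s l) = 0"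
  and ea: "\<And>k x. k < K \<Longrightarrow> x \<in> \<Theta> \<Longrightarrow> \<bar>indicator (V k) x - a k x\<bar> \<le> C * q x"
  and eh: "\<And>k j x. k < K \<Longrightarrow> j \<in> Basis \<Longrightarrow> x \<in> \<Theta> \<Longrightarrow> \<bar>offset k j x - h k j x\<bar> \<le> C * q x"
  and p: "regular p" and in\<Theta>: "\<And>i. snd p i \<in> \<Theta>"
  and test: "\<And>\<phi>. \<phi> \<in> insert q (a ` {..<K} \<union> case_prod h ` ({..<K} \<times> Basis)) \<Longrightarrow>
   \<bar>sp_mean \<phi> (fst p) (snd p) - (\<Sum>k<K. ws k * \<phi> (\<theta>s k))\<bar> \<le> 2 * \<tau>"
 shows "near ((2 + 2 * C) * \<tau>) (fst p) (snd p)"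
proof -
 have pp: "proper (fst p)" using p by (simp add: regular_def)
 have Q: "\<bar>sp_mean q (fst p) (snd p)\<bar> \<le> 2 * \<tau>" using test[of q] by (simp add: q0)
 have \<tau>: "0 \<le> \<tau>" using Q by linarith
 have CQ: "C * sp_mean q (fst p) (snd p) \<le> 2 * C * \<tau>" using mult_left_mono[OF order_trans[OF abs_ge_self Q] C] by (simp add: mult_ac)
 show ?thesis unfolding near_def
 proof (intro conjI allI impI ballI)
  have "0 \<le> C * \<tau>" using C \<tau> by simp
  thus "\<bar>sp_mean q (fst p) (snd p)\<bar> \<le> (2 + 2 * C) * \<tau>" using Q by (simp add: algebra_simps)
  fix k assume k: "k < K"
  obtain Ba where Ba: "\<And>x. \<bar>a k x\<bar> \<le> Ba" by (rule test_dual_bounded[OF at[OF k]]) blast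
  have "\<bar>sp_mean (indicator (V k)) (fst p) (snd p) - sp_mean (a k) (fst p) (snd p)\<bar> \<le> C * sp_mean q (fst p) (snd p)"
   by (rule sp_mean_diff_le[OF pp, of "indicator (V k)" b "a k" Ba q b, OF abs_indicator_le Ba abs_q_le]) (rule ea[OF k in\<Theta>])
  moreover have "\<bar>sp_mean (a k) (fst p) (snd p) - ws k\<bar> \<le> 2 * \<tau>"
  proof -
   have "(\<Sum>l<K. ws l * a k (\<theta>s l)) = (\<Sum>l<K. if l = k then ws l else 0)" by (intro sum.cong) (auto simp: a0[OF k])
   also have "\<dots> = ws k" using k by simp
   finally show ?thesis using test[of "a k"] k by simp
  qed
  ultimately show "\<bar>sp_mean (indicator (V k)) (fst p) (snd p) - ws k\<bar> \<le> (2 + 2 * C) * \<tau>" using CQ by (simp add: algebra_simps)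
  fix j :: 'a assume j: "j \<in> Basis"
  obtain Bh where Bh: "\<And>x. \<bar>h k j x\<bar> \<le> Bh" by (rule test_dual_bounded[OF ht[OF k j]]) blast
  have "\<bar>sp_mean (offset k j) (fst p) (snd p) - sp_mean (h k j) (fst p) (snd p)\<bar> \<le> C * sp_mean q (fst p) (snd p)"
   by (rule sp_mean_diff_le[OF pp, of "offset k j" b "h k j" Bh q b, OF abs_offset_le[OF k j] Bh abs_q_le]) (rule eh[OF k j in\<Theta>])
  moreover have "\<bar>sp_mean (h k j) (fst p) (snd p)\<bar> \<le> 2 * \<tau>"
  proof -
   have "(\<Sum>l<K. ws l * h k j (\<theta>s l)) = 0" by (intro sum.neutral) (auto simp: h0[OF k _ j])
   moreover have "h k j \<in> case_prod h ` ({..<K} \<times> Basis)" using k j by force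
   ultimately show ?thesis using test[of "h k j"] by simp
  qed
  ultimately show "\<bar>sp_mean (offset k j) (fst p) (snd p)\<bar> \<le> (2 + 2 * C) * \<tau>" using CQ by (simp add: algebra_simps)
 qed
qed

text \<open>Combines the tests at tolerance \<open>real n powr (-1/2 + \<delta>1)\<close>, the
  evidence bound at scale \<open>real n powr (-1/2)\<close> and the small prior mass of near
  measures with leftover mass beyond \<open>real n powr (-1/2 + \<delta>2)\<close>. The sets
  \<open>G n\<close> enter only through the remaining parameters, which are near and have little
  leftover mass.\<close>

lemma posterior_concentration:
 assumes \<delta>2: "0 < \<delta>2" "\<delta>2 \<le> 1 / (4 * (prior_exponent + 1))"
  and \<Phi>: "finite \<Phi>" "\<And>\<phi>. \<phi> \<in> \<Phi> \<Longrightarrow> test_dual f \<phi>" and c1: "0 < c1"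
  and near: "\<And>p \<tau>. regular p \<Longrightarrow> (\<And>i. snd p i \<in> \<Theta>) \<Longrightarrow>
   (\<And>\<phi>. \<phi> \<in> \<Phi> \<Longrightarrow> \<bar>sp_mean \<phi> (fst p) (snd p) - (\<Sum>k<K. ws k * \<phi> (\<theta>s k))\<bar> \<le> 2 * \<tau>) \<Longrightarrow> near (c1 * \<tau>) (fst p) (snd p)"
  and lower: "0 < c" "0 < \<epsilon>0" "\<And>\<epsilon>. 0 < \<epsilon> \<Longrightarrow> \<epsilon> \<le> \<epsilon>0 \<Longrightarrow> ennreal (c * \<epsilon> powr prior_exponent) \<le> emeasure prior (good_nbhd \<epsilon>)"
  and chi: "0 \<le> C" "\<And>p \<epsilon>. regular p \<Longrightarrow> (\<And>i. snd p i \<in> \<Theta>) \<Longrightarrow> 0 < \<epsilon> \<Longrightarrow> \<epsilon> \<le> \<epsilon>0 \<Longrightarrow> p \<in> good_nbhd \<epsilon> \<Longrightarrow>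
   chi2 p \<le> ennreal (1 + C * \<epsilon>\<^sup>2)"
  and G: "\<And>n. G n \<in> sets (DP_prior \<alpha> P0)"
  and good: "\<forall>\<^sub>F n in sequentially. \<forall>p \<epsilon>. regular p \<longrightarrow> (\<forall>i. snd p i \<in> \<Theta>) \<longrightarrow> near \<epsilon> (fst p) (snd p) \<longrightarrow>
   \<epsilon> \<le> real n powr (-1/2 + \<delta>2) \<longrightarrow> rem_mass (fst p) K \<le> real n powr (-1/2 + \<delta>2) \<longrightarrow> p \<in> pull (G n)"
 shows "tendsto_in_prob data_law (\<lambda>n X. posterior (DP_prior \<alpha> P0) f n X (G n)) 1"
proof (rule posterior_tendsto_1[OF G])
 fix e :: real assume e: "0 < e"
 obtain \<delta>1 \<eta> u where \<delta>1: "0 < \<delta>1" "\<delta>1 < \<delta>2" and \<eta>: "0 < \<eta>" and u: "\<And>n. 0 \<le> u n"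
  and ulim: "(\<lambda>n. u n * real n powr (prior_exponent / 2 + \<eta>)) \<longlonglongrightarrow> 0"
  and ubound: "\<forall>\<^sub>F n in sequentially. emeasure prior {p. proper (fst p) \<and> near (c1 * real n powr (-1/2 + \<delta>1)) (fst p) (snd p) \<and>
    real n powr (-1/2 + \<delta>2) < rem_mass (fst p) K} \<le> ennreal (u n)"
  by (rule prior_near_rate[OF \<delta>2 c1]) blast
 obtain \<G> b' where \<G>: "finite \<G>" "0 < b'" "\<And>g. g \<in> \<G> \<Longrightarrow> g \<in> borel_measurable borel" "\<And>g x. g \<in> \<G> \<Longrightarrow> \<bar>g x\<bar> \<le> b'"
  and tests: "\<And>p \<tau>. regular p \<Longrightarrow> (\<And>g. g \<in> \<G> \<Longrightarrow> mean_dens g p \<le> mean_true g + 2 * \<tau>) \<Longrightarrow>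
   (\<forall>\<phi>\<in>\<Phi>. \<bar>sp_mean \<phi> (fst p) (snd p) - (\<Sum>k<K. ws k * \<phi> (\<theta>s k))\<bar> \<le> 2 * \<tau>)"
  by (rule finite_tests[OF \<Phi>]) blast+
 define s where "s = prior_exponent"
 \<comment> \<open>At this radius the chi-square divergence is of order 1/n, so its effect on
   \<open>n\<close> observations is at most the constant \<open>exp C\<close>.\<close>
 define N where "N n = {p. \<forall>i. snd p i \<in> \<Theta>} \<inter> good_nbhd (real n powr (-1/2))" for n :: nat
 define Us where "Us n = {p. proper (fst p) \<and> near (c1 * real n powr (-1/2 + \<delta>1)) (fst p) (snd p) \<and> real n powr (-1/2 + \<delta>2) < rem_mass (fst p) K}" for n :: nat
 define x where "x n = real (card \<G>) * exp (- (1 / (2 * b'\<^sup>2) * real n powr (2 * \<delta>1)))" for n :: nat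
 \<comment> \<open>The slack \<open>t\<close> of the evidence bound is
   \<open>real n powr \<eta>\<close>: the failure probability tends to 0, and the last summand pays
   the same power, which \<open>prior_near_rate\<close> has reserved.\<close>
 define bd where "bd n = exp C * real n powr (- \<eta>) + x n + (x n + u n) * real n powr (s / 2 + \<eta>) / (e * c)" for n
 have Nm: "{p. \<forall>i. snd p i \<in> \<Theta>} \<in> sets prior" by (rule sets_prior_Collect) measurable
 have Usm: "Us n \<in> sets prior" for n unfolding Us_def by (rule sets_prior_Collect) measurable
 have bd: "bd \<longlonglongrightarrow> 0"
 proof -
  have L: "0 < 1 / (2 * b'\<^sup>2)" "0 < 2 * \<delta>1" using \<G>(2) \<delta>1 by auto
  have x0: "(\<lambda>n. x n * real n powr p) \<longlonglongrightarrow> 0" for p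
   using tendsto_mult_right_zero[OF powr_exp_tendsto_0[OF L, of p], of "real (card \<G>)"] by (simp add: x_def mult_ac)
  have x1: "x \<longlonglongrightarrow> 0"
  proof (rule Lim_transform_eventually[OF x0[of 0]])
   show "\<forall>\<^sub>F n in sequentially. x n * real n powr 0 = x n" using eventually_gt_at_top[of 0] by eventually_elim simp
  qed
  have "(\<lambda>n. exp C * real n powr (- \<eta>) + x n + (x n * real n powr (s / 2 + \<eta>) + u n * real n powr (s / 2 + \<eta>)) / (e * c)) \<longlonglongrightarrow>
   exp C * 0 + 0 + (0 + 0) / (e * c)"
   using e lower(1) \<eta> ulim by (intro tendsto_intros real_powr_tendsto_0 x0 x1) (auto simp: s_def)
  thus ?thesis by (simp add: bd_def[abs_def] distrib_right)
 qed
 have ev1: "\<forall>\<^sub>F n in sequentially. c1 * real n powr (\<delta>1 - \<delta>2) < 1"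
 proof (rule order_tendstoD(2))
  show "(\<lambda>n. c1 * real n powr (\<delta>1 - \<delta>2)) \<longlonglongrightarrow> c1 * 0"
   using \<delta>1 by (intro tendsto_intros real_powr_tendsto_0) simp
 qed simp
 have ev2: "\<forall>\<^sub>F n in sequentially. real n powr (-1/2) < \<epsilon>0"
  by (rule order_tendstoD(2)[OF real_powr_tendsto_0]) (use lower in auto)
 have le: "\<forall>\<^sub>F n in sequentially. measure data_law {X. ennreal e * evidence n X <
    evidence_on (- pull (G n)) n X} \<le> bd n"
  using ev1 ev2 ubound good eventually_ge_at_top[of 1]
 proof eventually_elim
  case (elim n)
  define \<tau> where "\<tau> = real n powr (-1/2 + \<delta>1)"
  have n0: "0 < real n" using elim by simp
  note gd = elim(4)
  have c\<tau>: "c1 * \<tau> \<le> real n powr (-1/2 + \<delta>2)"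
  proof -
   have "c1 * \<tau> = c1 * real n powr (\<delta>1 - \<delta>2) * real n powr (-1/2 + \<delta>2)" by (simp add: \<tau>_def mult.assoc powr_add[symmetric])
   also have "\<dots> \<le> 1 * real n powr (-1/2 + \<delta>2)" using elim by (intro mult_right_mono) auto
   finally show ?thesis by simp
  qed
  have xe: "x n = real (card \<G>) * exp (- (real n * \<tau>\<^sup>2 / (2 * b'\<^sup>2)))"
  proof -
   have "real n * \<tau>\<^sup>2 = real n powr 1 * (real n powr (-1/2 + \<delta>1) * real n powr (-1/2 + \<delta>1))" using n0 by (simp add: \<tau>_def power2_eq_square)
   also have "\<dots> = real n powr (2 * \<delta>1)" unfolding powr_add[symmetric] by simp
   finally show ?thesis by (simp add: x_def)
  qed
  have "emeasure data_law {X. ennreal e * evidence n X <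
    evidence_on (- pull (G n)) n X} \<le>
   ennreal (exp C / real n powr \<eta> + real (card \<G>) * exp (- (real n * \<tau>\<^sup>2 / (2 * b'\<^sup>2))) +
    (real (card \<G>) * exp (- (real n * \<tau>\<^sup>2 / (2 * b'\<^sup>2))) + u n) * real n powr \<eta> / (e * (c * (real n powr (-1/2)) powr s)))"
  proof (rule posterior_numerator_bound[where Us = "Us n" and N = "N n"])
   show "- pull (G n) \<in> sets prior" using sets.compl_sets[OF sets_pull[OF G[of n]]] by (simp add: Compl_eq_Diff_UNIV)
   show "Us n \<in> sets prior" by (rule Usm)
   show "N n \<in> sets prior" unfolding N_def using Nm sets_good_nbhd by (rule sets.Int)
   show "emeasure prior (Us n) \<le> ennreal (u n)" unfolding Us_def using elim by blast
   show "AE p in prior. p \<in> - pull (G n) \<longrightarrow> (\<exists>g\<in>\<G>. mean_true g + 2 * \<tau> < mean_dens g p) \<or> p \<in> Us n"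
    using AE_regular AE_atoms[OF \<Theta>_meas AE_\<Theta>]
   proof eventually_elim
    case (elim p)
    show ?case
    proof (intro impI)
     assume "p \<in> - pull (G n)"
     hence pG: "p \<notin> pull (G n)" by simp
     show "(\<exists>g\<in>\<G>. mean_true g + 2 * \<tau> < mean_dens g p) \<or> p \<in> Us n"
     proof (rule disjCI)
      assume "p \<notin> Us n"
      show "\<exists>g\<in>\<G>. mean_true g + 2 * \<tau> < mean_dens g p"
      proof (rule ccontr)
       assume "\<not> ?thesis"
       hence "\<And>g. g \<in> \<G> \<Longrightarrow> mean_dens g p \<le> mean_true g + 2 * \<tau>" by (simp add: not_less)
       hence "\<forall>\<phi>\<in>\<Phi>. \<bar>sp_mean \<phi> (fst p) (snd p) - (\<Sum>k<K. ws k * \<phi> (\<theta>s k))\<bar> \<le> 2 * \<tau>" by (rule tests[OF elim(1)])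
       hence nr: "near (c1 * \<tau>) (fst p) (snd p)" using elim by (intro near) auto
       have "rem_mass (fst p) K \<le> real n powr (-1/2 + \<delta>2)"
        using \<open>p \<notin> Us n\<close> nr elim(1) by (auto simp: Us_def \<tau>_def regular_def)
       thus False using gd c\<tau> nr elim pG by blast
      qed
     qed
    qed
   qed
   show "ennreal (c * (real n powr (-1/2)) powr s) \<le> emeasure prior (N n)"
   proof -
    have "ennreal (c * (real n powr (-1/2)) powr s) \<le> emeasure prior (good_nbhd (real n powr (-1/2)))"
     unfolding s_def using elim n0 by (intro lower) auto
    also have "\<dots> = emeasure prior (N n)"
    proof (rule emeasure_eq_AE)
     show "AE p in prior. (p \<in> good_nbhd (real n powr (-1/2))) = (p \<in> N n)"
      using AE_atoms[OF \<Theta>_meas AE_\<Theta>] by eventually_elim (simp add: N_def)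
    qed (auto simp: N_def intro!: sets.Int Nm)
    finally show ?thesis .
   qed
   fix p assume p: "p \<in> N n" "regular p"
   have "chi2 p \<le> ennreal (1 + C * (real n powr (-1/2))\<^sup>2)"
    using p n0 elim by (intro chi(2)) (auto simp: N_def)
   also have "(real n powr (-1/2))\<^sup>2 = 1 / real n"
   proof -
    have "(real n powr (-1/2))\<^sup>2 = real n powr (- 1)" unfolding power2_eq_square powr_add[symmetric] by simp
    thus ?thesis using n0 by (simp add: powr_minus_divide)
   qed
   also have "1 + C * (1 / real n) \<le> exp (C / real n)" using exp_ge_add_one_self[of "C / real n"] by simp
   finally have "chi2 p \<le> ennreal (exp (C / real n))" by (simp add: ennreal_leI)
   hence "chi2 p ^ n \<le> ennreal (exp (C / real n)) ^ n" by (rule power_mono) simp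
   also have "\<dots> = ennreal (exp C)" using n0 by (simp add: ennreal_power exp_of_nat_mult[symmetric])
   finally show "chi2 p ^ n \<le> ennreal (exp C)" .
  qed (use n0 lower(1) \<G> e u in \<open>auto simp: \<tau>_def\<close>)
  also have "exp C / real n powr \<eta> + real (card \<G>) * exp (- (real n * \<tau>\<^sup>2 / (2 * b'\<^sup>2))) +
    (real (card \<G>) * exp (- (real n * \<tau>\<^sup>2 / (2 * b'\<^sup>2))) + u n) * real n powr \<eta> / (e * (c * (real n powr (-1/2)) powr s)) = bd n"
  proof -
   have "(real n powr (-1/2)) powr s = 1 / real n powr (s / 2)" unfolding powr_powr by (simp flip: powr_minus_divide)
   hence "real n powr \<eta> / (e * (c * (real n powr (-1/2)) powr s)) = real n powr (s / 2 + \<eta>) / (e * c)"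
    using n0 by (simp add: powr_add mult.commute)
   thus ?thesis unfolding bd_def xe[symmetric] by (simp only: times_divide_eq_right[symmetric]) (simp add: powr_minus_divide)
  qed
  finally have "emeasure data_law {X. ennreal e * evidence n X <
    evidence_on (- pull (G n)) n X} \<le> ennreal (bd n)" .
  moreover have "0 \<le> bd n" unfolding bd_def x_def using e lower(1) u[of n]
   by (intro add_nonneg_nonneg divide_nonneg_nonneg mult_nonneg_nonneg) auto
  ultimately show ?case unfolding measure_def by (intro enn2real_leI)
 qed
 show "(\<lambda>n. measure data_law {X. ennreal e * evidence n X <
    evidence_on (- pull (G n)) n X}) \<longlonglongrightarrow> 0"
  by (rule tendsto_sandwich[OF _ le tendsto_const bd]) simp
qed

end

section \<open>The prior density\<close>

lemma emeasure_lborel_box_le: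
 fixes x :: "'a::euclidean_space"
 assumes "0 \<le> r"
 shows "emeasure lborel {t. \<forall>j\<in>Basis. \<bar>t \<bullet> j - x \<bullet> j\<bar> \<le> r} = ennreal ((2 * r) ^ DIM('a))"
proof -
 have "{t. \<forall>j\<in>Basis. \<bar>t \<bullet> j - x \<bullet> j\<bar> \<le> r} = cbox (x - r *\<^sub>R One) (x + r *\<^sub>R One)"
  by (auto simp: mem_box abs_le_iff algebra_simps)
 thus ?thesis
  using assms by (simp add: emeasure_lborel_cbox_eq inner_diff_left inner_add_left)
qed

locale compactly_supported_prior =
 fixes \<Theta> :: "'a::euclidean_space set" and p0 :: "'a \<Rightarrow> real" and P0 :: "'a measure" and Pm :: real
 assumes P0_eq: "P0 = density lborel (\<lambda>\<theta>. ennreal (indicator \<Theta> \<theta> * p0 \<theta>))"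
  and P0_prob: "prob_space P0" and cpt: "compact \<Theta>" and p0_cont: "continuous_on \<Theta> p0"
  and p0_nonneg: "\<And>\<theta>. \<theta> \<in> \<Theta> \<Longrightarrow> 0 \<le> p0 \<theta>" and p0_le: "\<And>\<theta>. \<theta> \<in> \<Theta> \<Longrightarrow> p0 \<theta> \<le> Pm"
begin

lemma sets_support [measurable]: "\<Theta> \<in> sets borel"
 using compact_imp_closed[OF cpt] by (rule borel_closed)

lemma meas_dens [measurable]: "(\<lambda>\<theta>. indicator \<Theta> \<theta> * p0 \<theta>) \<in> borel_measurable borel"
 using borel_measurable_continuous_on_indicator[OF sets_support p0_cont] by simp

lemma sets_P0: "sets P0 = sets borel"
 by (simp add: P0_eq)

lemma Pm_nonneg: "0 \<le> Pm"
proof (rule ccontr)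
 assume "\<not> 0 \<le> Pm"
 hence "\<Theta> = {}" using p0_nonneg p0_le by fastforce
 hence "emeasure P0 (space P0) = 0" unfolding P0_eq by (simp add: emeasure_density)
 thus False using prob_space.emeasure_space_1[OF P0_prob] by simp
qed

lemma AE_support: "AE \<theta> in P0. \<theta> \<in> \<Theta>"
 unfolding P0_eq by (subst AE_density) (auto split: split_indicator_asm)

lemma emeasure_P0: "S \<in> sets borel \<Longrightarrow> emeasure P0 S = (\<integral>\<^sup>+\<theta>. ennreal (indicator \<Theta> \<theta> * p0 \<theta>) * indicator S \<theta> \<partial>lborel)"
 unfolding P0_eq by (rule emeasure_density) auto

lemma emeasure_P0_le:
 assumes [measurable]: "S \<in> sets borel" shows "emeasure P0 S \<le> ennreal Pm * emeasure lborel S"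
proof -
 have "emeasure P0 S \<le> (\<integral>\<^sup>+\<theta>. ennreal Pm * indicator S \<theta> \<partial>lborel)"
  unfolding emeasure_P0[OF assms] using p0_le Pm_nonneg
  by (intro nn_integral_mono mult_right_mono ennreal_leI) (auto split: split_indicator)
 thus ?thesis by (simp add: nn_integral_cmult_indicator)
qed

lemma emeasure_P0_box:
 assumes "0 \<le> r"
 shows "emeasure P0 {t. \<forall>j\<in>Basis. \<bar>t \<bullet> j - x \<bullet> j\<bar> \<le> r} \<le> ennreal (Pm * 2 ^ DIM('a) * r ^ DIM('a))"
proof -
 have "emeasure P0 {t. \<forall>j\<in>Basis. \<bar>t \<bullet> j - x \<bullet> j\<bar> \<le> r} \<le> ennreal Pm * ennreal ((2 * r) ^ DIM('a))"
  using emeasure_P0_le[of "{t. \<forall>j\<in>Basis. \<bar>t \<bullet> j - x \<bullet> j\<bar> \<le> r}"] emeasure_lborel_box_le[OF assms, of x] by simp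
 also have "\<dots> = ennreal (Pm * 2 ^ DIM('a) * r ^ DIM('a))"
  using Pm_nonneg by (simp add: ennreal_mult'[symmetric] power_mult_distrib mult.assoc)
 finally show ?thesis .
qed

text \<open>A small value of \<open>q\<close> puts a point of \<open>\<Theta>\<close> into a box of
  half-width \<open>r\<close> around some true atom. For \<open>r \<le> 1\<close> the volume
  \<open>r ^ DIM('a)\<close> is at most of order \<open>r\<close>; otherwise the bound exceeds
  1.\<close>

lemma emeasure_P0_sublevel:
 assumes [measurable]: "q \<in> borel_measurable borel" and C: "0 \<le> C" and y: "0 < y"
  and q: "\<And>x. x \<in> \<Theta> \<Longrightarrow> \<exists>k<K. (dist x (\<theta>s k))\<^sup>2 \<le> C * q x"
 shows "emeasure P0 {t. q t \<le> y} \<le> ennreal ((real K * (Pm * 2 ^ DIM('a)) + 1) * sqrt C * sqrt y)"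
proof -
 define r where "r = sqrt (C * y)"
 have r: "0 \<le> r" using C y by (simp add: r_def)
 define B where "B = Pm * 2 ^ DIM('a)"
 have B: "0 \<le> B" using Pm_nonneg by (simp add: B_def)
 have "emeasure P0 {t. q t \<le> y} \<le> ennreal ((real K * B + 1) * r)"
 proof (cases "r \<le> 1")
  case True
  let ?U = "\<lambda>k. {t. \<forall>j\<in>Basis. \<bar>t \<bullet> j - \<theta>s k \<bullet> j\<bar> \<le> r}"
  have "emeasure P0 {t. q t \<le> y} \<le> emeasure P0 (\<Union>k<K. ?U k)"
  proof (rule emeasure_mono_AE)
   show "AE t in P0. t \<in> {t. q t \<le> y} \<longrightarrow> t \<in> (\<Union>k<K. ?U k)"
    using AE_support
   proof eventually_elim
    case (elim t)
    show ?case
    proof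
     assume t: "t \<in> {t. q t \<le> y}"
     obtain k where k: "k < K" "(dist t (\<theta>s k))\<^sup>2 \<le> C * q t" using q[OF elim] by blast
     have "(dist t (\<theta>s k))\<^sup>2 \<le> C * y" using k(2) mult_left_mono[of "q t" y C] t C by simp
     hence d: "dist t (\<theta>s k) \<le> r" unfolding r_def by (rule real_le_rsqrt)
     have "\<bar>t \<bullet> j - \<theta>s k \<bullet> j\<bar> \<le> r" if "j \<in> Basis" for j
      using Basis_le_norm[OF that, of "t - \<theta>s k"] d by (simp add: dist_norm inner_diff_left)
     thus "t \<in> (\<Union>k<K. ?U k)" using k(1) by blast
    qed
   qed
   show "(\<Union>k<K. ?U k) \<in> sets P0" unfolding sets_P0 by measurable
  qed
  also have "\<dots> \<le> (\<Sum>k<K. emeasure P0 (?U k))" by (rule emeasure_subadditive_finite) (auto simp: sets_P0)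
  also have "\<dots> \<le> (\<Sum>k<K. ennreal (B * r ^ DIM('a)))" unfolding B_def by (intro sum_mono emeasure_P0_box r)
  also have "\<dots> = ennreal (real K * (B * r ^ DIM('a)))" using B r by (simp add: ennreal_mult ennreal_of_nat_eq_real_of_nat)
  also have "\<dots> \<le> ennreal ((real K * B + 1) * r)"
  proof (rule ennreal_leI)
   have "r ^ DIM('a) \<le> r ^ 1" using r True DIM_positive[where 'a='a] by (intro power_decreasing) auto
   hence "real K * B * r ^ DIM('a) \<le> real K * B * r" using B by (intro mult_left_mono) auto
   thus "real K * (B * r ^ DIM('a)) \<le> (real K * B + 1) * r" using r by (simp add: algebra_simps)
  qed
  finally show ?thesis .
 next
  case False
  have "emeasure P0 {t. q t \<le> y} \<le> 1" using prob_space.emeasure_le_1[OF P0_prob] .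
  also have "\<dots> \<le> ennreal ((real K * B + 1) * r)"
  proof -
   have "1 * 1 \<le> (real K * B + 1) * r" using False B r by (intro mult_mono) auto
   thus ?thesis by simp
  qed
  finally show ?thesis .
 qed
 thus ?thesis by (simp add: r_def B_def real_sqrt_mult mult.assoc)
qed

text \<open>By continuity \<open>p0\<close> stays above half its value at \<open>x\<close> on nearby
  points of \<open>\<Theta>\<close>, and \<open>\<Theta>\<close> fills a fixed proportion of small
  balls.\<close>

lemma emeasure_P0_cball:
 assumes x: "x \<in> \<Theta>" "0 < p0 x"
  and d: "\<exists>c>0. \<exists>\<rho>0>0. \<forall>\<rho>. 0 < \<rho> \<and> \<rho> \<le> \<rho>0 \<longrightarrow> measure lborel (\<Theta> \<inter> cball x \<rho>) \<ge> c * measure lborel (cball x \<rho>)"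
 shows "\<exists>c>0. \<exists>\<rho>0>0. \<forall>\<rho>. 0 < \<rho> \<and> \<rho> \<le> \<rho>0 \<longrightarrow> ennreal (c * \<rho> ^ DIM('a)) \<le> emeasure P0 (cball x \<rho>)"
proof -
 obtain c \<rho>0 where c: "0 < c" "0 < \<rho>0" "\<And>\<rho>. 0 < \<rho> \<Longrightarrow> \<rho> \<le> \<rho>0 \<Longrightarrow> c * measure lborel (cball x \<rho>) \<le> measure lborel (\<Theta> \<inter> cball x \<rho>)"
  using d by blast
 obtain \<rho>1 where \<rho>1: "0 < \<rho>1" "\<And>y. y \<in> \<Theta> \<Longrightarrow> dist y x < \<rho>1 \<Longrightarrow> dist (p0 y) (p0 x) < p0 x / 2"
  using p0_cont x unfolding continuous_on_iff by (meson half_gt_zero)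
 have "ennreal (p0 x / 2 * (c * unit_ball_vol (real DIM('a))) * \<rho> ^ DIM('a)) \<le> emeasure P0 (cball x \<rho>)"
  if \<rho>: "0 < \<rho>" "\<rho> \<le> min \<rho>0 (\<rho>1 / 2)" for \<rho>
 proof -
  have m: "c * (unit_ball_vol (real DIM('a)) * \<rho> ^ DIM('a)) \<le> measure lborel (\<Theta> \<inter> cball x \<rho>)"
   using c(3)[of \<rho>] \<rho> content_cball[of \<rho> x] by simp
  have "ennreal (p0 x / 2 * (c * unit_ball_vol (real DIM('a))) * \<rho> ^ DIM('a)) = ennreal (p0 x / 2) * ennreal (c * (unit_ball_vol (real DIM('a)) * \<rho> ^ DIM('a)))"
   using x by (subst ennreal_mult'[symmetric]) (auto simp: mult_ac)
  also have "\<dots> \<le> ennreal (p0 x / 2) * emeasure lborel (\<Theta> \<inter> cball x \<rho>)"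
  proof (rule mult_left_mono)
   have "emeasure lborel (\<Theta> \<inter> cball x \<rho>) \<noteq> \<infinity>"
    using emeasure_bounded_finite[OF bounded_subset[OF bounded_cball[of x \<rho>] Int_lower2[of \<Theta>]]] by simp
   thus "ennreal (c * (unit_ball_vol (real DIM('a)) * \<rho> ^ DIM('a))) \<le> emeasure lborel (\<Theta> \<inter> cball x \<rho>)"
    using m by (simp add: emeasure_eq_ennreal_measure ennreal_leI)
  qed simp
  also have "\<dots> = (\<integral>\<^sup>+\<theta>. ennreal (p0 x / 2) * indicator (\<Theta> \<inter> cball x \<rho>) \<theta> \<partial>lborel)"
   by (rule nn_integral_cmult_indicator[symmetric]) measurable
  also have "\<dots> \<le> emeasure P0 (cball x \<rho>)"
  proof (subst emeasure_P0, measurable, intro nn_integral_mono)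
   fix \<theta>
   show "ennreal (p0 x / 2) * indicator (\<Theta> \<inter> cball x \<rho>) \<theta> \<le> ennreal (indicator \<Theta> \<theta> * p0 \<theta>) * indicator (cball x \<rho>) \<theta>"
   proof (cases "\<theta> \<in> \<Theta> \<inter> cball x \<rho>")
    case True
    hence "dist \<theta> x < \<rho>1" using \<rho> \<rho>1(1) by (simp add: dist_commute)
    hence "dist (p0 \<theta>) (p0 x) < p0 x / 2" using \<rho>1(2) True by blast
    hence "p0 x / 2 \<le> p0 \<theta>" unfolding dist_real_def by linarith
    thus ?thesis using True by (simp add: ennreal_leI)
   qed simp
  qed
  finally show ?thesis .
 qed
 moreover have "0 < p0 x / 2 * (c * unit_ball_vol (real DIM('a)))" "0 < min \<rho>0 (\<rho>1 / 2)" using x c \<rho>1 by auto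
 ultimately show ?thesis by blast
qed

end

section \<open>The Wasserstein event\<close>

text \<open>Marginals of a coupling have equal total mass, so here the set of couplings is empty and
  its infimum is infinite. This places all unnormalised weight sequences inside the Wasserstein
  event.\<close>

lemma wasserstein1_eq_top:
 assumes ws: "\<And>k. k < K \<Longrightarrow> 0 \<le> ws k" "(\<Sum>k<K. ws k) = 1" and w: "(\<Sum>k. ennreal (w k)) \<noteq> 1"
 shows "wasserstein1 (discrete_measure {..<K} ws \<theta>s) (discrete_measure UNIV w \<theta>) = top"
proof -
 have "emeasure (discrete_measure UNIV w \<theta>) UNIV = (\<Sum>k. ennreal (w k))"
  by (simp add: emeasure_discrete_measure nn_integral_count_space_nat)
 moreover have "emeasure (discrete_measure {..<K} ws \<theta>s) UNIV = (\<Sum>k<K. ennreal (ws k))"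
  by (simp add: emeasure_discrete_measure nn_integral_count_space_finite)
 moreover have "(\<Sum>k<K. ennreal (ws k)) = 1" using ws by (subst sum_ennreal) auto
 moreover have "emeasure (distr \<gamma> borel fst) UNIV = emeasure (distr \<gamma> borel snd) UNIV"
  if "sets \<gamma> = sets (borel \<Otimes>\<^sub>M borel)" for \<gamma> :: "('a \<times> 'a) measure"
 proof -
  have "fst \<in> measurable \<gamma> borel" "snd \<in> measurable \<gamma> borel" unfolding measurable_cong_sets[OF that refl] by measurable
  thus ?thesis by (simp add: emeasure_distr)
 qed
 ultimately have "\<gamma> \<notin> couplings (discrete_measure {..<K} ws \<theta>s) (discrete_measure UNIV w \<theta>)" for \<gamma>
  using w unfolding couplings_def mem_Collect_eq by metis
 hence "couplings (discrete_measure {..<K} ws \<theta>s) (discrete_measure UNIV w \<theta>) = {}" by blast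
 thus ?thesis by (simp add: wasserstein1_def)
qed

context mixture_model
begin

text \<open>
 The Wasserstein event need not be shown measurable: where it is not, the integral defining its
 posterior probability is that of a non-measurable function, hence 0.
\<close>

lemma posterior_nonmeasurable:
 assumes W: "{p. (\<Sum>k. ennreal (fst p k)) \<noteq> 1} \<subseteq> W" and nm: "W \<notin> sets (DP_prior \<alpha> P0)"
 shows "posterior (DP_prior \<alpha> P0) f n X W = 0"
proof -
 let ?M = "DP_prior \<alpha> P0"
 define S where "S = {p :: 'a sticks. (\<Sum>k. ennreal (fst p k)) = 1}"
 have S: "S \<in> sets ?M"
 proof -
  have "(\<lambda>p. fst p k) \<in> borel_measurable ?M" for k
   unfolding measurable_cong_sets[OF sets_DP_prior refl]
   by (rule measurable_compose[OF measurable_fst measurable_component_singleton]) simp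
  hence [measurable]: "(\<lambda>p. \<Sum>k. ennreal (fst p k)) \<in> borel_measurable ?M" by measurable
  have "{p \<in> space ?M. (\<Sum>k. ennreal (fst p k)) = 1} \<in> sets ?M" by measurable
  thus ?thesis by (simp add: S_def)
 qed
 have pos: "0 < likelihood f X n p" if p: "p \<in> S" for p
 proof -
  have s1: "(\<Sum>k. ennreal (fst p k)) = 1" using p by (simp add: S_def)
  have "0 < mixture f (discrete_measure UNIV (fst p) (snd p)) x" for x
  proof -
   define z where "z k = ennreal (max 0 (fst p k) * f (x - snd p k))" for k
   have "(\<Sum>k. z k) \<le> (\<Sum>k. ennreal F * ennreal (fst p k))"
   proof (intro suminf_le summableI)
    fix k
    have "z k \<le> ennreal (F * max 0 (fst p k))" unfolding z_def
     by (subst mult.commute, intro ennreal_leI mult_right_mono f_le) simp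
    also have "\<dots> = ennreal F * ennreal (fst p k)" using F_pos by (simp add: ennreal_mult ennreal_max_0)
    finally show "z k \<le> ennreal F * ennreal (fst p k)" .
   qed
   also have "\<dots> = ennreal F" using s1 by simp
   finally have fin: "(\<Sum>k. z k) < \<infinity>" by (rule order.strict_trans1) simp
   obtain k where k: "ennreal (fst p k) \<noteq> 0"
   proof (rule ccontr)
    assume "\<not> thesis"
    hence "\<And>k. ennreal (fst p k) = 0" using that by blast
    thus False using s1 by simp
   qed
   hence "0 < fst p k" by (simp add: ennreal_eq_0_iff not_le)
   hence "0 < z k" using f_pos[of "x - snd p k"] by (simp add: z_def)
   hence "(\<Sum>k. z k) \<noteq> 0" by (metis less_irrefl suminf_eq_zero_iff summableI zero_le)
   hence "0 < enn2real (\<Sum>k. z k)" using fin by (simp add: enn2real_positive_iff zero_less_iff_neq_zero)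
   thus ?thesis unfolding mixture_eq_suminf z_def .
  qed
  thus ?thesis unfolding likelihood_def split_beta' by (intro prod_pos) auto
 qed
 \<comment> \<open>On \<open>S\<close> the likelihood is positive, so measurability of the product
   would make \<open>W \<inter> S\<close> measurable; outside \<open>S\<close> everything belongs to
   \<open>W\<close>, and \<open>W\<close> itself would be measurable.\<close>
 have "(\<lambda>p. indicator W p *\<^sub>R likelihood f X n p) \<notin> borel_measurable ?M"
 proof
  assume [measurable]: "(\<lambda>p. indicator W p *\<^sub>R likelihood f X n p) \<in> borel_measurable ?M"
  note [measurable] = S
  have "{p \<in> space ?M. p \<in> S \<and> 0 < indicator W p *\<^sub>R likelihood f X n p} \<in> sets ?M" by measurable
  moreover have "{p \<in> space ?M. p \<in> S \<and> 0 < indicator W p *\<^sub>R likelihood f X n p} = W \<inter> S"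
   using pos by (auto split: split_indicator_asm split_indicator)
  ultimately have "(W \<inter> S) \<union> (space ?M - S) \<in> sets ?M" using S by (metis sets.Un sets.compl_sets)
  moreover have "(W \<inter> S) \<union> (space ?M - S) = W" using W by (auto simp: S_def)
  ultimately show False using nm by simp
 qed
 hence "\<not> integrable ?M (\<lambda>p. indicator W p *\<^sub>R likelihood f X n p)" by auto
 thus ?thesis unfolding posterior_def set_lebesgue_integral_def by (simp add: not_integrable_integral_eq)
qed

text \<open>In both cases the event is governed by the posterior of a measurable set, to which
  concentration applies; in the second case the identity reads 0 = 1 - 1.\<close>

lemma posterior_compl_or_nonmeasurable:
 assumes W: "{p. (\<Sum>k. ennreal (fst p k)) \<noteq> 1} \<subseteq> W"
 shows "posterior (DP_prior \<alpha> P0) f n X W = 1 - posterior (DP_prior \<alpha> P0) f n X (if W \<in> sets (DP_prior \<alpha> P0) then - W else UNIV)"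
proof (cases "W \<in> sets (DP_prior \<alpha> P0)")
 case True
 thus ?thesis using posterior_compl[OF True, of n X] by simp
next
 case False
 have U: "UNIV \<in> sets (DP_prior \<alpha> P0)" using sets.top[of "DP_prior \<alpha> P0"] by simp
 have "posterior (DP_prior \<alpha> P0) f n X UNIV = 1"
  unfolding posterior_eq[OF U] using integral_lik_pos[of n X] by (simp add: pull_def)
 thus ?thesis using False posterior_nonmeasurable[OF W False, of n X] by simp
qed

end

lemma tendsto_in_prob_one_minus:
 assumes "tendsto_in_prob M Y 1"
 shows "tendsto_in_prob M (\<lambda>n x. 1 - Y n x) 0"
proof -
 have [measurable]: "Y n \<in> borel_measurable M" for n using assms by (simp add: tendsto_in_prob_def)
 have "\<bar>1 - Y n x - 0\<bar> = \<bar>Y n x - 1\<bar>" for n x by simp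
 thus ?thesis using assms unfolding tendsto_in_prob_def by (simp only:) measurable
qed

text \<open>Both claims are instances of one concentration statement. For the second the matching is
  turned into a coupling, whose cost is a constant times the matching error.\<close>

theorem corollary1:
  fixes f :: "'a::euclidean_space \<Rightarrow> real"
    and \<Theta> :: "'a set" and P0 :: "'a measure" and p0 :: "'a \<Rightarrow> real"
    and K :: nat and ws :: "nat \<Rightarrow> real" and \<theta>s :: "nat \<Rightarrow> 'a" and Ps :: "'a measure"
    and Q :: "'a measure" and Qinf :: "(nat \<Rightarrow> 'a) measure"
    and \<alpha> F R \<gamma> C r \<delta> :: real
  assumes f_density: "integrable lborel f" "(\<integral>x. f x \<partial>lborel) = 1"
    and \<alpha>: "\<alpha> > 0"
    (* A1 *)
    and ws_pos: "\<And>k. k < K \<Longrightarrow> ws k > 0"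
    and ws_sum: "(\<Sum>k<K. ws k) = 1"
    and \<theta>s_distinct: "inj_on \<theta>s {..<K}"
    and Ps: "Ps = discrete_measure {..<K} ws \<theta>s"
    and Q: "Q = density lborel (\<lambda>x. ennreal (mixture f Ps x))"
    and Qinf: "Qinf = (\<Pi>\<^sub>M i\<in>UNIV. Q)"
    (* A2 *)
    and \<Theta>_compact: "compact \<Theta>"
    and \<theta>s_in: "\<And>k. k < K \<Longrightarrow> \<theta>s k \<in> \<Theta>"
    (* A3 *)
    and P0_prob: "prob_space P0"
    and P0_density: "P0 = density lborel (\<lambda>\<theta>. ennreal (indicator \<Theta> \<theta> * p0 \<theta>))"
    and p0_nonneg: "\<And>\<theta>. \<theta> \<in> \<Theta> \<Longrightarrow> p0 \<theta> \<ge> 0"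
    and p0_cont: "continuous_on \<Theta> p0"
    and p0_bounded: "bounded (p0 ` \<Theta>)"
    and p0_pos: "\<And>k. k < K \<Longrightarrow> p0 (\<theta>s k) > 0"
    (* The true atoms are not Lebesgue-degenerate points of the parameter set
       (automatic for interior points, or if the set is a convex body). *)
    and \<Theta>_density: "\<And>k. k < K \<Longrightarrow> \<exists>c>0. \<exists>\<rho>0>0. \<forall>\<rho>. 0 < \<rho> \<and> \<rho> \<le> \<rho>0 \<longrightarrow>
          measure lborel (\<Theta> \<inter> cball (\<theta>s k) \<rho>) \<ge> c * measure lborel (cball (\<theta>s k) \<rho>)"
    (* B1 *)
    and f_C3: "C3_function f"
    and f_bounds: "\<And>x. 0 < f x \<and> f x < F"
    (* B2 *)
    and R: "R > 0" and \<gamma>: "\<gamma> \<ge> 0"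
    and grad_log: "\<And>x. norm (total_deriv (\<lambda>y. ln (f y)) x) \<le> R * (1 + norm x) powr \<gamma>"
    and hess_log: "\<And>x. norm (total_deriv (total_deriv (\<lambda>y. ln (f y))) x) \<le> R * (1 + norm x) powr \<gamma>"
    and exp_moments: "\<And>M. M > 0 \<Longrightarrow> integrable lborel (\<lambda>x. exp (M * norm x powr \<gamma>) * f x)"
    (* B3 *)
    and C: "C > 0" and r: "r > 0"
    and deriv1: "\<And>x. norm (total_deriv f x) \<le> C * (1 + norm x) powr (- (real DIM('a) + r))"
    and deriv2: "\<And>x. norm (total_deriv (total_deriv f) x)
                      \<le> C * (1 + norm x) powr (- (real DIM('a) + r))"
    and deriv3: "\<And>x. norm (total_deriv (total_deriv (total_deriv f)) x)
                      \<le> C * (1 + norm x) powr (- (real DIM('a) + r))"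
    and \<delta>: "\<delta> > 0"
  shows "tendsto_in_prob Qinf
           (\<lambda>n X. posterior (DP_prior \<alpha> P0) f n X
              {(w, \<theta>). \<exists>\<sigma>. \<sigma> permutes {..<K} \<and>
                 (\<forall>k<K. norm (\<theta>s k - \<theta> (\<sigma> k)) \<le> 1 / real n powr (1/2 - \<delta>) \<and>
                         \<bar>ws k - w (\<sigma> k)\<bar> \<le> 1 / real n powr (1/2 - \<delta>))}) 1
       \<and> tendsto_in_prob Qinf
           (\<lambda>n X. posterior (DP_prior \<alpha> P0) f n X
              {(w, \<theta>). wasserstein1 Ps (discrete_measure UNIV w \<theta>)
                         > ennreal (1 / real n powr (1/2 - \<delta>))}) 0"
proof -
 have K: "0 < K" using ws_sum by (cases K) auto
 have f0: "\<And>x. 0 \<le> f x" "\<And>x. 0 < f x" "\<And>x. f x \<le> F" using f_bounds less_imp_le by blast+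
 interpret dens: prob_density f by (rule prob_density.intro[OF f0(1) f_density])
 obtain Pm where Pm: "\<And>\<theta>. \<theta> \<in> \<Theta> \<Longrightarrow> p0 \<theta> \<le> Pm"
 proof -
  obtain Pm where "\<And>y. y \<in> p0 ` \<Theta> \<Longrightarrow> norm y \<le> Pm" using p0_bounded unfolding bounded_iff by blast
  hence "p0 \<theta> \<le> Pm" if "\<theta> \<in> \<Theta>" for \<theta> using \<open>\<And>y. y \<in> p0 ` \<Theta> \<Longrightarrow> norm y \<le> Pm\<close>[OF imageI[OF that]] by simp
  thus thesis by (rule that)
 qed
 interpret support: compactly_supported_prior \<Theta> p0 P0 Pm
  by (rule compactly_supported_prior.intro[OF P0_density P0_prob \<Theta>_compact p0_cont p0_nonneg Pm])
 have bdd: "bounded \<Theta>" by (rule compact_imp_bounded[OF \<Theta>_compact])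
 obtain T0 where T0: "\<And>\<theta>. \<theta> \<in> \<Theta> \<Longrightarrow> norm \<theta> \<le> T0" using bdd unfolding bounded_iff by blast
 define T where "T = max 0 T0"
 have T: "0 \<le> T" "\<And>\<theta>. \<theta> \<in> \<Theta> \<Longrightarrow> norm \<theta> \<le> T" using T0 by (auto simp: T_def le_max_iff_disj)
 obtain q a h r0 C0 b0 where r0: "0 < r0" "r0 \<le> 1" and C0: "0 \<le> C0"
  and disj: "\<And>k l. k < K \<Longrightarrow> l < K \<Longrightarrow> k \<noteq> l \<Longrightarrow> ball (\<theta>s k) r0 \<inter> ball (\<theta>s l) r0 = {}"
  and q: "continuous_on UNIV q" "\<And>x. 0 \<le> q x" "\<And>x. q x \<le> b0"
  and duals: "test_dual f q" "\<And>k. k < K \<Longrightarrow> test_dual f (a k)" "\<And>k j. k < K \<Longrightarrow> j \<in> Basis \<Longrightarrow> test_dual f (h k j)"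
  and vals: "\<And>k. k < K \<Longrightarrow> q (\<theta>s k) = 0" "\<And>k l. k < K \<Longrightarrow> l < K \<Longrightarrow> a k (\<theta>s l) = (if l = k then 1 else 0)"
   "\<And>k l j. k < K \<Longrightarrow> l < K \<Longrightarrow> j \<in> Basis \<Longrightarrow> h k j (\<theta>s l) = 0"
  and approx: "\<And>k x. k < K \<Longrightarrow> x \<in> \<Theta> \<Longrightarrow> \<bar>indicator (ball (\<theta>s k) r0) x - a k x\<bar> \<le> C0 * q x"
   "\<And>k j x. k < K \<Longrightarrow> j \<in> Basis \<Longrightarrow> x \<in> \<Theta> \<Longrightarrow> \<bar>indicator (ball (\<theta>s k) r0) x * ((x - \<theta>s k) \<bullet> j) - h k j x\<bar> \<le> C0 * q x"
  and qdist: "\<And>x. x \<in> \<Theta> \<Longrightarrow> \<exists>k<K. (dist x (\<theta>s k))\<^sup>2 \<le> C0 * q x"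
 proof (rule dens.test_functions[OF K bdd \<theta>s_distinct \<theta>s_in], goal_cases)
  case (2 q a h r C b)
  show ?case by (rule that[of r C q b a h]; (rule 2; assumption))
 qed
 have qm: "q \<in> borel_measurable borel" by (rule borel_measurable_continuous_onI[OF q(1)])
 have ball_coord: "\<bar>(t - \<theta>s k) \<bullet> j\<bar> \<le> max 1 b0" if "t \<in> ball (\<theta>s k) r0" "j \<in> Basis" for t k j
  using Basis_le_norm[OF that(2), of "t - \<theta>s k"] that(1) r0(2) by (auto simp: dist_norm norm_minus_commute)
 \<comment> \<open>The neighbourhoods are balls of radius at most 1, so \<open>max 1 b0\<close>
   bounds the indicators, the offsets and \<open>q\<close> at once.\<close>
 interpret mixture_setting \<alpha> P0 f F K ws \<theta>s "\<lambda>k. ball (\<theta>s k) r0" q "max 1 b0"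
  "(real K * (Pm * 2 ^ DIM('a)) + 1) * sqrt C0" "Pm * 2 ^ DIM('a)" \<Theta>
 proof (intro mixture_setting.intro mixture_model.intro true_mixture_prior.intro dirichlet_process.intro
   mixture_model_axioms.intro true_mixture_prior_axioms.intro mixture_setting_axioms.intro dirichlet_process_axioms.intro
   stick_proportions.intro P0_prob dens.prob_density_axioms \<alpha> support.sets_P0 K ws_pos ws_sum f0 disj ball_coord qm q(2)
   support.emeasure_P0_sublevel[OF qm C0 _ qdist] support.emeasure_P0_box support.sets_support support.AE_support)
  show "q t \<le> max 1 b0" for t using q(3)[of t] by simp
 qed (use support.Pm_nonneg C0 in auto)
 define w where "w = w_min"
 have w: "0 < w" "w \<le> 1" unfolding w_def by (rule w_min_pos w_min_le_1)+
 define s where "s = prior_exponent"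
 have s: "0 < s" unfolding s_def by (rule prior_exponent_pos)
 \<comment> \<open>Strictly below \<open>\<delta>\<close>, so that a power of \<open>n\<close>
   remains to absorb constants in the radius; the second bound is the one required by
   \<open>prior_near_rate\<close>.\<close>
 define \<delta>2 where "\<delta>2 = min (\<delta> / 2) (1 / (4 * (s + 1)))"
 have \<delta>2: "0 < \<delta>2" "\<delta>2 \<le> 1 / (4 * (s + 1))" "\<delta>2 < \<delta>" using \<delta> s by (auto simp: \<delta>2_def)
 have "1 / (4 * (s + 1)) \<le> 1 / 4" using s by (intro divide_left_mono) auto
 hence \<delta>2': "\<delta>2 < 1 / 2" using \<delta>2(2) by linarith
 obtain Cx where Cx: "0 \<le> Cx" and chi: "\<And>p \<epsilon>. regular p \<Longrightarrow> 0 < \<epsilon> \<Longrightarrow> real K * \<epsilon> \<le> w / 2 \<Longrightarrow> (\<And>j. norm (snd p j) \<le> T) \<Longrightarrow>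
   (\<And>k. k < K \<Longrightarrow> \<bar>stick_weights (fst p) k - ws k\<bar> \<le> real K * \<epsilon>) \<Longrightarrow> rem_mass (fst p) K \<le> \<epsilon> \<Longrightarrow>
   (\<And>k. k < K \<Longrightarrow> dist (\<theta>s k) (snd p k) \<le> \<epsilon>) \<Longrightarrow>
   chi2 p \<le> ennreal (1 + Cx * \<epsilon>\<^sup>2)"
 proof (rule chi_square_bound[of "\<lambda>x. (1 + norm x) powr \<gamma>" "R * (1 + T) powr \<gamma>" T w])
  show "1 \<le> (1 + norm x) powr \<gamma>" for x :: 'a using \<gamma> by (simp add: ge_one_powr_ge_zero)
  show "\<bar>ln (f (x - a)) - ln (f (x - b))\<bar> \<le> R * (1 + T) powr \<gamma> * (1 + norm x) powr \<gamma> * norm (a - b)"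
   if "norm a \<le> T" "norm b \<le> T" for x a b
   using f_C3 R by (intro ln_shift_bound f0 grad_log \<gamma> that) (auto simp: C3_function_def)
  show "integrable lborel (\<lambda>x. exp (M * (1 + norm x) powr \<gamma>) * f x)" if "0 < M" for M
   by (rule integrable_exp_one_plus[OF dens.f_meas f0(1) \<gamma> that exp_moments])
  show "norm (\<theta>s k) \<le> T" if "k < K" for k by (rule T(2)[OF \<theta>s_in[OF that]])
  show "w \<le> ws k" if "k < K" for k unfolding w_def by (rule w_min_le[OF that])
 qed (use R T w in auto)
 \<comment> \<open>The density condition on \<open>\<Theta>\<close> at the true atoms enters here:
   it turns a positive value of \<open>p0\<close> into prior mass of order
   \<open>\<rho> ^ DIM('a)\<close> for small balls.\<close>
 obtain cl \<epsilon>l where cl: "0 < cl" "0 < \<epsilon>l"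
  "\<And>\<epsilon>. 0 < \<epsilon> \<Longrightarrow> \<epsilon> \<le> \<epsilon>l \<Longrightarrow> ennreal (cl * \<epsilon> powr prior_exponent) \<le> emeasure prior (good_nbhd \<epsilon>)"
  by (rule good_nbhd_lower[OF support.emeasure_P0_cball[OF \<theta>s_in p0_pos \<Theta>_density]]) auto
 define \<epsilon>0 where "\<epsilon>0 = min \<epsilon>l (w / (2 * real K))"
 have \<epsilon>0: "0 < \<epsilon>0" "\<epsilon>0 \<le> \<epsilon>l" "real K * \<epsilon>0 \<le> w / 2"
 proof -
  show "0 < \<epsilon>0" "\<epsilon>0 \<le> \<epsilon>l" using cl w K by (auto simp: \<epsilon>0_def)
  have "real K * \<epsilon>0 \<le> real K * (w / (2 * real K))" by (intro mult_left_mono) (auto simp: \<epsilon>0_def)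
  thus "real K * \<epsilon>0 \<le> w / 2" using K by simp
 qed
 note concentration = posterior_concentration[where \<Phi> = "insert q (a ` {..<K} \<union> case_prod h ` ({..<K} \<times> Basis))" and ?c1.0 = "2 + 2 * C0"
   and c = cl and ?\<epsilon>0.0 = \<epsilon>0 and C = Cx, OF \<delta>2(1) \<delta>2(2)[unfolded s_def]]
 have concentrates: "tendsto_in_prob data_law (\<lambda>n X. posterior (DP_prior \<alpha> P0) f n X (G n)) 1"
  if G: "\<And>n. G n \<in> sets (DP_prior \<alpha> P0)"
  and good: "\<forall>\<^sub>F n in sequentially. \<forall>p \<epsilon>. regular p \<longrightarrow> (\<forall>i. snd p i \<in> \<Theta>) \<longrightarrow> near \<epsilon> (fst p) (snd p) \<longrightarrow>
   \<epsilon> \<le> real n powr (-1/2 + \<delta>2) \<longrightarrow> rem_mass (fst p) K \<le> real n powr (-1/2 + \<delta>2) \<longrightarrow> p \<in> pull (G n)" for G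
 proof (rule concentration[OF _ _ _ _ cl(1) \<epsilon>0(1) _ Cx _ G good])
  show "test_dual f \<phi>" if "\<phi> \<in> insert q (a ` {..<K} \<union> case_prod h ` ({..<K} \<times> Basis))" for \<phi>
   using that duals by auto
  show "near ((2 + 2 * C0) * \<tau>) (fst p) (snd p)" if "regular p" "\<And>i. snd p i \<in> \<Theta>"
   "\<And>\<phi>. \<phi> \<in> insert q (a ` {..<K} \<union> case_prod h ` ({..<K} \<times> Basis)) \<Longrightarrow> \<bar>sp_mean \<phi> (fst p) (snd p) - (\<Sum>k<K. ws k * \<phi> (\<theta>s k))\<bar> \<le> 2 * \<tau>" for p \<tau>
   by (rule near_of_tests[OF C0 duals vals approx(1) _ that]) (use approx(2) in \<open>simp_all add: offset_def\<close>)
  show "ennreal (cl * \<epsilon> powr prior_exponent) \<le> emeasure prior (good_nbhd \<epsilon>)" if "0 < \<epsilon>" "\<epsilon> \<le> \<epsilon>0" for \<epsilon>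
   using that \<epsilon>0 by (intro cl) auto
  show "chi2 p \<le> ennreal (1 + Cx * \<epsilon>\<^sup>2)"
   if p: "regular p" "\<And>i. snd p i \<in> \<Theta>" and e: "0 < \<epsilon>" "\<epsilon> \<le> \<epsilon>0" and g: "p \<in> good_nbhd \<epsilon>" for p \<epsilon>
  proof (rule chi[OF p(1) e(1)])
   have "real K * \<epsilon> \<le> real K * \<epsilon>0" using e by (intro mult_left_mono) auto
   thus "real K * \<epsilon> \<le> w / 2" using \<epsilon>0 by linarith
   show "norm (snd p j) \<le> T" for j by (rule T(2)[OF p(2)])
  qed (use g in \<open>auto simp: good_nbhd_def\<close>)
 qed (use C0 in auto)
 \<comment> \<open>The larger of the two constants that \<open>near_matching\<close> gives for atoms
   and for weights.\<close>
 define M0 where "M0 = max 2 (real DIM('a) * (2 * (max 1 b0 + 1) / w))"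
 have M0: "0 \<le> M0" by (simp add: M0_def)
 define \<rho> where "\<rho> n = real n powr (-1/2 + \<delta>2)" for n :: nat
 define rad where "rad n = 1 / real n powr (1/2 - \<delta>)" for n :: nat
 have matching: "\<forall>\<^sub>F n in sequentially. \<forall>p \<epsilon>. regular p \<longrightarrow> near \<epsilon> (fst p) (snd p) \<longrightarrow> \<epsilon> \<le> \<rho> n \<longrightarrow> rem_mass (fst p) K \<le> \<rho> n \<longrightarrow>
   (\<exists>\<sigma>. \<sigma> permutes {..<K} \<and> (\<forall>k<K. norm (\<theta>s k - snd p (\<sigma> k)) \<le> M0 * \<rho> n \<and> \<bar>ws k - stick_weights (fst p) (\<sigma> k)\<bar> \<le> M0 * \<rho> n))"
 proof -
  have "(\<lambda>n. (2 * max 1 b0 + 2) * \<rho> n) \<longlonglongrightarrow> (2 * max 1 b0 + 2) * 0"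
   unfolding \<rho>_def using \<delta>2' by (intro tendsto_intros real_powr_tendsto_0) simp
  hence "\<forall>\<^sub>F n in sequentially. (2 * max 1 b0 + 2) * \<rho> n < w / 2" by (rule order_tendstoD(2)) (use w in simp)
  thus ?thesis
  proof eventually_elim
   case (elim n)
   have \<rho>0: "0 \<le> \<rho> n" by (simp add: \<rho>_def)
   show ?case
   proof (intro allI impI)
    fix p \<epsilon> assume p: "regular p" "near \<epsilon> (fst p) (snd p)" "\<epsilon> \<le> \<rho> n" "rem_mass (fst p) K \<le> \<rho> n"
    have pp: "proper (fst p)" using p(1) by (simp add: regular_def)
    obtain \<sigma> where \<sigma>: "\<sigma> permutes {..<K}"
     "\<And>k. k < K \<Longrightarrow> norm (\<theta>s k - snd p (\<sigma> k)) \<le> real DIM('a) * (2 * (max 1 b0 + 1) / w) * \<rho> n"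
     "\<And>k. k < K \<Longrightarrow> \<bar>ws k - stick_weights (fst p) (\<sigma> k)\<bar> \<le> 2 * \<rho> n"
     using near_matching[OF pp p(2-4) elim[unfolded w_def]] unfolding w_def by blast
    have "real DIM('a) * (2 * (max 1 b0 + 1) / w) * \<rho> n \<le> M0 * \<rho> n" "2 * \<rho> n \<le> M0 * \<rho> n"
     using \<rho>0 by (intro mult_right_mono; simp add: M0_def)+
    thus "\<exists>\<sigma>. \<sigma> permutes {..<K} \<and> (\<forall>k<K. norm (\<theta>s k - snd p (\<sigma> k)) \<le> M0 * \<rho> n \<and> \<bar>ws k - stick_weights (fst p) (\<sigma> k)\<bar> \<le> M0 * \<rho> n)"
     using \<sigma> by (intro exI[of _ \<sigma>]) (auto intro: order_trans)
   qed
  qed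
 qed
 have radius: "\<forall>\<^sub>F n in sequentially. M * \<rho> n \<le> rad n" for M
 proof -
  have "(\<lambda>n. M * real n powr (\<delta>2 - \<delta>)) \<longlonglongrightarrow> M * 0"
   using \<delta>2 by (intro tendsto_intros real_powr_tendsto_0) simp
  hence "\<forall>\<^sub>F n in sequentially. M * real n powr (\<delta>2 - \<delta>) < 1" by (rule order_tendstoD(2)) simp
  thus ?thesis
  proof eventually_elim
   case (elim n)
   have "M * \<rho> n = M * real n powr (\<delta>2 - \<delta>) * real n powr (-1/2 + \<delta>)" by (simp add: \<rho>_def mult.assoc powr_add[symmetric])
   also have "\<dots> \<le> 1 * real n powr (-1/2 + \<delta>)" using elim by (intro mult_right_mono) auto
   also have "\<dots> = rad n" unfolding rad_def powr_minus_divide[symmetric] by simp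
   finally show ?case .
  qed
 qed
 have laws: "Qinf = data_law" unfolding Qinf Q Ps data_law_def true_law_def mixture_true ..
 define G1 where "G1 n = {(v :: nat \<Rightarrow> real, \<theta> :: nat \<Rightarrow> 'a). \<exists>\<sigma>. \<sigma> permutes {..<K} \<and>
  (\<forall>k<K. norm (\<theta>s k - \<theta> (\<sigma> k)) \<le> rad n \<and> \<bar>ws k - v (\<sigma> k)\<bar> \<le> rad n)}" for n
 define W where "W n = {(v, \<theta>). wasserstein1 Ps (discrete_measure UNIV v \<theta>) > ennreal (rad n)}" for n
 have part1: "tendsto_in_prob data_law (\<lambda>n X. posterior (DP_prior \<alpha> P0) f n X (G1 n)) 1"
 proof (rule concentrates)
  show "G1 n \<in> sets (DP_prior \<alpha> P0)" for n
  proof -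
   let ?M = "(\<Pi>\<^sub>M k\<in>UNIV. borel) \<Otimes>\<^sub>M (\<Pi>\<^sub>M k\<in>UNIV. borel) :: 'a sticks measure"
   have [measurable]: "(\<lambda>p. fst p k) \<in> borel_measurable ?M" "(\<lambda>p. snd p k) \<in> borel_measurable ?M" for k
    by (rule measurable_compose[OF measurable_fst measurable_component_singleton] measurable_compose[OF measurable_snd measurable_component_singleton]; simp)+
   have "{p \<in> space ?M. \<forall>k<K. norm (\<theta>s k - snd p (\<sigma> k)) \<le> rad n \<and> \<bar>ws k - fst p (\<sigma> k)\<bar> \<le> rad n} \<in> sets ?M" for \<sigma>
    by measurable
   hence "(\<Union>\<sigma>\<in>{\<sigma>. \<sigma> permutes {..<K}}. {p \<in> space ?M. \<forall>k<K. norm (\<theta>s k - snd p (\<sigma> k)) \<le> rad n \<and> \<bar>ws k - fst p (\<sigma> k)\<bar> \<le> rad n}) \<in> sets ?M"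
    by (intro sets.finite_UN finite_permutations) auto
   moreover have "(\<Union>\<sigma>\<in>{\<sigma>. \<sigma> permutes {..<K}}. {p \<in> space ?M. \<forall>k<K. norm (\<theta>s k - snd p (\<sigma> k)) \<le> rad n \<and> \<bar>ws k - fst p (\<sigma> k)\<bar> \<le> rad n}) = G1 n"
    by (auto simp: G1_def space_pair_measure space_PiM)
   ultimately show ?thesis by (simp add: sets_DP_prior)
  qed
  show "\<forall>\<^sub>F n in sequentially. \<forall>p \<epsilon>. regular p \<longrightarrow> (\<forall>i. snd p i \<in> \<Theta>) \<longrightarrow> near \<epsilon> (fst p) (snd p) \<longrightarrow>
   \<epsilon> \<le> real n powr (-1/2 + \<delta>2) \<longrightarrow> rem_mass (fst p) K \<le> real n powr (-1/2 + \<delta>2) \<longrightarrow> p \<in> pull (G1 n)"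
   using matching radius[of M0]
  proof eventually_elim
   case (elim n)
   show ?case
   proof (intro allI impI)
    fix p \<epsilon> assume p: "regular p" "near \<epsilon> (fst p) (snd p)" "\<epsilon> \<le> real n powr (-1/2 + \<delta>2)" "rem_mass (fst p) K \<le> real n powr (-1/2 + \<delta>2)"
    obtain \<sigma> where \<sigma>: "\<sigma> permutes {..<K}"
     "\<And>k. k < K \<Longrightarrow> norm (\<theta>s k - snd p (\<sigma> k)) \<le> M0 * \<rho> n \<and> \<bar>ws k - stick_weights (fst p) (\<sigma> k)\<bar> \<le> M0 * \<rho> n"
     using elim(1) p unfolding \<rho>_def by blast
    hence "\<And>k. k < K \<Longrightarrow> norm (\<theta>s k - snd p (\<sigma> k)) \<le> rad n \<and> \<bar>ws k - stick_weights (fst p) (\<sigma> k)\<bar> \<le> rad n"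
     using elim(2) order_trans by blast
    thus "p \<in> pull (G1 n)" using \<sigma>(1) unfolding pull_def G1_def by auto
   qed
  qed
 qed
 have part2: "tendsto_in_prob data_law (\<lambda>n X. posterior (DP_prior \<alpha> P0) f n X (W n)) 0"
 proof -
  have null: "{p. (\<Sum>k. ennreal (fst p k)) \<noteq> 1} \<subseteq> W n" for n
   using wasserstein1_eq_top[of K ws _ \<theta>s] ws_pos ws_sum by (auto simp: W_def Ps less_imp_le)
  \<comment> \<open>The complement of the Wasserstein event if that is measurable, and otherwise the
    whole space, whose posterior probability is 1.\<close>
  define G2 where "G2 n = (if W n \<in> sets (DP_prior \<alpha> P0) then - W n else UNIV)" for n
  have "tendsto_in_prob data_law (\<lambda>n X. posterior (DP_prior \<alpha> P0) f n X (G2 n)) 1"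
  proof (rule concentrates)
   show "G2 n \<in> sets (DP_prior \<alpha> P0)" for n
    using sets.compl_sets[of "W n" "DP_prior \<alpha> P0"] sets.top[of "DP_prior \<alpha> P0"] by (auto simp: G2_def Compl_eq_Diff_UNIV)
   show "\<forall>\<^sub>F n in sequentially. \<forall>p \<epsilon>. regular p \<longrightarrow> (\<forall>i. snd p i \<in> \<Theta>) \<longrightarrow> near \<epsilon> (fst p) (snd p) \<longrightarrow>
    \<epsilon> \<le> real n powr (-1/2 + \<delta>2) \<longrightarrow> rem_mass (fst p) K \<le> real n powr (-1/2 + \<delta>2) \<longrightarrow> p \<in> pull (G2 n)"
    \<comment> \<open>The constant comes from \<open>wasserstein1_matched_le\<close> with matching
      error \<open>M0 * \<rho> n\<close> and distances at most \<open>2 * T\<close> within the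
      support.\<close>
    using matching radius[of "M0 + real K * M0 * (2 * T)"]
   proof eventually_elim
    case (elim n)
    show ?case
    proof (intro allI impI)
     fix p \<epsilon> assume p: "regular p" "near \<epsilon> (fst p) (snd p)" "\<epsilon> \<le> real n powr (-1/2 + \<delta>2)" "rem_mass (fst p) K \<le> real n powr (-1/2 + \<delta>2)"
      and atoms: "\<forall>i. snd p i \<in> \<Theta>"
     have pp: "proper (fst p)" "stick_weights (fst p) sums 1" using p(1) by (auto simp: regular_def)
     obtain \<sigma> where \<sigma>: "\<sigma> permutes {..<K}"
      "\<And>k. k < K \<Longrightarrow> norm (\<theta>s k - snd p (\<sigma> k)) \<le> M0 * \<rho> n" "\<And>k. k < K \<Longrightarrow> \<bar>ws k - stick_weights (fst p) (\<sigma> k)\<bar> \<le> M0 * \<rho> n"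
      using elim(1) p unfolding \<rho>_def by blast
     have "wasserstein1 Ps (discrete_measure UNIV (stick_weights (fst p)) (snd p)) \<le> ennreal (M0 * \<rho> n + real K * (M0 * \<rho> n) * (2 * T))"
      unfolding Ps
     proof (rule wasserstein1_matched_le)
      show "norm (\<theta>s k - snd p j) \<le> 2 * T" if "k < K" for k j
       using norm_triangle_ineq4[of "\<theta>s k" "snd p j"] T(2)[OF \<theta>s_in[OF that]] T(2)[of "snd p j"] atoms by auto
     qed (use ws_pos ws_sum stick_weights_pos[OF pp(1)] pp(2) \<sigma> M0 T in \<open>auto simp: less_imp_le \<rho>_def\<close>)
     also have "\<dots> \<le> ennreal (rad n)" using elim(2) by (intro ennreal_leI) (simp add: algebra_simps)
     finally show "p \<in> pull (G2 n)" by (simp add: pull_def G2_def W_def not_less)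
    qed
   qed
  qed
  thus ?thesis unfolding posterior_compl_or_nonmeasurable[OF null] G2_def by (rule tendsto_in_prob_one_minus)
 qed
 show ?thesis using part1 part2 unfolding laws G1_def W_def rad_def ..
qed

end
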